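(* Let $\chi>0$, $\kappa\ge 0$, $\eta>0$, $\nu>0$, and consider on the torus $\mathbb T^3$ the initial value problem for the 3D incompressible magneto-micropolar equations with zero kinematic viscosity $$ \begin{cases} \partial_t u + u\cdot\nabla u - \chi\Delta u = -\nabla p + 2\chi\,\nabla\times\omega + b\cdot\nabla b,\\ \partial_t \omega + u\cdot\nabla\omega + 4\chi\,\omega - \kappa\nabla(\nabla\cdot\omega) - \eta\Delta\omega = 2\chi\,\nabla\times u,\\ \partial_t b + u\cdot\nabla b - \nu\Delta b = b\cdot\nabla u,\\ \nabla\cdot u = 0,\quad \nabla\cdot b = 0,\\ u(x,0)=u_0(x),\quad \omega(x,0)=\omega_0(x),\quad b(x,0)=b_0(x). \end{cases} $$ There exist constants $\epsilon>0$, $C>0$ and $C_0>0$ such that the following holds. Suppose that $(u_0,\omega_0,b_0)\in H^3(\mathbb T^3)$ with $\nabla\cdot u_0=\nabla\cdot b_0=0$ and $\int_{\mathbb T^3}u_0\,dx=\int_{\mathbb T^3}\omega_0\,dx=\int_{\mathbb T^3}b_0\,dx=0$. If $$ \|u_0\|_{H^3(\mathbb T^3)}+\|\omega_0\|_{H^3(\mathbb T^3)}+\|b_0\|_{H^3(\mathbb T^3)}\le\epsilon, $$ then the system has a unique global strong solution $(u,\omega,b)$ satisfying, for any $t>0$, $$ \|u(t)\|_{H^3(\mathbb T^3)}+\|\omega(t)\|_{H^3(\mathbb T^3)}+\|b(t)\|_{H^3(\mathbb T^3)}\le C\epsilon, $$ $$ \|u(t)\|_{H^3(\mathbb T^3)}+\|\omega(t)\|_{H^3(\mathbb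 T^3)}+\|b(t)\|_{H^3(\mathbb T^3)}\le C e^{-C_0 t}. $$
   Context: $\mathbb T^3$ is the three-dimensional torus (periodic domain). The unknowns are the fluid velocity $u$, the micro-rotational velocity $\omega$ and the magnetic field $b$, all $\mathbb R^3$-valued functions of $(x,t)\in\mathbb T^3\times[0,\infty)$, and the scalar pressure $p$. $\chi$ is the micro-rotation viscosity, $\kappa,\eta$ are the angular viscosities and $\nu$ is the magnetic diffusivity. $H^s(\mathbb T^3)$ is the usual $L^2$-based Sobolev space (applied componentwise to vector fields); $(u_0,\omega_0,b_0)\in H^3(\mathbb T^3)$ means each of the three fields lies in it. *)

theory Defs
  imports "HOL-Analysis.Analysis"
begin

text \<open>
  The torus is \<open>\<real>\<^sup>3 / (2\<pi>\<int>)\<^sup>3\<close>: functions on it are \<open>2\<pi>\<close>-periodic functions on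
  \<open>\<real>\<^sup>3\<close>, integrals are taken over one period cell, and the elements of \<open>L\<^sup>2\<close> are
  represented by Borel functions, so that equality in \<open>L\<^sup>2\<close> is equality almost everywhere.
  The codomain \<^typ>\<open>'b::euclidean_space\<close> covers scalar fields and vector fields at once; for
  vector fields all notions below are the componentwise ones.
\<close>

definition torus_cell :: "(real^3) set" where
  "torus_cell = cbox 0 (\<chi> i. 2 * pi)"

definition periodic :: "(real^3 \<Rightarrow> 'b) \<Rightarrow> bool" where
  "periodic f \<longleftrightarrow> (\<forall>x i. f (x + axis i (2 * pi)) = f x)"

definition L2_torus :: "(real^3 \<Rightarrow> 'b::euclidean_space) set" where
  "L2_torus = {f. f \<in> borel_measurable borel \<and> periodic f \<and>
                  set_integrable lborel torus_cell (\<lambda>x. (norm (f x))\<^sup>2)}"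

definition L2_norm :: "(real^3 \<Rightarrow> 'b::euclidean_space) \<Rightarrow> real" where
  "L2_norm f = sqrt (LINT x:torus_cell|lborel. (norm (f x))\<^sup>2)"


subsection \<open>Weak derivatives and Sobolev spaces\<close>

definition partial :: "3 \<Rightarrow> (real^3 \<Rightarrow> real) \<Rightarrow> real^3 \<Rightarrow> real" where
  "partial i \<phi> x = frechet_derivative \<phi> (at x) (axis i 1)"

text \<open>Test functions: all iterated partial derivatives exist and are Frechet differentiable,
  i.e. \<open>\<phi>\<close> is \<open>C\<^sup>\<infinity>\<close>.\<close>

definition test_function :: "(real^3 \<Rightarrow> real) \<Rightarrow> bool" where
  "test_function \<phi> \<longleftrightarrow>
     periodic \<phi> \<and> (\<forall>is x. fold partial is \<phi> differentiable (at x))"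

type_synonym multi_index = "nat^3"

definition mi_order :: "multi_index \<Rightarrow> nat" where
  "mi_order \<alpha> = (\<Sum>i\<in>UNIV. \<alpha> $ i)"

definition mpartial :: "multi_index \<Rightarrow> (real^3 \<Rightarrow> real) \<Rightarrow> real^3 \<Rightarrow> real" where
  "mpartial \<alpha> \<phi> =
     (partial 1 ^^ (\<alpha> $ 1)) ((partial 2 ^^ (\<alpha> $ 2)) ((partial 3 ^^ (\<alpha> $ 3)) \<phi>))"

definition has_weak_deriv ::
    "multi_index \<Rightarrow> (real^3 \<Rightarrow> 'b::euclidean_space) \<Rightarrow> (real^3 \<Rightarrow> 'b) \<Rightarrow> bool" where
  "has_weak_deriv \<alpha> f g \<longleftrightarrow> f \<in> L2_torus \<and> g \<in> L2_torus \<and>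
     (\<forall>\<phi>. test_function \<phi> \<longrightarrow>
        (LINT x:torus_cell|lborel. mpartial \<alpha> \<phi> x *\<^sub>R f x) =
        (-1) ^ mi_order \<alpha> *\<^sub>R (LINT x:torus_cell|lborel. \<phi> x *\<^sub>R g x))"

text \<open>Some representative of the weak derivative, which is unique up to null sets;
  meaningful only if the derivative exists in \<open>L\<^sup>2\<close>.\<close>

definition weak_deriv ::
    "multi_index \<Rightarrow> (real^3 \<Rightarrow> 'b::euclidean_space) \<Rightarrow> real^3 \<Rightarrow> 'b" where
  "weak_deriv \<alpha> f = (SOME g. has_weak_deriv \<alpha> f g)"

definition sobolev :: "nat \<Rightarrow> (real^3 \<Rightarrow> 'b::euclidean_space) set" where
  "sobolev s = {f \<in> L2_torus. \<forall>\<alpha>. mi_order \<alpha> \<le> s \<longrightarrow> (\<exists>g. has_weak_deriv \<alpha> f g)}"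

definition sobolev_norm :: "nat \<Rightarrow> (real^3 \<Rightarrow> 'b::euclidean_space) \<Rightarrow> real" where
  "sobolev_norm s f = sqrt (\<Sum>\<alpha> | mi_order \<alpha> \<le> s. (L2_norm (weak_deriv \<alpha> f))\<^sup>2)"

lemma finite_mi_order_le: "finite {\<alpha>. mi_order \<alpha> \<le> s}"
proof (rule finite_subset)
  show "{\<alpha>. mi_order \<alpha> \<le> s} \<subseteq> vec_lambda ` (UNIV \<rightarrow>\<^sub>E {..s})"
  proof
    fix \<alpha> assume "\<alpha> \<in> {\<alpha>. mi_order \<alpha> \<le> s}"
    then have "\<alpha> $ i \<le> s" for i
      unfolding mi_order_def using member_le_sum[of i UNIV "\<lambda>i. \<alpha> $ i"] by fastforce
    then have "vec_nth \<alpha> \<in> UNIV \<rightarrow>\<^sub>E {..s}" by auto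
    then show "\<alpha> \<in> vec_lambda ` (UNIV \<rightarrow>\<^sub>E {..s})"
      by (metis image_eqI vec_nth_inverse)
  qed
  show "finite (vec_lambda ` ((UNIV::3 set) \<rightarrow>\<^sub>E {..s}))"
    by (intro finite_imageI finite_PiE) auto
qed


subsection \<open>Vector calculus with weak derivatives\<close>

abbreviation wpartial :: "3 \<Rightarrow> (real^3 \<Rightarrow> 'b::euclidean_space) \<Rightarrow> real^3 \<Rightarrow> 'b" where
  "wpartial i \<equiv> weak_deriv (axis i 1)"

definition grad :: "(real^3 \<Rightarrow> real) \<Rightarrow> real^3 \<Rightarrow> real^3" where
  "grad f x = (\<chi> i. wpartial i f x)"

definition divg :: "(real^3 \<Rightarrow> real^3) \<Rightarrow> real^3 \<Rightarrow> real" where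
  "divg u x = (\<Sum>i\<in>UNIV. wpartial i u x $ i)"

definition curl :: "(real^3 \<Rightarrow> real^3) \<Rightarrow> real^3 \<Rightarrow> real^3" where
  "curl u x = vector [wpartial 2 u x $ 3 - wpartial 3 u x $ 2,
                      wpartial 3 u x $ 1 - wpartial 1 u x $ 3,
                      wpartial 1 u x $ 2 - wpartial 2 u x $ 1]"

definition laplacian :: "(real^3 \<Rightarrow> real^3) \<Rightarrow> real^3 \<Rightarrow> real^3" where
  "laplacian u x = (\<Sum>i\<in>UNIV. weak_deriv (axis i 2) u x)"

text \<open>\<open>v \<cdot> \<nabla>w\<close>\<close>

definition convect :: "(real^3 \<Rightarrow> real^3) \<Rightarrow> (real^3 \<Rightarrow> real^3) \<Rightarrow> real^3 \<Rightarrow> real^3" where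
  "convect v w x = (\<Sum>i\<in>UNIV. (v x $ i) *\<^sub>R wpartial i w x)"


subsection \<open>Strong solutions\<close>

text \<open>Time-dependent fields take the time as their first argument; only times \<open>t \<ge> 0\<close> matter.\<close>

definition continuous_into_sobolev :: "nat \<Rightarrow> (real \<Rightarrow> real^3 \<Rightarrow> real^3) \<Rightarrow> bool" where
  "continuous_into_sobolev s u \<longleftrightarrow>
     (\<forall>t\<ge>0. u t \<in> sobolev s \<and>
        ((\<lambda>\<tau>. sobolev_norm s (\<lambda>x. u \<tau> x - u t x)) \<longlongrightarrow> 0) (at t within {0..}))"

text \<open>\<open>v = \<partial>\<^sub>t u\<close> at time \<open>t\<close>, as a limit of difference quotients in \<open>L\<^sup>2\<close>.\<close>

definition has_time_deriv ::
    "(real \<Rightarrow> real^3 \<Rightarrow> real^3) \<Rightarrow> (real^3 \<Rightarrow> real^3) \<Rightarrow> real \<Rightarrow> bool" where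
  "has_time_deriv u v t \<longleftrightarrow> v \<in> L2_torus \<and>
     ((\<lambda>\<tau>. L2_norm (\<lambda>x. (u \<tau> x - u t x) /\<^sub>R (\<tau> - t) - v x)) \<longlongrightarrow> 0) (at t)"

text \<open>Global strong solutions with initial data in \<open>H\<^sup>3\<close>: the fields lie in
  \<open>C([0,\<infinity>); H\<^sup>3)\<close>, the time derivatives exist in \<open>L\<^sup>2\<close> at all positive times, and the equations
  hold almost everywhere in space. The pressure only has to exist; it is not a part of the
  solution, being determined up to a function of time.\<close>

definition global_strong_solution ::
    "real \<Rightarrow> real \<Rightarrow> real \<Rightarrow> real \<Rightarrow>
     (real^3 \<Rightarrow> real^3) \<Rightarrow> (real^3 \<Rightarrow> real^3) \<Rightarrow> (real^3 \<Rightarrow> real^3) \<Rightarrow>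
     (real \<Rightarrow> real^3 \<Rightarrow> real^3) \<Rightarrow> (real \<Rightarrow> real^3 \<Rightarrow> real^3) \<Rightarrow> (real \<Rightarrow> real^3 \<Rightarrow> real^3) \<Rightarrow> bool"
  where
  "global_strong_solution chi \<kappa> \<eta> \<nu> u0 \<omega>0 b0 u \<omega> b \<longleftrightarrow>
     continuous_into_sobolev 3 u \<and> continuous_into_sobolev 3 \<omega> \<and> continuous_into_sobolev 3 b \<and>
     (AE x in lborel. u 0 x = u0 x \<and> \<omega> 0 x = \<omega>0 x \<and> b 0 x = b0 x) \<and>
     (\<forall>t\<ge>0. AE x in lborel. divg (u t) x = 0 \<and> divg (b t) x = 0) \<and>
     (\<forall>t>0. \<exists>u' \<omega>' b' p.
        has_time_deriv u u' t \<and> has_time_deriv \<omega> \<omega>' t \<and> has_time_deriv b b' t \<and> p \<in> sobolev 1 \<and>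
        (AE x in lborel.
           u' x + convect (u t) (u t) x - chi *\<^sub>R laplacian (u t) x
             = - grad p x + (2 * chi) *\<^sub>R curl (\<omega> t) x + convect (b t) (b t) x \<and>
           \<omega>' x + convect (u t) (\<omega> t) x + (4 * chi) *\<^sub>R \<omega> t x
               - \<kappa> *\<^sub>R grad (divg (\<omega> t)) x - \<eta> *\<^sub>R laplacian (\<omega> t) x
             = (2 * chi) *\<^sub>R curl (u t) x \<and>
           b' x + convect (u t) (b t) x - \<nu> *\<^sub>R laplacian (b t) x
             = convect (b t) (u t) x))"

end

theory Submission
  imports Defs
begin

text \<open>
  In Fourier coefficients the system reads \<open>a\<^sub>k' = L\<^sub>k a\<^sub>k + P\<^sub>k B(a, a)\<^sub>k\<close> with the Leray projection
  \<open>P\<^sub>k\<close> in place of the pressure. The magnetic diffusion, the viscosities \<open>\<chi>\<close>, \<open>\<eta>\<close> and the damping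
  \<open>4\<chi>\<omega>\<close> together absorb the coupling terms \<open>2\<chi> curl\<close>, so that \<open>\<langle>z, L\<^sub>k z\<rangle> \<le> - c \<bar>k\<bar>\<^sup>2 \<bar>z\<bar>\<^sup>2\<close>, while
  incompressibility moves all derivatives of \<open>B\<close> to the outside and gives
  \<open>\<bar>B(a, a)\<^sub>k\<bar> \<le> 3 \<bar>k\<bar> (\<bar>a\<bar> * \<bar>a\<bar>)\<^sub>k\<close>. For small data there is a sequence \<open>m\<close> in the weighted \<open>\<ell>\<^sup>2\<close> space
  corresponding to \<open>H\<^sup>3\<close> which dominates the data and satisfies \<open>\<theta> (m * m)\<^sub>k \<le> \<bar>k\<bar> m\<^sub>k\<close>; Picard iteration
  then stays in the set \<open>\<bar>a\<^sub>k(t)\<bar> \<le> 2 m\<^sub>k exp (- c t / 2)\<close> and converges mode by mode. This gives global existence and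
  decay at once. Uniqueness is an \<open>\<ell>\<^sup>1\<close> estimate for the difference of two solutions, using that \<open>H\<^sup>3\<close>
  solutions have absolutely summable coefficients.
\<close>

section \<open>Integration over the torus\<close>

text \<open>Each mode is measured against a fixed weight, in the supremum over time and frequency.
  If the weight is an arbitrary H^3 sequence, no product estimate holds in such a norm; the
  supersolution property supplies one pointwise, and every mode then obeys a scalar damped
  inequality without loss of derivatives: one factor |k| from the nonlinearity and one from the
  supersolution face |k|^2 of dissipation. Only half of the dissipation rate is asked of the
  solution, so that every nonzero mode keeps at least half of its damping to absorb the forcing. The
  zero modes of u and b are not damped at all, hence the mean conditions; the nonlinearity has no
  zero mode, so these modes stay zero. Two obstacles lie outside the construction. The coefficients
  found are complex, and they belong to real fields only because the conjugate reflected family is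
  again a solution with the same data. And uniqueness is claimed against every strong solution with
  its own pressure, so it is proved for equations in which an unspecified multiple of k may be added
  to each velocity mode.\<close>

definition torus :: "(real^3) measure" where
  "torus = density lborel (\<lambda>x. ennreal (indicator torus_cell x))"

text \<open>Every point of space has exactly one lattice translate in this set, which cutting and
  shifting relies on; the closed cell differs from it by a null set and serves where compactness
  matters.\<close>

definition half_open_cell :: "(real^3) set" where
  "half_open_cell = {x. \<forall>i. 0 \<le> x $ i \<and> x $ i < 2 * pi}"

lemma space_torus [simp]: "space torus = UNIV"
  and sets_torus [measurable_cong, simp]: "sets torus = sets borel"
  by (simp_all add: torus_def)

lemma torus_cell_measurable [measurable]: "torus_cell \<in> sets borel"
  unfolding torus_cell_def by simp

lemma half_open_cell_measurable [measurable]: "half_open_cell \<in> sets borel"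
proof -
  have eq: "half_open_cell = (\<Inter>i. {x. 0 \<le> x $ i} \<inter> {x. x $ i < 2 * pi})"
    by (auto simp: half_open_cell_def) have "{x::real^3. 0 \<le> x $ i} \<inter> {x. x $ i < 2 * pi} \<in> sets borel" for i
    by (intro sets.Int borel_closed borel_open closed_halfspace_component_ge_cart open_halfspace_component_lt_cart)
  then show ?thesis unfolding eq by (intro sets.finite_INT) auto
qed

lemma AE_not_hyperplane: "AE x in lborel. (x::real^3) $ i \<noteq> c"
proof -
  have "negligible {x::real^3. x \<bullet> axis i 1 = c}"
    by (rule negligible_standard_hyperplane) (rule axis_in_Basis_iff[THEN iffD2], simp)
  then have "{x::real^3. x $ i = c} \<in> null_sets lebesgue"
    by (simp add: negligible_iff_null_sets inner_axis)
  moreover have "{x::real^3. x $ i = c} \<in> sets lborel"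
    using borel_closed[OF closed_hyperplane[of "axis i 1 :: real^3" c]] by (simp add: inner_axis')
  ultimately have "{x::real^3. x $ i = c} \<in> null_sets lborel"
    by (simp add: null_sets_completion_iff)
  then show ?thesis by (rule AE_I') auto
qed

lemma AE_half_open_cell: "AE x in lborel. x \<in> torus_cell \<longleftrightarrow> x \<in> half_open_cell"
proof -
  have "AE x in lborel. \<forall>i\<in>(UNIV::3 set). (x::real^3) $ i \<noteq> 2 * pi"
    by (rule AE_finite_allI) (auto intro: AE_not_hyperplane)
  then show ?thesis
    by eventually_elim (auto simp: torus_cell_def half_open_cell_def mem_box_cart less_le)
qed

lemma torus_eq: "torus = density lborel (\<lambda>x. ennreal (indicator half_open_cell x))"
  unfolding torus_def
proof (rule density_cong)
  show "AE x in lborel. ennreal (indicator torus_cell x) = ennreal (indicator half_open_cell x)"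
    using AE_half_open_cell by eventually_elim (auto simp: indicator_def)
qed auto

lemma emeasure_torus_space: "emeasure torus UNIV = ennreal ((2 * pi) ^ 3)"
proof -
  have "emeasure torus UNIV = emeasure lborel torus_cell"
    unfolding torus_def by (subst emeasure_density) (auto simp flip: ennreal_indicator nn_integral_indicator)
  also have "\<dots> = ennreal (measure lborel torus_cell)"
    unfolding torus_cell_def by (simp add: emeasure_lborel_cbox_eq measure_def)
  also have "measure lborel torus_cell = (2 * pi) ^ 3"
    unfolding torus_cell_def by (subst content_cbox_cart) (auto simp: interval_eq_empty_cart)
  finally show ?thesis .
qed

interpretation torus: finite_measure torus
  by standard (simp add: emeasure_torus_space)

lemma measure_torus [simp]: "measure torus UNIV = (2 * pi) ^ 3"
  by (simp add: measure_def emeasure_torus_space)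

lemma set_integral_torus:
  fixes f :: "real^3 \<Rightarrow> 'b::{banach, second_countable_topology}"
  assumes "f \<in> borel_measurable borel"
  shows "(LINT x:torus_cell|lborel. f x) = integral\<^sup>L torus f"
  unfolding torus_def set_lebesgue_integral_def
  by (subst integral_density) (use assms in auto)

lemma set_integrable_torus:
  fixes f :: "real^3 \<Rightarrow> 'b::{banach, second_countable_topology}"
  assumes "f \<in> borel_measurable borel"
  shows "set_integrable lborel torus_cell f \<longleftrightarrow> integrable torus f"
  unfolding torus_def set_integrable_def
  by (subst integrable_density) (use assms in auto)

section \<open>Translation invariance of integrals over the torus\<close>

lemma lborel_shift:
  fixes g :: "real^3 \<Rightarrow> 'b::{banach, second_countable_topology}"
  shows lborel_shift_integrable: "integrable lborel g \<Longrightarrow> integrable lborel (\<lambda>x. g (x + c))"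
    and lborel_shift_integral: "integrable lborel g \<Longrightarrow> integral\<^sup>L lborel (\<lambda>x. g (x + c)) = integral\<^sup>L lborel g"
proof -
  have eq: "distr lborel borel (\<lambda>x. x + c) = lborel"
    using lborel_distr_plus[of c] by (simp add: add.commute[of _ c])
  assume *: "integrable lborel g"
  then have [measurable]: "g \<in> borel_measurable borel" by auto
  have "integrable (distr lborel borel (\<lambda>x. x + c)) g" using * eq by simp
  then show "integrable lborel (\<lambda>x. g (x + c))"
    by (subst (asm) integrable_distr_eq) auto
  have "integral\<^sup>L (distr lborel borel (\<lambda>x. x + c)) g = integral\<^sup>L lborel (\<lambda>x. g (x + c))"
    by (subst integral_distr) auto
  then show "integral\<^sup>L lborel (\<lambda>x. g (x + c)) = integral\<^sup>L lborel g" using eq by simp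
qed

lemma periodicD: "periodic f \<Longrightarrow> f (x + axis i (2 * pi)) = f x"
  by (simp add: periodic_def)

lemma axis_nth_eq: "axis i c $ j = (if j = i then c else 0)"
  by (simp add: axis_def)

text \<open>The shifted cell consists of the part \<open>C\<close> of the old cell and of the
  complementary slab \<open>D\<close> moved by one full period; periodicity of \<open>f\<close>
  undoes the move of \<open>D\<close>.\<close>

lemma torus_shift:
  fixes f :: "real^3 \<Rightarrow> 'b::{banach, second_countable_topology}"
  assumes f: "integrable torus f" "periodic f" and s: "0 \<le> s" "s \<le> 2 * pi"
  shows torus_shift_integrable: "integrable torus (\<lambda>x. f (x + axis i s))"
    and torus_shift_integral: "integral\<^sup>L torus (\<lambda>x. f (x + axis i s)) = integral\<^sup>L torus f"
proof -
  let ?H = "half_open_cell"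
  define C where "C = {x \<in> half_open_cell. s \<le> x $ i}"
  define D where "D = {x \<in> half_open_cell. x $ i < s}"
  have [measurable]: "f \<in> borel_measurable borel" using f(1) by (auto dest: borel_measurable_integrable)
  have [measurable]: "C \<in> sets borel" "D \<in> sets borel" unfolding C_def D_def by measurable
  have If: "integrable lborel (\<lambda>x. indicator ?H x *\<^sub>R f x)"
    using f(1) unfolding torus_eq by (subst (asm) integrable_density) auto
  have IC: "integrable lborel (\<lambda>x. indicator C x *\<^sub>R f x)"
    by (rule Bochner_Integration.integrable_bound[OF If]) (auto simp: C_def indicator_def)
  have ID: "integrable lborel (\<lambda>x. indicator D x *\<^sub>R f x)"
    by (rule Bochner_Integration.integrable_bound[OF If]) (auto simp: D_def indicator_def)
  have ID': "integrable lborel (\<lambda>x. indicator D (x - axis i (2 * pi)) *\<^sub>R f (x - axis i (2 * pi)))"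
    using lborel_shift_integrable[OF ID, of "- axis i (2 * pi)"] by simp
  \<comment> \<open>\<open>g\<close> is \<open>f\<close> cut off to the translated cell, so its
    integral is that of the translate of \<open>f\<close> over the original cell.\<close>
  define g where "g y = indicator ?H (y - axis i s) *\<^sub>R f y" for y
  have fm: "f (x - axis i (2 * pi)) = f x" for x
    using periodicD[OF f(2), of "x - axis i (2 * pi)" i] by simp
  have shift: "x - axis i s \<in> ?H \<longleftrightarrow> x \<in> C \<or> x - axis i (2 * pi) \<in> D" for x
  proof -
    have 1: "x - axis i t \<in> ?H \<longleftrightarrow> (\<forall>j. j \<noteq> i \<longrightarrow> 0 \<le> x $ j \<and> x $ j < 2 * pi) \<and> t \<le> x $ i \<and> x $ i < t + 2 * pi" for t
    proof
      assume *: "x - axis i t \<in> ?H"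
      have "0 \<le> x $ j \<and> x $ j < 2 * pi" if "j \<noteq> i" for j
        using * that unfolding half_open_cell_def by (auto simp: axis_nth_eq dest!: spec[of _ j])
      moreover have "t \<le> x $ i \<and> x $ i < t + 2 * pi"
        using * unfolding half_open_cell_def by (auto simp: axis_nth_eq dest!: spec[of _ i])
      ultimately show "(\<forall>j. j \<noteq> i \<longrightarrow> 0 \<le> x $ j \<and> x $ j < 2 * pi) \<and> t \<le> x $ i \<and> x $ i < t + 2 * pi" by blast
    qed (auto simp: half_open_cell_def axis_nth_eq)
    have 0: "x - axis i 0 = x" by (simp add: vec_eq_iff axis_nth_eq)
    have di: "(x - axis i (2 * pi)) $ i = x $ i - 2 * pi" by (simp add: axis_nth_eq)
    have D: "x - axis i (2 * pi) \<in> D \<longleftrightarrow> x - axis i (2*pi) \<in> ?H \<and> x $ i - 2 * pi < s"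
      unfolding D_def using di by simp
    have C: "x \<in> C \<longleftrightarrow> x - axis i 0 \<in> ?H \<and> s \<le> x $ i"
      unfolding C_def 0 by simp
    show ?thesis
      unfolding C D 1 using s by auto
  qed
  have disj: "\<not> (x \<in> C \<and> x - axis i (2 * pi) \<in> D)" for x
    by (auto simp: C_def D_def half_open_cell_def axis_nth_eq dest!: spec[of _ i])
  have geq: "g = (\<lambda>x. indicator C x *\<^sub>R f x + indicator D (x - axis i (2 * pi)) *\<^sub>R f (x - axis i (2 * pi)))"
  proof
    fix x
    show "g x = indicator C x *\<^sub>R f x + indicator D (x - axis i (2 * pi)) *\<^sub>R f (x - axis i (2 * pi))"
      unfolding g_def fm using shift[of x] disj[of x] by (auto simp: indicator_def)
  qed
  have Ig: "integrable lborel g" unfolding geq by (rule Bochner_Integration.integrable_add[OF IC ID'])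
  have gs: "(\<lambda>x. g (x + axis i s)) = (\<lambda>x. indicator ?H x *\<^sub>R f (x + axis i s))"
    by (simp add: g_def)
  have Is: "integrable lborel (\<lambda>x. indicator ?H x *\<^sub>R f (x + axis i s))"
    using lborel_shift_integrable[OF Ig, of "axis i s"] unfolding gs .
  show "integrable torus (\<lambda>x. f (x + axis i s))"
    unfolding torus_eq by (subst integrable_density) (use Is in auto)
  have "integral\<^sup>L torus (\<lambda>x. f (x + axis i s)) = integral\<^sup>L lborel (\<lambda>x. indicator ?H x *\<^sub>R f (x + axis i s))"
    unfolding torus_eq by (subst integral_density) auto
  also have "\<dots> = integral\<^sup>L lborel g" using lborel_shift_integral[OF Ig, of "axis i s"] unfolding gs .
  also have "\<dots> = integral\<^sup>L lborel (\<lambda>x. indicator C x *\<^sub>R f x) + integral\<^sup>L lborel (\<lambda>x. indicator D (x - axis i (2 * pi)) *\<^sub>R f (x - axis i (2 * pi)))"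
    unfolding geq by (rule Bochner_Integration.integral_add[OF IC ID'])
  also have "integral\<^sup>L lborel (\<lambda>x. indicator D (x - axis i (2 * pi)) *\<^sub>R f (x - axis i (2 * pi))) = integral\<^sup>L lborel (\<lambda>x. indicator D x *\<^sub>R f x)"
    using lborel_shift_integral[OF ID, of "- axis i (2 * pi)"] by simp
  also have "integral\<^sup>L lborel (\<lambda>x. indicator C x *\<^sub>R f x) + \<dots> = integral\<^sup>L lborel (\<lambda>x. indicator C x *\<^sub>R f x + indicator D x *\<^sub>R f x)"
    by (rule Bochner_Integration.integral_add[OF IC ID, symmetric])
  also have "(\<lambda>x. indicator C x *\<^sub>R f x + indicator D x *\<^sub>R f x) = (\<lambda>x. indicator ?H x *\<^sub>R f x)"
    by (auto simp: C_def D_def indicator_def)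
  also have "integral\<^sup>L lborel (\<lambda>x. indicator ?H x *\<^sub>R f x) = integral\<^sup>L torus f"
    unfolding torus_eq by (subst integral_density) auto
  finally show "integral\<^sup>L torus (\<lambda>x. f (x + axis i s)) = integral\<^sup>L torus f" .
qed

lemma AE_torus_iff: "(AE x in torus. P x) \<longleftrightarrow> (AE x in lborel. x \<in> half_open_cell \<longrightarrow> P x)"
proof -
  have "(\<lambda>x. 0 < ennreal (indicator half_open_cell x) \<longrightarrow> P x) = (\<lambda>x. x \<in> half_open_cell \<longrightarrow> P x)"
    by (auto simp: indicator_def)
  then show ?thesis unfolding torus_eq by (subst AE_density) auto
qed

definition wave_vec :: "int^3 \<Rightarrow> real^3" where
  "wave_vec k = (\<chi> i. real_of_int (k $ i))"

lemma wave_vec_nth [simp]: "wave_vec k $ i = real_of_int (k $ i)"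
  by (simp add: wave_vec_def)

lemma periodic_add_lattice:
  assumes "periodic f" shows "f (x + (2 * pi) *\<^sub>R wave_vec k) = f x"
proof -
  have nat: "f (x + axis i (2 * pi * real n)) = f x" for x i n
  proof (induction n)
    case (Suc n)
    have "x + axis i (2 * pi * real (Suc n)) = (x + axis i (2 * pi * real n)) + axis i (2 * pi)"
      by (simp add: vec_eq_iff axis_nth_eq algebra_simps)
    then show ?case using Suc assms by (simp only: periodicD)
  next
    case 0
    have "x + axis i 0 = x" by (simp add: vec_eq_iff axis_nth_eq)
    then show ?case by (simp only: of_nat_0 mult_zero_right)
  qed
  have int: "f (x + axis i (2 * pi * of_int n)) = f x" for x i n
  proof (cases "n \<ge> 0")
    case True then show ?thesis using nat[of x i "nat n"] by simp
  next
    case False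
    have "x = (x + axis i (2 * pi * of_int n)) + axis i (2 * pi * real (nat (- n)))"
      using False by (simp add: vec_eq_iff axis_nth_eq)
    then show ?thesis using nat by metis
  qed
  have "x + (2 * pi) *\<^sub>R wave_vec k =
      x + axis 1 (2 * pi * of_int (k $ 1)) + axis 2 (2 * pi * of_int (k $ 2)) + axis 3 (2 * pi * of_int (k $ 3))"
    by (auto simp: vec_eq_iff axis_nth_eq forall_3)
  then show ?thesis by (simp only: int)
qed

lemma countable_int3: "countable (UNIV :: (int^3) set)"
proof -
  have "inj (\<lambda>k::int^3. (k $ 1, k $ 2, k $ 3))" by (auto simp: inj_def vec_eq_iff forall_3)
  then show ?thesis by (rule countableI')
qed

text \<open>The exceptional set in one cell is null, and so is the union of its countably many
  lattice translates; a point outside that union is carried into the cell without changing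
  \<open>P\<close>. This transfers identities between periodic functions from the cell to the whole
  space.\<close>

lemma AE_lborel_of_torus:
  assumes "AE x in torus. P x" and P: "\<And>x k. P (x + (2 * pi) *\<^sub>R wave_vec k) = P x"
  shows "AE x in lborel. P x"
proof -
  have "AE x in lborel. x \<in> half_open_cell \<longrightarrow> P x" using assms(1) AE_torus_iff by blast
  then obtain N where "{x \<in> space lborel. \<not> (x \<in> half_open_cell \<longrightarrow> P x)} \<subseteq> N"
      "emeasure lborel N = 0" "N \<in> sets lborel"
    by (rule AE_E)
  note N0 = this
  have N: "N \<in> null_sets lborel" "\<And>x. x \<in> half_open_cell \<Longrightarrow> x \<notin> N \<Longrightarrow> P x"
    using N0(2,3) apply blast
    using N0(1) by auto
  have shift: "AE x in lborel. x + c \<notin> N" for c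
  proof -
    have [measurable]: "N \<in> sets borel" using N by auto
    have eq: "distr lborel borel (\<lambda>x. x + c) = lborel"
      using lborel_distr_plus[of c] by (simp add: add.commute[of _ c])
    have "AE x in distr lborel borel (\<lambda>x. x + c). x \<notin> N"
      unfolding eq by (rule AE_not_in[OF N(1)])
    then show ?thesis by (subst (asm) AE_distr_iff) auto
  qed
  have "AE x in lborel. \<forall>k\<in>(UNIV::(int^3) set). x + (2 * pi) *\<^sub>R wave_vec k \<notin> N"
    unfolding AE_ball_countable[OF countable_int3] using shift by blast
  then show ?thesis
  proof eventually_elim
    case (elim x)
    define k where "k = (\<chi> i. - \<lfloor>x $ i / (2 * pi)\<rfloor>)"
    have "x + (2 * pi) *\<^sub>R wave_vec k \<in> half_open_cell"
      unfolding half_open_cell_def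
    proof (safe)
      fix i
      have "of_int \<lfloor>x $ i / (2 * pi)\<rfloor> \<le> x $ i / (2 * pi)" "x $ i / (2 * pi) < of_int \<lfloor>x $ i / (2 * pi)\<rfloor> + 1"
        by linarith+
      then have "of_int \<lfloor>x $ i / (2 * pi)\<rfloor> * (2 * pi) \<le> x $ i" "x $ i < (of_int \<lfloor>x $ i / (2 * pi)\<rfloor> + 1) * (2 * pi)"
        using pos_le_divide_eq[of "2 * pi"] pos_divide_less_eq[of "2 * pi"] mult_pos_pos[OF zero_less_numeral pi_gt_zero] by metis+
      then show "0 \<le> (x + (2 * pi) *\<^sub>R wave_vec k) $ i" "(x + (2 * pi) *\<^sub>R wave_vec k) $ i < 2 * pi"
        by (simp_all add: k_def algebra_simps)
    qed
    then have "P (x + (2 * pi) *\<^sub>R wave_vec k)" using elim N(2) by blast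
    then show "P x" unfolding P .
  qed
qed

lemma AE_torus_of_lborel: "AE x in lborel. P x \<Longrightarrow> AE x in torus. P x"
  unfolding AE_torus_iff by (erule eventually_mono) simp

section \<open>Fourier coefficients\<close>

definition echar :: "int^3 \<Rightarrow> real^3 \<Rightarrow> complex" where
  "echar k x = cis (wave_vec k \<bullet> x)"

definition fcoef :: "(real^3 \<Rightarrow> complex) \<Rightarrow> int^3 \<Rightarrow> complex" where
  "fcoef f k = (\<integral>x. f x * echar (- k) x \<partial>torus) / (2 * pi) ^ 3"

lemma wave_vec_0 [simp]: "wave_vec 0 = 0"
  and wave_vec_add: "wave_vec (j + k) = wave_vec j + wave_vec k"
  and wave_vec_minus: "wave_vec (- k) = - wave_vec k"
  and wave_vec_diff: "wave_vec (j - k) = wave_vec j - wave_vec k"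
  by (simp_all add: vec_eq_iff)

lemma norm_echar [simp]: "norm (echar k x) = 1"
  and echar_0 [simp]: "echar 0 x = 1"
  and echar_add: "echar (j + k) x = echar j x * echar k x"
  and echar_minus: "echar (- k) x = cnj (echar k x)"
  by (simp_all add: echar_def wave_vec_add wave_vec_minus inner_add_left cis_mult cis_cnj)

lemma continuous_on_echar: "continuous_on S (echar k)"
  unfolding echar_def by (intro continuous_intros)

lemma borel_measurable_echar [measurable]: "echar k \<in> borel_measurable borel"
  by (intro borel_measurable_continuous_onI continuous_on_echar)

lemma echar_shift: "echar k (x + axis i s) = cis (of_int (k $ i) * s) * echar k x"
  by (simp add: echar_def inner_add_right inner_axis cis_mult add.commute)

lemma periodic_echar: "periodic (echar k)"
proof -
  have "cis (of_int (k $ i) * (2 * pi)) = 1" for i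
    using cis_multiple_2pi[of "of_int (k $ i)"] by (simp add: mult.commute)
  then show ?thesis by (simp add: periodic_def echar_shift)
qed

lemma integrable_mult_bounded:
  fixes f g :: "real^3 \<Rightarrow> 'a::{banach, second_countable_topology, real_normed_algebra}"
  assumes "integrable torus f" "g \<in> borel_measurable borel" "\<And>x. norm (g x) \<le> B"
  shows "integrable torus (\<lambda>x. f x * g x)"
proof (rule Bochner_Integration.integrable_bound)
  show "integrable torus (\<lambda>x. B * norm (f x))" using assms(1) by simp
  have [measurable]: "f \<in> borel_measurable borel" "g \<in> borel_measurable borel"
    using assms borel_measurable_integrable[OF assms(1)] by auto
  show "(\<lambda>x. f x * g x) \<in> borel_measurable torus" by measurable
  have "norm (f x * g x) \<le> norm (B * norm (f x))" for x
  proof -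
    have "norm (f x * g x) \<le> norm (f x) * B"
      by (rule order_trans[OF norm_mult_ineq]) (intro mult_left_mono assms norm_ge_zero)
    also have "\<dots> \<le> norm (B * norm (f x))" by (simp add: mult.commute)
    finally show ?thesis .
  qed
  then show "AE x in torus. norm (f x * g x) \<le> norm (B * norm (f x))" by simp
qed

lemma integrable_mult_echar: "integrable torus f \<Longrightarrow> integrable torus (\<lambda>x. f x * echar k x)"
  by (rule integrable_mult_bounded[where B = 1]) auto

lemma integrable_echar: "integrable torus (echar k)"
  using integrable_mult_echar[of "\<lambda>x. 1" k] by simp

lemma integral_echar: "integral\<^sup>L torus (echar k) = (if k = 0 then (2 * pi) ^ 3 else 0)"
proof (cases "k = 0")
  case True
  then have "echar k = (\<lambda>x. 1)" by (auto simp: fun_eq_iff)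
  then show ?thesis using True by (simp add: scaleR_conv_of_real)
next
  case False
  then obtain i where i: "k $ i \<noteq> 0" by (auto simp: vec_eq_iff)
  define s where "s = pi / \<bar>of_int (k $ i)\<bar>"
  have "\<bar>of_int (k $ i)\<bar> \<ge> (1::real)" using i by linarith
  then have s: "0 \<le> s" "s \<le> 2 * pi"
    using pi_gt_zero by (auto simp: s_def divide_le_eq intro: order_trans[of pi "pi * 1"] mult_mono)
  have "of_int (k $ i) * s = pi \<or> of_int (k $ i) * s = - pi"
    using i by (auto simp: s_def abs_if field_simps)
  then have c: "cis (of_int (k $ i) * s) = -1" by (auto simp: complex_eq_iff)
  have "integral\<^sup>L torus (echar k) = integral\<^sup>L torus (\<lambda>x. echar k (x + axis i s))"
    using torus_shift_integral[OF integrable_echar periodic_echar s] by simp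
  also have "\<dots> = - integral\<^sup>L torus (echar k)" unfolding echar_shift c by simp
  finally show ?thesis using False by simp
qed

lemma fcoef_echar: "fcoef (echar j) k = (if j = k then 1 else 0)"
proof -
  have "(\<lambda>x. echar j x * echar (- k) x) = echar (j - k)"
    by (auto simp: echar_add[symmetric])
  then show ?thesis by (auto simp: fcoef_def integral_echar)
qed

lemma fcoef_add: "integrable torus f \<Longrightarrow> integrable torus g \<Longrightarrow> fcoef (\<lambda>x. f x + g x) k = fcoef f k + fcoef g k"
  by (simp add: fcoef_def distrib_right integrable_mult_echar add_divide_distrib)

lemma fcoef_diff: "integrable torus f \<Longrightarrow> integrable torus g \<Longrightarrow> fcoef (\<lambda>x. f x - g x) k = fcoef f k - fcoef g k"
  by (simp add: fcoef_def left_diff_distrib integrable_mult_echar diff_divide_distrib)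

lemma fcoef_cmult: "fcoef (\<lambda>x. c * f x) k = c * fcoef f k"
  by (simp add: fcoef_def mult.assoc)

lemma fcoef_sum:
  assumes "\<And>i. i \<in> I \<Longrightarrow> integrable torus (f i)"
  shows "fcoef (\<lambda>x. \<Sum>i\<in>I. f i x) k = (\<Sum>i\<in>I. fcoef (f i) k)"
  using assms by (simp add: fcoef_def sum_distrib_right integrable_mult_echar sum_divide_distrib)

lemma fcoef_cong_AE:
  assumes "AE x in torus. f x = g x" "f \<in> borel_measurable borel" "g \<in> borel_measurable borel"
  shows "fcoef f k = fcoef g k"
  unfolding fcoef_def using assms by (intro arg_cong2[of _ _ _ _ "(/)"] integral_cong_AE) auto

lemma fcoef_cnj: "fcoef (\<lambda>x. cnj (f x)) k = cnj (fcoef f (- k))"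
proof -
  have "(\<integral>x. cnj (f x) * echar (- k) x \<partial>torus) = (\<integral>x. cnj (f x * echar k x) \<partial>torus)"
    by (simp add: echar_minus)
  also have "\<dots> = cnj (\<integral>x. f x * echar k x \<partial>torus)" by (rule Bochner_Integration.integral_cnj)
  finally show ?thesis by (simp add: fcoef_def)
qed

lemma fcoef_mult_echar: "fcoef (\<lambda>x. f x * echar j x) k = fcoef f (k - j)"
  by (simp add: fcoef_def mult.assoc echar_add[symmetric])


section \<open>Completeness of the trigonometric system\<close>

inductive trig_poly :: "(real^3 \<Rightarrow> complex) \<Rightarrow> bool" where
  monom: "trig_poly (\<lambda>x. c * echar k x)"
| add: "trig_poly p \<Longrightarrow> trig_poly q \<Longrightarrow> trig_poly (\<lambda>x. p x + q x)"

lemma trig_poly_const: "trig_poly (\<lambda>x. c)"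
  using trig_poly.monom[of c 0] by simp

lemma trig_poly_mult:
  assumes "trig_poly p" "trig_poly q" shows "trig_poly (\<lambda>x. p x * q x)"
  using assms(1)
proof induction
  case (monom c k)
  show ?case using assms(2)
  proof induction
    case (monom d j)
    show ?case using trig_poly.monom[of "c * d" "k + j"] by (simp add: echar_add mult_ac)
  next
    case (add p q)
    then show ?case using trig_poly.add by (simp add: distrib_left)
  qed
next
  case (add p q)
  then show ?case using trig_poly.add by (simp add: distrib_right)
qed

lemma trig_poly_borel: "trig_poly p \<Longrightarrow> p \<in> borel_measurable borel"
  by (induction rule: trig_poly.induct) auto

lemma trig_poly_cos: "trig_poly (\<lambda>x. of_real (cos (x $ i - m)))"
proof -
  let ?k = "axis i 1 :: int^3"
  have w: "wave_vec ?k = axis i 1" by (simp add: vec_eq_iff axis_nth_eq)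
  have "trig_poly (\<lambda>x. (cis (- m) / 2) * echar ?k x + (cis m / 2) * echar (- ?k) x)"
    by (intro trig_poly.intros)
  also have "(\<lambda>x. (cis (- m) / 2) * echar ?k x + (cis m / 2) * echar (- ?k) x) = (\<lambda>x. of_real (cos (x $ i - m)))"
  proof
    fix x
    have "echar ?k x = cis (x $ i)" "echar (- ?k) x = cis (- (x $ i))"
      by (simp_all add: echar_def w wave_vec_minus inner_axis')
    then show "(cis (- m) / 2) * echar ?k x + (cis m / 2) * echar (- ?k) x = of_real (cos (x $ i - m))"
      by (simp add: complex_eq_iff cos_diff field_simps)
  qed
  finally show ?thesis .
qed

text \<open>Products of such functions, one per coordinate, are the approximants of box indicators
  used below; closure under products makes them admissible.\<close>

lemma trig_poly_poly_cos:
  assumes "real_polynomial_function q"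
  shows "trig_poly (\<lambda>x. of_real (q (cos (x $ i - m))))"
  using assms
proof induction
  case (linear f)
  then obtain c where "f = (\<lambda>t. t * c)" by (auto simp: real_bounded_linear)
  then show ?case using trig_poly_mult[OF trig_poly_cos trig_poly_const, of i m "of_real c"] by simp
next
  case (const c)
  then show ?case by (rule trig_poly_const)
next
  case (add f g)
  then show ?case using trig_poly.add by simp
next
  case (mult f g)
  then show ?case using trig_poly_mult by simp
qed

lemma integral_trig_poly_zero:
  assumes f: "integrable torus f" "\<And>k. fcoef f k = 0" and "trig_poly p"
  shows "integrable torus (\<lambda>x. f x * p x) \<and> integral\<^sup>L torus (\<lambda>x. f x * p x) = 0"
  using assms(3)
proof induction
  case (monom c k)
  have "(\<integral>x. f x * echar k x \<partial>torus) = 0"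
    using f(2)[of "- k"] by (simp add: fcoef_def)
  then have "(\<integral>x. c * (f x * echar k x) \<partial>torus) = 0" by simp
  moreover have "integrable torus (\<lambda>x. c * (f x * echar k x))" using integrable_mult_echar[OF f(1)] by simp
  ultimately show ?case by (simp add: mult_ac)
next
  case (add p q)
  then show ?case by (simp add: distrib_left)
qed

text \<open>Weierstrass approximation of the steep ramps \<open>h n\<close>, with errors tending to
  zero. Convergence is only pointwise, the step being discontinuous, but together with a uniform
  bound this suffices for dominated convergence; 2 is the bound 1 of the ramps plus an error of at
  most 1.\<close>

lemma poly_approx_step:
  obtains q :: "nat \<Rightarrow> real \<Rightarrow> real"
  where "\<And>n. real_polynomial_function (q n)" "\<And>n t. \<bar>t\<bar> \<le> 1 \<Longrightarrow> \<bar>q n t\<bar> \<le> 2"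
    "\<And>t. \<bar>t\<bar> \<le> 1 \<Longrightarrow> (\<lambda>n. q n t) \<longlonglongrightarrow> (if c < t then 1 else 0)"
proof -
  define h where "h n t = min 1 (real n * max 0 (t - c))" for n and t :: real
  have "\<exists>g. real_polynomial_function g \<and> (\<forall>t\<in>{-1..1}. \<bar>h n t - g t\<bar> < 1 / Suc n)" for n
  proof -
    have "continuous_on {-1..1::real} (h n)" unfolding h_def by (intro continuous_intros)
    then show ?thesis
      using Stone_Weierstrass_real_polynomial_function[of "{-1..1::real}" "h n" "1 / Suc n"] by (metis compact_Icc of_nat_0_less_iff zero_less_Suc zero_less_divide_1_iff)
  qed
  then obtain q where q: "\<And>n. real_polynomial_function (q n)" "\<And>n t. \<bar>t\<bar> \<le> 1 \<Longrightarrow> \<bar>h n t - q n t\<bar> < 1 / Suc n"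
    by (metis abs_le_iff atLeastAtMost_iff minus_le_iff)
  have h: "0 \<le> h n t" "h n t \<le> 1" for n t by (auto simp: h_def)
  have b: "\<bar>q n t\<bar> \<le> 2" if "\<bar>t\<bar> \<le> 1" for n t
  proof -
    have "1 / real (Suc n) \<le> 1" by simp
    then show ?thesis using q(2)[OF that, of n] h[of n t] by linarith
  qed
  have lim: "(\<lambda>n. q n t) \<longlonglongrightarrow> (if c < t then 1 else 0)" if t: "\<bar>t\<bar> \<le> 1" for t
  proof -
    have "(\<lambda>n. h n t) \<longlonglongrightarrow> (if c < t then 1 else 0)"
    proof (cases "c < t")
      case True
      obtain N where N: "1 / (t - c) < real N" using reals_Archimedean2 by blast
      have "\<forall>\<^sub>F n in sequentially. h n t = 1"
      proof (rule eventually_sequentiallyI[of N])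
        fix n assume "N \<le> n"
        then have "1 / (t - c) < real n" using N by linarith
        then have "1 < real n * (t - c)" using True by (simp add: field_simps)
        then show "h n t = 1" using True by (simp add: h_def)
      qed
      then show ?thesis using True by (simp add: tendsto_eventually)
    qed (simp add: h_def)
    moreover have "(\<lambda>n. h n t - q n t) \<longlonglongrightarrow> 0"
      by (rule Lim_null_comparison[OF _ LIMSEQ_Suc[OF lim_inverse_n']])
        (use q(2)[OF t] in \<open>auto intro!: eventuallyI simp: less_imp_le\<close>)
    ultimately have "(\<lambda>n. h n t - (h n t - q n t)) \<longlonglongrightarrow> (if c < t then 1 else 0) - 0"
      by (rule tendsto_diff)
    then show ?thesis by simp
  qed
  show ?thesis by (rule that[OF q(1) b lim])
qed

text \<open>The cosine centred at the midpoint is even about it and decreases up to distance pi. A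
  distance \<open>y\<close> beyond pi is replaced by \<open>2 * pi - y\<close>, which is still at
  least the half-length \<open>h\<close>. Intervals thereby become superlevel sets of a
  trigonometric polynomial.\<close>

lemma cos_gt_iff_in_interval:
  fixes a b x :: real
  assumes "0 \<le> a" "a < b" "b \<le> 2 * pi" "0 \<le> x" "x < 2 * pi"
  shows "cos ((b - a) / 2) < cos (x - (a + b) / 2) \<longleftrightarrow> a < x \<and> x < b"
proof -
  define m h y where "m = (a + b) / 2" and "h = (b - a) / 2" and "y = \<bar>x - m\<bar>"
  have cy: "cos (x - m) = cos y" by (simp add: y_def)
  have h: "0 < h" "h \<le> pi" using assms by (auto simp: h_def)
  have iff: "a < x \<and> x < b \<longleftrightarrow> y < h" unfolding y_def m_def h_def by (auto simp: abs_if field_simps)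
  have y: "0 \<le> y" "y \<le> 2 * pi - h" unfolding y_def m_def h_def using assms by (auto simp: abs_if field_simps)
  have "cos h < cos y \<longleftrightarrow> y < h"
  proof (cases "y \<le> pi")
    case True
    then show ?thesis using y h by (subst cos_mono_less_eq) auto
  next
    case False
    have "cos y = cos (2 * pi - y)" by simp
    also have "\<dots> \<le> cos h" using False y h by (subst cos_mono_le_eq) auto
    finally show ?thesis using False h by auto
  qed
  then show ?thesis using cy iff by (simp add: m_def h_def)
qed

text \<open>With a cosine threshold in each coordinate, the indicator of the box is on the half-open
  cell a pointwise limit of bounded trigonometric polynomials, against each of which
  \<open>f\<close> integrates to zero.\<close>

lemma integral_box_zero_aux:
  assumes f: "integrable torus f" "\<And>k. fcoef f k = 0"
    and ab: "\<And>i. 0 \<le> a $ i" "\<And>i. a $ i < b $ i" "\<And>i. b $ i \<le> 2 * pi"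
  shows "integral\<^sup>L torus (\<lambda>x. f x * indicator (box a b) x) = 0"
proof -
  define c where "c i = cos ((b $ i - a $ i) / 2)" for i
  define m where "m i = (a $ i + b $ i) / 2" for i
  have "\<exists>q. (\<forall>n. real_polynomial_function (q n)) \<and> (\<forall>n t. \<bar>t\<bar> \<le> 1 \<longrightarrow> \<bar>q n t\<bar> \<le> 2) \<and>
    (\<forall>t. \<bar>t\<bar> \<le> 1 \<longrightarrow> (\<lambda>n. q n t) \<longlonglongrightarrow> (if c i < t then 1 else 0))" for i
    by (rule poly_approx_step[of "c i"]) blast
  then obtain q where q: "\<And>i n. real_polynomial_function (q i n)" "\<And>i n t. \<bar>t\<bar> \<le> 1 \<Longrightarrow> \<bar>q i n t\<bar> \<le> 2"
    "\<And>i t. \<bar>t\<bar> \<le> 1 \<Longrightarrow> (\<lambda>n. q i n t) \<longlonglongrightarrow> (if c i < t then 1 else 0)" by metis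
  define p where "p n x = (\<Prod>i\<in>UNIV. complex_of_real (q i n (cos (x $ i - m i))))" for n and x :: "real^3"
  have tp: "trig_poly (p n)" for n
    unfolding p_def UNIV_3 by (auto intro!: trig_poly_mult trig_poly_poly_cos q)
  have [measurable]: "p n \<in> borel_measurable borel" for n by (rule trig_poly_borel[OF tp])
  have [measurable]: "f \<in> borel_measurable borel" using borel_measurable_integrable[OF f(1)] by simp
  have zero: "integral\<^sup>L torus (\<lambda>x. f x * p n x) = 0" for n using integral_trig_poly_zero[OF f tp] by blast
  \<comment> \<open>One factor 2 per coordinate.\<close>
  have pb: "norm (p n x) \<le> 8" for n x
  proof -
    have "norm (p n x) = (\<Prod>i\<in>UNIV. \<bar>q i n (cos (x $ i - m i))\<bar>)" by (simp add: p_def prod_norm[symmetric])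
    also have "\<dots> \<le> (\<Prod>i\<in>(UNIV::3 set). 2)" by (intro prod_mono) (auto intro: q)
    finally show ?thesis by simp
  qed
  have "(\<lambda>n. integral\<^sup>L torus (\<lambda>x. f x * p n x)) \<longlonglongrightarrow> integral\<^sup>L torus (\<lambda>x. f x * indicator (box a b) x)"
  proof (rule integral_dominated_convergence[where w = "\<lambda>x. norm (f x) * 8"])
    show "integrable torus (\<lambda>x. norm (f x) * 8)" using f(1) by simp
    show "AE x in torus. norm (f x * p n x) \<le> norm (f x) * 8" for n
      by (auto simp: norm_mult intro!: mult_left_mono pb)
    have "(\<lambda>n. f x * p n x) \<longlonglongrightarrow> f x * indicator (box a b) x" if x: "x \<in> half_open_cell" for x
    proof -
      have "(\<lambda>n. p n x) \<longlonglongrightarrow> (\<Prod>i\<in>UNIV. complex_of_real (if c i < cos (x $ i - m i) then 1 else 0))"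
        unfolding p_def by (intro tendsto_intros q) auto
      moreover have "c i < cos (x $ i - m i) \<longleftrightarrow> a $ i < x $ i \<and> x $ i < b $ i" for i
        unfolding c_def m_def using x ab by (intro cos_gt_iff_in_interval) (auto simp: half_open_cell_def)
      ultimately have "(\<lambda>n. p n x) \<longlonglongrightarrow> (\<Prod>i\<in>UNIV. if a $ i < x $ i \<and> x $ i < b $ i then 1 else 0)"
        by (simp add: if_distrib cong: if_cong)
      also have "(\<Prod>i\<in>(UNIV::3 set). if a $ i < x $ i \<and> x $ i < b $ i then 1 else 0) = (indicator (box a b) x :: complex)"
        by (auto simp: indicator_def mem_box_cart prod_zero_iff)
      finally show ?thesis by (intro tendsto_intros)
    qed
    then show "AE x in torus. (\<lambda>n. f x * p n x) \<longlonglongrightarrow> f x * indicator (box a b) x"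
      unfolding AE_torus_iff by simp
  qed simp_all
  then show ?thesis unfolding zero using LIMSEQ_unique tendsto_const by blast
qed

lemma integral_box_zero:
  assumes f: "integrable torus f" "\<And>k. fcoef f k = 0"
  shows "integral\<^sup>L torus (\<lambda>x. f x * indicator (box a b) x) = 0"
proof -
  \<comment> \<open>The box is clipped to the cell; within the half-open cell this loses only points
    with a vanishing coordinate.\<close>
  define a' where "a' = (\<chi> i. max 0 (a $ i))"
  define b' where "b' = (\<chi> i. min (2 * pi) (b $ i))"
  have [measurable]: "f \<in> borel_measurable borel" using borel_measurable_integrable[OF f(1)] by simp
  have "AE x in lborel. \<forall>i\<in>(UNIV::3 set). (x::real^3) $ i \<noteq> 0"
    by (rule AE_finite_allI) (auto intro: AE_not_hyperplane)
  then have "AE x in torus. x \<in> box a b \<longleftrightarrow> x \<in> box a' b'"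
    unfolding AE_torus_iff
    by eventually_elim (auto simp: a'_def b'_def mem_box_cart half_open_cell_def order.not_eq_order_implies_strict)
  then have "AE x in torus. f x * indicator (box a b) x = f x * indicator (box a' b') x"
    by eventually_elim (auto simp: indicator_def)
  then have eq: "integral\<^sup>L torus (\<lambda>x. f x * indicator (box a b) x) = integral\<^sup>L torus (\<lambda>x. f x * indicator (box a' b') x)"
    by (intro integral_cong_AE) auto
  show ?thesis
  proof (cases "\<forall>i. a' $ i < b' $ i")
    case True
    then show ?thesis unfolding eq by (intro integral_box_zero_aux f) (auto simp: a'_def b'_def)
  next
    case False
    then have "box a' b' = {}" by (auto simp: interval_eq_empty_cart not_less)
    then show ?thesis unfolding eq by simp
  qed
qed

text \<open>The positive and the negative part of \<open>g\<close> are densities of two finite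
  measures that agree on open boxes, an intersection-stable generator of the Borel sets, and hence
  everywhere; densities are unique almost everywhere.\<close>

lemma AE_zero_if_box_integrals_zero:
  fixes g :: "real^3 \<Rightarrow> real"
  assumes g: "integrable torus g" and box: "\<And>a b. integral\<^sup>L torus (\<lambda>x. g x * indicator (box a b) x) = 0"
  shows "AE x in torus. g x = 0"
proof -
  have [measurable]: "g \<in> borel_measurable borel" using borel_measurable_integrable[OF g] by simp
  let ?p = "\<lambda>x. ennreal (max 0 (g x))" and ?n = "\<lambda>x. ennreal (max 0 (- g x))"
  have ip: "integrable torus (\<lambda>x. max 0 (g x) * indicator A x)" "integrable torus (\<lambda>x. max 0 (- g x) * indicator A x)"
    if [measurable]: "A \<in> sets borel" for A
    by (rule Bochner_Integration.integrable_bound[OF g]; auto simp: indicator_def)+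
  have em: "emeasure (density torus ?p) A = ennreal (\<integral>x. max 0 (g x) * indicator A x \<partial>torus)"
      "emeasure (density torus ?n) A = ennreal (\<integral>x. max 0 (- g x) * indicator A x \<partial>torus)"
    if [measurable]: "A \<in> sets borel" for A
    by (subst nn_integral_eq_integral[symmetric, OF ip(1)[OF that]] nn_integral_eq_integral[symmetric, OF ip(2)[OF that]];
        auto simp: emeasure_density ennreal_mult'' ennreal_indicator)+
  have "density torus ?p = density torus ?n"
  proof (rule measure_eqI_generator_eq)
    let ?E = "range (\<lambda>(a, b). box a b::(real^3) set)"
    let ?A = "\<lambda>n::nat. box (- (real n *\<^sub>R One)) (real n *\<^sub>R One) :: (real^3) set"
    show "Int_stable ?E" by (auto simp: Int_stable_def box_Int_box)
    show "?E \<subseteq> Pow UNIV" "sets (density torus ?p) = sigma_sets UNIV ?E" "sets (density torus ?n) = sigma_sets UNIV ?E"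
      by (simp_all add: borel_eq_box)
    show "range ?A \<subseteq> ?E" "(\<Union>i. ?A i) = UNIV" unfolding UN_box_eq_UNIV by auto
    show "emeasure (density torus ?p) (?A i) \<noteq> \<infinity>" for i by (subst em) auto
    fix X assume "X \<in> ?E"
    then obtain a b where X: "X = box a b" by auto
    have "(\<integral>x. max 0 (g x) * indicator X x \<partial>torus) - (\<integral>x. max 0 (- g x) * indicator X x \<partial>torus)
        = (\<integral>x. max 0 (g x) * indicator X x - max 0 (- g x) * indicator X x \<partial>torus)"
      unfolding X by (intro Bochner_Integration.integral_diff[symmetric] ip) auto
    also have "\<dots> = (\<integral>x. g x * indicator X x \<partial>torus)"
      by (intro Bochner_Integration.integral_cong) (auto simp: indicator_def)
    also have "\<dots> = 0" unfolding X by (rule box)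
    finally show "emeasure (density torus ?p) X = emeasure (density torus ?n) X"
      unfolding X by (subst em, simp, subst em) auto
  qed
  then have "AE x in torus. ?p x = ?n x"
    by (intro torus.density_unique) auto
  then show ?thesis by eventually_elim (auto simp: max_def split: if_splits)
qed

text \<open>Real and imaginary part integrate to zero over every box. Integrability is the right
  generality: the convective terms, as products of square-integrable fields, are treated as merely
  integrable.\<close>

theorem fcoef_zero_imp_AE_zero:
  assumes f: "integrable torus f" "\<And>k. fcoef f k = 0"
  shows "AE x in torus. f x = 0"
proof -
  have ib: "integrable torus (\<lambda>x. f x * indicator (box a b) x)" for a b
    by (rule integrable_mult_bounded[OF f(1), where B = 1]) (auto simp: indicator_def)
  have "AE x in torus. Re (f x) = 0"
  proof (rule AE_zero_if_box_integrals_zero)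
    show "integrable torus (\<lambda>x. Re (f x))" using f(1) by simp
    have "(\<integral>x. Re (f x) * indicator (box a b) x \<partial>torus) = Re (\<integral>x. f x * indicator (box a b) x \<partial>torus)" for a b
      by (subst integral_Re[OF ib, symmetric], intro Bochner_Integration.integral_cong) (auto simp: indicator_def)
    then show "(\<integral>x. Re (f x) * indicator (box a b) x \<partial>torus) = 0" for a b
      using integral_box_zero[OF f] by simp
  qed
  moreover have "AE x in torus. Im (f x) = 0"
  proof (rule AE_zero_if_box_integrals_zero)
    show "integrable torus (\<lambda>x. Im (f x))" using f(1) by simp
    have "(\<integral>x. Im (f x) * indicator (box a b) x \<partial>torus) = Im (\<integral>x. f x * indicator (box a b) x \<partial>torus)" for a b
      by (subst integral_Im[OF ib, symmetric], intro Bochner_Integration.integral_cong) (auto simp: indicator_def)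
    then show "(\<integral>x. Im (f x) * indicator (box a b) x \<partial>torus) = 0" for a b
      using integral_box_zero[OF f] by simp
  qed
  ultimately show ?thesis by eventually_elim (simp add: complex_eq_iff)
qed

lemma AE_eq_if_fcoef_eq:
  assumes "integrable torus f" "integrable torus g" "\<And>k. fcoef f k = fcoef g k"
  shows "AE x in torus. f x = g x"
proof -
  have "AE x in torus. f x - g x = 0"
    by (rule fcoef_zero_imp_AE_zero) (use assms in \<open>auto simp: fcoef_diff\<close>)
  then show ?thesis by simp
qed

section \<open>Square-integrable functions on the torus\<close>

lemma L2_torus_iff:
  "f \<in> L2_torus \<longleftrightarrow> f \<in> borel_measurable borel \<and> periodic f \<and> integrable torus (\<lambda>x. (norm (f x))\<^sup>2)"
  unfolding L2_torus_def using set_integrable_torus[of "\<lambda>x. (norm (f x))\<^sup>2"] by auto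

lemma L2_torusD:
  assumes "f \<in> L2_torus"
  shows L2_torus_borel: "f \<in> borel_measurable borel"
    and L2_torus_periodic: "periodic f"
    and L2_torus_square_integrable: "integrable torus (\<lambda>x. (norm (f x))\<^sup>2)"
  using assms by (auto simp: L2_torus_iff)

lemma L2_norm_sq:
  "f \<in> borel_measurable borel \<Longrightarrow> (L2_norm f)\<^sup>2 = (\<integral>x. (norm (f x))\<^sup>2 \<partial>torus)"
  unfolding L2_norm_def by (subst set_integral_torus) auto

lemma L2_norm_nonneg [simp]: "0 \<le> L2_norm f"
proof -
  have "0 \<le> (LINT x:torus_cell|lborel. (norm (f x))\<^sup>2)"
    unfolding set_lebesgue_integral_def by (intro Bochner_Integration.integral_nonneg) auto
  then show ?thesis unfolding L2_norm_def by simp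
qed

lemma L2_torus_bound:
  assumes "f \<in> borel_measurable borel" "periodic f" "integrable torus g" "\<And>x. (norm (f x))\<^sup>2 \<le> g x"
  shows "f \<in> L2_torus"
  unfolding L2_torus_iff
proof (intro conjI assms)
  show "integrable torus (\<lambda>x. (norm (f x))\<^sup>2)"
    by (rule Bochner_Integration.integrable_bound[OF assms(3)])
      (use assms in \<open>auto intro!: AE_I2 order_trans[OF assms(4)]\<close>)
qed

lemma L2_torus_integrable:
  assumes "f \<in> L2_torus" shows "integrable torus f"
proof (rule Bochner_Integration.integrable_bound)
  show "integrable torus (\<lambda>x. 1 + (norm (f x))\<^sup>2)" using L2_torusD[OF assms] by simp
  have "norm (f x) \<le> norm (1 + (norm (f x))\<^sup>2)" for x
  proof -
    have "0 \<le> (norm (f x) - 1)\<^sup>2" "0 \<le> (norm (f x))\<^sup>2" by simp_all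
    then have "2 * norm (f x) \<le> 1 + (norm (f x))\<^sup>2" "norm (1 + (norm (f x))\<^sup>2) = 1 + (norm (f x))\<^sup>2"
      by (simp_all add: power2_eq_square algebra_simps)
    then show ?thesis using norm_ge_zero[of "f x"] by linarith
  qed
  then show "AE x in torus. norm (f x) \<le> norm (1 + (norm (f x))\<^sup>2)" by simp
qed (use L2_torusD[OF assms] in simp)

lemma periodic_comp: "periodic f \<Longrightarrow> periodic (\<lambda>x. h (f x))"
  and periodic_comp2: "periodic f \<Longrightarrow> periodic g \<Longrightarrow> periodic (\<lambda>x. h2 (f x) (g x))"
  by (auto simp: periodic_def)

lemma L2_torus_zero [simp]: "(\<lambda>x. 0) \<in> L2_torus"
  by (auto simp: L2_torus_iff periodic_def)

lemma L2_torus_linear_image: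
  assumes "f \<in> L2_torus" "bounded_linear h" shows "(\<lambda>x. h (f x)) \<in> L2_torus"
proof -
  obtain K where K: "\<And>x. norm (h x) \<le> norm x * K" using bounded_linear.bounded[OF assms(2)] by blast
  show ?thesis
  proof (rule L2_torus_bound)
    have "continuous_on UNIV h" by (rule linear_continuous_on[OF assms(2)])
    then have "h \<in> borel_measurable borel" by (rule borel_measurable_continuous_onI)
    then show "(\<lambda>x. h (f x)) \<in> borel_measurable borel" using L2_torus_borel[OF assms(1)] by simp
    show "integrable torus (\<lambda>x. K\<^sup>2 * (norm (f x))\<^sup>2)" using L2_torusD[OF assms(1)] by simp
    show "(norm (h (f x)))\<^sup>2 \<le> K\<^sup>2 * (norm (f x))\<^sup>2" for x
      using power_mono[OF K[of "f x"] norm_ge_zero, of 2] by (simp add: power_mult_distrib mult.commute)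
    show "periodic (\<lambda>x. h (f x))" by (rule periodic_comp[OF L2_torus_periodic[OF assms(1)]])
  qed
qed

lemma norm_add_sq_le:
  fixes a b :: "'a::real_normed_vector" shows "(norm (a + b))\<^sup>2 \<le> 2 * (norm a)\<^sup>2 + 2 * (norm b)\<^sup>2"
proof -
  have "(norm (a + b))\<^sup>2 \<le> (norm a + norm b)\<^sup>2" by (intro power_mono norm_triangle_ineq) simp
  also have "\<dots> \<le> 2 * (norm a)\<^sup>2 + 2 * (norm b)\<^sup>2"
    using zero_le_power2[of "norm a - norm b"] unfolding power2_diff power2_sum by linarith
  finally show ?thesis .
qed

lemma L2_torus_add:
  fixes f g :: "real^3 \<Rightarrow> 'b::euclidean_space"
  assumes "f \<in> L2_torus" "g \<in> L2_torus" shows "(\<lambda>x. f x + g x) \<in> L2_torus"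
proof (rule L2_torus_bound[where g = "\<lambda>x. 2 * (norm (f x))\<^sup>2 + 2 * (norm (g x))\<^sup>2"])
  show "periodic (\<lambda>x. f x + g x)"
    by (rule periodic_comp2[OF L2_torus_periodic[OF assms(1)] L2_torus_periodic[OF assms(2)]])
qed (use L2_torusD[OF assms(1)] L2_torusD[OF assms(2)] in \<open>simp_all add: norm_add_sq_le\<close>)

lemma L2_torus_scaleR: "f \<in> L2_torus \<Longrightarrow> (\<lambda>x. c *\<^sub>R f x) \<in> L2_torus"
  by (rule L2_torus_linear_image[OF _ bounded_linear_scaleR_right])

lemma L2_torus_uminus: "f \<in> L2_torus \<Longrightarrow> (\<lambda>x. - f x) \<in> L2_torus"
  using L2_torus_scaleR[of f "-1"] by simp

lemma L2_torus_diff: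
  fixes f g :: "real^3 \<Rightarrow> 'b::euclidean_space"
  assumes "f \<in> L2_torus" "g \<in> L2_torus" shows "(\<lambda>x. f x - g x) \<in> L2_torus"
  using L2_torus_add[OF assms(1) L2_torus_uminus[OF assms(2)]] by simp

lemma L2_torus_sum:
  fixes f :: "'i \<Rightarrow> real^3 \<Rightarrow> 'b::euclidean_space"
  assumes "\<And>i. i \<in> I \<Longrightarrow> f i \<in> L2_torus" shows "(\<lambda>x. \<Sum>i\<in>I. f i x) \<in> L2_torus"
  using assms by (induction I rule: infinite_finite_induct) (auto intro!: L2_torus_add)

lemma L2_torus_cmult:
  fixes f :: "real^3 \<Rightarrow> complex"
  shows "f \<in> L2_torus \<Longrightarrow> (\<lambda>x. c * f x) \<in> L2_torus"
  by (rule L2_torus_linear_image[OF _ bounded_linear_mult_right])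

lemma L2_torus_cnj:
  fixes f :: "real^3 \<Rightarrow> complex"
  shows "f \<in> L2_torus \<Longrightarrow> (\<lambda>x. cnj (f x)) \<in> L2_torus"
  by (rule L2_torus_linear_image[OF _ bounded_linear_cnj])

lemma L2_torus_echar: "echar k \<in> L2_torus"
  by (auto simp: L2_torus_iff periodic_echar)

lemma L2_torus_mult_echar: "f \<in> L2_torus \<Longrightarrow> (\<lambda>x. f x * echar k x) \<in> L2_torus"
proof (rule L2_torus_bound[where g = "\<lambda>x. (norm (f x))\<^sup>2"])
  assume f: "f \<in> L2_torus"
  show "periodic (\<lambda>x. f x * echar k x)"
    by (rule periodic_comp2[OF L2_torus_periodic[OF f] periodic_echar])
  have [measurable]: "f \<in> borel_measurable borel" by (rule L2_torus_borel[OF f])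
  show "(\<lambda>x. f x * echar k x) \<in> borel_measurable borel" by measurable
qed (simp_all add: L2_torus_square_integrable norm_mult)

lemma L2_torus_mult_integrable:
  fixes f g :: "real^3 \<Rightarrow> complex"
  assumes "f \<in> L2_torus" "g \<in> L2_torus" shows "integrable torus (\<lambda>x. f x * g x)"
proof (rule Bochner_Integration.integrable_bound)
  show "integrable torus (\<lambda>x. (norm (f x))\<^sup>2 + (norm (g x))\<^sup>2)" using L2_torusD[OF assms(1)] L2_torusD[OF assms(2)] by simp
  show "(\<lambda>x. f x * g x) \<in> borel_measurable torus" using L2_torusD[OF assms(1)] L2_torusD[OF assms(2)] by simp
  have "norm (f x * g x) \<le> norm ((norm (f x))\<^sup>2 + (norm (g x))\<^sup>2)" for x
  proof -
    have "0 \<le> (norm (f x) - norm (g x))\<^sup>2" "0 \<le> norm (f x) * norm (g x)" by simp_all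
    then have "norm (f x) * norm (g x) \<le> (norm (f x))\<^sup>2 + (norm (g x))\<^sup>2"
      unfolding power2_diff by linarith
    then show ?thesis by (simp add: norm_mult)
  qed
  then show "AE x in torus. norm (f x * g x) \<le> norm ((norm (f x))\<^sup>2 + (norm (g x))\<^sup>2)" by simp
qed

text \<open>Expanding the integral of the squared deviation of the norm of \<open>f\<close> from its
  mean yields this case of the Cauchy-Schwarz inequality.\<close>

lemma L1_norm_sq_le_L2:
  fixes f :: "real^3 \<Rightarrow> complex"
  assumes "f \<in> L2_torus"
  shows "(\<integral>x. norm (f x) \<partial>torus)\<^sup>2 \<le> (2 * pi) ^ 3 * (\<integral>x. (norm (f x))\<^sup>2 \<partial>torus)"
proof -
  let ?V = "(2 * pi) ^ 3 :: real" and ?I = "\<integral>x. norm (f x) \<partial>torus"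
  have V: "?V > 0" by simp
  have i: "integrable torus (\<lambda>x. norm (f x))" "integrable torus (\<lambda>x. (norm (f x))\<^sup>2)"
    using L2_torus_integrable[OF assms] L2_torusD[OF assms] by auto
  have "0 \<le> (\<integral>x. (norm (f x) - ?I / ?V)\<^sup>2 \<partial>torus)" by simp
  also have "\<dots> = (\<integral>x. (norm (f x))\<^sup>2 - (2 * (?I / ?V)) * norm (f x) + (?I / ?V)\<^sup>2 \<partial>torus)"
    by (intro Bochner_Integration.integral_cong) (auto simp: power2_diff)
  also have "\<dots> = (\<integral>x. (norm (f x))\<^sup>2 \<partial>torus) - (2 * (?I / ?V)) * ?I + ?V * (?I / ?V)\<^sup>2"
    using i by (subst Bochner_Integration.integral_add Bochner_Integration.integral_diff; simp)+
  also have "\<dots> = (\<integral>x. (norm (f x))\<^sup>2 \<partial>torus) - ?I\<^sup>2 / ?V"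
    using V by (simp add: field_simps power2_eq_square)
  finally show ?thesis using V by (simp add: field_simps)
qed


section \<open>Parseval's identity and the Riesz--Fischer theorem\<close>

definition trig_sum :: "(int^3) set \<Rightarrow> (int^3 \<Rightarrow> complex) \<Rightarrow> real^3 \<Rightarrow> complex" where
  "trig_sum F c x = (\<Sum>k\<in>F. c k * echar k x)"

lemma L2_torus_trig_sum: "trig_sum F c \<in> L2_torus"
  unfolding trig_sum_def[abs_def] by (intro L2_torus_sum L2_torus_cmult L2_torus_echar)

lemma fcoef_trig_sum: "finite F \<Longrightarrow> fcoef (trig_sum F c) k = (if k \<in> F then c k else 0)"
proof -
  assume F: "finite F"
  have "fcoef (trig_sum F c) k = (\<Sum>j\<in>F. c j * (if j = k then 1 else 0))"
    unfolding trig_sum_def[abs_def]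
    by (subst fcoef_sum) (auto simp: fcoef_cmult fcoef_echar integrable_echar)
  then show ?thesis using F by (simp add: sum.delta' if_distrib cong: if_cong)
qed

lemma integral_mult_cnj_trig_sum:
  assumes "integrable torus g"
  shows "(\<integral>x. g x * cnj (trig_sum F c x) \<partial>torus) = (2 * pi) ^ 3 * (\<Sum>k\<in>F. fcoef g k * cnj (c k))"
proof -
  have "(\<integral>x. g x * cnj (trig_sum F c x) \<partial>torus) = (\<integral>x. (\<Sum>k\<in>F. cnj (c k) * (g x * echar (- k) x)) \<partial>torus)"
    by (simp add: trig_sum_def sum_distrib_left echar_minus mult_ac)
  also have "\<dots> = (\<Sum>k\<in>F. cnj (c k) * (\<integral>x. g x * echar (- k) x \<partial>torus))"
    using integrable_mult_echar[OF assms] by simp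
  also have "\<dots> = (\<Sum>k\<in>F. (2 * pi) ^ 3 * (fcoef g k * cnj (c k)))"
    by (intro sum.cong) (auto simp: fcoef_def)
  finally show ?thesis by (simp add: sum_distrib_left)
qed

lemma of_real_integral_norm_sq:
  fixes f :: "real^3 \<Rightarrow> complex"
  shows "complex_of_real (\<integral>x. (norm (f x))\<^sup>2 \<partial>torus) = (\<integral>x. f x * cnj (f x) \<partial>torus)"
proof -
  have "(\<integral>x. f x * cnj (f x) \<partial>torus) = (\<integral>x. complex_of_real ((norm (f x))\<^sup>2) \<partial>torus)"
    by (intro Bochner_Integration.integral_cong refl complex_norm_square[symmetric])
  also have "\<dots> = complex_of_real (\<integral>x. (norm (f x))\<^sup>2 \<partial>torus)"
    by (rule integral_complex_of_real)
  finally show ?thesis by (rule sym)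
qed

lemma cmod_add_sq: "(norm (a + b))\<^sup>2 = (norm a)\<^sup>2 + (norm b)\<^sup>2 + 2 * Re (a * cnj b)"
proof -
  have "(Re a + Re b)\<^sup>2 + (Im a + Im b)\<^sup>2 = (Re a)\<^sup>2 + (Im a)\<^sup>2 + ((Re b)\<^sup>2 + (Im b)\<^sup>2) + 2 * (Re a * Re b + Im a * Im b)"
    by (simp add: power2_sum)
  then show ?thesis by (simp only: cmod_power2 plus_complex.sel times_complex.sel complex_cnj) simp
qed

lemma cmod_diff_sq: "(norm (a - b))\<^sup>2 = (norm a)\<^sup>2 + (norm b)\<^sup>2 - 2 * Re (a * cnj b)"
  using cmod_add_sq[of a "- b"] by simp

lemma integral_norm_sq_trig_sum:
  assumes "finite F"
  shows "(\<integral>x. (norm (trig_sum F c x))\<^sup>2 \<partial>torus) = (2 * pi) ^ 3 * (\<Sum>k\<in>F. (norm (c k))\<^sup>2)"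
proof -
  have "complex_of_real (\<integral>x. (norm (trig_sum F c x))\<^sup>2 \<partial>torus) = complex_of_real ((2 * pi) ^ 3 * (\<Sum>k\<in>F. (norm (c k))\<^sup>2))"
    unfolding of_real_integral_norm_sq
    by (subst integral_mult_cnj_trig_sum)
      (auto simp: L2_torus_integrable L2_torus_trig_sum fcoef_trig_sum assms complex_norm_square[symmetric] simp del: of_real_power)
  then show ?thesis by (simp only: of_real_eq_iff)
qed

text \<open>The remainder has no coefficients in \<open>F\<close>, hence is orthogonal to the
  partial sum, and Pythagoras applies.\<close>

lemma Bessel_identity:
  assumes f: "f \<in> L2_torus" and F: "finite F"
  shows "(\<integral>x. (norm (f x - trig_sum F (fcoef f) x))\<^sup>2 \<partial>torus)
    = (\<integral>x. (norm (f x))\<^sup>2 \<partial>torus) - (2 * pi) ^ 3 * (\<Sum>k\<in>F. (norm (fcoef f k))\<^sup>2)"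
proof -
  let ?S = "trig_sum F (fcoef f)"
  have S: "?S \<in> L2_torus" by (rule L2_torus_trig_sum)
  have d: "(\<lambda>x. f x - ?S x) \<in> L2_torus" by (rule L2_torus_diff[OF f S])
  have i: "integrable torus f" "integrable torus ?S" "integrable torus (\<lambda>x. f x - ?S x)"
    using f S d by (auto intro: L2_torus_integrable)
  have "(\<integral>x. (f x - ?S x) * cnj (?S x) \<partial>torus) = 0"
    unfolding integral_mult_cnj_trig_sum[OF i(3)] fcoef_diff[OF i(1,2)] fcoef_trig_sum[OF F] by simp
  then have orth: "(\<integral>x. Re ((f x - ?S x) * cnj (?S x)) \<partial>torus) = 0"
    by (subst integral_Re) (auto intro: L2_torus_mult_integrable d L2_torus_cnj[OF S])
  have "(\<integral>x. (norm (f x))\<^sup>2 \<partial>torus) = (\<integral>x. (norm (f x - ?S x))\<^sup>2 + (norm (?S x))\<^sup>2 + 2 * Re ((f x - ?S x) * cnj (?S x)) \<partial>torus)"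
    using cmod_add_sq[of "f x - ?S x" "?S x" for x] by simp
  also have "\<dots> = (\<integral>x. (norm (f x - ?S x))\<^sup>2 \<partial>torus) + (\<integral>x. (norm (?S x))\<^sup>2 \<partial>torus) + 2 * (\<integral>x. Re ((f x - ?S x) * cnj (?S x)) \<partial>torus)"
  proof -
    have "integrable torus (\<lambda>x. Re ((f x - ?S x) * cnj (?S x)))"
      by (intro integrable_Re L2_torus_mult_integrable d L2_torus_cnj[OF S])
    then show ?thesis using L2_torus_square_integrable[OF d] L2_torus_square_integrable[OF S]
      by (simp del: times_complex.sel complex_cnj_diff)
  qed
  finally show ?thesis unfolding orth integral_norm_sq_trig_sum[OF F] by simp
qed

lemma Bessel_inequality:
  assumes "f \<in> L2_torus" "finite F"
  shows "(\<Sum>k\<in>F. (norm (fcoef f k))\<^sup>2) \<le> (\<integral>x. (norm (f x))\<^sup>2 \<partial>torus) / (2 * pi) ^ 3"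
proof -
  have "0 \<le> (\<integral>x. (norm (f x - trig_sum F (fcoef f) x))\<^sup>2 \<partial>torus)" by simp
  then show ?thesis unfolding Bessel_identity[OF assms] by (simp add: field_simps)
qed

text \<open>An increasing sequence of finite sets, cofinal among all finite sets of frequencies: it
  turns unordered sums into limits of sequences, as the extraction of an almost everywhere
  convergent subsequence requires.\<close>

definition index_box :: "nat \<Rightarrow> (int^3) set" where
  "index_box n = {k. \<forall>i. \<bar>k $ i\<bar> \<le> int n}"

lemma finite_index_box: "finite (index_box n)"
proof (rule finite_subset)
  show "index_box n \<subseteq> vec_lambda ` (UNIV \<rightarrow>\<^sub>E {- int n..int n})"
  proof
    fix k assume k: "k \<in> index_box n"
    then have "vec_nth k \<in> UNIV \<rightarrow>\<^sub>E {- int n..int n}" by (force simp: index_box_def abs_le_iff minus_le_iff)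
    then show "k \<in> vec_lambda ` (UNIV \<rightarrow>\<^sub>E {- int n..int n})" by (metis image_eqI vec_nth_inverse)
  qed
  show "finite (vec_lambda ` ((UNIV::3 set) \<rightarrow>\<^sub>E {- int n..int n}))"
    by (intro finite_imageI finite_PiE) auto
qed

lemma index_box_mono: "m \<le> n \<Longrightarrow> index_box m \<subseteq> index_box n"
proof
  fix k assume "m \<le> n" "k \<in> index_box m"
  then have "\<bar>k $ i\<bar> \<le> int m" "int m \<le> int n" for i by (auto simp: index_box_def)
  then have "\<bar>k $ i\<bar> \<le> int n" for i by (rule order_trans)
  then show "k \<in> index_box n" by (simp add: index_box_def)
qed

lemma finite_subset_index_box:
  assumes "finite F" obtains n where "F \<subseteq> index_box n"
proof -
  define n where "n = (\<Sum>k\<in>F. \<Sum>i\<in>UNIV. nat \<bar>k $ i\<bar>)"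
  have "nat \<bar>k $ i\<bar> \<le> n" if "k \<in> F" for k i
  proof -
    have "nat \<bar>k $ i\<bar> \<le> (\<Sum>i\<in>UNIV. nat \<bar>k $ i\<bar>)" by (rule member_le_sum) auto
    also have "\<dots> \<le> n" unfolding n_def by (rule member_le_sum) (use that assms in auto)
    finally show ?thesis .
  qed
  then have "\<bar>k $ i\<bar> \<le> int n" if "k \<in> F" for k i using that by (simp add: nat_le_iff)
  then have "F \<subseteq> index_box n" by (auto simp: index_box_def)
  then show ?thesis by (rule that)
qed

lemma filterlim_index_box: "filterlim index_box (finite_subsets_at_top UNIV) sequentially"
  unfolding filterlim_finite_subsets_at_top
proof (safe)
  fix X :: "(int^3) set" assume "finite X"
  then obtain n where n: "X \<subseteq> index_box n" by (rule finite_subset_index_box)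
  show "\<forall>\<^sub>F m in sequentially. finite (index_box m) \<and> X \<subseteq> index_box m \<and> index_box m \<subseteq> UNIV"
    using eventually_ge_at_top[of n] by eventually_elim (use n index_box_mono finite_index_box in blast)
qed

lemma has_sum_imp_LIMSEQ_index_box: "(f has_sum s) UNIV \<Longrightarrow> (\<lambda>n. sum f (index_box n)) \<longlonglongrightarrow> s"
  unfolding has_sum_def by (rule filterlim_compose[OF _ filterlim_index_box])

text \<open>Partial sums over index boxes are Cauchy in L^2, hence in L^1, so a subsequence
  converges almost everywhere. Fatou's lemma along it bounds the L^2 distance of the limit to every
  partial sum by the tail of the series; coefficients and norm follow from this bound.\<close>

theorem Riesz_Fischer:
  assumes c: "(\<lambda>k. (norm (c k))\<^sup>2) summable_on (UNIV :: (int^3) set)"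
  obtains f :: "real^3 \<Rightarrow> complex" where "f \<in> L2_torus" "\<And>k. fcoef f k = c k"
    "(\<integral>x. (norm (f x))\<^sup>2 \<partial>torus) = (2 * pi) ^ 3 * (\<Sum>\<^sub>\<infinity>k. (norm (c k))\<^sup>2)"
proof -
  let ?V = "(2 * pi) ^ 3 :: real"
  have V: "?V > 0" by simp
  define \<sigma> where "\<sigma> n = (\<Sum>k\<in>index_box n. (norm (c k))\<^sup>2)" for n
  define S where "S = (\<Sum>\<^sub>\<infinity>k. (norm (c k))\<^sup>2)"
  define s where "s n = trig_sum (index_box n) c" for n
  have \<sigma>S: "\<sigma> \<longlonglongrightarrow> S"
    unfolding \<sigma>_def[abs_def] S_def by (intro has_sum_imp_LIMSEQ_index_box has_sum_infsum c)
  have \<sigma>_le: "\<sigma> n \<le> S" for n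
    unfolding \<sigma>_def S_def by (rule finite_sum_le_infsum[OF c]) (auto intro: finite_index_box)
  have sL2: "s n \<in> L2_torus" for n unfolding s_def by (rule L2_torus_trig_sum)
  have [measurable]: "s n \<in> borel_measurable borel" for n by (rule L2_torus_borel[OF sL2])
  have sd: "(\<integral>x. (norm (s n x - s m x))\<^sup>2 \<partial>torus) = ?V * (\<sigma> n - \<sigma> m)" if "m \<le> n" for m n
  proof -
    have sub: "index_box m \<subseteq> index_box n" by (rule index_box_mono[OF that])
    have "s n x - s m x = trig_sum (index_box n - index_box m) c x" for x
      unfolding s_def trig_sum_def by (rule sum_diff[OF finite_index_box sub, symmetric])
    then have "(\<integral>x. (norm (s n x - s m x))\<^sup>2 \<partial>torus) = ?V * (\<Sum>k\<in>index_box n - index_box m. (norm (c k))\<^sup>2)"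
      by (simp add: integral_norm_sq_trig_sum finite_index_box)
    then show ?thesis unfolding \<sigma>_def sum_diff[OF finite_index_box sub] .
  qed
  have sd': "(\<integral>x. (norm (s n x - s m x))\<^sup>2 \<partial>torus) \<le> ?V * \<bar>\<sigma> n - \<sigma> m\<bar>" for m n
  proof (cases "m \<le> n")
    case False
    then have "(\<integral>x. (norm (s n x - s m x))\<^sup>2 \<partial>torus) = ?V * (\<sigma> m - \<sigma> n)"
      using sd[of n m] by (simp add: norm_minus_commute)
    then show ?thesis by (simp add: mult_left_mono)
  qed (simp add: sd mult_left_mono)
  have "\<exists>N. \<forall>i\<ge>N. \<forall>j\<ge>N. (\<integral>x. norm (s i x - s j x) \<partial>torus) < e" if "e > 0" for e
  proof -
    have "Cauchy \<sigma>" using \<sigma>S by (rule LIMSEQ_imp_Cauchy)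
    moreover have "e\<^sup>2 / ?V\<^sup>2 > 0" using that V by simp
    ultimately obtain N where N: "\<And>i j. i \<ge> N \<Longrightarrow> j \<ge> N \<Longrightarrow> \<bar>\<sigma> i - \<sigma> j\<bar> < e\<^sup>2 / ?V\<^sup>2"
      unfolding Cauchy_def dist_real_def by blast
    have "(\<integral>x. norm (s i x - s j x) \<partial>torus) < e" if "i \<ge> N" "j \<ge> N" for i j
    proof -
      have "(\<integral>x. norm (s i x - s j x) \<partial>torus)\<^sup>2 \<le> ?V * (\<integral>x. (norm (s i x - s j x))\<^sup>2 \<partial>torus)"
        by (rule L1_norm_sq_le_L2[OF L2_torus_diff[OF sL2 sL2]])
      also have "\<dots> \<le> ?V * (?V * \<bar>\<sigma> i - \<sigma> j\<bar>)" using sd' V by (intro mult_left_mono) auto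
      also have "\<dots> < ?V * (?V * (e\<^sup>2 / ?V\<^sup>2))" using N[OF that] V by (intro mult_strict_left_mono) auto
      also have "\<dots> = e\<^sup>2"
      proof -
        have "v * (v * (e\<^sup>2 / v\<^sup>2)) = e\<^sup>2" if "v > 0" for v :: real using that by (simp add: power2_eq_square)
        from this[OF V] show ?thesis .
      qed
      finally show ?thesis using \<open>e > 0\<close> by (simp add: power_less_imp_less_base)
    qed
    then show ?thesis by blast
  qed
  then obtain r where r: "strict_mono r" and Cy: "AE x in torus. Cauchy (\<lambda>i. s (r i) x)"
    using cauchy_L1_AE_cauchy_subseq[of torus s] L2_torus_integrable[OF sL2] by blast
  \<comment> \<open>Taking \<open>lim\<close> at every point, even where the sequence diverges,
    makes \<open>f\<close> exactly periodic and Borel, not just up to a null set.\<close>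
  define f where "f x = lim (\<lambda>i. s (r i) x)" for x
  have fb [measurable]: "f \<in> borel_measurable borel" unfolding f_def[abs_def] by measurable
  have fp: "periodic f"
    using L2_torus_periodic[OF sL2] unfolding f_def periodic_def by simp
  have conv: "AE x in torus. (\<lambda>i. s (r i) x) \<longlonglongrightarrow> f x"
    using Cy by eventually_elim (simp add: f_def Cauchy_convergent_iff convergent_LIMSEQ_iff)
  have Fatou: "(\<integral>\<^sup>+x. ennreal ((norm (f x - s n x))\<^sup>2) \<partial>torus) \<le> ennreal (?V * (S - \<sigma> n))" for n
  proof -
    have "(\<integral>\<^sup>+x. ennreal ((norm (f x - s n x))\<^sup>2) \<partial>torus)
        = (\<integral>\<^sup>+x. liminf (\<lambda>i. ennreal ((norm (s (r i) x - s n x))\<^sup>2)) \<partial>torus)"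
    proof (rule nn_integral_cong_AE)
      show "AE x in torus. ennreal ((norm (f x - s n x))\<^sup>2) = liminf (\<lambda>i. ennreal ((norm (s (r i) x - s n x))\<^sup>2))"
        using conv
      proof eventually_elim
        case (elim x)
        have "(\<lambda>i. ennreal ((norm (s (r i) x - s n x))\<^sup>2)) \<longlonglongrightarrow> ennreal ((norm (f x - s n x))\<^sup>2)"
          by (intro tendsto_intros elim)
        then show ?case by (intro lim_imp_Liminf[symmetric]) auto
      qed
    qed
    also have "\<dots> \<le> liminf (\<lambda>i. \<integral>\<^sup>+x. ennreal ((norm (s (r i) x - s n x))\<^sup>2) \<partial>torus)"
      by (rule nn_integral_liminf) measurable
    also have "\<dots> \<le> limsup (\<lambda>i. \<integral>\<^sup>+x. ennreal ((norm (s (r i) x - s n x))\<^sup>2) \<partial>torus)"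
      by (rule Liminf_le_Limsup) simp
    also have "\<dots> \<le> ennreal (?V * (S - \<sigma> n))"
    proof (rule Limsup_bounded, rule eventually_sequentiallyI[of n])
      fix i assume "n \<le> i"
      then have "n \<le> r i" using seq_suble[OF r, of i] by linarith
      have "(\<integral>\<^sup>+x. ennreal ((norm (s (r i) x - s n x))\<^sup>2) \<partial>torus) = ennreal (\<integral>x. (norm (s (r i) x - s n x))\<^sup>2 \<partial>torus)"
        by (intro nn_integral_eq_integral L2_torus_square_integrable L2_torus_diff sL2) auto
      also have "\<dots> \<le> ennreal (?V * (S - \<sigma> n))"
        unfolding sd[OF \<open>n \<le> r i\<close>] using \<sigma>_le[of "r i"] V by (intro ennreal_leI mult_left_mono) auto
      finally show "(\<integral>\<^sup>+x. ennreal ((norm (s (r i) x - s n x))\<^sup>2) \<partial>torus) \<le> ennreal (?V * (S - \<sigma> n))" .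
    qed
    finally show ?thesis .
  qed
  have dL2: "(\<lambda>x. f x - s n x) \<in> L2_torus" for n
    unfolding L2_torus_iff
  proof (intro conjI)
    show "integrable torus (\<lambda>x. (norm (f x - s n x))\<^sup>2)"
      using Fatou[of n] by (intro integrableI_bounded) (auto simp: less_top[symmetric] top_unique)
    show "periodic (\<lambda>x. f x - s n x)" using fp L2_torus_periodic[OF sL2] by (rule periodic_comp2)
  qed measurable
  have bound: "(\<integral>x. (norm (f x - s n x))\<^sup>2 \<partial>torus) \<le> ?V * (S - \<sigma> n)" for n
  proof -
    have "ennreal (\<integral>x. (norm (f x - s n x))\<^sup>2 \<partial>torus) = (\<integral>\<^sup>+x. ennreal ((norm (f x - s n x))\<^sup>2) \<partial>torus)"
      by (intro nn_integral_eq_integral[symmetric] L2_torus_square_integrable dL2) auto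
    also have "\<dots> \<le> ennreal (?V * (S - \<sigma> n))" by (rule Fatou)
    finally show ?thesis using \<sigma>_le[of n] V by (subst (asm) ennreal_le_iff) auto
  qed
  have fL2: "f \<in> L2_torus"
    using L2_torus_add[OF dL2 sL2, of 0 0] by simp
  have fc: "fcoef f k = c k" for k
  proof -
    obtain m where "{k} \<subseteq> index_box m" by (rule finite_subset_index_box[of "{k}"]) auto
    then have m: "k \<in> index_box n" if "n \<ge> m" for n using index_box_mono[OF that] by blast
    have "(norm (fcoef f k - c k))\<^sup>2 \<le> S - \<sigma> n" if "n \<ge> m" for n
    proof -
      have "fcoef f k - c k = fcoef (\<lambda>x. f x - s n x) k"
        unfolding fcoef_diff[OF L2_torus_integrable[OF fL2] L2_torus_integrable[OF sL2]]
        unfolding s_def fcoef_trig_sum[OF finite_index_box] using m[OF that] by simp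
      then have "(norm (fcoef f k - c k))\<^sup>2 \<le> (\<integral>x. (norm (f x - s n x))\<^sup>2 \<partial>torus) / ?V"
        using Bessel_inequality[OF dL2, of "{k}" n] by simp
      also have "\<dots> \<le> S - \<sigma> n" using bound[of n] V by (simp add: field_simps)
      finally show ?thesis .
    qed
    moreover have "(\<lambda>n. S - \<sigma> n) \<longlonglongrightarrow> S - S" by (intro tendsto_intros \<sigma>S)
    moreover have "\<forall>\<^sub>F n in sequentially. (norm (fcoef f k - c k))\<^sup>2 \<le> S - \<sigma> n"
      using eventually_ge_at_top[of m] by eventually_elim fact
    ultimately have "(norm (fcoef f k - c k))\<^sup>2 \<le> S - S"
      by (intro tendsto_lowerbound[of "\<lambda>n. S - \<sigma> n"]) auto
    then show ?thesis by simp
  qed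
  have "(\<integral>x. (norm (f x))\<^sup>2 \<partial>torus) = ?V * S"
  proof (rule antisym)
    have e: "fcoef f = c" using fc by auto
    have "(\<integral>x. (norm (f x))\<^sup>2 \<partial>torus) - ?V * \<sigma> 0 \<le> ?V * (S - \<sigma> 0)"
      using bound[of 0] Bessel_identity[OF fL2 finite_index_box, of 0] unfolding s_def \<sigma>_def e by simp
    then show "(\<integral>x. (norm (f x))\<^sup>2 \<partial>torus) \<le> ?V * S" by (simp add: algebra_simps)
    have "S \<le> (\<integral>x. (norm (f x))\<^sup>2 \<partial>torus) / ?V"
      unfolding S_def using Bessel_inequality[OF fL2] by (intro infsum_le_finite_sums c) (auto simp: e)
    then show "?V * S \<le> (\<integral>x. (norm (f x))\<^sup>2 \<partial>torus)" using V by (simp add: field_simps)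
  qed
  then show ?thesis using that[OF fL2 fc] unfolding S_def by blast
qed

text \<open>Bessel's inequality makes the coefficients square summable; the Riesz-Fischer function
  with these coefficients has the right norm and equals \<open>f\<close> almost everywhere by
  completeness.\<close>

theorem Parseval:
  assumes f: "f \<in> L2_torus"
  shows "((\<lambda>k. (norm (fcoef f k))\<^sup>2) has_sum (\<integral>x. (norm (f x))\<^sup>2 \<partial>torus) / (2 * pi) ^ 3) UNIV"
proof -
  have s: "(\<lambda>k. (norm (fcoef f k))\<^sup>2) summable_on UNIV"
    using Bessel_inequality[OF f] by (intro nonneg_bdd_above_summable_on bdd_aboveI2) auto
  obtain g where g: "g \<in> L2_torus" "\<And>k. fcoef g k = fcoef f k"
    "(\<integral>x. (norm (g x))\<^sup>2 \<partial>torus) = (2 * pi) ^ 3 * (\<Sum>\<^sub>\<infinity>k. (norm (fcoef f k))\<^sup>2)"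
    using Riesz_Fischer[OF s] by blast
  have "AE x in torus. g x = f x"
    by (intro AE_eq_if_fcoef_eq L2_torus_integrable f g)
  then have "(\<integral>x. (norm (g x))\<^sup>2 \<partial>torus) = (\<integral>x. (norm (f x))\<^sup>2 \<partial>torus)"
    using L2_torus_borel[OF f] L2_torus_borel[OF g(1)] by (intro integral_cong_AE) auto
  then have "(\<integral>x. (norm (f x))\<^sup>2 \<partial>torus) / (2 * pi) ^ 3 = (\<Sum>\<^sub>\<infinity>k. (norm (fcoef f k))\<^sup>2)"
    using g(3) by (simp add: field_simps)
  then show ?thesis using has_sum_infsum[OF s] by simp
qed

lemma Parseval_Re:
  assumes f: "f \<in> L2_torus" and h: "h \<in> L2_torus"
  shows "((\<lambda>k. Re (fcoef f k * cnj (fcoef h k))) has_sum (\<integral>x. Re (f x * cnj (h x)) \<partial>torus) / (2 * pi) ^ 3) UNIV"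
proof -
  have i: "integrable torus f" "integrable torus h" using f h by (auto intro: L2_torus_integrable)
  have pol: "Re (a * cnj b) = ((norm (a + b))\<^sup>2 + - (norm (a - b))\<^sup>2) * (1 / 4)" for a b
    unfolding cmod_add_sq cmod_diff_sq by simp
  note a = Parseval[OF L2_torus_add[OF f h]] and d = Parseval[OF L2_torus_diff[OF f h]]
  have "(\<integral>x. Re (f x * cnj (h x)) \<partial>torus)
      = (\<integral>x. (norm (f x + h x))\<^sup>2 - (norm (f x - h x))\<^sup>2 \<partial>torus) * (1 / 4)"
    unfolding pol by simp
  also have "(\<integral>x. (norm (f x + h x))\<^sup>2 - (norm (f x - h x))\<^sup>2 \<partial>torus)
      = (\<integral>x. (norm (f x + h x))\<^sup>2 \<partial>torus) - (\<integral>x. (norm (f x - h x))\<^sup>2 \<partial>torus)"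
    by (intro Bochner_Integration.integral_diff L2_torus_square_integrable L2_torus_add L2_torus_diff f h)
  finally have eq: "(\<integral>x. Re (f x * cnj (h x)) \<partial>torus) / (2 * pi) ^ 3
     = ((\<integral>x. (norm (f x + h x))\<^sup>2 \<partial>torus) / (2 * pi) ^ 3 + - ((\<integral>x. (norm (f x - h x))\<^sup>2 \<partial>torus) / (2 * pi) ^ 3)) * (1 / 4)"
    by (simp add: diff_divide_distrib)
  show ?thesis
    using has_sum_cmult_left[OF has_sum_add[OF a has_sum_uminusI[OF d]], of "1/4"]
    unfolding fcoef_add[OF i] fcoef_diff[OF i] eq[symmetric] pol[symmetric] .
qed

text \<open>The polarised identity for real parts is used for \<open>f\<close> and for
  \<open>- \<i> * f\<close>, the latter giving the imaginary part. The pairing is bilinear, so the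
  conjugate of \<open>g\<close> is inserted, and its conjugated coefficients are those of
  \<open>g\<close> at the opposite frequency.\<close>

lemma Parseval_mult:
  assumes f: "f \<in> L2_torus" and g: "g \<in> L2_torus"
  shows "((\<lambda>k. fcoef f k * fcoef g (- k)) has_sum (\<integral>x. f x * g x \<partial>torus) / (2 * pi) ^ 3) UNIV"
proof -
  define h where "h x = cnj (g x)" for x
  have h: "h \<in> L2_torus" unfolding h_def[abs_def] by (rule L2_torus_cnj[OF g])
  have fh: "cnj (fcoef h k) = fcoef g (- k)" for k
    unfolding h_def[abs_def] fcoef_cnj by simp
  have mf: "(\<lambda>x. - \<i> * f x) \<in> L2_torus" by (rule L2_torus_cmult[OF f])
  have ifg: "integrable torus (\<lambda>x. f x * g x)" by (rule L2_torus_mult_integrable[OF f g])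
  let ?I = "\<integral>x. f x * g x \<partial>torus"
  have 1: "((\<lambda>k. Re (fcoef f k * fcoef g (- k))) has_sum Re ?I / (2 * pi) ^ 3) UNIV"
    using Parseval_Re[OF f h] integral_Re[OF ifg] by (simp add: fh h_def)
  have "(\<integral>x. Re (- \<i> * f x * cnj (h x)) \<partial>torus) = Im ?I"
    using integral_Im[OF ifg] by (simp add: h_def)
  then have 2: "((\<lambda>k. Im (fcoef f k * fcoef g (- k))) has_sum Im ?I / (2 * pi) ^ 3) UNIV"
    using Parseval_Re[OF mf h] unfolding fcoef_cmult fh by simp
  have "((\<lambda>k. complex_of_real (Re (fcoef f k * fcoef g (- k))) + \<i> * complex_of_real (Im (fcoef f k * fcoef g (- k))))
      has_sum complex_of_real (Re ?I / (2 * pi) ^ 3) + \<i> * complex_of_real (Im ?I / (2 * pi) ^ 3)) UNIV"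
    by (intro has_sum_add has_sum_cmult_right has_sum_of_real 1 2)
  moreover have "complex_of_real (Re ?I / (2 * pi) ^ 3) + \<i> * complex_of_real (Im ?I / (2 * pi) ^ 3) = ?I / (2 * pi) ^ 3"
  proof -
    have "?I / (2 * pi) ^ 3 = (complex_of_real (Re ?I) + \<i> * complex_of_real (Im ?I)) / (2 * pi) ^ 3"
      using complex_eq[of ?I] by simp
    then show ?thesis by (simp add: add_divide_distrib)
  qed
  ultimately show ?thesis unfolding complex_eq[symmetric] by simp
qed

text \<open>The bilinear Parseval identity for \<open>f\<close> and for \<open>g\<close> modulated
  by \<open>echar (- k)\<close>.\<close>

theorem fcoef_mult:
  assumes f: "f \<in> L2_torus" and g: "g \<in> L2_torus"
  shows "((\<lambda>j. fcoef f j * fcoef g (k - j)) has_sum fcoef (\<lambda>x. f x * g x) k) UNIV"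
  using Parseval_mult[OF f L2_torus_mult_echar[OF g, of "- k"]]
  by (simp add: fcoef_mult_echar fcoef_def[of "\<lambda>x. f x * g x"] mult.assoc algebra_simps)

section \<open>Weak derivatives in terms of Fourier coefficients\<close>

lemma continuous_bounded_cbox:
  fixes f :: "real^3 \<Rightarrow> 'b::real_normed_vector"
  assumes "continuous_on UNIV f" obtains B where "\<And>x. x \<in> cbox a b \<Longrightarrow> norm (f x) \<le> B"
proof -
  have "bounded (f ` cbox a b)"
    by (intro compact_imp_bounded compact_continuous_image continuous_on_subset[OF assms]) auto
  then show ?thesis using that unfolding bounded_iff by auto
qed

lemma AE_torus_cell: "AE x in torus. x \<in> torus_cell"
  unfolding AE_torus_iff
  by (auto simp: half_open_cell_def torus_cell_def mem_box_cart less_imp_le)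

lemma integrable_torus_continuous:
  fixes f :: "real^3 \<Rightarrow> 'b::{banach, second_countable_topology}"
  assumes "continuous_on UNIV f" shows "integrable torus f"
proof -
  obtain B where B: "\<And>x. x \<in> torus_cell \<Longrightarrow> norm (f x) \<le> B"
    unfolding torus_cell_def using continuous_bounded_cbox[OF assms, of 0 "\<chi> i. 2 * pi"] by blast
  have [measurable]: "f \<in> borel_measurable borel" using assms by (rule borel_measurable_continuous_onI)
  show ?thesis
  proof (rule torus.integrable_const_bound)
    show "AE x in torus. norm (f x) \<le> B" using AE_torus_cell by eventually_elim (rule B)
  qed simp
qed

lemma L2_torus_continuous:
  fixes f :: "real^3 \<Rightarrow> 'b::euclidean_space"
  assumes "continuous_on UNIV f" "periodic f" shows "f \<in> L2_torus"
  unfolding L2_torus_iff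
  using assms by (auto intro!: borel_measurable_continuous_onI integrable_torus_continuous continuous_intros)

lemma axis_add: "axis i (s + t) = axis i s + (axis i t :: real^3)"
  by (simp add: vec_eq_iff axis_nth_eq)

lemma add_axis_0: "x + axis i (0::real) = (x :: real^3)"
  by (simp add: vec_eq_iff axis_nth_eq)

text \<open>Difference quotients of a periodic function integrate to zero by translation invariance,
  and they converge to \<open>D\<close> boundedly on the cell.\<close>

lemma integral_directional_derivative:
  fixes h D :: "real^3 \<Rightarrow> complex"
  assumes h: "continuous_on UNIV h" "periodic h" and D: "continuous_on UNIV D"
    and deriv: "\<And>x. ((\<lambda>s. h (x + axis i s)) has_vector_derivative D x) (at 0)"
  shows "integral\<^sup>L torus D = 0"
proof -
  define s where "s n = inverse (real (Suc n))" for n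
  have s: "0 < s n" "s n \<le> 1" for n by (auto simp: s_def inverse_le_1_iff)
  have s0: "s \<longlonglongrightarrow> 0" unfolding s_def[abs_def] by (rule LIMSEQ_inverse_real_of_nat)
  define q where "q n x = (h (x + axis i (s n)) - h x) /\<^sub>R s n" for n x
  have s2: "s n \<le> 2 * pi" for n using s(2)[of n] pi_gt3 by linarith
  have axis_cont: "continuous_on UNIV (\<lambda>x::real^3. x + axis i t)" for t by (intro continuous_intros)
  have hs: "continuous_on UNIV (\<lambda>x. h (x + axis i t))" for t
    by (rule continuous_on_compose2[OF h(1) axis_cont]) auto
  have ih: "integrable torus h" by (rule integrable_torus_continuous[OF h(1)])
  have ihs: "integrable torus (\<lambda>x. h (x + axis i (s n)))" for n by (rule integrable_torus_continuous[OF hs])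
  have iq: "integrable torus (q n)" for n
    unfolding q_def[abs_def] using ih ihs by simp
  have q0: "integral\<^sup>L torus (q n) = 0" for n
    unfolding q_def[abs_def] using ih ihs torus_shift_integral[OF ih h(2) less_imp_le[OF s(1)] s2] by simp
  have deriv': "((\<lambda>s. h (x + axis i s)) has_vector_derivative D (x + axis i t)) (at t)" for x t
  proof -
    have "((\<lambda>s. h (x + axis i t + axis i s)) has_vector_derivative D (x + axis i t)) (at (t - t))"
      using deriv[of "x + axis i t"] by simp
    then have "((\<lambda>s. h (x + axis i t + axis i s)) \<circ> (\<lambda>s. s - t) has_vector_derivative 1 *\<^sub>R D (x + axis i t)) (at t)"
      by (intro vector_diff_chain_at) (auto intro!: derivative_eq_intros simp: has_vector_derivative_def)
    moreover have "(\<lambda>s. h (x + axis i t + axis i s)) \<circ> (\<lambda>s. s - t) = (\<lambda>s. h (x + axis i s))"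
      by (auto simp: fun_eq_iff add.assoc axis_add[symmetric])
    ultimately show ?thesis by simp
  qed
  \<comment> \<open>The cell is enlarged by 1 because translates by \<open>s n\<close>, which is at
    most 1, may leave it.\<close>
  obtain B where B: "\<And>x. x \<in> cbox 0 (\<chi> i. 2 * pi + 1) \<Longrightarrow> norm (D x) \<le> B"
    by (rule continuous_bounded_cbox[OF D]) blast
  have qB: "norm (q n x) \<le> B" if x: "x \<in> torus_cell" for n x
  proof -
    have "norm (h (x + axis i (s n)) - h (x + axis i 0)) \<le> B * s n - B * 0"
    proof (rule differentiable_bound_general[where f = "\<lambda>t. h (x + axis i t)" and f' = "\<lambda>t. D (x + axis i t)" and \<phi>' = "\<lambda>_. B"])
      show "0 < s n" by (rule s)
      show "continuous_on {0..s n} (\<lambda>t. h (x + axis i t))"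
        using deriv' by (intro continuous_at_imp_continuous_on ballI has_vector_derivative_continuous)
      show "continuous_on {0..s n} ((*) B)" by (intro continuous_intros)
      fix t assume t: "0 < t" "t < s n"
      show "((\<lambda>t. h (x + axis i t)) has_vector_derivative D (x + axis i t)) (at t)" by (rule deriv')
      show "((*) B has_vector_derivative B) (at t)"
        unfolding has_vector_derivative_def by (auto intro!: derivative_eq_intros)
      have "x + axis i t \<in> cbox 0 (\<chi> i. 2 * pi + 1)"
        using x t s(2)[of n] unfolding torus_cell_def mem_box_cart
        by (auto simp: axis_nth_eq intro: order_trans[of _ "2 * pi"] add_mono)
      then show "norm (D (x + axis i t)) \<le> B" by (rule B)
    qed
    moreover have "norm (q n x) = norm (h (x + axis i (s n)) - h x) / s n"
      using s(1)[of n] by (simp add: q_def divide_inverse_commute)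
    ultimately show ?thesis using s(1)[of n] by (simp add: add_axis_0 pos_divide_le_eq)
  qed
  have qD: "(\<lambda>n. q n x) \<longlonglongrightarrow> D x" for x
  proof -
    have lim0: "((\<lambda>t. norm (h (x + axis i t) - h x - t *\<^sub>R D x) / norm t) \<longlongrightarrow> 0) (at 0)"
      using deriv[of x] unfolding has_vector_derivative_def has_derivative_at by (simp add: add_axis_0)
    have sat: "filterlim s (at 0) sequentially"
      unfolding filterlim_at using s0 s(1) by (simp add: less_imp_neq[symmetric])
    have "(\<lambda>n. norm (h (x + axis i (s n)) - h x - s n *\<^sub>R D x) / norm (s n)) \<longlonglongrightarrow> 0"
      by (rule filterlim_compose[OF lim0 sat])
    moreover have "norm (h (x + axis i (s n)) - h x - s n *\<^sub>R D x) / norm (s n) = norm (q n x - D x)" for n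
    proof -
      have "q n x - D x = (h (x + axis i (s n)) - h x - s n *\<^sub>R D x) /\<^sub>R s n"
        using s(1)[of n] by (simp add: q_def scaleR_diff_right)
      then show ?thesis by (simp add: divide_inverse_commute)
    qed
    ultimately have "(\<lambda>n. norm (q n x - D x)) \<longlonglongrightarrow> 0" by simp
    then show ?thesis by (rule LIM_zero_cancel[OF tendsto_norm_zero_cancel])
  qed
  have "(\<lambda>n. integral\<^sup>L torus (q n)) \<longlonglongrightarrow> integral\<^sup>L torus D"
  proof (rule integral_dominated_convergence[where w = "\<lambda>_. B"])
    show "AE x in torus. norm (q n x) \<le> B" for n using AE_torus_cell by eventually_elim (rule qB)
    show "AE x in torus. (\<lambda>n. q n x) \<longlonglongrightarrow> D x" using qD by simp
    show "D \<in> borel_measurable torus" using borel_measurable_continuous_onI[OF D] by simp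
    show "q n \<in> borel_measurable torus" for n using iq by auto
  qed simp
  then show ?thesis unfolding q0 using LIMSEQ_unique tendsto_const by blast
qed

section \<open>Derivatives of test functions on the Fourier side\<close>

lemma test_function_differentiable: "test_function \<phi> \<Longrightarrow> \<phi> differentiable (at x)"
  unfolding test_function_def using fold_simps(1)[of partial \<phi>] by metis

lemma test_function_continuous: "test_function \<phi> \<Longrightarrow> continuous_on UNIV \<phi>"
  by (intro differentiable_imp_continuous_on)
    (simp add: differentiable_on_def test_function_differentiable)

lemma test_function_periodic: "test_function \<phi> \<Longrightarrow> periodic \<phi>"
  unfolding test_function_def by blast

lemma has_derivative_partial:
  assumes "\<phi> differentiable (at x)"
  shows "((\<lambda>s. \<phi> (x + axis i s)) has_vector_derivative partial i \<phi> x) (at 0)"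
proof -
  have ax: "axis i s = s *\<^sub>R axis i 1" for s :: real by (simp add: vec_eq_iff axis_nth_eq)
  let ?D = "frechet_derivative \<phi> (at x)"
  have D: "(\<phi> has_derivative ?D) (at x)" using assms frechet_derivative_works by blast
  have "((\<lambda>s. x + s *\<^sub>R axis i 1) has_derivative (\<lambda>s. s *\<^sub>R axis i 1)) (at (0::real))"
    by (auto intro!: derivative_eq_intros)
  then have "(\<phi> \<circ> (\<lambda>s. x + s *\<^sub>R axis i 1) has_derivative ?D \<circ> (\<lambda>s. s *\<^sub>R axis i 1)) (at 0)"
    using D by (intro diff_chain_at) auto
  moreover have "?D (s *\<^sub>R axis i 1) = s *\<^sub>R ?D (axis i 1)" for s
    using D by (intro linear_scale has_derivative_linear)
  moreover have "(\<lambda>s. \<phi> (x + axis i s)) = \<phi> \<circ> (\<lambda>s. x + s *\<^sub>R axis i 1)"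
    by (rule ext) (subst ax, simp)
  ultimately show ?thesis unfolding has_vector_derivative_def partial_def by (simp add: o_def)
qed

lemma periodic_partial:
  assumes "periodic \<phi>" "\<And>x. \<phi> differentiable (at x)" shows "periodic (partial i \<phi>)"
  unfolding periodic_def
proof safe
  fix x j
  let ?c = "axis j (2 * pi) :: real^3"
  have "(\<phi> has_derivative frechet_derivative \<phi> (at (x + ?c))) (at (x + ?c))"
    using assms(2) frechet_derivative_works by blast
  moreover have "((\<lambda>y. y + ?c) has_derivative (\<lambda>h. h)) (at x)" by (auto intro!: derivative_eq_intros)
  ultimately have "(\<phi> \<circ> (\<lambda>y. y + ?c) has_derivative frechet_derivative \<phi> (at (x + ?c)) \<circ> (\<lambda>h. h)) (at x)"
    by (intro diff_chain_at)
  moreover have "\<phi> \<circ> (\<lambda>y. y + ?c) = \<phi>" using assms(1) by (auto simp: periodic_def)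
  ultimately have "(\<phi> has_derivative frechet_derivative \<phi> (at (x + ?c))) (at x)" by (simp add: o_def)
  then show "partial i \<phi> (x + ?c) = partial i \<phi> x"
    unfolding partial_def using frechet_derivative_at by fastforce
qed

lemma test_function_partial:
  assumes "test_function \<phi>" shows "test_function (partial i \<phi>)"
  unfolding test_function_def
proof safe
  show "periodic (partial i \<phi>)"
    using assms test_function_differentiable test_function_periodic by (intro periodic_partial) auto
  fix "is" x
  show "fold partial is (partial i \<phi>) differentiable (at x)"
    using assms unfolding test_function_def by (metis fold_simps(2))
qed

text \<open>Integration by parts without boundary terms: the derivative of the periodic product of
  \<open>\<phi>\<close> and \<open>echar (- k)\<close> has integral zero.\<close>

lemma fcoef_partial:
  assumes "test_function \<phi>"
  shows "fcoef (\<lambda>x. of_real (partial i \<phi> x)) k = \<i> * of_int (k $ i) * fcoef (\<lambda>x. of_real (\<phi> x)) k"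
proof -
  let ?e = "echar (- k)" and ?c = "\<i> * of_int (k $ i) :: complex"
  have c1: "continuous_on UNIV (\<lambda>x. complex_of_real (\<phi> x))"
    using test_function_continuous[OF assms] by (intro continuous_intros)
  have c2: "continuous_on UNIV (\<lambda>x. complex_of_real (partial i \<phi> x))"
    using test_function_continuous[OF test_function_partial[OF assms]] by (intro continuous_intros)
  have de: "((\<lambda>s. ?e (x + axis i s)) has_vector_derivative (- ?c * ?e x)) (at 0)" for x
  proof -
    have "((\<lambda>s. exp (s *\<^sub>R (- ?c)) * ?e x) has_vector_derivative (exp (0 *\<^sub>R (- ?c)) * - ?c * ?e x)) (at 0)"
      by (intro has_vector_derivative_mult_left exp_scaleR_has_vector_derivative_right)
    moreover have "?e (x + axis i s) = exp (s *\<^sub>R (- ?c)) * ?e x" for s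
    proof -
      have "\<i> * of_real (real_of_int (- (k $ i)) * s) = s *\<^sub>R (- ?c)" by (simp add: scaleR_conv_of_real)
      then show ?thesis unfolding echar_shift cis_conv_exp by simp
    qed
    ultimately show ?thesis by simp
  qed
  have "(\<integral>x. of_real (partial i \<phi> x) * ?e x + of_real (\<phi> x) * (- ?c * ?e x) \<partial>torus) = 0"
  proof (rule integral_directional_derivative[where h = "\<lambda>x. of_real (\<phi> x) * ?e x" and i = i])
    show "periodic (\<lambda>x. complex_of_real (\<phi> x) * ?e x)"
      using periodic_comp2[OF test_function_periodic[OF assms] periodic_echar[of "- k"], of "\<lambda>a b. complex_of_real a * b"] .
    show "continuous_on UNIV (\<lambda>x. complex_of_real (\<phi> x) * ?e x)"
      by (intro continuous_on_mult c1 continuous_on_echar)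
    show "continuous_on UNIV (\<lambda>x. of_real (partial i \<phi> x) * ?e x + of_real (\<phi> x) * (- ?c * ?e x))"
      by (intro continuous_on_add continuous_on_mult c1 c2 continuous_on_echar continuous_on_const)
    fix x
    have "((\<lambda>s. complex_of_real (\<phi> (x + axis i s))) has_vector_derivative of_real (partial i \<phi> x)) (at 0)"
      by (rule bounded_linear.has_vector_derivative[OF bounded_linear_of_real])
        (rule has_derivative_partial[OF test_function_differentiable[OF assms]])
    from has_vector_derivative_mult[OF this de[of x]]
    show "((\<lambda>s. of_real (\<phi> (x + axis i s)) * ?e (x + axis i s)) has_vector_derivative
       of_real (partial i \<phi> x) * ?e x + of_real (\<phi> x) * (- ?c * ?e x)) (at 0)"
      by (simp only: add_axis_0 add.commute)
  qed
  moreover have "(\<integral>x. of_real (partial i \<phi> x) * ?e x + of_real (\<phi> x) * (- ?c * ?e x) \<partial>torus)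
    = (\<integral>x. of_real (partial i \<phi> x) * ?e x \<partial>torus) - ?c * (\<integral>x. of_real (\<phi> x) * ?e x \<partial>torus)"
  proof -
    have i: "integrable torus (\<lambda>x. of_real (partial i \<phi> x) * ?e x)" "integrable torus (\<lambda>x. of_real (\<phi> x) * ?e x)"
      by (intro integrable_mult_echar integrable_torus_continuous c1 c2)+
    have "(\<lambda>x. of_real (partial i \<phi> x) * ?e x + of_real (\<phi> x) * (- ?c * ?e x))
      = (\<lambda>x. of_real (partial i \<phi> x) * ?e x - ?c * (of_real (\<phi> x) * ?e x))" by (simp add: fun_eq_iff)
    then show ?thesis
      using i by (simp only: Bochner_Integration.integral_diff integrable_mult_right integral_mult_right_zero)
  qed
  ultimately show ?thesis by (simp add: fcoef_def)
qed

text \<open>The Fourier multiplier \<open>(\<i> k)^\<alpha>\<close> of the derivative with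
  multi-index \<open>\<alpha>\<close>.\<close>

definition deriv_symbol :: "multi_index \<Rightarrow> int^3 \<Rightarrow> complex" where
  "deriv_symbol \<alpha> k = (\<i> * of_int (k $ 1)) ^ (\<alpha> $ 1) * (\<i> * of_int (k $ 2)) ^ (\<alpha> $ 2) * (\<i> * of_int (k $ 3)) ^ (\<alpha> $ 3)"

lemma mi_order_3: "mi_order \<alpha> = \<alpha> $ 1 + \<alpha> $ 2 + \<alpha> $ 3"
  by (simp add: mi_order_def sum_3)

lemma deriv_symbol_minus: "deriv_symbol \<alpha> (- k) = (-1) ^ mi_order \<alpha> * deriv_symbol \<alpha> k"
proof -
  have "(\<i> * of_int ((- k) $ j)) ^ n = (-1) ^ n * (\<i> * of_int (k $ j)) ^ n" for j n
    by (simp flip: power_mult_distrib)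
  then show ?thesis unfolding deriv_symbol_def mi_order_3 power_add by (simp only: mult_ac)
qed

lemma deriv_symbol_cnj: "cnj (deriv_symbol \<alpha> k) = deriv_symbol \<alpha> (- k)"
  unfolding deriv_symbol_def by simp

lemma test_function_partial_pow: "test_function \<phi> \<Longrightarrow> test_function ((partial i ^^ n) \<phi>)"
  by (induction n) (auto intro: test_function_partial)

lemma fcoef_partial_pow:
  "test_function \<phi> \<Longrightarrow> fcoef (\<lambda>x. of_real ((partial i ^^ n) \<phi> x)) k = (\<i> * of_int (k $ i)) ^ n * fcoef (\<lambda>x. of_real (\<phi> x)) k"
  by (induction n) (auto simp: fcoef_partial test_function_partial_pow)

lemma test_function_mpartial: "test_function \<phi> \<Longrightarrow> test_function (mpartial \<alpha> \<phi>)"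
  unfolding mpartial_def by (intro test_function_partial_pow)

lemma fcoef_mpartial:
  "test_function \<phi> \<Longrightarrow> fcoef (\<lambda>x. of_real (mpartial \<alpha> \<phi> x)) k = deriv_symbol \<alpha> k * fcoef (\<lambda>x. of_real (\<phi> x)) k"
  unfolding mpartial_def by (simp add: fcoef_partial_pow test_function_partial_pow deriv_symbol_def)

text \<open>Weak derivatives are tested with real functions, so characters enter through real parts.
  The complex amplitude covers sine and cosine at once, and differentiation just multiplies it by
  the symbol.\<close>

definition real_wave :: "complex \<Rightarrow> int^3 \<Rightarrow> real^3 \<Rightarrow> real" where
  "real_wave c k x = Re (c * echar k x)"

lemma real_wave_has_derivative:
  "(real_wave c k has_derivative (\<lambda>h. (wave_vec k \<bullet> h) * real_wave (\<i> * c) k x)) (at x)"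
proof -
  have "real_wave c k = (\<lambda>x. Re c * cos (wave_vec k \<bullet> x) - Im c * sin (wave_vec k \<bullet> x))"
    by (auto simp: real_wave_def echar_def)
  then show ?thesis
    by (auto intro!: derivative_eq_intros simp: real_wave_def echar_def algebra_simps)
qed

lemma partial_real_wave: "partial i (real_wave c k) = real_wave (\<i> * of_int (k $ i) * c) k"
proof
  fix x
  have "frechet_derivative (real_wave c k) (at x) = (\<lambda>h. (wave_vec k \<bullet> h) * real_wave (\<i> * c) k x)"
    by (rule frechet_derivative_at[OF real_wave_has_derivative, symmetric])
  then show "partial i (real_wave c k) x = real_wave (\<i> * of_int (k $ i) * c) k x"
    by (simp add: partial_def inner_axis real_wave_def algebra_simps)
qed

lemma test_function_real_wave: "test_function (real_wave c k)"
  unfolding test_function_def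
proof safe
  show "periodic (real_wave c k)"
    unfolding real_wave_def[abs_def] using periodic_comp[OF periodic_echar, of "\<lambda>z. Re (c * z)" k] .
  fix "is" x
  have "\<exists>c'. fold partial is (real_wave c k) = real_wave c' k"
    by (induction "is" arbitrary: c) (auto simp: partial_real_wave)
  then show "fold partial is (real_wave c k) differentiable (at x)"
    using real_wave_has_derivative differentiable_def by metis
qed

lemma mpartial_real_wave: "mpartial \<alpha> (real_wave c k) = real_wave (deriv_symbol \<alpha> k * c) k"
proof -
  have "(partial i ^^ n) (real_wave c k) = real_wave ((\<i> * of_int (k $ i)) ^ n * c) k" for i n c
    by (induction n) (auto simp: partial_real_wave mult.assoc)
  then show ?thesis by (simp add: mpartial_def deriv_symbol_def mult.assoc)
qed

definition coef :: "(real^3 \<Rightarrow> 'b::euclidean_space) \<Rightarrow> 'b \<Rightarrow> int^3 \<Rightarrow> complex" where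
  "coef f b = fcoef (\<lambda>x. complex_of_real (f x \<bullet> b))"

lemma coef_minus: "coef f b (- k) = cnj (coef f b k)"
  unfolding coef_def using fcoef_cnj[of "\<lambda>x. complex_of_real (f x \<bullet> b)" "- k"] by simp

lemma L2_torus_component:
  fixes f :: "real^3 \<Rightarrow> 'b::euclidean_space"
  assumes "f \<in> L2_torus" shows "(\<lambda>x. complex_of_real (f x \<bullet> b)) \<in> L2_torus"
proof -
  have "bounded_linear (\<lambda>v. complex_of_real (v \<bullet> b))"
    by (rule bounded_linear_compose[OF bounded_linear_of_real bounded_linear_inner_left])
  then show ?thesis using L2_torus_linear_image[OF assms] by blast
qed

lemma L2_torus_of_real: "f \<in> L2_torus \<Longrightarrow> (\<lambda>x. complex_of_real (f x)) \<in> L2_torus"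
  by (rule L2_torus_linear_image[OF _ bounded_linear_of_real])

lemma L2_torus_test_function:
  assumes "test_function \<phi>" shows "\<phi> \<in> L2_torus"
  using assms by (intro L2_torus_continuous test_function_continuous test_function_periodic)

lemma L2_torus_scaleR_integrable:
  fixes f :: "real^3 \<Rightarrow> 'b::euclidean_space"
  assumes "\<phi> \<in> L2_torus" "f \<in> L2_torus" shows "integrable torus (\<lambda>x. \<phi> x *\<^sub>R f x)"
proof (rule Bochner_Integration.integrable_bound)
  have [measurable]: "\<phi> \<in> borel_measurable borel" "f \<in> borel_measurable borel" using assms by (auto dest: L2_torus_borel)
  show "(\<lambda>x. \<phi> x *\<^sub>R f x) \<in> borel_measurable torus" by simp
  show "integrable torus (\<lambda>x. (norm (\<phi> x))\<^sup>2 + (norm (f x))\<^sup>2)"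
    using L2_torus_square_integrable[OF assms(1)] L2_torus_square_integrable[OF assms(2)] by simp
  have "norm (\<phi> x *\<^sub>R f x) \<le> norm ((norm (\<phi> x))\<^sup>2 + (norm (f x))\<^sup>2)" for x
  proof -
    have "0 \<le> (norm (\<phi> x) - norm (f x))\<^sup>2" "0 \<le> norm (\<phi> x) * norm (f x)" by simp_all
    then have "norm (\<phi> x) * norm (f x) \<le> (norm (\<phi> x))\<^sup>2 + (norm (f x))\<^sup>2"
      unfolding power2_diff by linarith
    then show ?thesis by simp
  qed
  then show "AE x in torus. norm (\<phi> x *\<^sub>R f x) \<le> norm ((norm (\<phi> x))\<^sup>2 + (norm (f x))\<^sup>2)" by simp
qed

lemma integral_scaleR_inner:
  fixes f :: "real^3 \<Rightarrow> 'b::euclidean_space"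
  assumes "\<phi> \<in> L2_torus" "f \<in> L2_torus"
  shows "complex_of_real ((LINT x:torus_cell|lborel. \<phi> x *\<^sub>R f x) \<bullet> b)
    = (\<integral>x. complex_of_real (\<phi> x) * complex_of_real (f x \<bullet> b) \<partial>torus)"
proof -
  have "(LINT x:torus_cell|lborel. \<phi> x *\<^sub>R f x) = (\<integral>x. \<phi> x *\<^sub>R f x \<partial>torus)"
    by (intro set_integral_torus borel_measurable_scaleR L2_torus_borel assms)
  moreover have "(\<integral>x. \<phi> x *\<^sub>R f x \<partial>torus) \<bullet> b = (\<integral>x. \<phi> x *\<^sub>R f x \<bullet> b \<partial>torus)"
    by (rule integral_inner_left[symmetric]) (rule L2_torus_scaleR_integrable[OF assms])
  ultimately have "(LINT x:torus_cell|lborel. \<phi> x *\<^sub>R f x) \<bullet> b = (\<integral>x. \<phi> x * (f x \<bullet> b) \<partial>torus)"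
    by simp
  then show ?thesis by (simp flip: integral_complex_of_real)
qed

text \<open>One direction tests with real waves of frequency \<open>- k\<close> and recombines them
  into a character. The other applies the bilinear Parseval identity to an arbitrary test function;
  the sign of the symbol under reflection of the frequency matches the sign in the weak
  derivative.\<close>

theorem has_weak_deriv_iff:
  fixes f g :: "real^3 \<Rightarrow> 'b::euclidean_space"
  shows "has_weak_deriv \<alpha> f g \<longleftrightarrow> f \<in> L2_torus \<and> g \<in> L2_torus \<and>
    (\<forall>b\<in>Basis. \<forall>k. coef g b k = deriv_symbol \<alpha> k * coef f b k)" (is "?L \<longleftrightarrow> ?R")
proof
  assume L: ?L
  then have fg: "f \<in> L2_torus" "g \<in> L2_torus" by (auto simp: has_weak_deriv_def)
  have "coef g b k = deriv_symbol \<alpha> k * coef f b k" for b k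
  proof -
    let ?F = "\<lambda>x. complex_of_real (f x \<bullet> b)" and ?G = "\<lambda>x. complex_of_real (g x \<bullet> b)"
    let ?s = "deriv_symbol \<alpha> (- k)" and ?m = "(-1) ^ mi_order \<alpha> :: complex"
    have wave: "(\<integral>x. of_real (real_wave (?s * c) (- k) x) * ?F x \<partial>torus)
       = ?m * (\<integral>x. of_real (real_wave c (- k) x) * ?G x \<partial>torus)" for c
    proof -
      let ?\<phi> = "real_wave c (- k)"
      have "test_function ?\<phi>" by (rule test_function_real_wave)
      then have "(LINT x:torus_cell|lborel. mpartial \<alpha> ?\<phi> x *\<^sub>R f x) =
        (-1) ^ mi_order \<alpha> *\<^sub>R (LINT x:torus_cell|lborel. ?\<phi> x *\<^sub>R g x)"
        using L unfolding has_weak_deriv_def by blast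
      then have "complex_of_real ((LINT x:torus_cell|lborel. mpartial \<alpha> ?\<phi> x *\<^sub>R f x) \<bullet> b) =
        ?m * complex_of_real ((LINT x:torus_cell|lborel. ?\<phi> x *\<^sub>R g x) \<bullet> b)" by simp
      then show ?thesis
        by (simp only: integral_scaleR_inner L2_torus_test_function test_function_mpartial test_function_real_wave fg mpartial_real_wave)
    qed
    \<comment> \<open>\<open>z = Re z + \<i> * Re (- \<i> * z)\<close>, so the waves of amplitudes
      \<open>c\<close> and \<open>- \<i> * c\<close> together give
      \<open>c * echar (- k)\<close>.\<close>
    have comb: "(\<integral>x. of_real (real_wave c (- k) x) * H x \<partial>torus) + \<i> * (\<integral>x. of_real (real_wave (- \<i> * c) (- k) x) * H x \<partial>torus)
       = c * complex_of_real ((2 * pi) ^ 3) * fcoef H k" if H: "H \<in> L2_torus" for c H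
    proof -
      have i: "integrable torus (\<lambda>x. of_real (real_wave d (- k) x) * H x)" for d
        by (intro L2_torus_mult_integrable H L2_torus_of_real L2_torus_test_function test_function_real_wave)
      have "(\<integral>x. of_real (real_wave c (- k) x) * H x \<partial>torus) + \<i> * (\<integral>x. of_real (real_wave (- \<i> * c) (- k) x) * H x \<partial>torus)
        = (\<integral>x. of_real (real_wave c (- k) x) * H x + \<i> * (of_real (real_wave (- \<i> * c) (- k) x) * H x) \<partial>torus)"
        using i by (simp only: Bochner_Integration.integral_add integrable_mult_right integral_mult_right_zero)
      also have "\<dots> = (\<integral>x. c * (H x * echar (- k) x) \<partial>torus)"
      proof (intro Bochner_Integration.integral_cong refl)
        fix x
        have eq: "of_real (real_wave c (- k) x) + \<i> * of_real (real_wave (- \<i> * c) (- k) x) = c * echar (- k) x"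
          by (simp add: real_wave_def complex_eq_iff)
        have "of_real (real_wave c (- k) x) * H x + \<i> * (of_real (real_wave (- \<i> * c) (- k) x) * H x)
          = (of_real (real_wave c (- k) x) + \<i> * of_real (real_wave (- \<i> * c) (- k) x)) * H x"
          by (simp only: distrib_right mult.assoc)
        also have "\<dots> = c * (H x * echar (- k) x)" unfolding eq by (simp only: mult_ac)
        finally show "of_real (real_wave c (- k) x) * H x + \<i> * (of_real (real_wave (- \<i> * c) (- k) x) * H x) = c * (H x * echar (- k) x)" .
      qed
      finally show ?thesis by (simp add: fcoef_def)
    qed
    have F: "?F \<in> L2_torus" and G: "?G \<in> L2_torus" using fg by (auto intro: L2_torus_component)
    have w1: "(\<integral>x. of_real (real_wave ?s (- k) x) * ?F x \<partial>torus) = ?m * (\<integral>x. of_real (real_wave 1 (- k) x) * ?G x \<partial>torus)"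
      using wave[of 1] by (simp only: mult_1_right)
    have "?s * (- \<i> * 1) = - \<i> * ?s" by simp
    then have w2: "(\<integral>x. of_real (real_wave (- \<i> * ?s) (- k) x) * ?F x \<partial>torus) = ?m * (\<integral>x. of_real (real_wave (- \<i> * 1) (- k) x) * ?G x \<partial>torus)"
      using wave[of "- \<i> * 1"] by (simp only:)
    have "?s * complex_of_real ((2 * pi) ^ 3) * fcoef ?F k = ?m * (1 * complex_of_real ((2 * pi) ^ 3) * fcoef ?G k)"
      unfolding comb[OF F, of "?s", symmetric] comb[OF G, of 1, symmetric] distrib_left w1 w2
      by (simp only: mult.left_commute)
    then have "?s * fcoef ?F k = ?m * fcoef ?G k" by (simp add: mult.left_commute mult.assoc)
    then have "?m * (deriv_symbol \<alpha> k * fcoef ?F k) = ?m * fcoef ?G k"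
      unfolding deriv_symbol_minus by (simp only: mult.assoc)
    then show ?thesis by (simp add: coef_def)
  qed
  then show ?R using fg by blast
next
  assume R: ?R
  then have fg: "f \<in> L2_torus" "g \<in> L2_torus" by auto
  show ?L unfolding has_weak_deriv_def
  proof (intro conjI fg allI impI)
    fix \<phi> assume \<phi>: "test_function \<phi>"
    show "(LINT x:torus_cell|lborel. mpartial \<alpha> \<phi> x *\<^sub>R f x) =
        (-1) ^ mi_order \<alpha> *\<^sub>R (LINT x:torus_cell|lborel. \<phi> x *\<^sub>R g x)"
    proof (rule euclidean_eqI)
      fix b :: 'b assume b: "b \<in> Basis"
      let ?F = "\<lambda>x. complex_of_real (f x \<bullet> b)" and ?G = "\<lambda>x. complex_of_real (g x \<bullet> b)"
      have F: "?F \<in> L2_torus" and G: "?G \<in> L2_torus" using fg by (auto intro: L2_torus_component)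
      have P: "(\<lambda>x. complex_of_real (\<phi> x)) \<in> L2_torus" "(\<lambda>x. complex_of_real (mpartial \<alpha> \<phi> x)) \<in> L2_torus"
        by (intro L2_torus_of_real L2_torus_test_function test_function_mpartial \<phi>)+
      have "fcoef (\<lambda>x. of_real (mpartial \<alpha> \<phi> x)) k * fcoef ?F (- k)
          = (-1) ^ mi_order \<alpha> * (fcoef (\<lambda>x. of_real (\<phi> x)) k * fcoef ?G (- k))" for k
        using R b unfolding coef_def by (simp add: fcoef_mpartial[OF \<phi>] deriv_symbol_minus flip: power_mult_distrib)
      then have "(\<integral>x. of_real (mpartial \<alpha> \<phi> x) * ?F x \<partial>torus) / (2 * pi) ^ 3
          = (-1) ^ mi_order \<alpha> * ((\<integral>x. of_real (\<phi> x) * ?G x \<partial>torus) / (2 * pi) ^ 3)"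
        using Parseval_mult[OF P(2) F] has_sum_cmult_right[OF Parseval_mult[OF P(1) G], of "(-1) ^ mi_order \<alpha>"]
        by (simp only: has_sum_unique)
      then have "(\<integral>x. of_real (mpartial \<alpha> \<phi> x) * ?F x \<partial>torus) = (-1) ^ mi_order \<alpha> * (\<integral>x. of_real (\<phi> x) * ?G x \<partial>torus)"
        by (simp add: divide_eq_eq)
      then have "complex_of_real ((LINT x:torus_cell|lborel. mpartial \<alpha> \<phi> x *\<^sub>R f x) \<bullet> b)
          = complex_of_real (((-1) ^ mi_order \<alpha> *\<^sub>R (LINT x:torus_cell|lborel. \<phi> x *\<^sub>R g x)) \<bullet> b)"
        using \<phi> fg by (simp add: integral_scaleR_inner L2_torus_test_function test_function_mpartial)
      then show "(LINT x:torus_cell|lborel. mpartial \<alpha> \<phi> x *\<^sub>R f x) \<bullet> b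
          = ((-1) ^ mi_order \<alpha> *\<^sub>R (LINT x:torus_cell|lborel. \<phi> x *\<^sub>R g x)) \<bullet> b"
        by (simp only: of_real_eq_iff)
    qed
  qed
qed

lemma has_sum_finite_sum:
  fixes f :: "'i \<Rightarrow> 'a \<Rightarrow> 'b::topological_comm_monoid_add"
  assumes "finite I" "\<And>i. i \<in> I \<Longrightarrow> (f i has_sum s i) A"
  shows "((\<lambda>k. \<Sum>i\<in>I. f i k) has_sum (\<Sum>i\<in>I. s i)) A"
  using assms
proof (induction I)
  case (insert i I)
  then have "((\<lambda>k. f i k + (\<Sum>i\<in>I. f i k)) has_sum (s i + (\<Sum>i\<in>I. s i))) A"
    by (intro has_sum_add) simp_all
  then show ?case using insert.hyps by simp
qed simp

lemma has_sum_L2_norm: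
  fixes f :: "real^3 \<Rightarrow> 'b::euclidean_space"
  assumes "f \<in> L2_torus"
  shows "((\<lambda>k. \<Sum>b\<in>Basis. (norm (coef f b k))\<^sup>2) has_sum (L2_norm f)\<^sup>2 / (2 * pi) ^ 3) UNIV"
proof -
  have "(norm v)\<^sup>2 = (\<Sum>b\<in>Basis. (norm (complex_of_real (v \<bullet> b)))\<^sup>2)" for v :: 'b
  proof -
    have "(norm v)\<^sup>2 = v \<bullet> v" by (rule power2_norm_eq_inner)
    also have "\<dots> = (\<Sum>b\<in>Basis. (v \<bullet> b) * (v \<bullet> b))" by (rule euclidean_inner)
    finally show ?thesis by (simp add: power2_eq_square)
  qed
  then have "(L2_norm f)\<^sup>2 = (\<integral>x. (\<Sum>b\<in>Basis. (norm (complex_of_real (f x \<bullet> b)))\<^sup>2) \<partial>torus)"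
    unfolding L2_norm_sq[OF L2_torus_borel[OF assms]] by simp
  also have "\<dots> = (\<Sum>b\<in>Basis. (\<integral>x. (norm (complex_of_real (f x \<bullet> b)))\<^sup>2 \<partial>torus))"
    by (intro Bochner_Integration.integral_sum L2_torus_square_integrable L2_torus_component assms)
  finally have "(L2_norm f)\<^sup>2 / (2 * pi) ^ 3 = (\<Sum>b\<in>Basis. (\<integral>x. (norm (complex_of_real (f x \<bullet> b)))\<^sup>2 \<partial>torus) / (2 * pi) ^ 3)"
    by (simp add: sum_divide_distrib)
  then show ?thesis
    unfolding coef_def using Parseval[OF L2_torus_component[OF assms]]
    by (simp only:) (intro has_sum_finite_sum, auto)
qed

text \<open>The real part of a Riesz-Fischer function is its average with its conjugate; Hermitian
  symmetry of \<open>c\<close> says that both have the same coefficients.\<close>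

lemma ex_L2_with_coef:
  fixes c :: "'b::euclidean_space \<Rightarrow> int^3 \<Rightarrow> complex"
  assumes s: "\<And>b. b \<in> Basis \<Longrightarrow> (\<lambda>k. (norm (c b k))\<^sup>2) summable_on UNIV"
    and r: "\<And>b k. b \<in> Basis \<Longrightarrow> c b (- k) = cnj (c b k)"
  shows "\<exists>f\<in>L2_torus. \<forall>b\<in>Basis. coef f b = c b"
proof -
  have "\<exists>g. g \<in> L2_torus \<and> (\<forall>k. fcoef g k = c b k)" if "b \<in> Basis" for b
    using Riesz_Fischer[OF s[OF that]] by metis
  then obtain g where g: "\<And>b. b \<in> Basis \<Longrightarrow> g b \<in> L2_torus" "\<And>b k. b \<in> Basis \<Longrightarrow> fcoef (g b) k = c b k"
    by metis
  define f where "f x = (\<Sum>b\<in>Basis. Re (g b x) *\<^sub>R b)" for x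
  have "f \<in> L2_torus" unfolding f_def[abs_def]
  proof (rule L2_torus_sum)
    fix b :: 'b assume b: "b \<in> Basis"
    have "bounded_linear (\<lambda>z. Re z *\<^sub>R b)"
      by (rule bounded_linear_compose[OF bounded_linear_scaleR_left bounded_linear_Re])
    then show "(\<lambda>x. Re (g b x) *\<^sub>R b) \<in> L2_torus" by (rule L2_torus_linear_image[OF g(1)[OF b]])
  qed
  moreover have "coef f b = c b" if b: "b \<in> Basis" for b
  proof
    fix k
    have fb: "complex_of_real (f x \<bullet> b) = (1 / 2) * (g b x + cnj (g b x))" for x
      using b by (simp add: f_def inner_sum_left inner_Basis if_distrib complex_add_cnj cong: if_cong)
    have "coef f b k = (1 / 2) * (fcoef (g b) k + cnj (fcoef (g b) (- k)))"
      unfolding coef_def fb fcoef_cmult fcoef_cnj[symmetric]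
      by (subst fcoef_add) (auto intro: L2_torus_integrable L2_torus_cnj g b)
    then show "coef f b k = c b k" using b by (simp add: g r)
  qed
  ultimately show ?thesis by blast
qed

section \<open>Sums over the integer lattice\<close>

abbreviation wave_norm :: "int^3 \<Rightarrow> real" where
  "wave_norm k \<equiv> norm (wave_vec k)"

lemma wave_norm_sq: "(wave_norm k)\<^sup>2 = (\<Sum>i\<in>UNIV. (of_int (k $ i))\<^sup>2)"
  unfolding norm_vec_def L2_set_def by (simp add: sum_nonneg)

lemma wave_norm_ge_1: "k \<noteq> 0 \<Longrightarrow> 1 \<le> wave_norm k"
proof -
  assume "k \<noteq> 0"
  then obtain i where "k $ i \<noteq> 0" by (auto simp: vec_eq_iff)
  then have "1 \<le> \<bar>real_of_int (k $ i)\<bar>" by linarith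
  also have "\<dots> \<le> wave_norm k" using component_le_norm_cart[of "wave_vec k" i] by simp
  finally show ?thesis .
qed

lemma wave_norm_minus [simp]: "wave_norm (- k) = wave_norm k"
  by (simp add: wave_vec_minus)

text \<open>One factor 2 accounts for the two signs of \<open>m\<close>, the other for comparing
  \<open>1 + i\<^sup>2\<close> with \<open>(i + 1)\<^sup>2\<close>; what remains is the Basel
  sum.\<close>

lemma inverse_square_int_sum_le:
  "(\<Sum>m\<in>{- int n..int n}. 1 / (1 + (real_of_int m)\<^sup>2)) \<le> 4 * (pi\<^sup>2 / 6)"
proof -
  let ?g = "\<lambda>m. 1 / (1 + (real_of_int m)\<^sup>2)"
  have "{- int n..int n} \<subseteq> int ` {..n} \<union> (\<lambda>i. - int i) ` {..n}"
  proof
    fix m assume m: "m \<in> {- int n..int n}"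
    show "m \<in> int ` {..n} \<union> (\<lambda>i. - int i) ` {..n}"
    proof (cases "m \<ge> 0")
      case True
      then show ?thesis using m by (intro UnI1 image_eqI[of _ _ "nat m"]) auto
    next
      case False
      then show ?thesis using m by (intro UnI2 image_eqI[of _ _ "nat (- m)"]) auto
    qed
  qed
  then have "sum ?g {- int n..int n} \<le> sum ?g (int ` {..n} \<union> (\<lambda>i. - int i) ` {..n})"
    by (intro sum_mono2) (auto intro!: divide_nonneg_nonneg add_nonneg_nonneg)
  also have "\<dots> \<le> sum ?g (int ` {..n}) + sum ?g ((\<lambda>i. - int i) ` {..n})"
  proof -
    have "sum ?g (int ` {..n} \<union> (\<lambda>i. - int i) ` {..n}) + sum ?g (int ` {..n} \<inter> (\<lambda>i. - int i) ` {..n})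
      = sum ?g (int ` {..n}) + sum ?g ((\<lambda>i. - int i) ` {..n})" by (rule sum.union_inter) auto
    moreover have "0 \<le> sum ?g (int ` {..n} \<inter> (\<lambda>i. - int i) ` {..n})"
      by (intro sum_nonneg divide_nonneg_nonneg add_nonneg_nonneg) auto
    ultimately show ?thesis by linarith
  qed
  also have "\<dots> = 2 * (\<Sum>i\<le>n. 1 / (1 + (real i)\<^sup>2))"
    by (subst (1 2) sum.reindex) (auto simp: inj_on_def)
  also have "(\<Sum>i\<le>n. 1 / (1 + (real i)\<^sup>2)) \<le> (\<Sum>i\<le>n. 2 * (1 / (real i + 1)\<^sup>2))"
  proof (intro sum_mono)
    fix i
    have "(real i + 1)\<^sup>2 \<le> 2 * (1 + (real i)\<^sup>2)"
      using zero_le_power2[of "real i - 1"] unfolding power2_diff power2_sum by simp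
    moreover have "0 < (real i + 1)\<^sup>2" "0 < 1 + (real i)\<^sup>2" by (auto intro: add_pos_nonneg)
    ultimately show "1 / (1 + (real i)\<^sup>2) \<le> 2 * (1 / (real i + 1)\<^sup>2)" by (simp add: field_simps)
  qed
  also have "\<dots> = 2 * (\<Sum>i\<in>{..n}. 1 / (real i + 1)\<^sup>2)" by (simp add: sum_distrib_left)
  also have "(\<Sum>i\<in>{..n}. 1 / (real i + 1)\<^sup>2) \<le> pi\<^sup>2 / 6"
    using sum_le_suminf[OF sums_summable[OF inverse_squares_sums], of "{..n}"] sums_unique[OF inverse_squares_sums]
    by (simp add: add.commute)
  finally show ?thesis by simp
qed

definition lattice_const :: real where
  "lattice_const = sqrt (8 * (4 * (pi\<^sup>2 / 6)) ^ 3)"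

lemma lattice_const_pos: "lattice_const > 0"
  by (simp add: lattice_const_def)

text \<open>For nonzero \<open>k\<close> each \<open>1 + k\<^sub>i\<^sup>2\<close> is at most
  \<open>2 * |k|^2\<close>, so the product of the three is at most \<open>8 * |k|^6\<close>, and the
  sum of the reciprocals over a box factorises into one-dimensional sums.\<close>

lemma inverse_wave_norm_sum_le:
  assumes "finite F" shows "L2_set (\<lambda>k. 1 / wave_norm k ^ 3) F \<le> lattice_const"
proof -
  let ?g = "\<lambda>m::int. 1 / (1 + (real_of_int m)\<^sup>2)" and ?Z = "4 * (pi\<^sup>2 / 6) :: real"
  have gpos: "0 \<le> ?g m" for m by (intro divide_nonneg_nonneg add_nonneg_nonneg) auto
  have le: "(1 / wave_norm k ^ 3)\<^sup>2 \<le> 8 * (?g (k $ 1) * ?g (k $ 2) * ?g (k $ 3))" for k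
  proof (cases "k = 0")
    \<comment> \<open>At the zero frequency the quotient is \<open>1 / 0 = 0\<close>.\<close>
    case True then show ?thesis by simp
  next
    case False
    define a b c where "a = (real_of_int (k $ 1))\<^sup>2" and "b = (real_of_int (k $ 2))\<^sup>2" and "c = (real_of_int (k $ 3))\<^sup>2"
    define N where "N = (wave_norm k)\<^sup>2"
    have N: "N = a + b + c" unfolding N_def wave_norm_sq sum_3 a_def b_def c_def by simp
    have nn: "0 \<le> a" "0 \<le> b" "0 \<le> c" by (auto simp: a_def b_def c_def)
    have "1 \<le> N" using wave_norm_ge_1[OF False] by (simp add: N_def)
    have "(1 + a) * (1 + b) * (1 + c) \<le> (2 * N) * (2 * N) * (2 * N)"
      using nn \<open>1 \<le> N\<close> unfolding N by (intro mult_mono) auto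
    then have "(1 + a) * (1 + b) * (1 + c) \<le> 8 * N ^ 3" by (simp add: power3_eq_cube)
    moreover have "0 < (1 + a) * (1 + b) * (1 + c)" using nn by (intro mult_pos_pos) auto
    moreover have "0 < N ^ 3" using \<open>1 \<le> N\<close> by simp
    ultimately have "1 / N ^ 3 \<le> 8 * (1 / ((1 + a) * (1 + b) * (1 + c)))" by (simp add: field_simps)
    moreover have "(1 / wave_norm k ^ 3)\<^sup>2 = 1 / N ^ 3" by (simp add: N_def power_divide flip: power_mult)
    ultimately show ?thesis by (simp add: a_def b_def c_def)
  qed
  obtain n where n: "F \<subseteq> index_box n" using assms by (rule finite_subset_index_box)
  let ?I = "{- int n..int n}"
  have inj: "inj_on (\<lambda>k::int^3. (k $ 1, k $ 2, k $ 3)) (index_box n)" by (auto simp: inj_on_def vec_eq_iff forall_3)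
  have "(\<Sum>k\<in>F. (1 / wave_norm k ^ 3)\<^sup>2) \<le> (\<Sum>k\<in>index_box n. (1 / wave_norm k ^ 3)\<^sup>2)"
    by (intro sum_mono2 n finite_index_box) auto
  also have "\<dots> \<le> (\<Sum>k\<in>index_box n. 8 * (?g (k $ 1) * ?g (k $ 2) * ?g (k $ 3)))" by (intro sum_mono le)
  also have "\<dots> = 8 * (\<Sum>p\<in>(\<lambda>k. (k $ 1, k $ 2, k $ 3)) ` index_box n. ?g (fst p) * ?g (fst (snd p)) * ?g (snd (snd p)))"
    by (subst sum.reindex[OF inj]) (simp add: sum_distrib_left)
  also have "\<dots> \<le> 8 * (\<Sum>p\<in>?I \<times> ?I \<times> ?I. ?g (fst p) * ?g (fst (snd p)) * ?g (snd (snd p)))"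
  proof (intro mult_left_mono sum_mono2)
    show "(\<lambda>k. (k $ 1, k $ 2, k $ 3)) ` index_box n \<subseteq> ?I \<times> ?I \<times> ?I"
      by (auto simp: index_box_def abs_le_iff minus_le_iff)
  qed (auto intro!: mult_nonneg_nonneg gpos)
  also have "(\<Sum>p\<in>?I \<times> ?I \<times> ?I. ?g (fst p) * ?g (fst (snd p)) * ?g (snd (snd p))) = sum ?g ?I ^ 3"
  proof -
    have "(\<Sum>p\<in>I \<times> I \<times> I. g (fst p) * g (fst (snd p)) * g (snd (snd p))) = sum g I ^ 3" for g :: "int \<Rightarrow> real" and I
      by (simp add: sum.cartesian_product' sum_distrib_left[symmetric] sum_distrib_right[symmetric] power3_eq_cube mult.assoc)
    then show ?thesis .
  qed
  also have "\<dots> \<le> ?Z ^ 3"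
    by (intro power_mono inverse_square_int_sum_le sum_nonneg gpos)
  finally have "(\<Sum>k\<in>F. (1 / wave_norm k ^ 3)\<^sup>2) \<le> 8 * ?Z ^ 3" by simp
  then show ?thesis unfolding L2_set_def lattice_const_def by (rule real_sqrt_le_mono)
qed

section \<open>Young's inequality for convolutions of sequences\<close>

lemma L2_set_sum_le:
  assumes "finite I" shows "L2_set (\<lambda>k. \<Sum>i\<in>I. f i k) F \<le> (\<Sum>i\<in>I. L2_set (f i) F)"
  using assms
proof (induction I)
  case empty
  then show ?case by (simp add: L2_set_0')
next
  case (insert i I)
  have "L2_set (\<lambda>k. f i k + (\<Sum>i\<in>I. f i k)) F \<le> L2_set (f i) F + L2_set (\<lambda>k. \<Sum>i\<in>I. f i k) F"
    by (rule L2_set_triangle_ineq)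
  then show ?case using insert by simp
qed

lemma L2_set_shift:
  fixes f :: "int^3 \<Rightarrow> real"
  shows "L2_set (\<lambda>k. f (k - j)) F = L2_set f ((\<lambda>k. k - j) ` F)"
  unfolding L2_set_def by (subst sum.reindex) (auto simp: inj_on_def)

text \<open>The convolution is a superposition of shifts of \<open>f\<close> with weights
  \<open>g j\<close>; Minkowski's inequality and the shift invariance of the l^2 bound give the
  product. Finite index sets postpone all questions of convergence to a final limit.\<close>

lemma Young_finite:
  fixes f g :: "int^3 \<Rightarrow> real"
  assumes f: "\<And>F. finite F \<Longrightarrow> L2_set f F \<le> S" and g: "\<And>D. finite D \<Longrightarrow> sum g D \<le> G" "\<And>k. 0 \<le> g k"
    and fin: "finite F" "finite D"
  shows "L2_set (\<lambda>k. \<Sum>j\<in>D. g j * f (k - j)) F \<le> G * S"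
proof -
  have S: "0 \<le> S" using f[of "{}"] by simp
  have "L2_set (\<lambda>k. \<Sum>j\<in>D. g j * f (k - j)) F \<le> (\<Sum>j\<in>D. L2_set (\<lambda>k. g j * f (k - j)) F)"
    by (rule L2_set_sum_le[OF fin(2)])
  also have "\<dots> = (\<Sum>j\<in>D. g j * L2_set f ((\<lambda>k. k - j) ` F))"
    using g(2) by (simp add: L2_set_right_distrib[symmetric] L2_set_shift[symmetric])
  also have "\<dots> \<le> (\<Sum>j\<in>D. g j * S)" by (intro sum_mono mult_left_mono f g) (use fin in auto)
  also have "\<dots> = sum g D * S" by (simp add: sum_distrib_right)
  also have "\<dots> \<le> G * S" by (intro mult_right_mono g fin S)
  finally show ?thesis .
qed

text \<open>Here the l^2 factor carries the summation index. Reflecting \<open>j\<close> to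
  \<open>k - j\<close> makes the index set depend on \<open>k\<close>; nonnegativity permits
  enlarging it to the common set \<open>E\<close>.\<close>

lemma Young_finite':
  fixes f g :: "int^3 \<Rightarrow> real"
  assumes f: "\<And>F. finite F \<Longrightarrow> L2_set f F \<le> S" "\<And>k. 0 \<le> f k" and g: "\<And>D. finite D \<Longrightarrow> sum g D \<le> G" "\<And>k. 0 \<le> g k"
    and fin: "finite F" "finite D"
  shows "L2_set (\<lambda>k. \<Sum>j\<in>D. f j * g (k - j)) F \<le> G * S"
proof -
  define E where "E = (\<Union>k\<in>F. (\<lambda>j. k - j) ` D)"
  have E: "finite E" unfolding E_def using fin by auto
  have "L2_set (\<lambda>k. \<Sum>j\<in>D. f j * g (k - j)) F \<le> L2_set (\<lambda>k. \<Sum>j\<in>E. g j * f (k - j)) F"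
  proof (intro L2_set_mono sum_nonneg mult_nonneg_nonneg f g)
    fix k assume k: "k \<in> F"
    have "(\<Sum>j\<in>D. f j * g (k - j)) = (\<Sum>l\<in>(\<lambda>j. k - j) ` D. g l * f (k - l))"
      by (subst sum.reindex) (auto simp: inj_on_def mult.commute)
    also have "\<dots> \<le> (\<Sum>l\<in>E. g l * f (k - l))"
      by (intro sum_mono2 E mult_nonneg_nonneg f g) (use k in \<open>auto simp: E_def\<close>)
    finally show "(\<Sum>j\<in>D. f j * g (k - j)) \<le> (\<Sum>j\<in>E. g j * f (k - j))" .
  qed
  also have "\<dots> \<le> G * S" by (rule Young_finite[OF f(1) g fin(1) E])
  finally show ?thesis .
qed

definition conv :: "(int^3 \<Rightarrow> real) \<Rightarrow> (int^3 \<Rightarrow> real) \<Rightarrow> int^3 \<Rightarrow> real" where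
  "conv f g k = (\<Sum>\<^sub>\<infinity>j. f j * g (k - j))"

lemma summable_on_if_sums_le:
  fixes g :: "'a \<Rightarrow> real"
  assumes "\<And>D. finite D \<Longrightarrow> sum g D \<le> G" "\<And>k. 0 \<le> g k" shows "g summable_on UNIV"
  using assms by (intro nonneg_bdd_above_summable_on bdd_aboveI2) auto

lemma summable_conv:
  fixes f g :: "int^3 \<Rightarrow> real"
  assumes g: "g summable_on UNIV" "\<And>k. 0 \<le> g k" and f: "\<And>k. 0 \<le> f k" "\<And>k. f k \<le> B"
  shows "(\<lambda>j. g j * f (k - j)) summable_on UNIV"
proof (rule summable_on_comparison_test)
  show "(\<lambda>j. g j * B) summable_on UNIV" by (rule summable_on_cmult_left[OF g(1)])
qed (use assms in \<open>auto intro!: mult_left_mono mult_nonneg_nonneg\<close>)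

lemma tendsto_sum_conv:
  assumes "(\<lambda>j. f j * g (k - j)) summable_on UNIV"
  shows "((\<lambda>D. \<Sum>j\<in>D. f j * g (k - j)) \<longlongrightarrow> conv f g k) (finite_subsets_at_top UNIV)"
  using has_sum_infsum[OF assms] unfolding conv_def has_sum_def by simp

text \<open>For fixed finite \<open>F\<close> the finite inequality passes to the limit of growing
  summation sets.\<close>

lemma Young:
  fixes f g :: "int^3 \<Rightarrow> real"
  assumes f: "\<And>F. finite F \<Longrightarrow> L2_set f F \<le> S" "\<And>k. 0 \<le> f k"
    and g: "\<And>D. finite D \<Longrightarrow> sum g D \<le> G" "\<And>k. 0 \<le> g k" and F: "finite F"
  shows "L2_set (\<lambda>k. conv g f k) F \<le> G * S"
proof -
  have fS: "f k \<le> S" for k using f(1)[of "{k}"] f(2)[of k] by simp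
  have lim: "((\<lambda>D. L2_set (\<lambda>k. \<Sum>j\<in>D. g j * f (k - j)) F) \<longlongrightarrow> L2_set (\<lambda>k. conv g f k) F) (finite_subsets_at_top UNIV)"
    unfolding L2_set_def
    by (intro tendsto_intros tendsto_sum_conv summable_conv[where B = S] summable_on_if_sums_le[OF g] g f fS)
  show ?thesis
  proof (rule tendsto_upperbound[OF lim])
    show "\<forall>\<^sub>F D in finite_subsets_at_top UNIV. L2_set (\<lambda>k. \<Sum>j\<in>D. g j * f (k - j)) F \<le> G * S"
      by (intro eventually_finite_subsets_at_top_weakI Young_finite[OF f(1) g F])
  qed simp
qed

text \<open>Weighted square-summable sequences, the Fourier side of mean-free functions in \<open>H\<^sup>3\<close>.\<close>

definition h3_bounded :: "real \<Rightarrow> (int^3 \<Rightarrow> real) \<Rightarrow> bool" where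
  "h3_bounded A m \<longleftrightarrow> (\<forall>k. 0 \<le> m k) \<and> m 0 = 0 \<and> (\<forall>F. finite F \<longrightarrow> L2_set (\<lambda>k. wave_norm k ^ 3 * m k) F \<le> A)"

lemma h3_boundedD:
  assumes "h3_bounded A m"
  shows "0 \<le> m k" "m 0 = 0" "finite F \<Longrightarrow> L2_set (\<lambda>k. wave_norm k ^ 3 * m k) F \<le> A" "0 \<le> A"
  using assms unfolding h3_bounded_def using L2_set_empty by (auto dest: spec[of _ "{}"])

text \<open>Cauchy-Schwarz against \<open>1 / |k|^3\<close>, which is square summable on the
  three-dimensional lattice.\<close>

lemma h3_bounded_l1:
  assumes m: "h3_bounded A m" and "finite F" shows "sum m F \<le> lattice_const * A"
proof -
  have eq: "m k = \<bar>1 / wave_norm k ^ 3\<bar> * \<bar>wave_norm k ^ 3 * m k\<bar>" for k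
  proof (cases "k = 0")
    case False
    then show ?thesis using h3_boundedD(1)[OF m, of k] wave_norm_ge_1[of k] by (auto simp: abs_mult)
  qed (simp add: h3_boundedD(2)[OF m])
  have "sum m F = (\<Sum>k\<in>F. \<bar>1 / wave_norm k ^ 3\<bar> * \<bar>wave_norm k ^ 3 * m k\<bar>)"
    by (intro sum.cong refl eq)
  also have "\<dots> \<le> L2_set (\<lambda>k. 1 / wave_norm k ^ 3) F * L2_set (\<lambda>k. wave_norm k ^ 3 * m k) F"
    by (rule L2_set_mult_ineq)
  also have "\<dots> \<le> lattice_const * A"
    by (intro mult_mono inverse_wave_norm_sum_le assms(2) h3_boundedD[OF m] L2_set_nonneg less_imp_le[OF lattice_const_pos])
  finally show ?thesis .
qed

lemma h3_bounded_weight: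
  assumes m: "h3_bounded A m" and "s \<le> 3" "finite F" shows "L2_set (\<lambda>k. wave_norm k ^ s * m k) F \<le> A"
proof -
  have "wave_norm k ^ s * m k \<le> wave_norm k ^ 3 * m k" for k
    using h3_boundedD[OF m] wave_norm_ge_1[of k] assms(2) by (cases "k = 0") (auto intro!: mult_right_mono power_increasing)
  then have "L2_set (\<lambda>k. wave_norm k ^ s * m k) F \<le> L2_set (\<lambda>k. wave_norm k ^ 3 * m k) F"
    by (intro L2_set_mono mult_nonneg_nonneg h3_boundedD[OF m]) auto
  then show ?thesis using h3_boundedD(3)[OF m assms(3)] by linarith
qed

lemma h3_bounded_le: "h3_bounded A m \<Longrightarrow> m k \<le> A"
  using h3_bounded_weight[of A m 0 "{k}"] h3_boundedD(1)[of A m k] by simp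

lemma h3_summable: "h3_bounded A m \<Longrightarrow> m summable_on UNIV"
  using h3_bounded_l1 h3_boundedD(1) by (intro summable_on_if_sums_le)

lemma h3_conv_summable:
  assumes "h3_bounded A m" "h3_bounded A' m'" shows "(\<lambda>j. m j * m' (k - j)) summable_on UNIV"
  by (rule summable_conv[OF h3_summable[OF assms(1)] h3_boundedD(1)[OF assms(1)] h3_boundedD(1)[OF assms(2)] h3_bounded_le[OF assms(2)]])

text \<open>The product estimate \<open>H\<^sup>3 \<sqdot> H\<^sup>3 \<subseteq> H\<^sup>2\<close>.\<close>

lemma h3_conv:
  assumes m: "h3_bounded A m" and F: "finite F"
  shows "L2_set (\<lambda>k. (wave_norm k)\<^sup>2 * conv m m k) F \<le> 4 * lattice_const * A\<^sup>2"
proof -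
  let ?f = "\<lambda>k. (wave_norm k)\<^sup>2 * m k"
  note mD = h3_boundedD[OF m]
  have f: "0 \<le> ?f k" for k using mD by simp
  have fS: "finite F \<Longrightarrow> L2_set ?f F \<le> A" for F using h3_bounded_weight[OF m, of 2] by simp
  have fin: "L2_set (\<lambda>k. (wave_norm k)\<^sup>2 * (\<Sum>j\<in>D. m j * m (k - j))) F \<le> 4 * lattice_const * A\<^sup>2" if D: "finite D" for D
  proof -
    \<comment> \<open>The weight is split between the two factors, so that in each half one factor
      carries \<open>|k|^2\<close> in l^2 and the other is in l^1; each half contributes 2 to the
      constant 4.\<close>
    have le: "(wave_norm k)\<^sup>2 \<le> 2 * (wave_norm j)\<^sup>2 + 2 * (wave_norm (k - j))\<^sup>2" for k j
      using norm_add_sq_le[of "wave_vec j" "wave_vec (k - j)"] by (simp add: wave_vec_diff)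
    have "L2_set (\<lambda>k. (wave_norm k)\<^sup>2 * (\<Sum>j\<in>D. m j * m (k - j))) F
      \<le> L2_set (\<lambda>k. 2 * (\<Sum>j\<in>D. ?f j * m (k - j)) + 2 * (\<Sum>j\<in>D. m j * ?f (k - j))) F"
    proof (intro L2_set_mono mult_nonneg_nonneg sum_nonneg mD zero_le_power2)
      fix k
      have "(wave_norm k)\<^sup>2 * (\<Sum>j\<in>D. m j * m (k - j)) = (\<Sum>j\<in>D. (wave_norm k)\<^sup>2 * (m j * m (k - j)))"
        by (simp add: sum_distrib_left)
      also have "\<dots> \<le> (\<Sum>j\<in>D. (2 * (wave_norm j)\<^sup>2 + 2 * (wave_norm (k - j))\<^sup>2) * (m j * m (k - j)))"
        by (intro sum_mono mult_right_mono le mult_nonneg_nonneg mD)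
      also have "\<dots> = 2 * (\<Sum>j\<in>D. ?f j * m (k - j)) + 2 * (\<Sum>j\<in>D. m j * ?f (k - j))"
        unfolding distrib_right sum.distrib sum_distrib_left by (simp only: mult_ac)
      finally show "(wave_norm k)\<^sup>2 * (\<Sum>j\<in>D. m j * m (k - j)) \<le> 2 * (\<Sum>j\<in>D. ?f j * m (k - j)) + 2 * (\<Sum>j\<in>D. m j * ?f (k - j))" .
    qed
    also have "\<dots> \<le> L2_set (\<lambda>k. 2 * (\<Sum>j\<in>D. ?f j * m (k - j))) F + L2_set (\<lambda>k. 2 * (\<Sum>j\<in>D. m j * ?f (k - j))) F"
      by (rule L2_set_triangle_ineq)
    also have "\<dots> = 2 * L2_set (\<lambda>k. (\<Sum>j\<in>D. ?f j * m (k - j))) F + 2 * L2_set (\<lambda>k. (\<Sum>j\<in>D. m j * ?f (k - j))) F"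
      by (simp only: L2_set_right_distrib[symmetric] zero_le_numeral)
    also have "\<dots> \<le> 2 * (lattice_const * A * A) + 2 * (lattice_const * A * A)"
      by (intro add_mono mult_left_mono Young_finite[OF fS h3_bounded_l1[OF m] mD(1) F D]
          Young_finite'[OF fS f h3_bounded_l1[OF m] mD(1) F D]) auto
    finally show ?thesis by (simp add: power2_eq_square mult_ac)
  qed
  have lim: "((\<lambda>D. L2_set (\<lambda>k. (wave_norm k)\<^sup>2 * (\<Sum>j\<in>D. m j * m (k - j))) F) \<longlongrightarrow> L2_set (\<lambda>k. (wave_norm k)\<^sup>2 * conv m m k) F) (finite_subsets_at_top UNIV)"
    unfolding L2_set_def by (intro tendsto_intros tendsto_sum_conv h3_conv_summable[OF m m])
  show ?thesis
  proof (rule tendsto_upperbound[OF lim])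
    show "\<forall>\<^sub>F D in finite_subsets_at_top UNIV. L2_set (\<lambda>k. (wave_norm k)\<^sup>2 * (\<Sum>j\<in>D. m j * m (k - j))) F \<le> 4 * lattice_const * A\<^sup>2"
      by (intro eventually_finite_subsets_at_top_weakI fin)
  qed simp
qed

text \<open>The Picard iterates of \<open>m = a + \<theta> (m * m) / \<bar>k\<bar>\<close> increase to a supersolution. Since the
  product estimate then holds pointwise, \<open>(m * m)\<^sub>k \<le> \<bar>k\<bar> m\<^sub>k / \<theta>\<close>, weighted supremum norms
  with weight \<open>m\<close> suffice for the nonlinear problem.\<close>

fun majorant :: "real \<Rightarrow> (int^3 \<Rightarrow> real) \<Rightarrow> nat \<Rightarrow> int^3 \<Rightarrow> real" where
  "majorant \<theta> a 0 k = 0"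
| "majorant \<theta> a (Suc n) k = a k + \<theta> * conv (majorant \<theta> a n) (majorant \<theta> a n) k / wave_norm k"

lemma conv_nonneg: "(\<And>k. 0 \<le> f k) \<Longrightarrow> (\<And>k. 0 \<le> g k) \<Longrightarrow> 0 \<le> conv f g k"
  unfolding conv_def by (intro infsum_nonneg) auto

text \<open>The product estimate falls one power of |k| short of H^3, which the division by |k|
  restores. An iterate of size \<open>2 * A\<close> is therefore mapped to size
  \<open>A + 16 * \<theta> * lattice_const * A\<^sup>2\<close>, kept below \<open>2 * A\<close> by
  the smallness condition. The iterates increase, so their supremum inherits the bound; since only
  an inequality is wanted for it, finite partial sums of the convolution suffice.\<close>

lemma ex_majorant:
  assumes a: "h3_bounded A a" and \<theta>: "0 < \<theta>" "16 * \<theta> * lattice_const * A \<le> 1"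
  obtains m where "h3_bounded (2 * A) m" "\<And>k. a k \<le> m k" "\<And>k. k \<noteq> 0 \<Longrightarrow> \<theta> * conv m m k \<le> wave_norm k * m k"
proof -
  let ?M = "majorant \<theta> a"
  note aD = h3_boundedD[OF a]
  have M: "h3_bounded (2 * A) (?M n)" for n
  proof (induction n)
    case 0
    show ?case unfolding h3_bounded_def using aD(4) by (simp add: L2_set_0')
  next
    case (Suc n)
    note MD = h3_boundedD[OF Suc]
    have c: "0 \<le> conv (?M n) (?M n) k" for k by (intro conv_nonneg MD)
    show ?case unfolding h3_bounded_def
    proof (intro conjI allI impI)
      show "0 \<le> ?M (Suc n) k" for k using aD c \<theta> by simp
      show "?M (Suc n) 0 = 0" using aD by simp
      fix F :: "(int^3) set" assume F: "finite F"
      have "L2_set (\<lambda>k. wave_norm k ^ 3 * ?M (Suc n) k) F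
         = L2_set (\<lambda>k. wave_norm k ^ 3 * a k + \<theta> * ((wave_norm k)\<^sup>2 * conv (?M n) (?M n) k)) F"
        by (intro L2_set_cong refl) (simp add: distrib_left power2_eq_square power3_eq_cube)
      also have "\<dots> \<le> L2_set (\<lambda>k. wave_norm k ^ 3 * a k) F + L2_set (\<lambda>k. \<theta> * ((wave_norm k)\<^sup>2 * conv (?M n) (?M n) k)) F"
        by (rule L2_set_triangle_ineq)
      also have "L2_set (\<lambda>k. \<theta> * ((wave_norm k)\<^sup>2 * conv (?M n) (?M n) k)) F = \<theta> * L2_set (\<lambda>k. (wave_norm k)\<^sup>2 * conv (?M n) (?M n) k) F"
        using \<theta> by (simp add: L2_set_right_distrib)
      also have "L2_set (\<lambda>k. wave_norm k ^ 3 * a k) F + \<dots> \<le> A + \<theta> * (4 * lattice_const * (2 * A)\<^sup>2)"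
        using \<theta> by (intro add_mono mult_left_mono aD(3)[OF F] h3_conv[OF Suc F]) auto
      also have "\<dots> = A + (16 * \<theta> * lattice_const * A) * A" by (simp add: power2_eq_square)
      also have "\<dots> \<le> A + 1 * A" by (intro add_left_mono mult_right_mono \<theta> aD)
      finally show "L2_set (\<lambda>k. wave_norm k ^ 3 * ?M (Suc n) k) F \<le> 2 * A" by simp
    qed
  qed
  note MD = h3_boundedD[OF M]
  have mono: "?M n k \<le> ?M (Suc n) k" for n k
  proof (induction n arbitrary: k)
    case 0
    show ?case using MD(1)[of "Suc 0" k] by simp
  next
    case (Suc n)
    have "conv (?M n) (?M n) k \<le> conv (?M (Suc n)) (?M (Suc n)) k"
      unfolding conv_def
      by (intro infsum_mono h3_conv_summable[OF M M] mult_mono Suc MD)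
    then show ?case using \<theta> by (simp add: divide_right_mono mult_left_mono)
  qed
  define m where "m k = (SUP n. ?M n k)" for k
  have bdd: "bdd_above (range (\<lambda>n. ?M n k))" for k
    by (intro bdd_aboveI2[of _ _ "2 * A"] h3_bounded_le[OF M])
  have lim: "(\<lambda>n. ?M n k) \<longlonglongrightarrow> m k" for k
    unfolding m_def by (intro LIMSEQ_incseq_SUP bdd incseq_SucI mono)
  have Mm: "?M n k \<le> m k" for n k unfolding m_def by (intro cSUP_upper bdd) auto
  have m: "h3_bounded (2 * A) m" unfolding h3_bounded_def
  proof (intro conjI allI impI)
    show "0 \<le> m k" for k using Mm[of 0 k] by simp
    show "m 0 = 0" unfolding m_def using MD(2) by simp
    fix F :: "(int^3) set" assume F: "finite F"
    have "(\<lambda>n. L2_set (\<lambda>k. wave_norm k ^ 3 * ?M n k) F) \<longlonglongrightarrow> L2_set (\<lambda>k. wave_norm k ^ 3 * m k) F"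
      unfolding L2_set_def by (intro tendsto_intros lim)
    then show "L2_set (\<lambda>k. wave_norm k ^ 3 * m k) F \<le> 2 * A"
      by (rule LIMSEQ_le_const2) (use MD(3)[OF F] in blast)
  qed
  show ?thesis
  proof (rule that[OF m])
    fix k
    have "?M (Suc 0) k = a k" by (simp add: conv_def)
    then show "a k \<le> m k" using Mm[of "Suc 0" k] by (simp only:)
    assume k: "k \<noteq> 0"
    then have kp: "0 < wave_norm k" using wave_norm_ge_1[of k] by linarith
    have "conv m m k \<le> wave_norm k * m k / \<theta>"
      unfolding conv_def
    proof (rule infsum_le_finite_sums[OF h3_conv_summable[OF m m]])
      fix D :: "(int^3) set" assume D: "finite D"
      have "(\<lambda>n. \<Sum>j\<in>D. ?M n j * ?M n (k - j)) \<longlonglongrightarrow> (\<Sum>j\<in>D. m j * m (k - j))"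
        by (intro tendsto_intros lim)
      moreover have "(\<Sum>j\<in>D. ?M n j * ?M n (k - j)) \<le> wave_norm k * m k / \<theta>" for n
      proof -
        have "(\<Sum>j\<in>D. ?M n j * ?M n (k - j)) \<le> conv (?M n) (?M n) k"
          unfolding conv_def by (intro finite_sum_le_infsum h3_conv_summable[OF M M] D) (auto intro!: mult_nonneg_nonneg MD)
        moreover have "\<theta> * conv (?M n) (?M n) k / wave_norm k \<le> m k"
          using Mm[of "Suc n" k] aD(1)[of k] by simp
        then have "conv (?M n) (?M n) k \<le> wave_norm k * m k / \<theta>"
          using kp \<theta> by (simp add: field_simps)
        ultimately show ?thesis by linarith
      qed
      ultimately show "(\<Sum>j\<in>D. m j * m (k - j)) \<le> wave_norm k * m k / \<theta>"
        by (intro LIMSEQ_le_const2) auto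
    qed
    then show "\<theta> * conv m m k \<le> wave_norm k * m k" using \<theta> by (simp add: field_simps)
  qed
qed

text \<open>Dominated convergence for unordered sums: outside a finite set \<open>X\<close> the
  majorant sums to less than \<open>e / 3\<close>, so the tails are small uniformly in
  \<open>t\<close>, while on \<open>X\<close> the convergence is termwise.\<close>

lemma infsum_tendsto_dominated:
  fixes f :: "'t \<Rightarrow> 'k \<Rightarrow> 'b::banach"
  assumes lim: "\<And>k. ((\<lambda>t. f t k) \<longlongrightarrow> g k) L"
    and dom: "\<forall>\<^sub>F t in L. \<forall>k. norm (f t k) \<le> h k" and h: "h summable_on UNIV"
  shows "((\<lambda>t. infsum (f t) UNIV) \<longlongrightarrow> infsum g UNIV) L"
proof (cases "L = bot")
  case False
  have domg: "norm (g k) \<le> h k" for k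
    using dom by (intro tendsto_upperbound[OF tendsto_norm[OF lim] _ False]) (auto elim: eventually_mono)
  have h0: "0 \<le> h k" for k using domg[of k] norm_ge_zero order_trans by blast
  have sub: "h summable_on A" for A using h by (rule summable_on_subset_banach) auto
  show ?thesis
  proof (rule tendstoI)
    fix e :: real assume e: "0 < e"
    obtain X where X: "finite X" "\<bar>sum h X - infsum h UNIV\<bar> < e / 3"
      using infsum_finite_approximation[OF h, of "e / 4"] e by (auto simp: dist_real_def intro: that)
    have tail: "infsum h (- X) < e / 3"
    proof -
      have "infsum h UNIV = infsum h X + infsum h (- X)"
        using infsum_Un_disjoint[OF sub sub, of X "- X"] by (simp add: Compl_partition)
      then show ?thesis using X by simp
    qed
    have "((\<lambda>t. \<Sum>k\<in>X. f t k - g k) \<longlongrightarrow> (\<Sum>k\<in>X. g k - g k)) L" by (intro tendsto_intros lim)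
    then have "\<forall>\<^sub>F t in L. norm (\<Sum>k\<in>X. f t k - g k) < e / 3"
      using e by (auto dest!: tendstoD[of _ _ _ "e / 3"])
    then show "\<forall>\<^sub>F t in L. dist (infsum (f t) UNIV) (infsum g UNIV) < e" using dom
    proof eventually_elim
      case (elim t)
      have sf: "f t summable_on A" for A
        by (rule abs_summable_summable, rule summable_on_comparison_test[OF sub]) (use elim in auto)
      have sg: "g summable_on A" for A
        by (rule abs_summable_summable, rule summable_on_comparison_test[OF sub]) (use domg in auto)
      have nf: "norm (infsum (f t) (- X)) \<le> infsum h (- X)"
        using elim by (intro norm_infsum_le[OF has_sum_infsum has_sum_infsum] sf sub) auto
      have ng: "norm (infsum g (- X)) \<le> infsum h (- X)"
        using domg by (intro norm_infsum_le[OF has_sum_infsum has_sum_infsum] sg sub) auto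
      have "infsum (f t) UNIV = sum (f t) X + infsum (f t) (- X)"
        using infsum_Un_disjoint[OF sf sf, of X "- X"] X by (simp add: Compl_partition)
      moreover have "infsum g UNIV = sum g X + infsum g (- X)"
        using infsum_Un_disjoint[OF sg sg, of X "- X"] X by (simp add: Compl_partition)
      ultimately have "infsum (f t) UNIV - infsum g UNIV = (\<Sum>k\<in>X. f t k - g k) + (infsum (f t) (- X) - infsum g (- X))"
        by (simp add: sum_subtractf)
      also have "norm \<dots> \<le> norm (\<Sum>k\<in>X. f t k - g k) + (norm (infsum (f t) (- X)) + norm (infsum g (- X)))"
        by (intro order_trans[OF norm_triangle_ineq] add_left_mono norm_triangle_ineq4)
      also have "\<dots> < e" using elim(1) nf ng tail by linarith
      finally show ?case by (simp add: dist_norm)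
    qed
  qed
qed simp

section \<open>Linear ordinary differential equations\<close>

lemma at_within_atLeast_eq:
  assumes "0 \<le> t" "t < T" shows "at t within {0..} = at t within {0..(T::real)}"
  by (rule at_within_nhd[of t "{..<T}"]) (use assms in auto)

lemma has_vector_derivative_restrict:
  fixes t :: real
  assumes "\<And>T. 0 < T \<Longrightarrow> 0 \<le> t \<Longrightarrow> t \<le> T \<Longrightarrow> (y has_vector_derivative d) (at t within {0..T})" "0 \<le> t"
  shows "(y has_vector_derivative d) (at t within {0..})"
  using assms(1)[of "t + 1"] assms(2) at_within_atLeast_eq[of t "t + 1"] by simp

lemma integral_has_vector_derivative_atLeast:
  fixes f :: "real \<Rightarrow> 'a::banach"
  assumes "continuous_on {0..} f" "0 \<le> t"
  shows "((\<lambda>u. integral {0..u} f) has_vector_derivative f t) (at t within {0..})"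
proof (rule has_vector_derivative_restrict)
  fix T assume "0 < T" "0 \<le> t" "t \<le> T"
  then show "((\<lambda>u. integral {0..u} f) has_vector_derivative f t) (at t within {0..T})"
    by (intro integral_has_vector_derivative continuous_on_subset[OF assms(1)]) auto
qed fact

lemma has_vector_derivative_imp_continuous_on:
  assumes "\<And>t. t \<in> S \<Longrightarrow> (y has_vector_derivative d t) (at t within S)"
  shows "continuous_on S y"
  unfolding continuous_on_eq_continuous_within
  using assms has_vector_derivative_continuous by blast

lemma continuous_on_Icc_bounded:
  fixes f :: "real \<Rightarrow> 'a::real_normed_vector"
  assumes "continuous_on {a..b} f" shows "\<exists>M. \<forall>t\<in>{a..b}. norm (f t) \<le> M"
proof -
  have "bounded (f ` {a..b})" by (intro compact_imp_bounded compact_continuous_image assms) simp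
  then show ?thesis by (auto simp: bounded_iff)
qed

text \<open>These are the terms of the Dyson series, the increments of the Picard iteration and not
  its iterates; the solution is their sum over n.\<close>

fun picard :: "('a::banach \<Rightarrow> 'a) \<Rightarrow> (real \<Rightarrow> 'a) \<Rightarrow> nat \<Rightarrow> real \<Rightarrow> 'a" where
  "picard A z0 0 t = z0 t"
| "picard A z0 (Suc n) t = integral {0..t} (\<lambda>s. A (picard A z0 n s))"

text \<open>On \<open>{0..T}\<close> the n-th term is at most
  \<open>M * (K * T) ^ n / fact n\<close>, so the series and its termwise derivative converge
  uniformly on every bounded interval, without any restriction on \<open>T\<close>.\<close>

lemma linear_ode_exists:
  fixes A :: "'a::banach \<Rightarrow> 'a"
  assumes A: "bounded_linear A" and F: "continuous_on {0..} F"
  obtains y where "y 0 = y0" "\<And>t. 0 \<le> t \<Longrightarrow> (y has_vector_derivative A (y t) + F t) (at t within {0..})"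
proof -
  obtain K where K: "0 < K" "\<And>x. norm (A x) \<le> norm x * K" using bounded_linear.pos_bounded[OF A] by blast
  define z0 where "z0 t = y0 + integral {0..t} F" for t
  define z where "z = picard A z0"
  define d where "d n t = (case n of 0 \<Rightarrow> F t | Suc n \<Rightarrow> A (z n t))" for n t
  have d_simps: "d 0 t = F t" "d (Suc n) t = A (z n t)" for n t by (simp_all add: d_def)
  have z_simps: "z 0 = z0" "z (Suc n) = (\<lambda>t. integral {0..t} (\<lambda>s. A (z n s)))" for n by (auto simp: z_def)
  have zd: "(\<forall>t\<ge>0. (z n has_vector_derivative d n t) (at t within {0..}))" for n
  proof (induction n)
    case 0
    show ?case unfolding z_simps z0_def[abs_def] d_simps
      using has_vector_derivative_add[OF has_vector_derivative_const integral_has_vector_derivative_atLeast[OF F]] by simp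
  next
    case (Suc n)
    have "continuous_on {0..} (z n)" using Suc by (intro has_vector_derivative_imp_continuous_on) auto
    then have "continuous_on {0..} (\<lambda>s. A (z n s))"
      by (rule continuous_on_compose2[OF linear_continuous_on[OF A, of UNIV]]) auto
    then show ?case unfolding z_simps d_simps by (intro allI impI integral_has_vector_derivative_atLeast)
  qed
  have zcont: "continuous_on {0..} (z n)" for n using zd by (intro has_vector_derivative_imp_continuous_on) auto
  have z_at: "(z n has_vector_derivative d n t) (at t within {0..T})" if "t \<in> {0..T}" for n t T
    by (rule has_vector_derivative_within_subset[OF zd[rule_format]]) (use that in auto)
  have z0': "z n 0 = (if n = 0 then y0 else 0)" for n
    by (cases n) (simp_all add: z_simps z0_def)
  have sol: "\<exists>g. \<forall>t\<in>{0..T}. (\<lambda>n. z n t) sums g t \<and> (g has_derivative (\<lambda>h. h *\<^sub>R (\<Sum>n. d n t))) (at t within {0..T})"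
    and dsum: "\<forall>t\<in>{0..T}. summable (\<lambda>n. z n t)" if T: "0 < T" for T
  proof -
    have "\<exists>M. \<forall>t\<in>{0..T}. norm (z0 t) \<le> M"
      by (rule continuous_on_Icc_bounded[OF continuous_on_subset[OF zcont[of 0, unfolded z_simps]]]) auto
    then obtain M where M: "\<And>t. t \<in> {0..T} \<Longrightarrow> norm (z0 t) \<le> M" by blast
    have "\<exists>M. \<forall>t\<in>{0..T}. norm (F t) \<le> M"
      by (rule continuous_on_Icc_bounded[OF continuous_on_subset[OF F]]) auto
    then obtain M' where M': "\<And>t. t \<in> {0..T} \<Longrightarrow> norm (F t) \<le> M'" by blast
    have "norm (z0 0) \<le> M" by (rule M) (use T in auto)
    then have M0: "0 \<le> M" using norm_ge_zero[of "z0 0"] by linarith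
    have zb: "\<forall>t\<in>{0..T}. norm (z n t) \<le> M * (K * t) ^ n / fact n" for n
    proof (induction n)
      case 0
      then show ?case using M by (simp add: z_simps)
    next
      case (Suc n)
      show ?case
      proof
        fix t assume t: "t \<in> {0..T}"
        show "norm (z (Suc n) t) \<le> M * (K * t) ^ Suc n / fact (Suc n)"
        proof (cases "t = 0")
          case False
          let ?\<phi> = "\<lambda>s. M * (K * s) ^ Suc n / fact (Suc n)"
          have "norm (z (Suc n) t - z (Suc n) 0) \<le> ?\<phi> t - ?\<phi> 0"
          proof (rule differentiable_bound_general[where f' = "\<lambda>s. A (z n s)" and \<phi>' = "\<lambda>s. K * (M * (K * s) ^ n / fact n)"])
            show "0 < t" using t False by auto
            show "continuous_on {0..t} (z (Suc n))" by (rule continuous_on_subset[OF zcont]) auto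
            show "continuous_on {0..t} ?\<phi>" by (intro continuous_intros) auto
            fix s assume s: "0 < s" "s < t"
            have "(z (Suc n) has_vector_derivative d (Suc n) s) (at s within {0..})" using zd s by auto
            then show "(z (Suc n) has_vector_derivative A (z n s)) (at s)"
              using s at_within_interior[of s "{0..}"] by (simp add: d_simps)
            have \<phi>: "?\<phi> = (\<lambda>s. (M * K ^ Suc n / fact (Suc n)) * s ^ Suc n)" by (simp add: fun_eq_iff power_mult_distrib)
            have "(?\<phi> has_real_derivative (M * K ^ Suc n / fact (Suc n)) * (real (Suc n) * s ^ n)) (at s)"
              unfolding \<phi> using DERIV_cmult[OF DERIV_pow[of "Suc n" s UNIV], of "M * K ^ Suc n / fact (Suc n)"]
              by (simp only: diff_Suc_Suc minus_nat.diff_0)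
            moreover have "(M * K ^ Suc n / fact (Suc n)) * (real (Suc n) * s ^ n) = K * (M * (K * s) ^ n / fact n)"
            proof -
              have "real (Suc n) \<noteq> 0" by simp
              then have "(M * (K * X) / (real (Suc n) * fact n)) * (real (Suc n) * Y) = K * (M * (X * Y) / fact n)" for X Y
                by (simp add: divide_simps mult_ac del: of_nat_Suc)
              then show ?thesis unfolding fact_Suc power_Suc power_mult_distrib of_nat_mult by (simp only: of_nat_fact of_nat_Suc)
            qed
            ultimately show "(?\<phi> has_vector_derivative K * (M * (K * s) ^ n / fact n)) (at s)"
              by (simp only: has_real_derivative_iff_has_vector_derivative)
            have "norm (A (z n s)) \<le> norm (z n s) * K" by (rule K)
            also have "\<dots> \<le> (M * (K * s) ^ n / fact n) * K" using Suc s t K by (intro mult_right_mono) auto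
            finally show "norm (A (z n s)) \<le> K * (M * (K * s) ^ n / fact n)" by (simp only: mult.commute)
          qed
          then show ?thesis using z0'[of "Suc n"] by simp
        qed (use z0'[of "Suc n"] M0 in simp)
      qed
    qed
    define B where "B n = M * (K * T) ^ n / fact n" for n
    have zB: "norm (z n t) \<le> B n" if t: "t \<in> {0..T}" for n t
    proof -
      have "norm (z n t) \<le> M * (K * t) ^ n / fact n" using zb t by blast
      also have "\<dots> \<le> B n" unfolding B_def using t K M0 by (intro divide_right_mono mult_left_mono power_mono) auto
      finally show ?thesis .
    qed
    have sB: "summable B"
      using summable_mult[OF summable_exp[of "K * T"], of M] unfolding B_def by (simp add: divide_inverse mult_ac)
    have dB: "norm (d n t) \<le> (case n of 0 \<Rightarrow> M' | Suc n \<Rightarrow> B n * K)" if t: "t \<in> {0..T}" for n t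
      using M'[OF t] order_trans[OF K(2) mult_right_mono[OF zB[OF t] less_imp_le[OF K(1)]]]
      by (cases n) (auto simp: d_simps)
    have "summable (\<lambda>n. case Suc n of 0 \<Rightarrow> M' | Suc n \<Rightarrow> B n * K)" using summable_mult2[OF sB] by simp
    then have sd: "summable (\<lambda>n. case n of 0 \<Rightarrow> M' | Suc n \<Rightarrow> B n * K)" by (subst (asm) summable_Suc_iff)
    show "\<forall>t\<in>{0..T}. summable (\<lambda>n. z n t)"
    proof
      fix t assume "t \<in> {0..T}"
      then show "summable (\<lambda>n. z n t)" by (intro summable_comparison_test'[OF sB, of 0] zB)
    qed
    have ul: "uniform_limit {0..T} (\<lambda>n t. \<Sum>i<n. d i t) (\<lambda>t. \<Sum>n. d n t) sequentially"
      by (rule Weierstrass_m_test[OF dB sd])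
    show "\<exists>g. \<forall>t\<in>{0..T}. (\<lambda>n. z n t) sums g t \<and> (g has_derivative (\<lambda>h. h *\<^sub>R (\<Sum>n. d n t))) (at t within {0..T})"
    proof (rule has_derivative_series)
      show "convex {0..T}" by simp
      show "(z n has_derivative (\<lambda>h. h *\<^sub>R d n t)) (at t within {0..T})" if "t \<in> {0..T}" for n t
        using z_at[OF that] unfolding has_vector_derivative_def .
      show "0 \<in> {0..T}" using T by simp
      show "(\<lambda>n. z n 0) sums y0" using sums_single[of 0 "\<lambda>_. y0"] by (simp add: z0' if_distrib cong: if_cong)
      fix e :: real assume "e > 0"
      then have "\<forall>\<^sub>F n in sequentially. \<forall>t\<in>{0..T}. dist (\<Sum>i<n. d i t) (\<Sum>n. d n t) < e"
        using ul unfolding uniform_limit_iff by blast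
      then show "\<forall>\<^sub>F n in sequentially. \<forall>t\<in>{0..T}. \<forall>h. norm ((\<Sum>i<n. h *\<^sub>R d i t) - h *\<^sub>R (\<Sum>n. d n t)) \<le> e * norm h"
      proof eventually_elim
        case (elim n)
        show ?case
        proof (intro ballI allI)
          fix t h assume "t \<in> {0..T}"
          then have "norm ((\<Sum>i<n. d i t) - (\<Sum>n. d n t)) \<le> e" using elim by (auto simp: dist_norm less_imp_le)
          then show "norm ((\<Sum>i<n. h *\<^sub>R d i t) - h *\<^sub>R (\<Sum>n. d n t)) \<le> e * norm h"
            by (simp add: scaleR_right.sum[symmetric] scaleR_diff_right[symmetric] mult.commute[of e] mult_left_mono)
        qed
      qed
    qed
  qed
  \<comment> \<open>The sum does not depend on \<open>T\<close>, so the solutions found on the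
    intervals \<open>{0..T}\<close> fit together.\<close>
  define y where "y t = (\<Sum>n. z n t)" for t
  have szt: "summable (\<lambda>n. z n t)" if "0 \<le> t" for t using dsum[of "t + 1"] that by auto
  have "(y has_vector_derivative (\<Sum>n. d n t)) (at t within {0..T})" if T: "0 < T" and t: "t \<in> {0..T}" for t T
  proof -
    obtain g where g: "\<And>t. t \<in> {0..T} \<Longrightarrow> (\<lambda>n. z n t) sums g t"
      "\<And>t. t \<in> {0..T} \<Longrightarrow> (g has_derivative (\<lambda>h. h *\<^sub>R (\<Sum>n. d n t))) (at t within {0..T})"
      using sol[OF T] by blast
    have "(y has_derivative (\<lambda>h. h *\<^sub>R (\<Sum>n. d n t))) (at t within {0..T})"
      by (rule has_derivative_transform[OF t _ g(2)[OF t]]) (use sums_unique[OF g(1)] in \<open>auto simp: y_def\<close>)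
    then show ?thesis unfolding has_vector_derivative_def .
  qed
  then have yd: "(y has_vector_derivative (\<Sum>n. d n t)) (at t within {0..})" if "0 \<le> t" for t
    using that by (intro has_vector_derivative_restrict) auto
  have dt: "(\<Sum>n. d n t) = A (y t) + F t" if t: "0 \<le> t" for t
  proof -
    have "(\<lambda>n. d (Suc n) t) sums A (y t)"
      unfolding d_simps y_def using bounded_linear.sums[OF A summable_sums[OF szt[OF t]]] .
    then have "(\<lambda>n. d n t) sums (A (y t) + d 0 t)" by (subst (asm) sums_Suc_iff)
    then show ?thesis by (simp add: d_simps sums_unique[symmetric])
  qed
  have "y 0 = y0"
    unfolding y_def using sums_single[of 0 "\<lambda>_. y0"] by (intro sums_unique[symmetric]) (simp add: z0' if_distrib cong: if_cong)
  then show ?thesis using yd dt by (intro that[of y]) auto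
qed

section \<open>Decay from a differential energy inequality\<close>

lemma has_real_derivative_inner_self:
  assumes "(y has_vector_derivative d) (at t within S)"
  shows "((\<lambda>t. (norm (y t))\<^sup>2) has_real_derivative 2 * (y t \<bullet> d)) (at t within S)"
proof -
  have "((\<lambda>t. y t \<bullet> y t) has_derivative (\<lambda>h. y t \<bullet> (h *\<^sub>R d) + (h *\<^sub>R d) \<bullet> y t)) (at t within S)"
    using assms unfolding has_vector_derivative_def by (intro has_derivative_inner)
  then show ?thesis
    unfolding has_field_derivative_def power2_norm_eq_inner
    by (rule has_derivative_eq_rhs) (auto simp: inner_commute algebra_simps)
qed

text \<open>Formally \<open>r = exp (c * t) * norm (y t)\<close> satisfies
  \<open>r' \<le> - \<mu> * r + f\<close> with \<open>\<mu> = \<Lambda> - c\<close>. As the norm is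
  not differentiable at 0, the argument runs with its square: \<open>(r\<^sup>2)' \<le> - 2 * \<mu>
  * r\<^sup>2 + 2 * f * r \<le> - \<mu> * r\<^sup>2 + f\<^sup>2 / \<mu>\<close>, so that
  \<open>\<xi>\<close> does not increase.\<close>

lemma energy_decay:
  fixes y :: "real \<Rightarrow> 'a::real_inner"
  assumes deriv: "\<And>t. 0 \<le> t \<Longrightarrow> (y has_vector_derivative d t) (at t within {0..})"
    and energy: "\<And>t. 0 \<le> t \<Longrightarrow> y t \<bullet> d t \<le> - \<Lambda> * (norm (y t))\<^sup>2 + norm (y t) * (f * exp (- c * t))"
    and c: "c < \<Lambda>" and f: "0 \<le> f" and t: "0 \<le> t"
  shows "norm (y t) \<le> (norm (y 0) + f / (\<Lambda> - c)) * exp (- c * t)"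
proof -
  define \<mu> where "\<mu> = \<Lambda> - c"
  have \<mu>: "0 < \<mu>" using c by (simp add: \<mu>_def)
  define N where "N s = (norm (y s))\<^sup>2" for s
  have N': "(N has_real_derivative 2 * (y s \<bullet> d s)) (at s within {0..})" if "0 \<le> s" for s
    unfolding N_def[abs_def] by (rule has_real_derivative_inner_self[OF deriv[OF that]])
  define r where "r s = exp (c * s) * norm (y s)" for s
  define \<xi> where "\<xi> s = exp (\<mu> * s) * (exp (2 * c * s) * N s - (f / \<mu>)\<^sup>2)" for s
  have r2: "exp (2 * c * s) * N s = (r s)\<^sup>2" for s
    by (simp add: r_def N_def power_mult_distrib exp_double[symmetric] mult.assoc)
  define D where "D s = exp (\<mu> * s) * \<mu> * (exp (2 * c * s) * N s - (f / \<mu>)\<^sup>2)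
     + exp (\<mu> * s) * (exp (2 * c * s) * (2 * c) * N s + exp (2 * c * s) * (2 * (y s \<bullet> d s)))" for s
  have \<xi>': "(\<xi> has_real_derivative D s) (at s within {0..})" if "0 \<le> s" for s
    unfolding \<xi>_def[abs_def] D_def
    by (auto intro!: derivative_eq_intros N'[OF that])
  have Dneg: "D s \<le> 0" if s: "0 \<le> s" for s
  proof -
    have "exp (2 * c * s) * (2 * (y s \<bullet> d s)) \<le> exp (2 * c * s) * (2 * (- \<Lambda> * N s + norm (y s) * (f * exp (- c * s))))"
      unfolding N_def by (intro mult_left_mono energy s) auto
    also have "\<dots> = - 2 * \<Lambda> * (exp (2 * c * s) * N s) + 2 * f * (exp (2 * c * s) * exp (- c * s) * norm (y s))"
      by (simp add: algebra_simps)
    also have "exp (2 * c * s) * exp (- c * s) = exp (c * s)" by (simp flip: exp_add)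
    also have "exp (c * s) * norm (y s) = r s" by (simp add: r_def)
    finally have "exp (2 * c * s) * (2 * (y s \<bullet> d s)) \<le> - 2 * \<Lambda> * (r s)\<^sup>2 + 2 * f * r s" unfolding r2 .
    then have "\<mu> * ((r s)\<^sup>2 - (f / \<mu>)\<^sup>2) + ((2 * c) * (r s)\<^sup>2 + exp (2 * c * s) * (2 * (y s \<bullet> d s)))
       \<le> \<mu> * ((r s)\<^sup>2 - (f / \<mu>)\<^sup>2) + ((2 * c) * (r s)\<^sup>2 + (- 2 * \<Lambda> * (r s)\<^sup>2 + 2 * f * r s))" by linarith
    also have "\<dots> = - (\<mu> * r s - f)\<^sup>2 / \<mu>"
    proof -
      have "\<mu> * (r2' - (f / \<mu>)\<^sup>2) = \<mu> * r2' - f\<^sup>2 / \<mu>" for r2' using \<mu> by (simp add: power2_eq_square field_simps)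
      moreover have "- (\<mu> * r s - f)\<^sup>2 / \<mu> = - \<mu> * (r s)\<^sup>2 + 2 * f * r s - f\<^sup>2 / \<mu>"
        using \<mu> by (simp add: power2_diff power2_eq_square field_simps)
      moreover have "\<Lambda> = \<mu> + c" by (simp add: \<mu>_def)
      ultimately show ?thesis by (simp add: algebra_simps)
    qed
    also have "\<dots> \<le> 0" using \<mu> by (simp add: divide_nonpos_pos)
    finally have *: "\<mu> * ((r s)\<^sup>2 - (f / \<mu>)\<^sup>2) + ((2 * c) * (r s)\<^sup>2 + exp (2 * c * s) * (2 * (y s \<bullet> d s))) \<le> 0" .
    have "D s = exp (\<mu> * s) * (\<mu> * ((r s)\<^sup>2 - (f / \<mu>)\<^sup>2) + ((2 * c) * (r s)\<^sup>2 + exp (2 * c * s) * (2 * (y s \<bullet> d s))))"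
      unfolding D_def r2[symmetric] by (simp add: algebra_simps)
    then show ?thesis using * by (simp add: mult_nonneg_nonpos)
  qed
  have "\<xi> t \<le> \<xi> 0"
  proof (rule DERIV_nonpos_imp_decreasing_open[OF t])
    show "\<exists>y. (\<xi> has_real_derivative y) (at s) \<and> y \<le> 0" if "0 < s" "s < t" for s
    proof (intro exI conjI)
      show "(\<xi> has_real_derivative D s) (at s)" using \<xi>'[of s] that at_within_interior[of s "{0..}"] by simp
      show "D s \<le> 0" using Dneg that by simp
    qed
    have "continuous_on {0..} \<xi>" using \<xi>' by (intro DERIV_continuous_on) auto
    then show "continuous_on {0..t} \<xi>" by (rule continuous_on_subset) auto
  qed
  then have "exp (\<mu> * t) * ((r t)\<^sup>2 - (f / \<mu>)\<^sup>2) \<le> (norm (y 0))\<^sup>2 - (f / \<mu>)\<^sup>2"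
    unfolding \<xi>_def r2 by (simp add: r_def)
  also have "\<dots> \<le> (norm (y 0))\<^sup>2" by simp
  finally have "(r t)\<^sup>2 - (f / \<mu>)\<^sup>2 \<le> (norm (y 0))\<^sup>2 / exp (\<mu> * t)" by (simp add: field_simps)
  also have "\<dots> \<le> (norm (y 0))\<^sup>2"
    using \<mu> t by (simp add: divide_le_eq mult_left_le_one_le mult_le_cancel_left1)
  finally have "(r t)\<^sup>2 \<le> (norm (y 0))\<^sup>2 + (f / \<mu>)\<^sup>2" by simp
  also have "\<dots> \<le> (norm (y 0) + f / \<mu>)\<^sup>2" using f \<mu> by (simp add: power2_sum)
  finally have "r t \<le> norm (y 0) + f / \<mu>" by (rule power2_le_imp_le) (use f \<mu> in simp)
  then have "exp (c * t) * norm (y t) \<le> norm (y 0) + f / \<mu>" unfolding r_def .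
  then have "norm (y t) \<le> (norm (y 0) + f / \<mu>) / exp (c * t)" by (simp add: field_simps)
  also have "\<dots> = (norm (y 0) + f / \<mu>) * exp (- c * t)" by (simp add: exp_minus divide_inverse)
  finally show ?thesis unfolding \<mu>_def .
qed


section \<open>The system for the Fourier coefficients\<close>

type_synonym cvec = "complex^3"
text \<open>One Fourier coefficient of the triple velocity, micro-rotation, magnetic field, in this
  order.\<close>

type_synonym state = "cvec \<times> cvec \<times> cvec"

text \<open>The symbol of the divergence without its factor \<open>\<i>\<close>; the form is complex
  linear in \<open>v\<close>, without conjugation.\<close>

definition kdot :: "int^3 \<Rightarrow> cvec \<Rightarrow> complex" where
  "kdot k v = (\<Sum>i\<in>UNIV. of_int (k $ i) * v $ i)"

definition kvec :: "int^3 \<Rightarrow> cvec" where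
  "kvec k = (\<chi> i. of_int (k $ i))"

text \<open>The symbol of the curl, the cross product of \<open>\<i> k\<close> with
  \<open>v\<close>.\<close>

definition kcurl :: "int^3 \<Rightarrow> cvec \<Rightarrow> cvec" where
  "kcurl k v = vector [\<i> * (of_int (k $ 2) * v $ 3 - of_int (k $ 3) * v $ 2),
                       \<i> * (of_int (k $ 3) * v $ 1 - of_int (k $ 1) * v $ 3),
                       \<i> * (of_int (k $ 1) * v $ 2 - of_int (k $ 2) * v $ 1)]"

lemma kcurl_nth:
  "kcurl k v $ 1 = \<i> * (of_int (k $ 2) * v $ 3 - of_int (k $ 3) * v $ 2)"
  "kcurl k v $ 2 = \<i> * (of_int (k $ 3) * v $ 1 - of_int (k $ 1) * v $ 3)"
  "kcurl k v $ 3 = \<i> * (of_int (k $ 1) * v $ 2 - of_int (k $ 2) * v $ 1)"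
  by (simp_all add: kcurl_def)

lemma norm_cvec_sq: "(norm (v :: cvec))\<^sup>2 = (\<Sum>i\<in>UNIV. (norm (v $ i))\<^sup>2)"
  unfolding norm_vec_def L2_set_def by (simp add: sum_nonneg)

lemma norm_vector_scalar_mult: "norm (c *s (v :: cvec)) = norm c * norm v"
  unfolding norm_vec_def by (simp add: norm_mult L2_set_right_distrib)

lemma norm_kvec: "norm (kvec k) = wave_norm k"
  unfolding norm_vec_def kvec_def by simp

lemma kdot_linear:
  "kdot k (v + w) = kdot k v + kdot k w" "kdot k (r *\<^sub>R v) = r *\<^sub>R kdot k v" "kdot k (c *s v) = c * kdot k v"
  "kdot k (v - w) = kdot k v - kdot k w" "kdot k 0 = 0" "kdot k (- v) = - kdot k v"
  by (simp_all add: kdot_def sum_3 algebra_simps)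

lemma norm_kdot_le: "norm (kdot k v) \<le> wave_norm k * norm v"
proof -
  have "norm (kdot k v) \<le> (\<Sum>i\<in>UNIV. \<bar>norm (wave_vec k $ i)\<bar> * \<bar>norm (v $ i)\<bar>)"
    unfolding kdot_def by (rule sum_norm_le) (simp add: norm_mult)
  also have "\<dots> \<le> wave_norm k * norm v" unfolding norm_vec_def by (rule L2_set_mult_ineq)
  finally show ?thesis .
qed

lemma bounded_linear_kdot: "bounded_linear (kdot k)"
proof (rule bounded_linear_intro)
  show "norm (kdot k v) \<le> norm v * wave_norm k" for v
    using norm_kdot_le[of k v] by (simp only: mult.commute)
qed (simp_all add: kdot_linear)

lemma kcurl_linear: "kcurl k (v + w) = kcurl k v + kcurl k w" "kcurl k (r *\<^sub>R v) = r *\<^sub>R kcurl k v"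
  by (simp_all add: vec_eq_iff forall_3 kcurl_nth algebra_simps)

lemma kdot_kcurl: "kdot k (kcurl k v) = 0"
  by (simp add: kdot_def sum_3 kcurl_nth algebra_simps)

lemma kdot_kvec: "kdot k (kvec k) = of_real ((wave_norm k)\<^sup>2)"
  unfolding wave_norm_sq by (simp add: kdot_def kvec_def power2_eq_square)

text \<open>Lagrange's identity for the cross product with a real vector, applied to real and
  imaginary parts separately.\<close>

lemma norm_kcurl_le: "norm (kcurl k v) \<le> wave_norm k * norm v"
proof -
  define p q r where "p = real_of_int (k $ 1)" and "q = real_of_int (k $ 2)" and "r = real_of_int (k $ 3)"
  define a b c where "a = v $ 1" and "b = v $ 2" and "c = v $ 3"
  have id: "(q * z - r * y)\<^sup>2 + (r * x - p * z)\<^sup>2 + (p * y - q * x)\<^sup>2 \<le> (p\<^sup>2 + q\<^sup>2 + r\<^sup>2) * (x\<^sup>2 + y\<^sup>2 + z\<^sup>2)" for x y z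
  proof -
    have "(p\<^sup>2 + q\<^sup>2 + r\<^sup>2) * (x\<^sup>2 + y\<^sup>2 + z\<^sup>2) - ((q * z - r * y)\<^sup>2 + (r * x - p * z)\<^sup>2 + (p * y - q * x)\<^sup>2) = (p * x + q * y + r * z)\<^sup>2"
      by (simp add: power2_eq_square algebra_simps)
    then show ?thesis using zero_le_power2[of "p * x + q * y + r * z"] by linarith
  qed
  have "(norm (kcurl k v))\<^sup>2 = ((q * Re c - r * Re b)\<^sup>2 + (r * Re a - p * Re c)\<^sup>2 + (p * Re b - q * Re a)\<^sup>2)
     + ((q * Im c - r * Im b)\<^sup>2 + (r * Im a - p * Im c)\<^sup>2 + (p * Im b - q * Im a)\<^sup>2)"
    unfolding norm_cvec_sq sum_3 kcurl_nth norm_mult cmod_power2 p_def q_def r_def a_def b_def c_def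
    by (simp add: cmod_power2 power2_commute)
  also have "\<dots> \<le> (p\<^sup>2 + q\<^sup>2 + r\<^sup>2) * ((Re a)\<^sup>2 + (Re b)\<^sup>2 + (Re c)\<^sup>2) + (p\<^sup>2 + q\<^sup>2 + r\<^sup>2) * ((Im a)\<^sup>2 + (Im b)\<^sup>2 + (Im c)\<^sup>2)"
    by (intro add_mono id)
  also have "\<dots> = (wave_norm k * norm v)\<^sup>2"
    unfolding power_mult_distrib norm_cvec_sq wave_norm_sq sum_3 cmod_power2 p_def q_def r_def a_def b_def c_def
    by (simp add: algebra_simps)
  finally show ?thesis by (rule power2_le_imp_le) simp
qed

text \<open>The real inner product on \<open>cvec\<close> is the real part of the Hermitian one.
  Hence multiples of \<open>k\<close>, the modes of gradients, are orthogonal to every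
  \<open>v\<close> with \<open>kdot k v = 0\<close>; this removes the pressure from energy
  estimates.\<close>

lemma inner_scaled_kvec: "v \<bullet> (c *s kvec k) = Re (cnj (kdot k v) * c)"
  by (simp add: inner_vec_def kvec_def kdot_def sum_3 inner_complex_def algebra_simps)

text \<open>The Leray projection onto the orthogonal complement of \<open>k\<close>; at
  \<open>k = 0\<close> it is the identity.\<close>

definition project :: "int^3 \<Rightarrow> cvec \<Rightarrow> cvec" where
  "project k v = v - (kdot k v / of_real ((wave_norm k)\<^sup>2)) *s kvec k"

lemma kdot_project: "k \<noteq> 0 \<Longrightarrow> kdot k (project k v) = 0"
  using wave_norm_ge_1[of k] by (auto simp: project_def kdot_linear kdot_kvec)

lemma norm_project_le: "norm (project k v) \<le> norm v"
proof (cases "k = 0")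
  case True
  then show ?thesis by (simp add: project_def)
next
  case False
  let ?c = "kdot k v / of_real ((wave_norm k)\<^sup>2)"
  have "project k v \<bullet> (?c *s kvec k) = 0" unfolding inner_scaled_kvec kdot_project[OF False] by simp
  then have "(norm (project k v))\<^sup>2 + (norm (?c *s kvec k))\<^sup>2 = (norm (project k v + ?c *s kvec k))\<^sup>2"
    by (simp add: power2_norm_eq_inner inner_add_left inner_add_right inner_commute)
  also have "project k v + ?c *s kvec k = v" by (simp add: project_def)
  finally have "(norm (project k v))\<^sup>2 \<le> (norm v)\<^sup>2" using zero_le_power2[of "norm (?c *s kvec k)"] by linarith
  then show ?thesis by (rule power2_le_imp_le) simp
qed

lemma project_linear: "project k (v + w) = project k v + project k w" "project k (r *\<^sub>R v) = r *\<^sub>R project k v"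
  by (simp_all add: project_def kdot_linear vec_eq_iff algebra_simps add_divide_distrib) (simp add: divide_inverse)

text \<open>Only the velocity equation contains a pressure; the magnetic nonlinearity respects the
  divergence constraint by itself.\<close>

definition leray :: "int^3 \<Rightarrow> state \<Rightarrow> state" where
  "leray k z = (project k (fst z), snd z)"

lemma norm_leray_le: "norm (leray k z) \<le> norm z"
  unfolding leray_def norm_prod_def by (intro real_sqrt_le_mono add_mono power_mono) (auto intro: norm_project_le)

lemma leray_linear: "leray k (v + w) = leray k v + leray k w" "leray k (r *\<^sub>R v) = r *\<^sub>R leray k v"
  by (simp_all add: leray_def project_linear)

lemma bounded_linear_leray: "bounded_linear (leray k)"
  by (rule bounded_linear_intro[where K = 1]) (auto simp: leray_linear norm_leray_le)

text \<open>The contribution of the frequencies \<open>j\<close> and \<open>k - j\<close> to the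
  mode \<open>k\<close>, with the convective terms moved to the right-hand side. As u and b are
  divergence free, the derivative acts on the whole product, so the symbol is \<open>k\<close>
  instead of \<open>k - j\<close>.\<close>

definition advect :: "int^3 \<Rightarrow> state \<Rightarrow> state \<Rightarrow> state" where
  "advect k p q =
    (\<i> *s (kdot k (snd (snd p)) *s snd (snd q) - kdot k (fst p) *s fst q),
     - (\<i> *s (kdot k (fst p) *s fst (snd q))),
     \<i> *s (kdot k (snd (snd p)) *s fst q - kdot k (fst p) *s snd (snd q)))"

lemma norm_state_sq: "(norm ((u, w, b) :: state))\<^sup>2 = (norm u)\<^sup>2 + (norm w)\<^sup>2 + (norm b)\<^sup>2"
  by (simp add: norm_prod_def)

text \<open>Each of the three components is at most \<open>|k| * norm p * norm q\<close>, by
  Cauchy-Schwarz where it has two terms; the 3 is the triangle inequality over the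
  components.\<close>

lemma norm_advect_le: "norm (advect k p q) \<le> 3 * wave_norm k * norm p * norm q"
proof -
  obtain u \<omega> b where p: "p = (u, \<omega>, b)" by (metis prod_cases3)
  obtain u' \<omega>' b' where q: "q = (u', \<omega>', b')" by (metis prod_cases3)
  have le: "norm u \<le> norm p" "norm b \<le> norm p" "norm u' \<le> norm q" "norm \<omega>' \<le> norm q" "norm b' \<le> norm q"
    unfolding p q by (auto simp: norm_prod_def intro!: real_le_rsqrt)
  have cs: "norm x * norm y + norm x' * norm y' \<le> norm p * norm q"
    if "(norm x)\<^sup>2 + (norm x')\<^sup>2 \<le> (norm p)\<^sup>2" "(norm y)\<^sup>2 + (norm y')\<^sup>2 \<le> (norm q)\<^sup>2" for x x' y y' :: cvec
  proof -
    have "(norm x * norm y + norm x' * norm y')\<^sup>2 \<le> ((norm x)\<^sup>2 + (norm x')\<^sup>2) * ((norm y)\<^sup>2 + (norm y')\<^sup>2)"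
      using zero_le_power2[of "norm x * norm y' - norm x' * norm y"] by (simp add: power2_eq_square algebra_simps)
    also have "\<dots> \<le> (norm p)\<^sup>2 * (norm q)\<^sup>2" by (intro mult_mono that) auto
    finally have "(norm x * norm y + norm x' * norm y')\<^sup>2 \<le> (norm p * norm q)\<^sup>2"
      by (simp only: power_mult_distrib)
    then show ?thesis by (rule power2_le_imp_le) simp
  qed
  let ?n = "wave_norm k"
  have 1: "norm (kdot k x *s y) \<le> ?n * (norm x * norm y)" for x y :: cvec
    unfolding norm_vector_scalar_mult mult.assoc[symmetric] by (intro mult_right_mono norm_kdot_le) auto
  have 2: "norm (kdot k x *s y - kdot k x' *s y') \<le> ?n * (norm p * norm q)"
    if "(norm x)\<^sup>2 + (norm x')\<^sup>2 \<le> (norm p)\<^sup>2" "(norm y)\<^sup>2 + (norm y')\<^sup>2 \<le> (norm q)\<^sup>2" for x x' y y' :: cvec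
  proof -
    have "norm (kdot k x *s y - kdot k x' *s y') \<le> ?n * (norm x * norm y) + ?n * (norm x' * norm y')"
      by (intro order_trans[OF norm_triangle_ineq4] add_mono 1)
    also have "\<dots> = ?n * (norm x * norm y + norm x' * norm y')" by (simp add: distrib_left)
    also have "\<dots> \<le> ?n * (norm p * norm q)" by (intro mult_left_mono cs that) auto
    finally show ?thesis .
  qed
  have 3: "norm (kdot k u *s \<omega>') \<le> ?n * (norm p * norm q)"
    by (rule order_trans[OF 1]) (intro mult_left_mono mult_mono le, auto)
  have tri: "norm ((x, y, z) :: state) \<le> norm x + norm y + norm z" for x y z
    using norm_Pair_le[of x "(y, z)"] norm_Pair_le[of y z] by linarith
  have ii: "norm (\<i> *s v) = norm v" for v :: cvec by (simp add: norm_vector_scalar_mult)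
  have sq: "(norm b)\<^sup>2 + (norm u)\<^sup>2 \<le> (norm p)\<^sup>2" "(norm b')\<^sup>2 + (norm u')\<^sup>2 \<le> (norm q)\<^sup>2" "(norm u')\<^sup>2 + (norm b')\<^sup>2 \<le> (norm q)\<^sup>2"
    unfolding p q norm_state_sq by simp_all
  have c1: "norm (\<i> *s (kdot k b *s b' - kdot k u *s u')) \<le> ?n * (norm p * norm q)"
    unfolding ii by (rule 2[OF sq(1,2)])
  have c2: "norm (- (\<i> *s (kdot k u *s \<omega>'))) \<le> ?n * (norm p * norm q)"
    unfolding norm_minus_cancel ii by (rule 3)
  have c3: "norm (\<i> *s (kdot k b *s u' - kdot k u *s b')) \<le> ?n * (norm p * norm q)"
    unfolding ii by (rule 2[OF sq(1,3)])
  have adv: "advect k p q = (\<i> *s (kdot k b *s b' - kdot k u *s u'), - (\<i> *s (kdot k u *s \<omega>')), \<i> *s (kdot k b *s u' - kdot k u *s b'))"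
    by (simp add: advect_def p q)
  have "norm (advect k p q) \<le> ?n * (norm p * norm q) + ?n * (norm p * norm q) + ?n * (norm p * norm q)"
    unfolding adv by (rule order_trans[OF tri]) (intro add_mono c1 c2 c3)
  also have "\<dots> = 3 * (?n * (norm p * norm q))" by simp
  finally show ?thesis by (simp only: mult.assoc)
qed

lemma bounded_bilinear_advect: "bounded_bilinear (advect k)"
proof
  show "\<exists>K. \<forall>a b. norm (advect k a b) \<le> norm a * norm b * K"
    using norm_advect_le[of k] by (intro exI[of _ "3 * wave_norm k"]) (simp add: mult_ac)
qed (simp_all add: advect_def kdot_linear vec_eq_iff prod_eq_iff algebra_simps)

text \<open>The increments telescope, and \<open>2 * C / 2 ^ n\<close> is the tail of the geometric
  series from index \<open>n\<close> on.\<close>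

lemma geometric_Cauchy:
  fixes x :: "nat \<Rightarrow> 'a::banach"
  assumes "\<And>n. norm (x (Suc n) - x n) \<le> C / 2 ^ n"
  obtains l where "\<And>n. norm (l - x n) \<le> 2 * C / 2 ^ n"
proof -
  have geo: "(\<lambda>i. C / 2 ^ (i + n)) sums (2 * C / 2 ^ n)" for n
  proof -
    have "(\<lambda>i. (C / 2 ^ n) * (1 / 2) ^ i) sums ((C / 2 ^ n) * (1 / (1 - 1 / 2)))"
      by (intro sums_mult geometric_sums) simp
    then show ?thesis by (simp add: power_add power_divide field_simps)
  qed
  have "summable (\<lambda>n. x (Suc n) - x n)"
    by (rule summable_comparison_test'[of "\<lambda>n. C / 2 ^ n" 0]) (use geo[of 0] assms in \<open>auto simp: sums_iff\<close>)
  then have "convergent (\<lambda>n. \<Sum>i<n. x (Suc i) - x i)" by (simp add: summable_iff_convergent)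
  then obtain s where "(\<lambda>n. \<Sum>i<n. x (Suc i) - x i) \<longlonglongrightarrow> s" by (auto simp: convergent_def)
  then have "(\<lambda>n. x n - x 0) \<longlonglongrightarrow> s" by (simp only: sum_lessThan_telescope)
  then have "(\<lambda>n. (x n - x 0) + x 0) \<longlonglongrightarrow> s + x 0" by (intro tendsto_intros)
  then have l: "x \<longlonglongrightarrow> s + x 0" by simp
  have "norm ((s + x 0) - x n) \<le> 2 * C / 2 ^ n" for n
  proof -
    have "(\<lambda>i. x (i + n)) \<longlonglongrightarrow> s + x 0" using l by (rule LIMSEQ_ignore_initial_segment)
    then have t: "(\<lambda>i. x (Suc i + n) - x (i + n)) sums ((s + x 0) - x (0 + n))" by (rule telescope_sums)
    have "norm (\<Sum>i. x (Suc i + n) - x (i + n)) \<le> (\<Sum>i. C / 2 ^ (i + n))"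
      using assms[of "i + n" for i] geo[of n] by (intro norm_suminf_le) (auto simp: sums_iff)
    then show ?thesis using t geo[of n] by (simp add: sums_iff)
  qed
  then show ?thesis by (rule that)
qed

section \<open>The convolution nonlinearity\<close>

lemma conv_commute: "conv f g k = conv g f k"
proof -
  have "bij_betw (\<lambda>j. k - j) UNIV UNIV" by (rule bij_betwI[where g = "\<lambda>j. k - j"]) auto
  from infsum_reindex_bij_betw[OF this, of "\<lambda>j. f j * g (k - j)"] show ?thesis
    by (simp add: conv_def mult.commute)
qed

lemma conv_summable_commute:
  "(\<lambda>j. f j * g (k - j)) summable_on UNIV \<Longrightarrow> (\<lambda>j. g j * f (k - j)) summable_on (UNIV :: (int^3) set)" for f g :: "int^3 \<Rightarrow> real"
proof -
  assume *: "(\<lambda>j. f j * g (k - j)) summable_on UNIV"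
  have "bij_betw (\<lambda>j. k - j) UNIV UNIV" by (rule bij_betwI[where g = "\<lambda>j. k - j"]) auto
  from summable_on_reindex_bij_betw[OF this, of "\<lambda>j. f j * g (k - j)"] show ?thesis
    using * by (simp add: mult.commute)
qed

lemma conv_scale: "conv (\<lambda>j. x * f j) (\<lambda>j. y * g j) k = (x * y) * conv f g k"
proof -
  have "(\<lambda>j. (x * f j) * (y * g (k - j))) = (\<lambda>j. (x * y) * (f j * g (k - j)))" by (auto simp: mult_ac)
  then show ?thesis unfolding conv_def by (simp only: infsum_cmult_right')
qed

definition bilin :: "(int^3 \<Rightarrow> state) \<Rightarrow> (int^3 \<Rightarrow> state) \<Rightarrow> int^3 \<Rightarrow> state" where
  "bilin a b k = (\<Sum>\<^sub>\<infinity>j. advect k (a j) (b (k - j)))"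

lemma norm_advect_dominated:
  assumes "\<And>j. norm (a j) \<le> f j" "\<And>j. norm (b j) \<le> g j"
  shows "norm (advect k (a j) (b (k - j))) \<le> 3 * wave_norm k * (f j * g (k - j))"
proof -
  have "norm (advect k (a j) (b (k - j))) \<le> 3 * wave_norm k * (norm (a j) * norm (b (k - j)))"
    using norm_advect_le[of k "a j" "b (k - j)"] by (simp add: mult.assoc)
  also have "\<dots> \<le> 3 * wave_norm k * (f j * g (k - j))"
    by (intro mult_left_mono mult_mono assms) (auto intro: order_trans[OF norm_ge_zero assms(1)])
  finally show ?thesis .
qed

lemma
  assumes "\<And>j. norm (a j) \<le> f j" "\<And>j. norm (b j) \<le> g j"
    and s: "(\<lambda>j. f j * g (k - j)) summable_on UNIV"
  shows bilin_summable: "(\<lambda>j. advect k (a j) (b (k - j))) summable_on UNIV"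
    and norm_bilin_le: "norm (bilin a b k) \<le> 3 * wave_norm k * conv f g k"
proof -
  have s': "(\<lambda>j. 3 * wave_norm k * (f j * g (k - j))) summable_on UNIV"
    by (rule summable_on_cmult_right[OF s])
  show sm: "(\<lambda>j. advect k (a j) (b (k - j))) summable_on UNIV"
    by (rule abs_summable_summable, rule summable_on_comparison_test[OF s'])
      (use norm_advect_dominated[OF assms(1,2)] in auto)
  have "norm (bilin a b k) \<le> (\<Sum>\<^sub>\<infinity>j. 3 * wave_norm k * (f j * g (k - j)))"
    unfolding bilin_def
    by (rule norm_infsum_le[OF has_sum_infsum[OF sm] has_sum_infsum[OF s']]) (rule norm_advect_dominated[OF assms(1,2)])
  then show "norm (bilin a b k) \<le> 3 * wave_norm k * conv f g k"
    unfolding conv_def by (simp only: infsum_cmult_right')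
qed

text \<open>The quadratic difference splits as \<open>B(a - b, a) + B(b, a - b)\<close>.\<close>

lemma bilin_diff:
  assumes "\<And>j. norm (a j) \<le> f j" "\<And>j. norm (b j) \<le> g j" "\<And>j. norm (a j - b j) \<le> h j"
    and s: "(\<lambda>j. f j * f (k - j)) summable_on UNIV" "(\<lambda>j. g j * g (k - j)) summable_on UNIV"
      "(\<lambda>j. h j * f (k - j)) summable_on UNIV" "(\<lambda>j. g j * h (k - j)) summable_on UNIV"
  shows "norm (bilin a a k - bilin b b k) \<le> 3 * wave_norm k * (conv h f k + conv g h k)"
proof -
  note sa = bilin_summable[OF assms(1) assms(1) s(1)] and sb = bilin_summable[OF assms(2) assms(2) s(2)]
  have sd: "(\<lambda>j. advect k (a j - b j) (a (k - j))) summable_on UNIV"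
    using bilin_summable[of "\<lambda>j. a j - b j" h a f k] assms by blast
  have se: "(\<lambda>j. advect k (b j) (a (k - j) - b (k - j))) summable_on UNIV"
    using bilin_summable[of b g "\<lambda>j. a j - b j" h k] assms by blast
  interpret adv: bounded_bilinear "advect k" by (rule bounded_bilinear_advect)
  have "bilin a a k = (\<Sum>\<^sub>\<infinity>j. (advect k (a j - b j) (a (k - j)) + advect k (b j) (a (k - j) - b (k - j))) + advect k (b j) (b (k - j)))"
    unfolding bilin_def by (simp add: adv.diff_left adv.diff_right)
  also have "\<dots> = (\<Sum>\<^sub>\<infinity>j. advect k (a j - b j) (a (k - j)) + advect k (b j) (a (k - j) - b (k - j))) + bilin b b k"
    unfolding bilin_def by (rule infsum_add[OF summable_on_add[OF sd se] sb])
  also have "(\<Sum>\<^sub>\<infinity>j. advect k (a j - b j) (a (k - j)) + advect k (b j) (a (k - j) - b (k - j)))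
     = bilin (\<lambda>j. a j - b j) a k + bilin b (\<lambda>j. a j - b j) k"
    unfolding bilin_def by (rule infsum_add[OF sd se])
  finally have "bilin a a k - bilin b b k = bilin (\<lambda>j. a j - b j) a k + bilin b (\<lambda>j. a j - b j) k" by simp
  then have "norm (bilin a a k - bilin b b k) \<le> norm (bilin (\<lambda>j. a j - b j) a k) + norm (bilin b (\<lambda>j. a j - b j) k)"
    by (simp add: norm_triangle_ineq)
  also have "\<dots> \<le> 3 * wave_norm k * conv h f k + 3 * wave_norm k * conv g h k"
    by (intro add_mono norm_bilin_le assms)
  finally show ?thesis by (simp only: distrib_left)
qed

lemma continuous_on_bilin:
  fixes a :: "real \<Rightarrow> int^3 \<Rightarrow> state"
  assumes cont: "\<And>k. continuous_on S (\<lambda>t. a t k)"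
    and dom: "\<And>t k. t \<in> S \<Longrightarrow> norm (a t k) \<le> f k" and s: "(\<lambda>j. f j * f (k - j)) summable_on UNIV"
  shows "continuous_on S (\<lambda>t. bilin (a t) (a t) k)"
  unfolding continuous_on_def bilin_def
proof
  fix t assume t: "t \<in> S"
  interpret adv: bounded_bilinear "advect k" by (rule bounded_bilinear_advect)
  show "((\<lambda>t. \<Sum>\<^sub>\<infinity>j. advect k (a t j) (a t (k - j))) \<longlongrightarrow> (\<Sum>\<^sub>\<infinity>j. advect k (a t j) (a t (k - j)))) (at t within S)"
  proof (rule infsum_tendsto_dominated)
    show "((\<lambda>t. advect k (a t j) (a t (k - j))) \<longlongrightarrow> advect k (a t j) (a t (k - j))) (at t within S)" for j
      using cont t unfolding continuous_on_def by (intro adv.tendsto) auto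
    show "(\<lambda>j. 3 * wave_norm k * (f j * f (k - j))) summable_on UNIV" by (rule summable_on_cmult_right[OF s])
    have "\<forall>\<^sub>F t in at t within S. t \<in> S" by (simp add: eventually_at_filter)
    then show "\<forall>\<^sub>F t in at t within S. \<forall>j. norm (advect k (a t j) (a t (k - j))) \<le> 3 * wave_norm k * (f j * f (k - j))"
      by eventually_elim (intro allI norm_advect_dominated dom)
  qed
qed

text \<open>\<open>F_j - F_(k-j)\<close> sums to zero: the magnetic part of the nonlinearity is divergence free.\<close>

lemma kdot_bilin_magnetic:
  assumes "\<And>j. norm (a j) \<le> f j" "(\<lambda>j. f j * f (k - j)) summable_on UNIV"
  shows "kdot k (snd (snd (bilin a a k))) = 0"
proof -
  let ?h = "\<lambda>z. kdot k (snd (snd z))"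
  have bl: "bounded_linear ?h"
    using bounded_linear_compose[OF bounded_linear_kdot bounded_linear_compose[OF bounded_linear_snd bounded_linear_snd]] .
  \<comment> \<open>\<open>G j\<close> is the stretching term contracted with \<open>k\<close>; the
    transport term contracted with \<open>k\<close> is \<open>G (k - j)\<close>.\<close>
  define G where "G j = \<i> * (kdot k (snd (snd (a j))) * kdot k (fst (a (k - j))))" for j
  have bij: "bij_betw (\<lambda>j. k - j) UNIV UNIV" by (rule bij_betwI[where g = "\<lambda>j. k - j"]) auto
  have nG: "norm (G j) \<le> (wave_norm k)\<^sup>2 * (f j * f (k - j))" for j
  proof -
    have c: "norm (kdot k (snd (snd (a j)))) \<le> wave_norm k * f j" "norm (kdot k (fst (a j))) \<le> wave_norm k * f j" for j
    proof -
      have z: "norm (fst z) \<le> norm z" "norm (snd z) \<le> norm z" for z :: "'x::real_normed_vector \<times> 'y::real_normed_vector"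
        by (metis norm_fst_le prod.collapse, metis norm_snd_le prod.collapse)
      have "norm (snd (snd (a j))) \<le> f j" using z(2)[of "snd (a j)"] z(2)[of "a j"] assms(1)[of j] by linarith
      then show "norm (kdot k (snd (snd (a j)))) \<le> wave_norm k * f j"
        by (intro order_trans[OF norm_kdot_le] mult_left_mono) auto
      have "norm (fst (a j)) \<le> f j" using z(1)[of "a j"] assms(1)[of j] by linarith
      then show "norm (kdot k (fst (a j))) \<le> wave_norm k * f j"
        by (intro order_trans[OF norm_kdot_le] mult_left_mono) auto
    qed
    have "norm (G j) \<le> (wave_norm k * f j) * (wave_norm k * f (k - j))"
      unfolding G_def norm_mult norm_ii mult_1_left
      by (intro mult_mono c) (auto intro: order_trans[OF norm_ge_zero c(1)])
    then show ?thesis by (simp add: power2_eq_square mult_ac)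
  qed
  have sG: "G summable_on UNIV"
    by (rule abs_summable_summable, rule summable_on_comparison_test[OF summable_on_cmult_right[OF assms(2), of "(wave_norm k)\<^sup>2"]])
      (use nG in auto)
  have sG': "(\<lambda>j. G (k - j)) summable_on UNIV"
    using summable_on_reindex_bij_betw[OF bij, of G] sG by simp
  have "?h (bilin a a k) = (\<Sum>\<^sub>\<infinity>j. ?h (advect k (a j) (a (k - j))))"
    unfolding bilin_def
    by (intro infsumI[symmetric] has_sum_bounded_linear[OF bl] has_sum_infsum bilin_summable[OF assms(1) assms(1) assms(2)])
  also have "\<dots> = (\<Sum>\<^sub>\<infinity>j. G j + - G (k - j))"
    by (intro infsum_cong) (simp add: advect_def kdot_linear G_def algebra_simps)
  also have "\<dots> = (\<Sum>\<^sub>\<infinity>j. G j) + (\<Sum>\<^sub>\<infinity>j. - G (k - j))"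
    by (rule infsum_add[OF sG]) (simp add: summable_on_uminus sG')
  also have "\<dots> = 0" using infsum_reindex_bij_betw[OF bij, of G] by (simp add: infsum_uminus)
  finally show ?thesis .
qed

section \<open>Dissipation of the linear part and estimates for small data\<close>

locale mhd =
  fixes chi \<kappa> \<eta> \<nu> :: real
  assumes chi: "0 < chi" and kappa: "0 \<le> \<kappa>" and eta: "0 < \<eta>" and nu: "0 < \<nu>"
begin

definition lin :: "int^3 \<Rightarrow> state \<Rightarrow> state" where
  "lin k z =
    (- (chi * (wave_norm k)\<^sup>2) *\<^sub>R fst z + (2 * chi) *\<^sub>R kcurl k (fst (snd z)),
     - (4 * chi + \<eta> * (wave_norm k)\<^sup>2) *\<^sub>R fst (snd z) - \<kappa> *\<^sub>R (kdot k (fst (snd z)) *s kvec k) + (2 * chi) *\<^sub>R kcurl k (fst z),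
     - (\<nu> * (wave_norm k)\<^sup>2) *\<^sub>R snd (snd z))"

lemma bounded_linear_lin: "bounded_linear (lin k)"
  unfolding linear_conv_bounded_linear[symmetric]
proof (rule linearI)
  show "lin k (x + y) = lin k x + lin k y" for x y
    by (simp add: lin_def kcurl_linear kdot_linear scaleR_add_right vector_sadd_rdistrib algebra_simps)
  show "lin k (r *\<^sub>R x) = r *\<^sub>R lin k x" for r x
  proof -
    have "(r *\<^sub>R c) *s v = r *\<^sub>R (c *s v)" for c and v :: cvec by (simp add: vec_eq_iff)
    then show ?thesis by (simp add: lin_def kcurl_linear kdot_linear scaleR_add_right scaleR_diff_right mult_ac)
  qed
qed

text \<open>The dissipation constant of the linear part. With \<open>rate \<le> \<eta> / 10\<close>
  and \<open>rate \<le> chi / 2\<close> the losses \<open>5 * chi * rate\<close> and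
  \<open>rate * \<eta>\<close> each use up at most half of the gain \<open>chi * \<eta>\<close> in
  the determinant of the form coupling velocity and micro-rotation; \<open>rate \<le> \<nu>\<close>
  serves the magnetic part.\<close>

definition rate :: real where
  "rate = min (chi / 2) (min (\<eta> / 10) \<nu>)"

lemma rate: "0 < rate" "rate \<le> chi / 2" "rate \<le> \<eta> / 10" "rate \<le> \<nu>"
  using chi eta nu by (auto simp: rate_def)

text \<open>With \<open>x = |k| * norm u\<close> and \<open>y = norm w\<close> the coupling costs up
  to \<open>4 * chi * x * y\<close>, while \<open>chi\<close> alone offers
  \<open>chi * x\<^sup>2 + 4 * chi * y\<^sup>2\<close>: together these form the degenerate square
  \<open>chi * (x - 2 * y)\<^sup>2\<close>. Strict positivity therefore comes from the angular
  viscosity \<open>\<eta>\<close>; the \<open>\<kappa>\<close> term has the favourable sign.\<close>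

lemma lin_energy: "z \<bullet> lin k z \<le> - rate * (wave_norm k)\<^sup>2 * (norm z)\<^sup>2"
proof -
  obtain u w b where z: "z = (u, w, b)" by (metis prod_cases3)
  define n where "n = wave_norm k"
  define x where "x = n * norm u"
  define y where "y = norm w"
  have cs: "u \<bullet> kcurl k w \<le> x * y" "w \<bullet> kcurl k u \<le> x * y"
  proof -
    have "u \<bullet> kcurl k w \<le> norm u * norm (kcurl k w)" by (rule norm_cauchy_schwarz)
    also have "\<dots> \<le> norm u * (n * norm w)" unfolding n_def by (intro mult_left_mono norm_kcurl_le) simp
    finally show "u \<bullet> kcurl k w \<le> x * y" by (simp add: x_def y_def mult_ac)
    have "w \<bullet> kcurl k u \<le> norm w * norm (kcurl k u)" by (rule norm_cauchy_schwarz)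
    also have "\<dots> \<le> norm w * (n * norm u)" unfolding n_def by (intro mult_left_mono norm_kcurl_le) simp
    finally show "w \<bullet> kcurl k u \<le> x * y" by (simp add: x_def y_def mult_ac)
  qed
  have kd: "0 \<le> w \<bullet> (kdot k w *s kvec k)"
    unfolding inner_scaled_kvec by simp
  have "z \<bullet> lin k z = - chi * n\<^sup>2 * (norm u)\<^sup>2 + 2 * chi * (u \<bullet> kcurl k w) - (4 * chi + \<eta> * n\<^sup>2) * (norm w)\<^sup>2
      - \<kappa> * (w \<bullet> (kdot k w *s kvec k)) + 2 * chi * (w \<bullet> kcurl k u) - \<nu> * n\<^sup>2 * (norm b)\<^sup>2"
    unfolding z lin_def n_def by (simp add: inner_add_right inner_diff_right power2_norm_eq_inner algebra_simps)
  also have "\<dots> \<le> - chi * n\<^sup>2 * (norm u)\<^sup>2 + 2 * chi * (x * y) - (4 * chi + \<eta> * n\<^sup>2) * (norm w)\<^sup>2 + 2 * chi * (x * y) - \<nu> * n\<^sup>2 * (norm b)\<^sup>2"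
    using mult_left_mono[OF cs(1), of "2 * chi"] mult_left_mono[OF cs(2), of "2 * chi"] mult_nonneg_nonneg[OF kappa kd] chi by linarith
  also have "\<dots> = (- chi * x\<^sup>2 + 4 * chi * (x * y) - 4 * chi * y\<^sup>2 - \<eta> * (n\<^sup>2 * y\<^sup>2)) - \<nu> * (n\<^sup>2 * (norm b)\<^sup>2)"
    by (simp add: x_def y_def power_mult_distrib algebra_simps)
  also have "\<dots> \<le> (- rate * (x\<^sup>2 + n\<^sup>2 * y\<^sup>2)) - rate * (n\<^sup>2 * (norm b)\<^sup>2)"
  proof (intro diff_mono mult_right_mono rate)
    show "- chi * x\<^sup>2 + 4 * chi * (x * y) - 4 * chi * y\<^sup>2 - \<eta> * (n\<^sup>2 * y\<^sup>2) \<le> - rate * (x\<^sup>2 + n\<^sup>2 * y\<^sup>2)"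
    proof (cases "k = 0")
      case True
      then have "n = 0" "x = 0" by (simp_all add: n_def x_def)
      then show ?thesis using chi by simp
    next
      case False
      have p: "0 < chi - rate" using rate chi by linarith
      have "1 \<le> n\<^sup>2" using wave_norm_ge_1[OF False] by (simp add: n_def)
      \<comment> \<open>As |k| is at least 1, the surplus of angular viscosity controls
        \<open>y\<^sup>2\<close> itself, which lifts the degeneracy.\<close>
      have "(\<eta> - rate) * (1 * y\<^sup>2) \<le> (\<eta> - rate) * (n\<^sup>2 * y\<^sup>2)"
        using rate(3) eta \<open>1 \<le> n\<^sup>2\<close> by (intro mult_left_mono mult_right_mono) auto
      moreover have "0 \<le> (chi - rate) * x\<^sup>2 - 4 * chi * (x * y) + (4 * chi + \<eta> - rate) * y\<^sup>2"
      proof -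
        have "5 * (chi * rate) \<le> 5 * (chi * (\<eta> / 10))" using rate(3) chi by (intro mult_left_mono) auto
        moreover have "rate * \<eta> \<le> (chi / 2) * \<eta>" using rate(2) eta by (intro mult_right_mono) auto
        moreover have "0 \<le> rate * rate" by simp
        moreover have "(chi - rate) * (4 * chi + \<eta> - rate) - 4 * chi\<^sup>2 = chi * \<eta> - 5 * (chi * rate) - rate * \<eta> + rate * rate"
          by (simp add: power2_eq_square algebra_simps)
        ultimately have "0 \<le> (chi - rate) * (4 * chi + \<eta> - rate) - 4 * chi\<^sup>2" by linarith
        \<comment> \<open>The square is completed after multiplication by \<open>chi - rate\<close>;
          the remaining coefficient of \<open>y\<^sup>2\<close> is the determinant just
          estimated.\<close>
        then have "0 \<le> ((chi - rate) * x - 2 * chi * y)\<^sup>2 + ((chi - rate) * (4 * chi + \<eta> - rate) - 4 * chi\<^sup>2) * y\<^sup>2" by simp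
        also have "\<dots> = (chi - rate) * ((chi - rate) * x\<^sup>2 - 4 * chi * (x * y) + (4 * chi + \<eta> - rate) * y\<^sup>2)"
          by (simp add: power2_eq_square algebra_simps)
        finally show ?thesis using p by (simp add: zero_le_mult_iff)
      qed
      ultimately show ?thesis by (simp add: algebra_simps)
    qed
  qed auto
  also have "\<dots> = - rate * n\<^sup>2 * (norm z)\<^sup>2"
    unfolding z norm_state_sq x_def y_def by (simp add: power_mult_distrib algebra_simps)
  finally show ?thesis by (simp add: n_def)
qed

text \<open>For coefficients bounded by \<open>2 * m\<close> the nonlinearity is at most
  \<open>3 * 2 * 2 = 12\<close> times \<open>|k| * conv m m\<close>; the factor 48 turns this into
  \<open>(rate / 4) * |k|^2 * m\<close>, a quarter of the dissipation. At \<open>k = 0\<close> the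
  nonlinearity vanishes.\<close>

definition supersolution :: "real \<Rightarrow> (int^3 \<Rightarrow> real) \<Rightarrow> bool" where
  "supersolution A m \<longleftrightarrow> h3_bounded A m \<and> (\<forall>k. k \<noteq> 0 \<longrightarrow> (48 / rate) * conv m m k \<le> wave_norm k * m k)"

text \<open>With half the dissipation rate as exponent, every nonzero mode retains at least half of
  its damping against the forcing.\<close>

definition decaying :: "(int^3 \<Rightarrow> real) \<Rightarrow> (real \<Rightarrow> int^3 \<Rightarrow> state) \<Rightarrow> bool" where
  "decaying m a \<longleftrightarrow> (\<forall>t\<ge>0. \<forall>k. norm (a t k) \<le> 2 * m k * exp (- (rate / 2) * t))"

lemma supersolution_conv_le:
  assumes "supersolution A m" shows "wave_norm k * conv m m k \<le> (rate / 48) * (wave_norm k)\<^sup>2 * m k"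
proof (cases "k = 0")
  case False
  then have "wave_norm k * ((48 / rate) * conv m m k) \<le> wave_norm k * (wave_norm k * m k)"
    using assms by (intro mult_left_mono) (auto simp: supersolution_def)
  then show ?thesis using rate(1) by (simp add: field_simps power2_eq_square)
qed simp

lemma decaying_summable:
  assumes "supersolution A m"
  shows "(\<lambda>j. (x * m j) * (y * m (k - j))) summable_on UNIV"
proof -
  have "(\<lambda>j. (x * y) * (m j * m (k - j))) summable_on UNIV"
    using assms by (intro summable_on_cmult_right h3_conv_summable) (auto simp: supersolution_def)
  then show ?thesis by (simp add: mult_ac)
qed

lemma exp_decay_le: "0 \<le> t \<Longrightarrow> exp (- (rate / 2) * t) \<le> 1"
  using rate(1) by simp

lemma norm_bilin_decaying:
  assumes m: "supersolution A m" and a: "decaying m a" and t: "0 \<le> t"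
  shows "norm (bilin (a t) (a t) k) \<le> (rate / 4) * (wave_norm k)\<^sup>2 * m k * exp (- (rate / 2) * t)"
proof -
  let ?e = "exp (- (rate / 2) * t)"
  have dom: "norm (a t j) \<le> (2 * ?e) * m j" for j using a t by (auto simp: decaying_def mult_ac)
  have "norm (bilin (a t) (a t) k) \<le> 3 * wave_norm k * conv (\<lambda>j. (2 * ?e) * m j) (\<lambda>j. (2 * ?e) * m j) k"
    by (rule norm_bilin_le[OF dom dom decaying_summable[OF m]])
  also have "\<dots> = 12 * (?e * ?e) * (wave_norm k * conv m m k)" unfolding conv_scale by simp
  also have "\<dots> \<le> 12 * (?e * ?e) * ((rate / 48) * (wave_norm k)\<^sup>2 * m k)"
    by (intro mult_left_mono supersolution_conv_le[OF m]) auto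
  \<comment> \<open>The nonlinearity decays like the square of \<open>?e\<close>; one factor is
    given up to match the decay of the class.\<close>
  also have "\<dots> \<le> 12 * (?e * 1) * ((rate / 48) * (wave_norm k)\<^sup>2 * m k)"
    using rate(1) m exp_decay_le[OF t]
    by (intro mult_right_mono mult_left_mono mult_nonneg_nonneg) (auto simp: supersolution_def h3_bounded_def)
  finally show ?thesis by (simp add: mult_ac)
qed

lemma norm_bilin_diff_decaying:
  assumes m: "supersolution A m" and a: "decaying m a" and b: "decaying m b" and t: "0 \<le> t" and D: "0 \<le> D"
    and diff: "\<And>k. norm (a t k - b t k) \<le> D * m k * exp (- (rate / 2) * t)"
  shows "norm (bilin (a t) (a t) k - bilin (b t) (b t) k) \<le> (rate / 4) * (wave_norm k)\<^sup>2 * (D * m k) * exp (- (rate / 2) * t)"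
proof -
  let ?e = "exp (- (rate / 2) * t)"
  have doma: "norm (a t j) \<le> (2 * ?e) * m j" for j using a t by (auto simp: decaying_def mult_ac)
  have domb: "norm (b t j) \<le> (2 * ?e) * m j" for j using b t by (auto simp: decaying_def mult_ac)
  have domd: "norm (a t j - b t j) \<le> (D * ?e) * m j" for j using diff[of j] by (simp add: mult_ac)
  have "norm (bilin (a t) (a t) k - bilin (b t) (b t) k)
     \<le> 3 * wave_norm k * (conv (\<lambda>j. (D * ?e) * m j) (\<lambda>j. (2 * ?e) * m j) k + conv (\<lambda>j. (2 * ?e) * m j) (\<lambda>j. (D * ?e) * m j) k)"
    by (intro bilin_diff doma domb domd decaying_summable[OF m])
  also have "\<dots> = 12 * D * (?e * ?e) * (wave_norm k * conv m m k)" unfolding conv_scale by (simp add: algebra_simps)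
  also have "\<dots> \<le> 12 * D * (?e * ?e) * ((rate / 48) * (wave_norm k)\<^sup>2 * m k)"
    using D by (intro mult_left_mono supersolution_conv_le[OF m]) auto
  also have "\<dots> \<le> 12 * D * (?e * 1) * ((rate / 48) * (wave_norm k)\<^sup>2 * m k)"
    using rate(1) m D exp_decay_le[OF t]
    by (intro mult_right_mono mult_left_mono mult_nonneg_nonneg) (auto simp: supersolution_def h3_bounded_def)
  finally show ?thesis by (simp add: mult_ac)
qed

text \<open>The forced response is the forcing \<open>(rate / 4) * |k|^2 * f\<close> divided by the
  margin \<open>rate * |k|^2 - rate / 2\<close>, which is at least \<open>rate * |k|^2 / 2\<close>.
  The resulting factor 1/2 yields both the invariance of the class, as
  \<open>m + m / 2 \<le> 2 * m\<close>, and the contraction.\<close>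

lemma mode_decay:
  assumes k: "k \<noteq> 0"
    and y: "\<And>t. 0 \<le> t \<Longrightarrow> (y has_vector_derivative lin k (y t) + F t) (at t within {0..})"
    and F: "\<And>t. 0 \<le> t \<Longrightarrow> norm (F t) \<le> (rate / 4) * (wave_norm k)\<^sup>2 * f * exp (- (rate / 2) * t)"
    and f: "0 \<le> f" and t: "0 \<le> t"
  shows "norm (y t) \<le> (norm (y 0) + f / 2) * exp (- (rate / 2) * t)"
proof -
  let ?n2 = "(wave_norm k)\<^sup>2"
  have n1: "1 \<le> ?n2" using wave_norm_ge_1[OF k] by simp
  have rn: "rate * 1 \<le> rate * ?n2" using rate(1) n1 by (intro mult_left_mono) auto
  have le: "norm (y t) \<le> (norm (y 0) + ((rate / 4) * ?n2 * f) / (rate * ?n2 - rate / 2)) * exp (- (rate / 2) * t)"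
  proof (rule energy_decay[OF y _ _ _ t])
    show "rate / 2 < rate * ?n2" using rn rate(1) by linarith
    show "0 \<le> (rate / 4) * ?n2 * f" using rate(1) f by simp
    fix s :: real assume s: "0 \<le> s"
    have "y s \<bullet> (lin k (y s) + F s) = y s \<bullet> lin k (y s) + y s \<bullet> F s" by (rule inner_add_right)
    also have "\<dots> \<le> - rate * ?n2 * (norm (y s))\<^sup>2 + norm (y s) * norm (F s)"
      by (intro add_mono lin_energy norm_cauchy_schwarz)
    also have "\<dots> \<le> - rate * ?n2 * (norm (y s))\<^sup>2 + norm (y s) * ((rate / 4) * ?n2 * f * exp (- (rate / 2) * s))"
      by (intro add_left_mono mult_left_mono F s) simp
    finally show "y s \<bullet> (lin k (y s) + F s) \<le> - (rate * ?n2) * (norm (y s))\<^sup>2 + norm (y s) * ((rate / 4) * ?n2 * f * exp (- (rate / 2) * s))"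
      by simp
  qed
  have "((rate / 4) * ?n2 * f) / (rate * ?n2 - rate / 2) \<le> f / 2"
  proof -
    have "(rate / 4) * ?n2 * f \<le> (f / 2) * (rate * ?n2 - rate / 2)"
      using mult_left_mono[OF rn f] by (simp add: algebra_simps)
    moreover have "0 < rate * ?n2 - rate / 2" using rn rate(1) by linarith
    ultimately show ?thesis by (simp only: pos_divide_le_eq)
  qed
  then have "(norm (y 0) + ((rate / 4) * ?n2 * f) / (rate * ?n2 - rate / 2)) * exp (- (rate / 2) * t)
     \<le> (norm (y 0) + f / 2) * exp (- (rate / 2) * t)" by (intro mult_right_mono add_left_mono) auto
  with le show ?thesis by linarith
qed

text \<open>Only the nonlinearity is frozen; the linear part is solved exactly in each mode, so that
  its dissipation is available. It is a relation because values at negative times are left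
  open.\<close>

definition picard_step :: "(int^3 \<Rightarrow> state) \<Rightarrow> (real \<Rightarrow> int^3 \<Rightarrow> state) \<Rightarrow> (real \<Rightarrow> int^3 \<Rightarrow> state) \<Rightarrow> bool" where
  "picard_step a0 a b \<longleftrightarrow> b 0 = a0 \<and> (\<forall>t\<ge>0. b t 0 = 0) \<and>
     (\<forall>k. \<forall>t\<ge>0. ((\<lambda>t. b t k) has_vector_derivative lin k (b t k) + leray k (bilin (a t) (a t) k)) (at t within {0..}))"

lemma bilin_0: "bilin a b 0 = 0"
proof -
  have "advect 0 p q = 0" for p q using norm_advect_le[of 0 p q] by simp
  then show ?thesis by (simp add: bilin_def)
qed

lemma leray_0 [simp]: "leray k 0 = 0"
  using norm_leray_le[of k 0] by simp

lemma lin_0 [simp]: "lin k 0 = 0"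
  using bounded_linear.linear[OF bounded_linear_lin] linear_0 by blast

section \<open>Picard iteration below a fixed majorant\<close>

context
  fixes A :: real and m :: "int^3 \<Rightarrow> real" and a0 :: "int^3 \<Rightarrow> state"
  assumes m: "supersolution A m" and a0: "\<And>k. norm (a0 k) \<le> m k"
begin

lemma m_pos: "0 \<le> m k" and m_0: "m 0 = 0"
  using m by (auto simp: supersolution_def h3_bounded_def)

lemma ex_picard_step:
  assumes cont: "\<And>k. continuous_on {0..} (\<lambda>t. a t k)" and a: "decaying m a"
  shows "\<exists>b. picard_step a0 a b"
proof -
  have "\<exists>y. y 0 = a0 k \<and> (k = 0 \<longrightarrow> (\<forall>t\<ge>0. y t = 0)) \<and>
    (\<forall>t\<ge>0. (y has_vector_derivative lin k (y t) + leray k (bilin (a t) (a t) k)) (at t within {0..}))" for k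
  proof (cases "k = 0")
    case True
    then have "a0 k = 0" using a0[of k] m_0 by simp
    \<comment> \<open>The zero mode stays zero: its datum vanishes with \<open>m 0\<close>, and the
      nonlinearity has no zero mode.\<close>
    then show ?thesis using True by (intro exI[of _ "\<lambda>_. 0"]) (simp add: bilin_0)
  next
    case False
    have dom: "norm (a t j) \<le> 2 * m j" if "t \<in> {0..}" for t j
    proof -
      have "norm (a t j) \<le> 2 * m j * exp (- (rate / 2) * t)" using a that by (auto simp: decaying_def)
      also have "\<dots> \<le> 2 * m j * 1" using exp_decay_le[of t] that m_pos by (intro mult_left_mono) auto
      finally show ?thesis by simp
    qed
    have "continuous_on {0..} (\<lambda>t. bilin (a t) (a t) k)"
      by (rule continuous_on_bilin[OF cont dom decaying_summable[OF m]])
    then have "continuous_on {0..} (\<lambda>t. leray k (bilin (a t) (a t) k))"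
      by (rule continuous_on_compose2[OF linear_continuous_on[OF bounded_linear_leray, of UNIV]]) auto
    then obtain y where "y 0 = a0 k"
      "\<And>t. 0 \<le> t \<Longrightarrow> (y has_vector_derivative lin k (y t) + leray k (bilin (a t) (a t) k)) (at t within {0..})"
      using linear_ode_exists[OF bounded_linear_lin] by blast
    then show ?thesis using False by blast
  qed
  then obtain Y where "\<And>k. Y k 0 = a0 k" "\<And>t. 0 \<le> t \<Longrightarrow> Y 0 t = 0"
    "\<And>k t. 0 \<le> t \<Longrightarrow> (Y k has_vector_derivative lin k (Y k t) + leray k (bilin (a t) (a t) k)) (at t within {0..})"
    by metis
  then show ?thesis unfolding picard_step_def by (intro exI[of _ "\<lambda>t k. Y k t"]) auto
qed

lemma picard_step_decaying:
  assumes a: "decaying m a" and b: "picard_step a0 a b"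
  shows "decaying m b" "continuous_on {0..} (\<lambda>t. b t k)"
proof -
  show "continuous_on {0..} (\<lambda>t. b t k)"
    by (rule has_vector_derivative_imp_continuous_on) (use b in \<open>auto simp: picard_step_def\<close>)
  show "decaying m b" unfolding decaying_def
  proof (intro allI impI)
    fix t :: real and k assume t: "0 \<le> t"
    show "norm (b t k) \<le> 2 * m k * exp (- (rate / 2) * t)"
    proof (cases "k = 0")
      case True
      then show ?thesis using b t m_pos[of k] by (auto simp: picard_step_def)
    next
      case False
      have "norm (b t k) \<le> (norm (b 0 k) + m k / 2) * exp (- (rate / 2) * t)"
      proof (rule mode_decay[OF False _ _ m_pos t])
        show "((\<lambda>t. b t k) has_vector_derivative lin k (b s k) + leray k (bilin (a s) (a s) k)) (at s within {0..})" if "0 \<le> s" for s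
          using b that by (auto simp: picard_step_def)
        show "norm (leray k (bilin (a s) (a s) k)) \<le> (rate / 4) * (wave_norm k)\<^sup>2 * m k * exp (- (rate / 2) * s)" if "0 \<le> s" for s
          by (rule order_trans[OF norm_leray_le norm_bilin_decaying[OF m a that]])
      qed
      also have "\<dots> \<le> (2 * m k) * exp (- (rate / 2) * t)"
        using b a0[of k] m_pos[of k] by (intro mult_right_mono) (auto simp: picard_step_def)
      finally show ?thesis .
    qed
  qed
qed

text \<open>The difference of two images starts at 0 and is forced by the difference of the
  nonlinearities, so only the halved forced response remains.\<close>

lemma picard_step_contraction:
  assumes a: "decaying m a" "decaying m a'" and b: "picard_step a0 a b" "picard_step a0 a' b'" and D: "0 \<le> D"
    and diff: "\<And>t k. 0 \<le> t \<Longrightarrow> norm (a t k - a' t k) \<le> D * m k * exp (- (rate / 2) * t)" and t: "0 \<le> t"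
  shows "norm (b t k - b' t k) \<le> (D / 2) * m k * exp (- (rate / 2) * t)"
proof (cases "k = 0")
  case True
  then show ?thesis using b t m_pos[of k] D by (auto simp: picard_step_def)
next
  case False
  let ?F = "\<lambda>s. leray k (bilin (a s) (a s) k - bilin (a' s) (a' s) k)"
  have "norm (b t k - b' t k) \<le> (norm (b 0 k - b' 0 k) + (D * m k) / 2) * exp (- (rate / 2) * t)"
  proof (rule mode_decay[OF False _ _ _ t])
    fix s :: real assume s: "0 \<le> s"
    have "((\<lambda>t. b t k - b' t k) has_vector_derivative
       (lin k (b s k) + leray k (bilin (a s) (a s) k)) - (lin k (b' s k) + leray k (bilin (a' s) (a' s) k))) (at s within {0..})"
      using b s by (intro has_vector_derivative_diff) (auto simp: picard_step_def)
    moreover have "(lin k (b s k) + leray k (bilin (a s) (a s) k)) - (lin k (b' s k) + leray k (bilin (a' s) (a' s) k))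
      = lin k (b s k - b' s k) + ?F s"
      using bounded_linear.linear[OF bounded_linear_lin] bounded_linear.linear[OF bounded_linear_leray] by (simp add: linear_diff)
    ultimately show "((\<lambda>t. b t k - b' t k) has_vector_derivative lin k (b s k - b' s k) + ?F s) (at s within {0..})" by simp
    show "norm (?F s) \<le> (rate / 4) * (wave_norm k)\<^sup>2 * (D * m k) * exp (- (rate / 2) * s)"
      by (rule order_trans[OF norm_leray_le norm_bilin_diff_decaying[OF m a s D diff[OF s]]])
  qed (use D m_pos in simp)
  moreover have "b 0 k - b' 0 k = 0" using b by (simp add: picard_step_def)
  ultimately show ?thesis by simp
qed

text \<open>The iteration contracts by 1/2 in the supremum weighted by \<open>m\<close> and the
  exponential. In each mode the derivatives then converge uniformly in time as well, so the limit
  may be differentiated and solves the fixed-point equation.\<close>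

lemma ex_fixed_point: "\<exists>a. picard_step a0 a a \<and> decaying m a"
proof -
  define good where "good a \<longleftrightarrow> (\<forall>k. continuous_on {0..} (\<lambda>t. a t k)) \<and> decaying m a" for a :: "real \<Rightarrow> int^3 \<Rightarrow> state"
  \<comment> \<open>Putting the condition inside the existential makes the choice function
    total.\<close>
  have "\<exists>b. good a \<longrightarrow> picard_step a0 a b" for a using ex_picard_step unfolding good_def by blast
  then obtain \<Phi> where \<Phi>: "\<And>a. good a \<Longrightarrow> picard_step a0 a (\<Phi> a)" by metis
  define s where "s n = (\<Phi> ^^ n) (\<lambda>t k. 0)" for n
  have s_Suc: "s (Suc n) = \<Phi> (s n)" for n by (simp add: s_def)
  have good: "good (s n)" for n
  proof (induction n)
    case 0
    show ?case using m_pos by (simp add: good_def s_def decaying_def)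
  next
    case (Suc n)
    then show ?case using picard_step_decaying[OF _ \<Phi>[OF Suc]] unfolding s_Suc good_def by blast
  qed
  have step: "picard_step a0 (s n) (s (Suc n))" for n unfolding s_Suc by (rule \<Phi>[OF good])
  have dec: "decaying m (s n)" for n using good by (simp add: good_def)
  have diff: "\<forall>t\<ge>0. \<forall>k. norm (s (Suc n) t k - s n t k) \<le> (2 / 2 ^ n) * m k * exp (- (rate / 2) * t)" for n
  proof (induction n)
    case 0
    have "s 0 = (\<lambda>t k. 0)" by (simp add: s_def)
    then show ?case using dec[of "Suc 0"] by (simp add: decaying_def)
  next
    case (Suc n)
    show ?case
    proof (intro allI impI)
      fix t :: real and k assume t: "0 \<le> t"
      have "norm (s (Suc (Suc n)) t k - s (Suc n) t k) \<le> ((2 / 2 ^ n) / 2) * m k * exp (- (rate / 2) * t)"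
        by (rule picard_step_contraction[OF dec dec step step _ _ t]) (use Suc in auto)
      then show "norm (s (Suc (Suc n)) t k - s (Suc n) t k) \<le> (2 / 2 ^ Suc n) * m k * exp (- (rate / 2) * t)" by simp
    qed
  qed
  have "\<exists>l. \<forall>n. norm (l - s n t k) \<le> (4 / 2 ^ n) * m k * exp (- (rate / 2) * t)" if t: "0 \<le> t" for t k
  proof -
    have "norm (s (Suc n) t k - s n t k) \<le> (2 * m k * exp (- (rate / 2) * t)) / 2 ^ n" for n
      using diff[of n] t by simp
    then obtain l where "\<And>n. norm (l - s n t k) \<le> 2 * (2 * m k * exp (- (rate / 2) * t)) / 2 ^ n"
      using geometric_Cauchy[of "\<lambda>n. s n t k"] by blast
    then show ?thesis by (intro exI[of _ l]) (simp add: mult.assoc)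
  qed
  then obtain a where a: "\<And>t k n. 0 \<le> t \<Longrightarrow> norm (a t k - s n t k) \<le> (4 / 2 ^ n) * m k * exp (- (rate / 2) * t)" by metis
  have lim2: "(\<lambda>n. Q / 2 ^ n) \<longlonglongrightarrow> 0" for Q :: real by (rule LIMSEQ_divide_realpow_zero) simp
  have lim: "(\<lambda>n. s n t k) \<longlonglongrightarrow> a t k" if t: "0 \<le> t" for t k
  proof -
    have "(\<lambda>n. a t k - s n t k) \<longlonglongrightarrow> 0"
      by (rule Lim_null_comparison[OF _ lim2[of "4 * m k * exp (- (rate / 2) * t)"]]) (use a[OF t] in simp)
    then have "(\<lambda>n. a t k - (a t k - s n t k)) \<longlonglongrightarrow> a t k - 0" by (intro tendsto_intros)
    then show ?thesis by simp
  qed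
  have deca: "decaying m a" unfolding decaying_def
  proof (intro allI impI)
    fix t :: real and k assume t: "0 \<le> t"
    show "norm (a t k) \<le> 2 * m k * exp (- (rate / 2) * t)"
      by (rule LIMSEQ_le_const2[OF tendsto_norm[OF lim[OF t]]]) (use dec t in \<open>auto simp: decaying_def\<close>)
  qed
  have ode: "((\<lambda>t. a t k) has_vector_derivative lin k (a t k) + leray k (bilin (a t) (a t) k)) (at t within {0..})" if t: "0 \<le> t" for t k
  proof -
    obtain K where K: "0 < K" "\<And>z. norm (lin k z) \<le> norm z * K" using bounded_linear.pos_bounded[OF bounded_linear_lin] by blast
    \<comment> \<open>\<open>Q\<close> depends on \<open>k\<close> through the bound
      \<open>K\<close> for \<open>lin k\<close>; this is harmless because derivatives are compared
      mode by mode.\<close>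
    define Q where "Q = 4 * m k * K + (rate / 4) * (wave_norm k)\<^sup>2 * (4 * m k)"
    let ?d = "\<lambda>n t. lin k (s (Suc n) t k) + leray k (bilin (s n t) (s n t) k)"
    let ?d' = "\<lambda>t. lin k (a t k) + leray k (bilin (a t) (a t) k)"
    have dd: "norm (?d n t - ?d' t) \<le> Q / 2 ^ n" if t: "0 \<le> t" for n t
    proof -
      have "norm (lin k (s (Suc n) t k) - lin k (a t k)) = norm (lin k (a t k - s (Suc n) t k))"
        using bounded_linear.linear[OF bounded_linear_lin] by (simp add: linear_diff norm_minus_commute)
      also have "\<dots> \<le> norm (a t k - s (Suc n) t k) * K" by (rule K)
      also have "\<dots> \<le> ((4 / 2 ^ Suc n) * m k * exp (- (rate / 2) * t)) * K" by (rule mult_right_mono[OF a[OF t]]) (use K in simp)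
      also have "\<dots> \<le> ((4 / 2 ^ n) * m k * 1) * K"
        using K m_pos[of k] exp_decay_le[OF t] by (intro mult_right_mono mult_mono) (auto simp: field_simps)
      finally have 1: "norm (lin k (s (Suc n) t k) - lin k (a t k)) \<le> ((4 / 2 ^ n) * m k * 1) * K" .
      have "norm (leray k (bilin (s n t) (s n t) k) - leray k (bilin (a t) (a t) k)) = norm (leray k (bilin (a t) (a t) k - bilin (s n t) (s n t) k))"
        using bounded_linear.linear[OF bounded_linear_leray] by (simp add: linear_diff norm_minus_commute)
      also have "\<dots> \<le> norm (bilin (a t) (a t) k - bilin (s n t) (s n t) k)" by (rule norm_leray_le)
      also have "\<dots> \<le> (rate / 4) * (wave_norm k)\<^sup>2 * ((4 / 2 ^ n) * m k) * exp (- (rate / 2) * t)"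
        by (rule norm_bilin_diff_decaying[OF m deca dec t _ a[OF t]]) simp
      also have "\<dots> \<le> (rate / 4) * (wave_norm k)\<^sup>2 * ((4 / 2 ^ n) * m k) * 1"
        using rate(1) m_pos[of k] exp_decay_le[OF t] by (intro mult_left_mono) auto
      finally have 2: "norm (leray k (bilin (s n t) (s n t) k) - leray k (bilin (a t) (a t) k)) \<le> (rate / 4) * (wave_norm k)\<^sup>2 * ((4 / 2 ^ n) * m k) * 1" .
      have "?d n t - ?d' t = (lin k (s (Suc n) t k) - lin k (a t k)) + (leray k (bilin (s n t) (s n t) k) - leray k (bilin (a t) (a t) k))" by simp
      also have "norm \<dots> \<le> ((4 / 2 ^ n) * m k * 1) * K + (rate / 4) * (wave_norm k)\<^sup>2 * ((4 / 2 ^ n) * m k) * 1"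
        by (rule order_trans[OF norm_triangle_ineq add_mono[OF 1 2]])
      also have "\<dots> = Q / 2 ^ n" by (simp add: Q_def add_divide_distrib)
      finally show ?thesis .
    qed
    have "\<exists>g. \<forall>t\<in>{0..}. (\<lambda>n. s (Suc n) t k) \<longlonglongrightarrow> g t \<and> (g has_derivative (\<lambda>h. h *\<^sub>R ?d' t)) (at t within {0..})"
    proof (rule has_derivative_sequence)
      show "convex {0::real..}" by (rule convex_real_interval)
      show "((\<lambda>t. s (Suc n) t k) has_derivative (\<lambda>h. h *\<^sub>R ?d n t)) (at t within {0..})" if "t \<in> {0..}" for n t
        using step[of n] that unfolding picard_step_def has_vector_derivative_def by auto
      show "0 \<in> {0::real..}" by simp
      show "(\<lambda>n. s (Suc n) 0 k) \<longlonglongrightarrow> a 0 k" using lim[of 0 k] by (intro LIMSEQ_Suc) simp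
      fix e :: real assume "0 < e"
      then have "\<forall>\<^sub>F n in sequentially. Q / 2 ^ n < e" using order_tendstoD(2)[OF lim2] by blast
      then show "\<forall>\<^sub>F n in sequentially. \<forall>t\<in>{0..}. \<forall>h. norm (h *\<^sub>R ?d n t - h *\<^sub>R ?d' t) \<le> e * norm h"
      proof eventually_elim
        case (elim n)
        show ?case
        proof (intro ballI allI)
          fix t h :: real assume "t \<in> {0..}"
          then have "norm (?d n t - ?d' t) \<le> e" using dd[of t n] elim by auto
          then have "norm h * norm (?d n t - ?d' t) \<le> norm h * e" by (intro mult_left_mono) auto
          then show "norm (h *\<^sub>R ?d n t - h *\<^sub>R ?d' t) \<le> e * norm h"
            unfolding scaleR_diff_right[symmetric] norm_scaleR real_norm_def by (simp only: mult.commute)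
        qed
      qed
    qed
    then obtain g where g: "\<And>t. 0 \<le> t \<Longrightarrow> (\<lambda>n. s (Suc n) t k) \<longlonglongrightarrow> g t"
      "\<And>t. 0 \<le> t \<Longrightarrow> (g has_derivative (\<lambda>h. h *\<^sub>R ?d' t)) (at t within {0..})" by auto
    have ga: "a t k = g t" if "0 \<le> t" for t
      using LIMSEQ_unique[OF g(1)[OF that] LIMSEQ_Suc[OF lim[OF that]]] by simp
    have "((\<lambda>t. a t k) has_derivative (\<lambda>h. h *\<^sub>R ?d' t)) (at t within {0..})"
      by (rule has_derivative_transform[OF _ _ g(2)[OF t]]) (use t ga in auto)
    then show ?thesis unfolding has_vector_derivative_def .
  qed
  have "a 0 = a0"
  proof
    fix k
    have "s (Suc n) 0 k = a0 k" for n using step[of n] by (simp add: picard_step_def)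
    then have "(\<lambda>n. s (Suc n) 0 k) \<longlonglongrightarrow> a0 k" by simp
    then show "a 0 k = a0 k" using LIMSEQ_unique LIMSEQ_Suc[OF lim[of 0 k]] by blast
  qed
  moreover have "a t 0 = 0" if "0 \<le> t" for t
  proof -
    have "norm (a t 0) \<le> 2 * m 0 * exp (- (rate / 2) * t)" using deca that unfolding decaying_def by blast
    then show ?thesis using m_0 by simp
  qed
  ultimately show ?thesis using ode deca unfolding picard_step_def by blast
qed

text \<open>The divergence of each mode solves a homogeneous damped scalar equation with initial
  value zero: for the velocity the curl and the projected nonlinearity drop out, and the magnetic
  nonlinearity is divergence free.\<close>

lemma fixed_point_divergence_free:
  assumes a: "picard_step a0 a a" "decaying m a"
    and div: "\<And>k. kdot k (fst (a0 k)) = 0" "\<And>k. kdot k (snd (snd (a0 k))) = 0" and t: "0 \<le> t"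
  shows "kdot k (fst (a t k)) = 0" "kdot k (snd (snd (a t k))) = 0"
proof -
  have dom: "norm (a t j) \<le> 2 * m j" if "0 \<le> t" for t j
  proof -
    have "norm (a t j) \<le> 2 * m j * exp (- (rate / 2) * t)" using a that by (auto simp: decaying_def)
    also have "\<dots> \<le> 2 * m j * 1" using exp_decay_le[of t] that m_pos by (intro mult_left_mono) auto
    finally show ?thesis by simp
  qed
  have zero: "y t = 0" if y: "\<And>t. 0 \<le> t \<Longrightarrow> (y has_vector_derivative - (c * (wave_norm k)\<^sup>2) *\<^sub>R y t) (at t within {0..})"
    and "y 0 = 0" "0 < c" "k \<noteq> 0" for y :: "real \<Rightarrow> complex" and c
  proof -
    have "norm (y t) \<le> (norm (y 0) + 0 / (c * (wave_norm k)\<^sup>2 - 0)) * exp (- 0 * t)"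
    proof (rule energy_decay[OF y _ _ _ t])
      show "y s \<bullet> (- (c * (wave_norm k)\<^sup>2) *\<^sub>R y s) \<le> - (c * (wave_norm k)\<^sup>2) * (norm (y s))\<^sup>2 + norm (y s) * (0 * exp (- 0 * s))" for s
        by (simp add: power2_norm_eq_inner)
      have "0 < wave_norm k" using wave_norm_ge_1[OF \<open>k \<noteq> 0\<close>] by linarith
      then show "0 < c * (wave_norm k)\<^sup>2" using \<open>0 < c\<close> by (intro mult_pos_pos zero_less_power)
    qed auto
    then show ?thesis using \<open>y 0 = 0\<close> by simp
  qed
  have ode: "((\<lambda>t. a t k) has_vector_derivative lin k (a t k) + leray k (bilin (a t) (a t) k)) (at t within {0..})" if "0 \<le> t" for t
    using a that by (auto simp: picard_step_def)
  have bl1: "bounded_linear (\<lambda>z::state. kdot k (fst z))"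
    using bounded_linear_compose[OF bounded_linear_kdot bounded_linear_fst] .
  have bl2: "bounded_linear (\<lambda>z::state. kdot k (snd (snd z)))"
    using bounded_linear_compose[OF bounded_linear_kdot bounded_linear_compose[OF bounded_linear_snd bounded_linear_snd]] .
  have at0: "a 0 = a0" using a by (simp add: picard_step_def)
  show "kdot k (fst (a t k)) = 0"
  proof (cases "k = 0")
    case False
    show ?thesis
    proof (rule zero[where y = "\<lambda>t. kdot k (fst (a t k))" and c = chi])
      fix s :: real assume "0 \<le> s"
      from bounded_linear.has_vector_derivative[OF bl1 ode[OF this]]
      show "((\<lambda>t. kdot k (fst (a t k))) has_vector_derivative - (chi * (wave_norm k)\<^sup>2) *\<^sub>R kdot k (fst (a s k))) (at s within {0..})"
        by (simp add: lin_def leray_def kdot_linear kdot_kcurl kdot_project[OF False])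
    qed (use False chi div at0 in auto)
  qed (simp add: kdot_def)
  show "kdot k (snd (snd (a t k))) = 0"
  proof (cases "k = 0")
    case False
    show ?thesis
    proof (rule zero[where y = "\<lambda>t. kdot k (snd (snd (a t k)))" and c = \<nu>])
      fix s :: real assume s: "0 \<le> s"
      have "kdot k (snd (snd (bilin (a s) (a s) k))) = 0"
        by (rule kdot_bilin_magnetic[OF dom[OF s] decaying_summable[OF m]])
      with bounded_linear.has_vector_derivative[OF bl2 ode[OF s]]
      show "((\<lambda>t. kdot k (snd (snd (a t k)))) has_vector_derivative - (\<nu> * (wave_norm k)\<^sup>2) *\<^sub>R kdot k (snd (snd (a s k)))) (at s within {0..})"
        by (simp add: lin_def leray_def kdot_linear)
    qed (use False nu div at0 in auto)
  qed (simp add: kdot_def)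
qed

end

end

section \<open>Uniqueness for the mode equations\<close>

context mhd
begin

text \<open>The pressure appears as an arbitrary multiple \<open>\<pi>\<close> of \<open>k\<close>,
  chosen anew for each time and mode, so the notion fits both the projected system and strong
  solutions with any pressure. The bound on finite sums is what H^3 solutions provide on bounded
  time intervals.\<close>

definition mode_solution :: "real \<Rightarrow> real \<Rightarrow> (real \<Rightarrow> int^3 \<Rightarrow> state) \<Rightarrow> bool" where
  "mode_solution T M a \<longleftrightarrow>
     (\<forall>k. continuous_on {0..T} (\<lambda>t. a t k)) \<and>
     (\<forall>t\<in>{0..T}. \<forall>F. finite F \<longrightarrow> (\<Sum>k\<in>F. norm (a t k)) \<le> M) \<and>
     (\<forall>t\<in>{0..T}. \<forall>k. kdot k (fst (a t k)) = 0) \<and>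
     (\<forall>t k. 0 < t \<and> t < T \<longrightarrow> (\<exists>\<pi>. ((\<lambda>t. a t k) has_vector_derivative
        lin k (a t k) + bilin (a t) (a t) k + (\<pi> *s kvec k, 0)) (at t)))"

lemma mode_solutionD:
  assumes "mode_solution T M a"
  shows "continuous_on {0..T} (\<lambda>t. a t k)"
    and "t \<in> {0..T} \<Longrightarrow> finite F \<Longrightarrow> (\<Sum>k\<in>F. norm (a t k)) \<le> M"
    and "t \<in> {0..T} \<Longrightarrow> kdot k (fst (a t k)) = 0"
    and "0 < t \<Longrightarrow> t < T \<Longrightarrow> \<exists>\<pi>. ((\<lambda>t. a t k) has_vector_derivative
        lin k (a t k) + bilin (a t) (a t) k + (\<pi> *s kvec k, 0)) (at t)"
  using assms unfolding mode_solution_def by auto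

text \<open>Per mode, the dissipation absorbs the factor \<open>\<bar>k\<bar>\<close> of the nonlinearity, so that the energy of the
  difference grows at most like a constant times the convolution. Summing over finitely many
  modes and iterating gives the bound \<open>(K t)\<^sup>n / n!\<close>.\<close>

theorem mode_solution_unique:
  assumes a: "mode_solution T M a" and a': "mode_solution T M a'" and init: "a 0 = a' 0" and t: "t \<in> {0..T}"
  shows "a t k = a' t k"
proof -
  note D = mode_solutionD[OF a] and D' = mode_solutionD[OF a']
  define w where "w t k = norm (a t k - a' t k)" for t k
  define g where "g t k = norm (a t k) + norm (a' t k)" for t k
  \<comment> \<open>This is \<open>9 / (2 * rate)\<close>, from absorbing the nonlinearity, times
    \<open>(2 * M)\<^sup>2\<close>, the square of the l^1 bound of \<open>g\<close>.\<close>
  define K where "K = 18 * M\<^sup>2 / rate"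
  have w0: "0 \<le> w t k" and g0: "0 \<le> g t k" for t k by (simp_all add: w_def g_def)
  have M0: "0 \<le> M" using D(2)[OF t, of "{}"] by simp
  have K0: "0 \<le> K" using rate(1) by (simp add: K_def)
  have gM: "(\<Sum>k\<in>F. g t k) \<le> 2 * M" if "t \<in> {0..T}" "finite F" for t F
    using D(2)[OF that] D'(2)[OF that] by (simp add: g_def sum.distrib)
  have wg: "w t k \<le> g t k" for t k unfolding w_def g_def by (rule norm_triangle_ineq4)
  have wS: "L2_set (w t) F \<le> 2 * M" if "t \<in> {0..T}" "finite F" for t F
  proof -
    have "L2_set (w t) F \<le> (\<Sum>k\<in>F. w t k)" by (rule L2_set_le_sum) (simp add: w0)
    also have "\<dots> \<le> (\<Sum>k\<in>F. g t k)" by (intro sum_mono wg)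
    finally show ?thesis using gM[OF that] by linarith
  qed
  \<comment> \<open>The pressure difference is orthogonal to the divergence-free difference and
    drops out. Completing the square lets the dissipation consume the factor
    \<open>|k| * w t k\<close>; what remains is a square of the convolution alone.\<close>
  have diss: "\<exists>d. ((\<lambda>s. (w s k)\<^sup>2) has_real_derivative d) (at t) \<and> d \<le> (9 / (2 * rate)) * (conv (g t) (w t) k)\<^sup>2"
    if t: "0 < t" "t < T" for t k
  proof -
    have tT: "t \<in> {0..T}" using t by auto
    let ?z = "a t k - a' t k"
    let ?N = "bilin (a t) (a t) k - bilin (a' t) (a' t) k"
    obtain \<pi> \<pi>' where \<pi>: "((\<lambda>t. a t k) has_vector_derivative lin k (a t k) + bilin (a t) (a t) k + (\<pi> *s kvec k, 0)) (at t)"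
      "((\<lambda>t. a' t k) has_vector_derivative lin k (a' t k) + bilin (a' t) (a' t) k + (\<pi>' *s kvec k, 0)) (at t)"
      using D(4)[OF t] D'(4)[OF t] by blast
    let ?P = "((\<pi> - \<pi>') *s kvec k, 0) :: state"
    have "\<pi> *s kvec k - \<pi>' *s kvec k = (\<pi> - \<pi>') *s kvec k" by (simp add: vec_eq_iff algebra_simps)
    then have pk: "?P = (\<pi> *s kvec k, 0) - (\<pi>' *s kvec k, 0)" by (simp add: minus_prod_def)
    have "lin k (a t k) + bilin (a t) (a t) k + (\<pi> *s kvec k, 0) - (lin k (a' t k) + bilin (a' t) (a' t) k + (\<pi>' *s kvec k, 0))
       = lin k ?z + ?N + ?P"
      unfolding pk using linear_diff[OF bounded_linear.linear[OF bounded_linear_lin]] by (simp only: algebra_simps)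
    then have "((\<lambda>t. a t k - a' t k) has_vector_derivative lin k ?z + ?N + ?P) (at t)"
      using has_vector_derivative_diff[OF \<pi>] by (simp only:)
    then have d: "((\<lambda>s. (w s k)\<^sup>2) has_real_derivative 2 * (?z \<bullet> (lin k ?z + ?N + ?P))) (at t)"
      unfolding w_def by (rule has_real_derivative_inner_self)
    have "?z \<bullet> ?P = 0"
    proof -
      have "kdot k (fst ?z) = 0" using D(3)[OF tT, of k] D'(3)[OF tT, of k] by (simp add: kdot_linear)
      then show ?thesis unfolding inner_prod_def fst_conv snd_conv inner_scaled_kvec by simp
    qed
    have sg: "g t summable_on UNIV" by (rule summable_on_if_sums_le[OF gM[OF tT] g0])
    have g2M: "g t k \<le> 2 * M" for k using gM[OF tT, of "{k}"] by simp
    have sn: "(\<lambda>k. norm (a t k)) summable_on UNIV" "(\<lambda>k. norm (a' t k)) summable_on UNIV"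
      by (rule summable_on_if_sums_le[OF D(2)[OF tT]], assumption, simp)
        (rule summable_on_if_sums_le[OF D'(2)[OF tT]], assumption, simp)
    have bn: "norm (a t k) \<le> 2 * M" "norm (a' t k) \<le> 2 * M" "w t k \<le> 2 * M" for k
      using g2M[of k] wg[of t k] norm_ge_zero[of "a t k"] norm_ge_zero[of "a' t k"] unfolding g_def by linarith+
    have s1: "(\<lambda>j. norm (a t j) * w t (k - j)) summable_on UNIV" "(\<lambda>j. norm (a' t j) * w t (k - j)) summable_on UNIV"
      by (rule summable_conv[OF sn(1) norm_ge_zero w0 bn(3)], rule summable_conv[OF sn(2) norm_ge_zero w0 bn(3)])
    have "norm ?N \<le> 3 * wave_norm k * (conv (w t) (\<lambda>k. norm (a t k)) k + conv (\<lambda>k. norm (a' t k)) (w t) k)"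
    proof (rule bilin_diff)
      show "(\<lambda>j. norm (a t j) * norm (a t (k - j))) summable_on UNIV" by (rule summable_conv[OF sn(1) norm_ge_zero norm_ge_zero bn(1)])
      show "(\<lambda>j. norm (a' t j) * norm (a' t (k - j))) summable_on UNIV" by (rule summable_conv[OF sn(2) norm_ge_zero norm_ge_zero bn(2)])
      show "(\<lambda>j. w t j * norm (a t (k - j))) summable_on UNIV" by (rule conv_summable_commute[OF s1(1)])
      show "(\<lambda>j. norm (a' t j) * w t (k - j)) summable_on UNIV" by (rule s1(2))
    qed (simp_all add: w_def)
    also have "conv (w t) (\<lambda>k. norm (a t k)) k + conv (\<lambda>k. norm (a' t k)) (w t) k = conv (g t) (w t) k"
      unfolding conv_commute[of "w t"] unfolding conv_def g_def distrib_right using infsum_add[OF s1] by simp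
    finally have N: "norm ?N \<le> 3 * wave_norm k * conv (g t) (w t) k" .
    define x where "x = wave_norm k * w t k"
    define C where "C = conv (g t) (w t) k"
    have "?z \<bullet> (lin k ?z + ?N + ?P) = ?z \<bullet> lin k ?z + ?z \<bullet> ?N" using \<open>?z \<bullet> ?P = 0\<close> by (simp add: inner_add_right)
    also have "\<dots> \<le> - rate * (wave_norm k)\<^sup>2 * (norm ?z)\<^sup>2 + norm ?z * norm ?N"
      by (intro add_mono lin_energy norm_cauchy_schwarz)
    also have "\<dots> \<le> - rate * (wave_norm k)\<^sup>2 * (norm ?z)\<^sup>2 + norm ?z * (3 * wave_norm k * conv (g t) (w t) k)"
      by (intro add_left_mono mult_left_mono N) simp
    also have "\<dots> = - rate * x\<^sup>2 + 3 * (x * C)" by (simp add: x_def C_def w_def power_mult_distrib)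
    also have "\<dots> \<le> (9 / (4 * rate)) * C\<^sup>2"
    proof -
      have "0 \<le> rate * (x - 3 * C / (2 * rate))\<^sup>2" using rate(1) by simp
      also have "\<dots> = rate * x\<^sup>2 - 3 * (x * C) + (9 / (4 * rate)) * C\<^sup>2"
        using rate(1) by (simp add: power2_eq_square field_simps)
      finally show ?thesis by linarith
    qed
    finally have "2 * (?z \<bullet> (lin k ?z + ?N + ?P)) \<le> (9 / (2 * rate)) * C\<^sup>2" by (simp add: field_simps)
    then show ?thesis using d unfolding C_def by blast
  qed
  \<comment> \<open>A sum over \<open>F\<close> is controlled only by a convolution over all
    frequencies, so it satisfies no closed Gronwall inequality; the induction therefore treats all
    finite sets at once. In the convolution \<open>w\<close> is measured in l^2 and \<open>g\<close>
    in l^1.\<close>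
  have bound: "\<forall>t\<in>{0..T}. \<forall>F. finite F \<longrightarrow> (\<Sum>k\<in>F. (w t k)\<^sup>2) \<le> (2 * M)\<^sup>2 * (K * t) ^ n / fact n" for n
  proof (induction n)
    case 0
    show ?case
    proof (intro ballI allI impI)
      fix t and F :: "(int^3) set" assume "t \<in> {0..T}" "finite F"
      then have "(L2_set (w t) F)\<^sup>2 \<le> (2 * M)\<^sup>2" by (intro power_mono wS) auto
      then show "(\<Sum>k\<in>F. (w t k)\<^sup>2) \<le> (2 * M)\<^sup>2 * (K * t) ^ 0 / fact 0" by (simp add: L2_set_def sum_nonneg)
    qed
  next
    case (Suc n)
    show ?case
    proof (intro ballI allI impI)
      fix t and F :: "(int^3) set" assume t: "t \<in> {0..T}" and F: "finite F"
      define B where "B = (2 * M)\<^sup>2"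
      \<comment> \<open>The subtracted term is \<open>K\<close> times the time integral of the bound
        for \<open>n\<close>.\<close>
      define \<phi> where "\<phi> s = (\<Sum>k\<in>F. (w s k)\<^sup>2) - (B * K ^ Suc n / fact (Suc n)) * s ^ Suc n" for s
      have "\<phi> t \<le> \<phi> 0"
      proof (rule DERIV_nonpos_imp_decreasing_open[of 0 t \<phi>])
        show "0 \<le> t" using t by simp
        show "continuous_on {0..t} \<phi>"
        proof -
          have "continuous_on {0..t} (\<lambda>s. a s k)" "continuous_on {0..t} (\<lambda>s. a' s k)" for k
            by (rule continuous_on_subset[OF D(1)], use t in auto)
              (rule continuous_on_subset[OF D'(1)], use t in auto)
          then show ?thesis unfolding \<phi>_def w_def by (intro continuous_intros)
        qed
        fix s assume s: "0 < s" "s < t"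
        then have sT: "0 < s" "s < T" "s \<in> {0..T}" using t by auto
        obtain d where d: "\<And>k. ((\<lambda>s. (w s k)\<^sup>2) has_real_derivative d k) (at s)"
            "\<And>k. d k \<le> (9 / (2 * rate)) * (conv (g s) (w s) k)\<^sup>2"
          using diss[OF sT(1,2)] by metis
        have "(\<phi> has_real_derivative ((\<Sum>k\<in>F. d k) - (B * K ^ Suc n / fact (Suc n)) * (real (Suc n) * s ^ n))) (at s)"
        proof -
          have "((\<lambda>s. (B * K ^ Suc n / fact (Suc n)) * s ^ Suc n) has_real_derivative (B * K ^ Suc n / fact (Suc n)) * (real (Suc n) * s ^ n)) (at s)"
            using DERIV_cmult[OF DERIV_pow[of "Suc n" s UNIV], of "B * K ^ Suc n / fact (Suc n)"]
            by (simp only: diff_Suc_Suc minus_nat.diff_0)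
          then show ?thesis unfolding \<phi>_def by (intro DERIV_diff DERIV_sum d(1))
        qed
        moreover have "(\<Sum>k\<in>F. d k) \<le> (B * K ^ Suc n / fact (Suc n)) * (real (Suc n) * s ^ n)"
        proof -
          define S where "S = sqrt (B * (K * s) ^ n / fact n)"
          have S2: "S\<^sup>2 = B * (K * s) ^ n / fact n" unfolding S_def B_def using K0 s by simp
          have wSb: "L2_set (w s) F' \<le> S" if "finite F'" for F'
            unfolding L2_set_def S_def B_def using Suc sT(3) that by (intro real_sqrt_le_mono) auto
          have "L2_set (\<lambda>k. conv (g s) (w s) k) F \<le> (2 * M) * S"
            by (rule Young[OF wSb w0 gM[OF sT(3)] g0 F])
          then have "(L2_set (\<lambda>k. conv (g s) (w s) k) F)\<^sup>2 \<le> ((2 * M) * S)\<^sup>2" by (intro power_mono) auto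
          then have C: "(\<Sum>k\<in>F. (conv (g s) (w s) k)\<^sup>2) \<le> (2 * M)\<^sup>2 * (B * (K * s) ^ n / fact n)"
            unfolding power_mult_distrib S2 by (simp add: L2_set_def sum_nonneg)
          have "(\<Sum>k\<in>F. d k) \<le> (\<Sum>k\<in>F. (9 / (2 * rate)) * (conv (g s) (w s) k)\<^sup>2)" by (intro sum_mono d)
          also have "\<dots> = (9 / (2 * rate)) * (\<Sum>k\<in>F. (conv (g s) (w s) k)\<^sup>2)" by (simp add: sum_distrib_left)
          also have "\<dots> \<le> (9 / (2 * rate)) * ((2 * M)\<^sup>2 * (B * (K * s) ^ n / fact n))"
            using rate(1) by (intro mult_left_mono C) auto
          also have "\<dots> = K * (B * (K * s) ^ n / fact n)" using rate(1) by (simp add: K_def power_mult_distrib)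
          also have "\<dots> = (B * K ^ Suc n / fact (Suc n)) * (real (Suc n) * s ^ n)"
          proof -
            have "real (Suc n) \<noteq> 0" by simp
            then have "K * (B * (X * Y) / fact n) = (B * (K * X) / (real (Suc n) * fact n)) * (real (Suc n) * Y)" for X Y
              by (simp add: divide_simps mult_ac del: of_nat_Suc)
            then show ?thesis unfolding fact_Suc power_Suc power_mult_distrib of_nat_mult by (simp only: of_nat_fact of_nat_Suc)
          qed
          finally show ?thesis .
        qed
        ultimately show "\<exists>y. (\<phi> has_real_derivative y) (at s) \<and> y \<le> 0" by (intro exI conjI) auto
      qed
      moreover have "\<phi> 0 = 0" unfolding \<phi>_def w_def using init by simp
      ultimately have "(\<Sum>k\<in>F. (w t k)\<^sup>2) \<le> (B * K ^ Suc n / fact (Suc n)) * t ^ Suc n" unfolding \<phi>_def by linarith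
      also have "\<dots> = (2 * M)\<^sup>2 * (K * t) ^ Suc n / fact (Suc n)" by (simp add: B_def power_mult_distrib mult_ac)
      finally show "(\<Sum>k\<in>F. (w t k)\<^sup>2) \<le> (2 * M)\<^sup>2 * (K * t) ^ Suc n / fact (Suc n)" .
    qed
  qed
  have "(w t k)\<^sup>2 \<le> (2 * M)\<^sup>2 * (inverse (fact n) * (K * t) ^ n)" for n
    using bound[of n] t by (auto simp: divide_inverse mult_ac dest!: bspec[of _ _ t] spec[of _ "{k}"])
  moreover have "(\<lambda>n. (2 * M)\<^sup>2 * (inverse (fact n) * (K * t) ^ n)) \<longlonglongrightarrow> (2 * M)\<^sup>2 * 0"
    by (intro tendsto_intros summable_LIMSEQ_zero summable_exp)
  ultimately have "(w t k)\<^sup>2 \<le> (2 * M)\<^sup>2 * 0" by (intro LIMSEQ_le_const) auto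
  then show ?thesis by (simp add: w_def)
qed

end

section \<open>Conjugate symmetry\<close>

definition vcnj :: "cvec \<Rightarrow> cvec" where
  "vcnj v = (\<chi> i. cnj (v $ i))"

text \<open>Applied to the mode at \<open>- k\<close> it gives the mode at \<open>k\<close> of the
  conjugate fields; coefficients of real fields are fixed by this operation.\<close>

definition scnj :: "state \<Rightarrow> state" where
  "scnj z = (vcnj (fst z), vcnj (fst (snd z)), vcnj (snd (snd z)))"

lemma vcnj_nth [simp]: "vcnj v $ i = cnj (v $ i)"
  by (simp add: vcnj_def)

lemma vcnj_simps:
  "vcnj (v + w) = vcnj v + vcnj w" "vcnj (v - w) = vcnj v - vcnj w" "vcnj (- v) = - vcnj v"
  "vcnj (r *\<^sub>R v) = r *\<^sub>R vcnj v" "vcnj (c *s v) = cnj c *s vcnj v" "norm (vcnj v) = norm v" "vcnj (vcnj v) = v"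
  by (simp_all add: vec_eq_iff norm_vec_def)

lemma kdot_vcnj: "kdot k (vcnj v) = - cnj (kdot (- k) v)"
  by (simp add: kdot_def sum_negf)

lemma vcnj_kcurl: "vcnj (kcurl (- k) v) = kcurl k (vcnj v)"
  by (simp add: vec_eq_iff forall_3 kcurl_nth algebra_simps)

lemma vcnj_kvec: "vcnj (kvec (- k)) = - kvec k"
  by (simp add: vec_eq_iff kvec_def)

lemma bounded_linear_scnj: "bounded_linear scnj"
  unfolding linear_conv_bounded_linear[symmetric]
  by (rule linearI) (simp_all add: scnj_def vcnj_simps)

lemma norm_scnj: "norm (scnj z) = norm z"
  by (simp add: scnj_def norm_prod_def vcnj_simps)

lemma scnj_scnj: "scnj (scnj z) = z"
  by (simp add: scnj_def vcnj_simps)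

text \<open>Conjugation changes the sign of the factor \<open>\<i>\<close>, and reflecting the
  frequency changes that of \<open>kdot\<close>; the two signs cancel.\<close>

lemma scnj_advect: "scnj (advect (- k) p q) = advect k (scnj p) (scnj q)"
  by (simp add: scnj_def advect_def vcnj_simps kdot_vcnj vec_eq_iff algebra_simps)

lemma scnj_bilin:
  assumes "\<And>j. norm (a j) \<le> f j" "(\<lambda>j. f j * f (- k - j)) summable_on UNIV"
  shows "scnj (bilin a a (- k)) = bilin (\<lambda>j. scnj (a (- j))) (\<lambda>j. scnj (a (- j))) k"
proof -
  have "((\<lambda>j. scnj (advect (- k) (a j) (a (- k - j)))) has_sum scnj (bilin a a (- k))) UNIV"
    unfolding bilin_def
    by (intro has_sum_bounded_linear[OF bounded_linear_scnj] has_sum_infsum bilin_summable[OF assms(1) assms(1) assms(2)])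
  then have "scnj (bilin a a (- k)) = (\<Sum>\<^sub>\<infinity>j. advect k (scnj (a j)) (scnj (a (- k - j))))"
    unfolding scnj_advect by (rule infsumI[symmetric])
  also have "\<dots> = (\<Sum>\<^sub>\<infinity>j. advect k (scnj (a (- j))) (scnj (a (- (k - j)))))"
  proof -
    have "bij_betw uminus UNIV (UNIV :: (int^3) set)" by (rule bij_betwI[where g = uminus]) auto
    from infsum_reindex_bij_betw[OF this, of "\<lambda>j. advect k (scnj (a j)) (scnj (a (- k - j)))"]
    show ?thesis by (simp add: algebra_simps)
  qed
  finally show ?thesis unfolding bilin_def .
qed

context mhd
begin

lemma scnj_lin: "scnj (lin (- k) z) = lin k (scnj z)"
  by (simp add: scnj_def lin_def vcnj_simps kdot_vcnj vcnj_kcurl vcnj_kvec)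

lemma leray_eq: "\<exists>\<pi>. leray k z = z + (\<pi> *s kvec k, 0)"
proof
  show "leray k z = z + ((- (kdot k (fst z) / of_real ((wave_norm k)\<^sup>2))) *s kvec k, 0)"
    by (simp add: leray_def project_def prod_eq_iff vec_eq_iff)
qed

text \<open>All but the symmetry comes from the fixed point. Real data coincide with their reflected
  conjugates, and reflected conjugation preserves the equations up to a multiple of
  \<open>k\<close>; uniqueness then identifies the solution with its reflected conjugate.\<close>

theorem coefficient_solution_exists:
  assumes h3: "h3_bounded A (\<lambda>k. norm (a0 k))" and small: "16 * (48 / rate) * lattice_const * A \<le> 1"
    and div: "\<And>k. kdot k (fst (a0 k)) = 0" "\<And>k. kdot k (snd (snd (a0 k))) = 0"
    and real: "\<And>k. a0 (- k) = scnj (a0 k)"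
  obtains a m where "h3_bounded (2 * A) m" "a 0 = a0"
    "\<And>t k. 0 \<le> t \<Longrightarrow> norm (a t k) \<le> 2 * m k * exp (- (rate / 2) * t)"
    "\<And>t k. 0 \<le> t \<Longrightarrow> ((\<lambda>t. a t k) has_vector_derivative lin k (a t k) + leray k (bilin (a t) (a t) k)) (at t within {0..})"
    "\<And>t k. 0 \<le> t \<Longrightarrow> kdot k (fst (a t k)) = 0" "\<And>t k. 0 \<le> t \<Longrightarrow> kdot k (snd (snd (a t k))) = 0"
    "\<And>t k. 0 \<le> t \<Longrightarrow> a t (- k) = scnj (a t k)"
    "\<And>t k. 0 \<le> t \<Longrightarrow> norm (bilin (a t) (a t) k) \<le> (rate / 4) * (wave_norm k)\<^sup>2 * m k"
proof -
  have "0 < 48 / rate" using rate(1) by simp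
  then obtain m where m: "h3_bounded (2 * A) m" "\<And>k. norm (a0 k) \<le> m k"
     "\<And>k. k \<noteq> 0 \<Longrightarrow> (48 / rate) * conv m m k \<le> wave_norm k * m k"
    using ex_majorant[OF h3 _ small] by blast
  have sup: "supersolution (2 * A) m" using m by (simp add: supersolution_def)
  obtain a where a: "picard_step a0 a a" "decaying m a" using ex_fixed_point[OF sup m(2)] by blast
  have dec: "norm (a t k) \<le> 2 * m k * exp (- (rate / 2) * t)" if "0 \<le> t" for t k
    using a(2) that unfolding decaying_def by blast
  have ode: "((\<lambda>t. a t k) has_vector_derivative lin k (a t k) + leray k (bilin (a t) (a t) k)) (at t within {0..})" if "0 \<le> t" for t k
    using a(1) that unfolding picard_step_def by blast
  have dv: "kdot k (fst (a t k)) = 0" "kdot k (snd (snd (a t k))) = 0" if "0 \<le> t" for t k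
    using fixed_point_divergence_free[OF sup m(2) a div that] by blast+
  have dom: "norm (a t k) \<le> 2 * m k" if "0 \<le> t" for t k
  proof -
    have "2 * m k * exp (- (rate / 2) * t) \<le> 2 * m k * 1"
      using exp_decay_le[OF that] h3_boundedD(1)[OF m(1)] by (intro mult_left_mono) auto
    then show ?thesis using dec[OF that, of k] by linarith
  qed
  define b where "b t k = scnj (a t (- k))" for t k
  have refl: "a t k = b t k" if t: "0 \<le> t" for t k
  proof -
    define M where "M = 2 * (lattice_const * (2 * A))"
    have sumM: "(\<Sum>k\<in>F. norm (a t k)) \<le> M" if "0 \<le> t" "finite F" for t F
    proof -
      have "(\<Sum>k\<in>F. norm (a t k)) \<le> (\<Sum>k\<in>F. 2 * m k)" by (intro sum_mono dom that)
      also have "\<dots> = 2 * sum m F" by (simp add: sum_distrib_left)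
      also have "\<dots> \<le> M" unfolding M_def by (intro mult_left_mono h3_bounded_l1[OF m(1)] that) simp
      finally show ?thesis .
    qed
    have ode_at: "((\<lambda>t. a t k) has_vector_derivative lin k (a t k) + leray k (bilin (a t) (a t) k)) (at t)" if "0 < t" for t k
      using ode[of t k] that at_within_interior[of t "{0..}"] by simp
    have cont: "continuous_on {0..t} (\<lambda>t. a t k)" for k
      by (rule continuous_on_subset[OF has_vector_derivative_imp_continuous_on[OF ode]]) auto
    have 1: "mode_solution t M a" unfolding mode_solution_def
    proof (intro conjI allI impI ballI)
      fix s k assume s: "0 < s \<and> s < t"
      obtain \<pi> where "leray k (bilin (a s) (a s) k) = bilin (a s) (a s) k + (\<pi> *s kvec k, 0)" using leray_eq by blast
      then show "\<exists>\<pi>. ((\<lambda>t. a t k) has_vector_derivative lin k (a s k) + bilin (a s) (a s) k + (\<pi> *s kvec k, 0)) (at s)"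
        using ode_at[of s k] s by (auto simp: add.assoc)
    qed (use cont sumM dv in auto)
    have 2: "mode_solution t M b" unfolding mode_solution_def
    proof (intro conjI allI impI ballI)
      show "continuous_on {0..t} (\<lambda>t. b t k)" for k
        unfolding b_def by (rule continuous_on_compose2[OF linear_continuous_on[OF bounded_linear_scnj, of UNIV] cont]) auto
      show "(\<Sum>k\<in>F. norm (b s k)) \<le> M" if "s \<in> {0..t}" "finite F" for s F
      proof -
        have "(\<Sum>k\<in>F. norm (b s k)) = (\<Sum>k\<in>uminus ` F. norm (a s k))"
          by (subst sum.reindex) (auto simp: b_def norm_scnj)
        then show ?thesis using sumM[of s "uminus ` F"] that by simp
      qed
      show "kdot k (fst (b s k)) = 0" if "s \<in> {0..t}" for s k
        using dv(1)[of s "- k"] that by (simp add: b_def scnj_def kdot_vcnj)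
      fix s k assume s: "0 < s \<and> s < t"
      obtain \<pi> where \<pi>: "leray (- k) (bilin (a s) (a s) (- k)) = bilin (a s) (a s) (- k) + (\<pi> *s kvec (- k), 0)" using leray_eq by blast
      have "scnj (bilin (a s) (a s) (- k)) = bilin (b s) (b s) k"
        unfolding b_def[abs_def] using s by (intro scnj_bilin[where f = "\<lambda>j. 2 * m j"] decaying_summable[OF sup] dom) auto
      moreover have "scnj (\<pi> *s kvec (- k), 0) = ((- cnj \<pi>) *s kvec k, 0)"
        unfolding scnj_def by (simp add: vcnj_simps vcnj_kvec zero_prod_def vec_eq_iff)
      moreover have "((\<lambda>t. b t k) has_vector_derivative scnj (lin (- k) (a s (- k)) + (bilin (a s) (a s) (- k) + (\<pi> *s kvec (- k), 0)))) (at s)"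
        unfolding b_def using bounded_linear.has_vector_derivative[OF bounded_linear_scnj ode_at[of s "- k"]] s unfolding \<pi> by blast
      ultimately have "((\<lambda>t. b t k) has_vector_derivative lin k (b s k) + bilin (b s) (b s) k + ((- cnj \<pi>) *s kvec k, 0)) (at s)"
        using bounded_linear.linear[OF bounded_linear_scnj] by (simp add: linear_add scnj_lin b_def add.assoc)
      then show "\<exists>\<pi>. ((\<lambda>t. b t k) has_vector_derivative lin k (b s k) + bilin (b s) (b s) k + (\<pi> *s kvec k, 0)) (at s)" by blast
    qed
    have a00: "a 0 = a0" using a(1) by (simp add: picard_step_def)
    have "a 0 = b 0" unfolding b_def[abs_def] a00 real scnj_scnj ..
    from mode_solution_unique[OF 1 2 this] t show ?thesis by auto
  qed
  have "a t (- k) = scnj (a t k)" if "0 \<le> t" for t k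
    using refl[OF that, of "- k"] by (simp add: b_def)
  moreover have "norm (bilin (a t) (a t) k) \<le> (rate / 4) * (wave_norm k)\<^sup>2 * m k" if "0 \<le> t" for t k
  proof -
    have "(rate / 4) * (wave_norm k)\<^sup>2 * m k * exp (- (rate / 2) * t) \<le> (rate / 4) * (wave_norm k)\<^sup>2 * m k * 1"
      using exp_decay_le[OF that] h3_boundedD(1)[OF m(1)] rate(1) by (intro mult_left_mono) auto
    then show ?thesis using norm_bilin_decaying[OF sup a(2) that, of k] by linarith
  qed
  moreover have "a 0 = a0" using a(1) by (auto simp: picard_step_def)
  ultimately show ?thesis using that[OF m(1) _ dec ode dv] by blast
qed

end

section \<open>Vector fields and their Fourier coefficients\<close>

definition vcoef :: "(real^3 \<Rightarrow> real^3) \<Rightarrow> int^3 \<Rightarrow> cvec" where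
  "vcoef u k = (\<chi> i. coef u (axis i 1) k)"

definition scoef :: "(real^3 \<Rightarrow> real) \<Rightarrow> int^3 \<Rightarrow> complex" where
  "scoef p k = coef p 1 k"

lemma vcoef_nth: "vcoef u k $ i = fcoef (\<lambda>x. complex_of_real (u x $ i)) k"
  by (simp add: vcoef_def coef_def inner_axis)

lemma scoef_eq: "scoef p k = fcoef (\<lambda>x. complex_of_real (p x)) k"
  by (simp add: scoef_def coef_def)

lemma Basis_real_3: "(Basis :: (real^3) set) = (\<lambda>i. axis i 1) ` UNIV"
  by (auto simp: Basis_vec_def)

lemma sum_Basis_real_3: "(\<Sum>b\<in>(Basis :: (real^3) set). g b) = (\<Sum>i\<in>UNIV. g (axis i 1))"
  unfolding Basis_real_3 by (subst sum.reindex) (auto simp: inj_on_def axis_eq_axis)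

lemma vcoef_minus: "vcoef u (- k) = vcnj (vcoef u k)"
  by (simp add: vec_eq_iff vcoef_def coef_minus)

lemma has_sum_L2_norm_vcoef:
  assumes "u \<in> L2_torus"
  shows "((\<lambda>k. (norm (vcoef u k))\<^sup>2) has_sum (L2_norm u)\<^sup>2 / (2 * pi) ^ 3) UNIV"
  using has_sum_L2_norm[OF assms] unfolding sum_Basis_real_3 norm_cvec_sq by (simp add: vcoef_def)

lemma has_weak_deriv_vcoef:
  "has_weak_deriv \<alpha> u v \<longleftrightarrow> u \<in> L2_torus \<and> v \<in> L2_torus \<and> (\<forall>k. vcoef v k = deriv_symbol \<alpha> k *s vcoef u k)"
  unfolding has_weak_deriv_iff Basis_real_3 by (auto simp: vec_eq_iff vcoef_def)

lemma has_weak_deriv_scoef: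
  fixes p q :: "real^3 \<Rightarrow> real"
  shows "has_weak_deriv \<alpha> p q \<longleftrightarrow> p \<in> L2_torus \<and> q \<in> L2_torus \<and> (\<forall>k. scoef q k = deriv_symbol \<alpha> k * scoef p k)"
  unfolding has_weak_deriv_iff by (simp add: scoef_def)

lemma ex_L2_with_vcoef:
  assumes "(\<lambda>k. (norm (c k))\<^sup>2) summable_on UNIV" "\<And>k. c (- k) = vcnj (c k)"
  shows "\<exists>u\<in>L2_torus. vcoef u = c"
proof -
  \<comment> \<open>Reindexes \<open>c\<close> by the basis vectors \<open>axis i 1\<close>; at each
    of them exactly one of the conditions holds.\<close>
  define d where "d b k = (\<Sum>i\<in>UNIV. if b = axis i 1 then c k $ i else 0)" for b :: "real^3" and k
  have d: "d (axis i 1) k = c k $ i" for i k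
    unfolding d_def by (simp add: axis_eq_axis if_distrib cong: if_cong)
  have "\<exists>u\<in>L2_torus. \<forall>b\<in>Basis. coef u b = d b"
  proof (rule ex_L2_with_coef)
    fix b :: "real^3" assume "b \<in> Basis"
    then obtain i where b: "b = axis i 1" unfolding Basis_real_3 by blast
    show "(\<lambda>k. (norm (d b k))\<^sup>2) summable_on UNIV"
      unfolding b d
      by (rule summable_on_comparison_test[OF assms(1)]) (auto intro!: power_mono Finite_Cartesian_Product.norm_nth_le)
    show "d b (- k) = cnj (d b k)" for k unfolding b d assms(2) by simp
  qed
  then obtain u where u: "u \<in> L2_torus" "\<forall>b\<in>Basis. coef u b = d b" by blast
  have "coef u (axis i 1) = d (axis i 1)" for i using u(2) by (simp add: Basis_real_3)
  then show ?thesis using u(1) by (intro bexI[of _ u] ext) (simp_all add: vec_eq_iff vcoef_def d)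
qed

lemma ex_L2_with_scoef:
  assumes "(\<lambda>k. (norm (c k))\<^sup>2) summable_on UNIV" "\<And>k. c (- k) = cnj (c k)"
  shows "\<exists>p\<in>L2_torus. scoef p = c"
  using ex_L2_with_coef[of "\<lambda>b::real. c"] assms by (auto simp: scoef_def fun_eq_iff)

text \<open>The multiplier of the squared Sobolev norm; it is 1 at \<open>k = 0\<close> and
  comparable to \<open>|k|^(2 * s)\<close> elsewhere.\<close>

definition sobolev_weight :: "nat \<Rightarrow> int^3 \<Rightarrow> real" where
  "sobolev_weight s k = (\<Sum>\<alpha> | mi_order \<alpha> \<le> s. (norm (deriv_symbol \<alpha> k))\<^sup>2)"

lemma norm_deriv_symbol_le: "norm (deriv_symbol \<alpha> k) \<le> wave_norm k ^ mi_order \<alpha>"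
proof -
  have "norm (complex_of_int (k $ i)) \<le> wave_norm k" for i
    using component_le_norm_cart[of "wave_vec k" i] by simp
  then have "norm (deriv_symbol \<alpha> k) \<le> wave_norm k ^ (\<alpha> $ 1) * wave_norm k ^ (\<alpha> $ 2) * wave_norm k ^ (\<alpha> $ 3)"
    unfolding deriv_symbol_def norm_mult norm_power norm_ii mult_1_left by (intro mult_mono power_mono) auto
  then show ?thesis by (simp add: mi_order_3 power_add)
qed

lemma sobolev_weight_ge_1: "1 \<le> sobolev_weight s k"
proof -
  have "(norm (deriv_symbol 0 k))\<^sup>2 \<le> sobolev_weight s k"
    unfolding sobolev_weight_def
    by (rule member_le_sum) (simp_all add: finite_mi_order_le, simp add: mi_order_3)
  then show ?thesis by (simp add: deriv_symbol_def)
qed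

lemma sobolev_weight_le:
  assumes "k \<noteq> 0" shows "sobolev_weight s k \<le> real (card {\<alpha>. mi_order \<alpha> \<le> s}) * wave_norm k ^ (2 * s)"
proof -
  have "(norm (deriv_symbol \<alpha> k))\<^sup>2 \<le> wave_norm k ^ (2 * s)" if "mi_order \<alpha> \<le> s" for \<alpha>
  proof -
    have "(norm (deriv_symbol \<alpha> k))\<^sup>2 \<le> (wave_norm k ^ mi_order \<alpha>)\<^sup>2" by (intro power_mono norm_deriv_symbol_le) simp
    also have "\<dots> = wave_norm k ^ (2 * mi_order \<alpha>)" by (simp add: power_mult[symmetric] mult.commute)
    also have "\<dots> \<le> wave_norm k ^ (2 * s)" using that wave_norm_ge_1[OF assms] by (intro power_increasing) auto
    finally show ?thesis .
  qed
  then show ?thesis unfolding sobolev_weight_def by (intro sum_bounded_above) auto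
qed

lemma deriv_symbol_axis: "deriv_symbol (axis i n) k = (\<i> * of_int (k $ i)) ^ n"
  using exhaust_3[of i] by (auto simp: deriv_symbol_def axis_def)

lemma mi_order_axis: "mi_order (axis i n) = n"
  using exhaust_3[of i] by (auto simp: mi_order_3 axis_def)

text \<open>The component of largest modulus satisfies
  \<open>|k|^2 \<le> 3 * k\<^sub>i\<^sup>2\<close>; cubing gives the 27, and the pure third
  derivative in direction \<open>i\<close> is one summand of the weight.\<close>

lemma wave_norm_le_sobolev_weight: "wave_norm k ^ 6 \<le> 27 * sobolev_weight 3 k"
proof -
  have "Max (range (\<lambda>i. \<bar>real_of_int (k $ i)\<bar>)) \<in> range (\<lambda>i. \<bar>real_of_int (k $ i)\<bar>)" by (intro Max_in) auto
  then obtain i where Max: "Max (range (\<lambda>i. \<bar>real_of_int (k $ i)\<bar>)) = \<bar>real_of_int (k $ i)\<bar>" by blast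
  have i: "\<bar>real_of_int (k $ j)\<bar> \<le> \<bar>real_of_int (k $ i)\<bar>" for j
    unfolding Max[symmetric] by (rule Max_ge) auto
  have "(wave_norm k)\<^sup>2 \<le> (\<Sum>j\<in>(UNIV::3 set). (of_int (k $ i))\<^sup>2)"
    unfolding wave_norm_sq using i by (intro sum_mono) (simp add: abs_le_square_iff[symmetric])
  then have "(wave_norm k)\<^sup>2 \<le> 3 * (of_int (k $ i))\<^sup>2" by simp
  then have "((wave_norm k)\<^sup>2) ^ 3 \<le> (3 * (of_int (k $ i))\<^sup>2) ^ 3" by (intro power_mono) auto
  then have "wave_norm k ^ 6 \<le> 27 * (norm (deriv_symbol (axis i 3) k))\<^sup>2"
    by (simp add: deriv_symbol_axis norm_mult norm_power power_mult_distrib power_mult[symmetric] power_even_abs)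
  also have "(norm (deriv_symbol (axis i 3) k))\<^sup>2 \<le> sobolev_weight 3 k"
    unfolding sobolev_weight_def by (rule member_le_sum) (auto simp: mi_order_axis finite_mi_order_le)
  finally show ?thesis by simp
qed

section \<open>Sobolev spaces as weighted sequence spaces\<close>

lemma sobolev_L2: "u \<in> sobolev s \<Longrightarrow> u \<in> L2_torus"
  by (simp add: sobolev_def)

lemma sobolev_weak_deriv:
  "u \<in> sobolev s \<Longrightarrow> mi_order \<alpha> \<le> s \<Longrightarrow> has_weak_deriv \<alpha> u (weak_deriv \<alpha> u)"
  unfolding sobolev_def weak_deriv_def using someI_ex[of "has_weak_deriv \<alpha> u"] by blast

lemma sobolev_weak_deriv_vcoef:
  assumes "u \<in> sobolev s" "mi_order \<alpha> \<le> s"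
  shows "weak_deriv \<alpha> u \<in> L2_torus" "vcoef (weak_deriv \<alpha> u) k = deriv_symbol \<alpha> k *s vcoef u k"
  using sobolev_weak_deriv[OF assms] unfolding has_weak_deriv_vcoef by auto

lemma sobolev_weak_deriv_scoef:
  fixes p :: "real^3 \<Rightarrow> real"
  assumes "p \<in> sobolev s" "mi_order \<alpha> \<le> s"
  shows "weak_deriv \<alpha> p \<in> L2_torus" "scoef (weak_deriv \<alpha> p) k = deriv_symbol \<alpha> k * scoef p k"
  using sobolev_weak_deriv[OF assms] unfolding has_weak_deriv_scoef by auto

lemma has_sum_sobolev_norm:
  assumes u: "u \<in> sobolev s"
  shows "((\<lambda>k. sobolev_weight s k * (norm (vcoef u k))\<^sup>2) has_sum (sobolev_norm s u)\<^sup>2 / (2 * pi) ^ 3) UNIV"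
proof -
  have "((\<lambda>k. \<Sum>\<alpha> | mi_order \<alpha> \<le> s. (norm (vcoef (weak_deriv \<alpha> u) k))\<^sup>2) has_sum
     (\<Sum>\<alpha> | mi_order \<alpha> \<le> s. (L2_norm (weak_deriv \<alpha> u))\<^sup>2 / (2 * pi) ^ 3)) UNIV"
    by (rule has_sum_finite_sum[OF finite_mi_order_le])
      (intro has_sum_L2_norm_vcoef sobolev_weak_deriv_vcoef[OF u], simp)
  moreover have "(\<Sum>\<alpha> | mi_order \<alpha> \<le> s. (norm (vcoef (weak_deriv \<alpha> u) k))\<^sup>2) = sobolev_weight s k * (norm (vcoef u k))\<^sup>2" for k
    unfolding sobolev_weight_def sum_distrib_right
    by (intro sum.cong refl) (simp add: sobolev_weak_deriv_vcoef[OF u] norm_vector_scalar_mult power_mult_distrib)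
  moreover have "(\<Sum>\<alpha> | mi_order \<alpha> \<le> s. (L2_norm (weak_deriv \<alpha> u))\<^sup>2 / (2 * pi) ^ 3) = (sobolev_norm s u)\<^sup>2 / (2 * pi) ^ 3"
    unfolding sobolev_norm_def by (simp add: sum_nonneg sum_divide_distrib)
  ultimately show ?thesis by simp
qed

lemma sobolev_norm_nonneg [simp]: "0 \<le> sobolev_norm s u"
  unfolding sobolev_norm_def by (simp add: sum_nonneg)

lemma weak_deriv_exists_vcoef:
  assumes u: "u \<in> L2_torus" and s: "(\<lambda>k. (norm (deriv_symbol \<alpha> k *s vcoef u k))\<^sup>2) summable_on UNIV"
  shows "\<exists>g. has_weak_deriv \<alpha> u g"
proof -
  have "\<exists>g\<in>L2_torus. vcoef g = (\<lambda>k. deriv_symbol \<alpha> k *s vcoef u k)"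
    by (rule ex_L2_with_vcoef[OF s]) (simp add: vcoef_minus vcnj_simps deriv_symbol_cnj)
  then show ?thesis unfolding has_weak_deriv_vcoef using u by (metis (no_types))
qed

lemma sobolev_if_summable:
  assumes u: "u \<in> L2_torus" and s: "(\<lambda>k. sobolev_weight s k * (norm (vcoef u k))\<^sup>2) summable_on UNIV"
  shows "u \<in> sobolev s"
  unfolding sobolev_def
proof (intro CollectI conjI u allI impI weak_deriv_exists_vcoef)
  fix \<alpha> assume "mi_order \<alpha> \<le> s"
  then have "(norm (deriv_symbol \<alpha> k))\<^sup>2 \<le> sobolev_weight s k" for k
    unfolding sobolev_weight_def by (intro member_le_sum) (auto simp: finite_mi_order_le)
  then show "(\<lambda>k. (norm (deriv_symbol \<alpha> k *s vcoef u k))\<^sup>2) summable_on UNIV"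
    by (intro summable_on_comparison_test[OF s]) (auto simp: norm_vector_scalar_mult power_mult_distrib mult_right_mono)
qed

lemma ex_sobolev_with_vcoef:
  assumes s: "(\<lambda>k. sobolev_weight s k * (norm (c k))\<^sup>2) summable_on UNIV" and c: "\<And>k. c (- k) = vcnj (c k)"
  shows "\<exists>u\<in>sobolev s. vcoef u = c"
proof -
  have "(norm (c k))\<^sup>2 \<le> sobolev_weight s k * (norm (c k))\<^sup>2" for k
    using mult_right_mono[OF sobolev_weight_ge_1[of s k], of "(norm (c k))\<^sup>2"] by simp
  then have "(\<lambda>k. (norm (c k))\<^sup>2) summable_on UNIV" by (intro summable_on_comparison_test[OF s]) auto
  then obtain u where u: "u \<in> L2_torus" "vcoef u = c" using ex_L2_with_vcoef[of c] c by blast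
  then have "u \<in> sobolev s" using s by (intro sobolev_if_summable) auto
  then show ?thesis using u by blast
qed

lemma scalar_sobolev_if_summable:
  fixes p :: "real^3 \<Rightarrow> real"
  assumes p: "p \<in> L2_torus" and s: "(\<lambda>k. sobolev_weight s k * (norm (scoef p k))\<^sup>2) summable_on UNIV"
  shows "p \<in> sobolev s"
  unfolding sobolev_def
proof (intro CollectI conjI p allI impI)
  fix \<alpha> assume "mi_order \<alpha> \<le> s"
  then have "(norm (deriv_symbol \<alpha> k))\<^sup>2 \<le> sobolev_weight s k" for k
    unfolding sobolev_weight_def by (intro member_le_sum) (auto simp: finite_mi_order_le)
  then have "(\<lambda>k. (norm (deriv_symbol \<alpha> k * scoef p k))\<^sup>2) summable_on UNIV"
    by (intro summable_on_comparison_test[OF s]) (auto simp: norm_mult power_mult_distrib mult_right_mono)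
  then have "\<exists>g\<in>L2_torus. scoef g = (\<lambda>k. deriv_symbol \<alpha> k * scoef p k)"
    by (rule ex_L2_with_scoef) (simp add: scoef_def coef_minus deriv_symbol_cnj)
  then show "\<exists>g. has_weak_deriv \<alpha> p g" unfolding has_weak_deriv_scoef using p by (metis (no_types))
qed

lemma norm_vcoef_le_L2_norm:
  assumes "u \<in> L2_torus" shows "norm (vcoef u k) \<le> L2_norm u"
proof -
  have "(norm (vcoef u k))\<^sup>2 \<le> (L2_norm u)\<^sup>2 / (2 * pi) ^ 3"
    using finite_sum_le_has_sum[OF has_sum_L2_norm_vcoef[OF assms], of "{k}"] by simp
  also have "\<dots> \<le> (L2_norm u)\<^sup>2"
  proof -
    have "1 \<le> (2 * pi) ^ 3" using pi_gt3 by (intro one_le_power) linarith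
    then show ?thesis by (simp add: divide_le_eq mult_le_cancel_left1)
  qed
  finally show ?thesis by (rule power2_le_imp_le) simp
qed


section \<open>Differential operators on the Fourier side\<close>

text \<open>A class that contains L^2 fields and convective terms alike and in which the
  coefficients still determine the field. Periodicity is included so that equality on a cell extends
  to all of space.\<close>

definition L1_field :: "(real^3 \<Rightarrow> real^3) \<Rightarrow> bool" where
  "L1_field u \<longleftrightarrow> periodic u \<and> integrable torus u"

lemma L1_field_L2: "u \<in> L2_torus \<Longrightarrow> L1_field u"
  by (simp add: L1_field_def L2_torus_periodic L2_torus_integrable)

lemma L1_field_integrable_nth: "L1_field u \<Longrightarrow> integrable torus (\<lambda>x. complex_of_real (u x $ i))"
  unfolding L1_field_def using integrable_bounded_linear[OF bounded_linear_compose[OF bounded_linear_of_real bounded_linear_vec_nth]]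
  by blast

lemma L1_field_ops:
  assumes "L1_field u" "L1_field v"
  shows "L1_field (\<lambda>x. u x + v x)" "L1_field (\<lambda>x. u x - v x)" "L1_field (\<lambda>x. r *\<^sub>R u x)" "L1_field (\<lambda>x. - u x)"
  using assms by (auto simp: L1_field_def periodic_def)

lemma vcoef_ops:
  assumes "L1_field u" "L1_field v"
  shows "vcoef (\<lambda>x. u x + v x) k = vcoef u k + vcoef v k" "vcoef (\<lambda>x. u x - v x) k = vcoef u k - vcoef v k"
  using L1_field_integrable_nth[OF assms(1)] L1_field_integrable_nth[OF assms(2)]
  by (simp_all add: vec_eq_iff vcoef_nth fcoef_add fcoef_diff)

lemma vcoef_scaleR: "vcoef (\<lambda>x. r *\<^sub>R u x) k = r *\<^sub>R vcoef u k"
  by (simp add: vec_eq_iff vcoef_nth fcoef_cmult scaleR_conv_of_real[where 'a = complex])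

text \<open>Completeness in each component, with lattice invariance to pass from the cell to the
  space. One direction reads modes off a strong solution, the other reassembles modes into
  one.\<close>

lemma AE_eq_iff_vcoef:
  assumes "L1_field u" "L1_field v"
  shows "(AE x in lborel. u x = v x) \<longleftrightarrow> (\<forall>k. vcoef u k = vcoef v k)"
proof
  assume "AE x in lborel. u x = v x"
  then have ae: "AE x in torus. u x = v x" by (rule AE_torus_of_lborel)
  have "fcoef (\<lambda>x. complex_of_real (u x $ i)) k = fcoef (\<lambda>x. complex_of_real (v x $ i)) k" for i k
  proof (rule fcoef_cong_AE)
    show "AE x in torus. complex_of_real (u x $ i) = complex_of_real (v x $ i)" using ae by eventually_elim simp
  qed (use L1_field_integrable_nth[OF assms(1), THEN borel_measurable_integrable] L1_field_integrable_nth[OF assms(2), THEN borel_measurable_integrable] in auto)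
  then show "\<forall>k. vcoef u k = vcoef v k" by (simp add: vec_eq_iff vcoef_nth)
next
  assume eq: "\<forall>k. vcoef u k = vcoef v k"
  have "AE x in torus. complex_of_real (u x $ i) = complex_of_real (v x $ i)" for i
    using eq by (intro AE_eq_if_fcoef_eq L1_field_integrable_nth assms) (simp add: vec_eq_iff vcoef_nth)
  then have "AE x in torus. \<forall>i\<in>UNIV. complex_of_real (u x $ i) = complex_of_real (v x $ i)"
    by (intro AE_finite_allI) auto
  then have "AE x in torus. u x = v x" by eventually_elim (simp add: vec_eq_iff)
  moreover have "(u (x + (2 * pi) *\<^sub>R wave_vec k) = v (x + (2 * pi) *\<^sub>R wave_vec k)) = (u x = v x)" for x k
    using assms by (simp add: L1_field_def periodic_add_lattice)
  ultimately show "AE x in lborel. u x = v x" by (rule AE_lborel_of_torus)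
qed

lemma AE_zero_iff_scoef:
  fixes p :: "real^3 \<Rightarrow> real"
  assumes p: "p \<in> L2_torus"
  shows "(AE x in lborel. p x = 0) \<longleftrightarrow> (\<forall>k. scoef p k = 0)"
proof
  have b: "p \<in> borel_measurable borel" by (rule L2_torus_borel[OF p])
  assume "AE x in lborel. p x = 0"
  then have "AE x in torus. complex_of_real (p x) = 0" by (auto dest: AE_torus_of_lborel)
  then have "scoef p k = fcoef (\<lambda>x. 0) k" for k
    unfolding scoef_eq by (intro fcoef_cong_AE) (use b in auto)
  then show "\<forall>k. scoef p k = 0" by (simp add: fcoef_def)
next
  assume "\<forall>k. scoef p k = 0"
  then have "AE x in torus. complex_of_real (p x) = 0"
    by (intro fcoef_zero_imp_AE_zero L2_torus_integrable L2_torus_of_real p) (simp add: scoef_eq)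
  then have "AE x in torus. p x = 0" by simp
  then show "AE x in lborel. p x = 0"
    by (rule AE_lborel_of_torus) (simp add: periodic_add_lattice[OF L2_torus_periodic[OF p]])
qed

lemma wpartial_vcoef:
  assumes "u \<in> sobolev s" "1 \<le> s"
  shows "wpartial i u \<in> L2_torus" "vcoef (wpartial i u) k = (\<i> * of_int (k $ i)) *s vcoef u k"
  using sobolev_weak_deriv_vcoef[OF assms(1), of "axis i 1"] assms(2) by (auto simp: mi_order_axis deriv_symbol_axis)

lemma L2_torus_nth: "u \<in> L2_torus \<Longrightarrow> (\<lambda>x. (u x :: real^3) $ i) \<in> L2_torus"
  using L2_torus_linear_image[OF _ bounded_linear_vec_nth] by blast

lemma L2_torus_vec:
  assumes "\<And>i. (\<lambda>x. f x $ i) \<in> L2_torus" shows "(f :: real^3 \<Rightarrow> real^3) \<in> L2_torus"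
proof -
  have "(\<lambda>x. \<Sum>i\<in>UNIV. axis i (f x $ i)) \<in> L2_torus"
  proof (rule L2_torus_sum)
    fix i :: 3
    have "bounded_linear (\<lambda>r::real. axis i r :: real^3)"
      unfolding linear_conv_bounded_linear[symmetric] by (rule linearI) (simp_all add: vec_eq_iff axis_def)
    then show "(\<lambda>x. axis i (f x $ i)) \<in> L2_torus" by (rule L2_torus_linear_image[OF assms])
  qed
  moreover have "(\<lambda>x. \<Sum>i\<in>UNIV. axis i (f x $ i)) = f"
    by (auto simp: fun_eq_iff vec_eq_iff axis_def)
  ultimately show ?thesis by simp
qed

lemma laplacian_vcoef:
  assumes "u \<in> sobolev 3"
  shows "laplacian u \<in> L2_torus" "vcoef (laplacian u) k = - ((wave_norm k)\<^sup>2 *\<^sub>R vcoef u k)"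
proof -
  have d: "weak_deriv (axis i 2) u \<in> L2_torus" "vcoef (weak_deriv (axis i 2) u) k = - ((of_int (k $ i))\<^sup>2 *\<^sub>R vcoef u k)" for i k
    using sobolev_weak_deriv_vcoef[OF assms, of "axis i 2"]
    by (auto simp: mi_order_axis deriv_symbol_axis vec_eq_iff power_mult_distrib scaleR_conv_of_real[where 'a = complex])
  show L: "laplacian u \<in> L2_torus" unfolding laplacian_def[abs_def] by (intro L2_torus_sum d)
  have "laplacian u = (\<lambda>x. weak_deriv (axis 1 2) u x + weak_deriv (axis 2 2) u x + weak_deriv (axis 3 2) u x)"
    by (simp add: laplacian_def[abs_def] sum_3)
  then show "vcoef (laplacian u) k = - ((wave_norm k)\<^sup>2 *\<^sub>R vcoef u k)"
    by (simp add: vcoef_ops L1_field_ops L1_field_L2 d wave_norm_sq sum_3 scaleR_add_left)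
qed

lemma curl_vcoef:
  assumes "u \<in> sobolev 3"
  shows "curl u \<in> L2_torus" "vcoef (curl u) k = kcurl k (vcoef u k)"
proof -
  note w = wpartial_vcoef[OF assms]
  have n: "(\<lambda>x. wpartial i u x $ j - wpartial i' u x $ j') \<in> L2_torus" for i j i' j'
    by (intro L2_torus_diff L2_torus_nth w) auto
  show "curl u \<in> L2_torus"
  proof (rule L2_torus_vec)
    fix i :: 3
    show "(\<lambda>x. curl u x $ i) \<in> L2_torus" using exhaust_3[of i] n by (auto simp: curl_def)
  qed
  have "fcoef (\<lambda>x. complex_of_real (wpartial i u x $ j - wpartial i' u x $ j')) k
     = \<i> * (of_int (k $ i) * vcoef u k $ j - of_int (k $ i') * vcoef u k $ j')" for i j i' j'
  proof -
    have "fcoef (\<lambda>x. complex_of_real (wpartial i u x $ j - wpartial i' u x $ j')) k = vcoef (wpartial i u) k $ j - vcoef (wpartial i' u) k $ j'"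
      unfolding vcoef_nth of_real_diff
      by (intro fcoef_diff L1_field_integrable_nth L1_field_L2 w) auto
    then show ?thesis using w(2) by (simp add: algebra_simps)
  qed
  then show "vcoef (curl u) k = kcurl k (vcoef u k)"
    unfolding vec_eq_iff forall_3 kcurl_nth vcoef_nth[of "curl u"] by (simp add: curl_def)
qed

lemma divg_scoef:
  assumes "u \<in> sobolev 3"
  shows "divg u \<in> L2_torus" "scoef (divg u) k = \<i> * kdot k (vcoef u k)"
proof -
  note w = wpartial_vcoef[OF assms]
  show "divg u \<in> L2_torus" unfolding divg_def[abs_def] by (intro L2_torus_sum L2_torus_nth w) auto
  have "scoef (divg u) k = (\<Sum>i\<in>UNIV. vcoef (wpartial i u) k $ i)"
    unfolding scoef_eq divg_def of_real_sum vcoef_nth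
    by (intro fcoef_sum L1_field_integrable_nth L1_field_L2 w) auto
  then show "scoef (divg u) k = \<i> * kdot k (vcoef u k)"
    using w(2) by (simp add: kdot_def sum_distrib_left mult.assoc)
qed

lemma grad_vcoef:
  assumes "p \<in> sobolev 1"
  shows "grad p \<in> L2_torus" "vcoef (grad p) k = (\<i> * scoef p k) *s kvec k"
proof -
  have w: "wpartial i p \<in> L2_torus" "scoef (wpartial i p) k = \<i> * of_int (k $ i) * scoef p k" for i k
    using sobolev_weak_deriv_scoef[OF assms, of "axis i 1"] by (auto simp: mi_order_axis deriv_symbol_axis)
  show "grad p \<in> L2_torus" by (rule L2_torus_vec) (simp add: grad_def w del: One_nat_def)
  show "vcoef (grad p) k = (\<i> * scoef p k) *s kvec k"
    using w(2) unfolding vec_eq_iff vcoef_nth scoef_eq by (simp add: grad_def kvec_def mult_ac)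
qed

text \<open>\<open>grad (divg w)\<close> is meaningful only if the divergence has a weak gradient.
  The divergence costs one factor |k| and the H^1 weight is of order |k|^2, so four powers of |k|
  have to be dominated by the six of H^3.\<close>

lemma divg_sobolev:
  assumes u: "u \<in> sobolev 3" shows "divg u \<in> sobolev 1"
proof (rule scalar_sobolev_if_summable[OF divg_scoef(1)[OF u]])
  let ?W = "real (card {\<alpha>. mi_order \<alpha> \<le> 1})"
  have s: "(\<lambda>k. (27 * ?W) * (sobolev_weight 3 k * (norm (vcoef u k))\<^sup>2)) summable_on UNIV"
    using has_sum_sobolev_norm[OF u] by (intro summable_on_cmult_right has_sum_imp_summable)
  show "(\<lambda>k. sobolev_weight 1 k * (norm (scoef (divg u) k))\<^sup>2) summable_on UNIV"
  proof (rule summable_on_comparison_test[OF s])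
    fix k
    show "0 \<le> sobolev_weight 1 k * (norm (scoef (divg u) k))\<^sup>2"
      using sobolev_weight_ge_1[of 1 k] by simp
    show "sobolev_weight 1 k * (norm (scoef (divg u) k))\<^sup>2 \<le> (27 * ?W) * (sobolev_weight 3 k * (norm (vcoef u k))\<^sup>2)"
    proof (cases "k = 0")
      case True
      then show ?thesis using sobolev_weight_ge_1[of 3 k] by (simp add: divg_scoef[OF u] kdot_def)
    next
      case False
      have "(norm (scoef (divg u) k))\<^sup>2 \<le> (wave_norm k * norm (vcoef u k))\<^sup>2"
        unfolding divg_scoef[OF u] norm_mult by (intro power_mono) (auto intro: norm_kdot_le)
      then have "sobolev_weight 1 k * (norm (scoef (divg u) k))\<^sup>2 \<le> (?W * wave_norm k ^ (2 * 1)) * (wave_norm k * norm (vcoef u k))\<^sup>2"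
        by (intro mult_mono sobolev_weight_le[OF False]) auto
      also have "\<dots> = ?W * (wave_norm k ^ 4 * (norm (vcoef u k))\<^sup>2)"
        by (simp add: power_mult_distrib power2_eq_square power4_eq_xxxx mult_ac)
      also have "\<dots> \<le> ?W * (wave_norm k ^ 6 * (norm (vcoef u k))\<^sup>2)"
        using wave_norm_ge_1[OF False] by (intro mult_left_mono mult_right_mono power_increasing) auto
      also have "\<dots> \<le> ?W * ((27 * sobolev_weight 3 k) * (norm (vcoef u k))\<^sup>2)"
        by (intro mult_left_mono mult_right_mono wave_norm_le_sobolev_weight) auto
      finally show ?thesis by (simp add: mult_ac)
    qed
  qed
qed

lemma has_sum_vecI:
  fixes f :: "'a \<Rightarrow> complex^3"
  assumes "\<And>i. ((\<lambda>j. f j $ i) has_sum s $ i) A" shows "(f has_sum s) A"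
  using assms unfolding has_sum_def by (intro vec_tendstoI) (simp add: sum_component)

text \<open>The convolution theorem produces the factor \<open>kdot (k - j) (vcoef v j)\<close>; the
  divergence constraint on \<open>v\<close> replaces \<open>k - j\<close> by \<open>k\<close>, which
  puts the derivative in front of the product as in \<open>advect\<close>.\<close>

lemma convect_vcoef:
  assumes v: "v \<in> sobolev 3" and w: "w \<in> sobolev 3" and div: "\<And>k. kdot k (vcoef v k) = 0"
  shows "L1_field (convect v w)"
    "((\<lambda>j. \<i> *s (kdot k (vcoef v j) *s vcoef w (k - j))) has_sum vcoef (convect v w) k) UNIV"
proof -
  note wp = wpartial_vcoef[OF w]
  have vL: "(\<lambda>x. v x $ i) \<in> L2_torus" for i by (rule L2_torus_nth[OF sobolev_L2[OF v]])
  have wL: "wpartial i w \<in> L2_torus" for i by (rule wp) simp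
  have prodi: "integrable torus (\<lambda>x. complex_of_real (v x $ i) * complex_of_real (wpartial i w x $ c))" for i c
    by (intro L2_torus_mult_integrable L2_torus_of_real vL L2_torus_nth wL)
  show "L1_field (convect v w)" unfolding L1_field_def
  proof
    show "integrable torus (convect v w)" unfolding convect_def[abs_def]
      by (intro Bochner_Integration.integrable_sum L2_torus_scaleR_integrable vL wL)
    show "periodic (convect v w)" unfolding convect_def[abs_def]
      using L2_torus_periodic[OF sobolev_L2[OF v]] L2_torus_periodic[OF wL] by (simp add: periodic_def)
  qed
  show "((\<lambda>j. \<i> *s (kdot k (vcoef v j) *s vcoef w (k - j))) has_sum vcoef (convect v w) k) UNIV"
  proof (rule has_sum_vecI)
    fix c
    have "((\<lambda>j. \<Sum>i\<in>UNIV. vcoef v j $ i * vcoef (wpartial i w) (k - j) $ c) has_sum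
       (\<Sum>i\<in>UNIV. fcoef (\<lambda>x. complex_of_real (v x $ i) * complex_of_real (wpartial i w x $ c)) k)) UNIV"
      unfolding vcoef_nth
      by (intro has_sum_finite_sum fcoef_mult L2_torus_of_real vL L2_torus_nth wL) simp
    also have "(\<Sum>i\<in>UNIV. fcoef (\<lambda>x. complex_of_real (v x $ i) * complex_of_real (wpartial i w x $ c)) k) = vcoef (convect v w) k $ c"
      unfolding vcoef_nth convect_def by (subst fcoef_sum[symmetric]) (auto intro: prodi simp: sum_component simp del: One_nat_def)
    also have "(\<lambda>j. \<Sum>i\<in>UNIV. vcoef v j $ i * vcoef (wpartial i w) (k - j) $ c) = (\<lambda>j. (\<i> *s (kdot k (vcoef v j) *s vcoef w (k - j))) $ c)"
    proof
      fix j
      have "(\<Sum>i\<in>UNIV. vcoef v j $ i * vcoef (wpartial i w) (k - j) $ c) = \<i> * (kdot (k - j) (vcoef v j) * vcoef w (k - j) $ c)"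
        using wp(2) by (simp add: kdot_def sum_distrib_left sum_distrib_right mult_ac)
      also have "kdot (k - j) (vcoef v j) = kdot k (vcoef v j)"
      proof -
        have "kdot (k - j) (vcoef v j) = kdot k (vcoef v j) - kdot j (vcoef v j)"
          by (simp add: kdot_def left_diff_distrib sum_subtractf)
        then show ?thesis using div by simp
      qed
      finally show "(\<Sum>i\<in>UNIV. vcoef v j $ i * vcoef (wpartial i w) (k - j) $ c) = (\<i> *s (kdot k (vcoef v j) *s vcoef w (k - j))) $ c" by simp
    qed
    finally show "((\<lambda>j. (\<i> *s (kdot k (vcoef v j) *s vcoef w (k - j))) $ c) has_sum vcoef (convect v w) k $ c) UNIV" .
  qed
qed

lemma has_sum_Pair:
  assumes "(f has_sum s) A" "(g has_sum t) A" shows "((\<lambda>x. (f x, g x)) has_sum (s, t)) A"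
proof -
  have "sum (\<lambda>x. (f x, g x)) = (\<lambda>X. (sum f X, sum g X))" by (auto simp: fun_eq_iff sum_prod)
  then show ?thesis using assms unfolding has_sum_def by (simp add: tendsto_Pair)
qed

definition state_coef :: "(real^3 \<Rightarrow> real^3) \<Rightarrow> (real^3 \<Rightarrow> real^3) \<Rightarrow> (real^3 \<Rightarrow> real^3) \<Rightarrow> int^3 \<Rightarrow> state" where
  "state_coef u \<omega> b k = (vcoef u k, vcoef \<omega> k, vcoef b k)"

lemma bilin_state_coef:
  assumes u: "u \<in> sobolev 3" and w: "w \<in> sobolev 3" and b: "b \<in> sobolev 3"
    and du: "\<And>k. kdot k (vcoef u k) = 0" and db: "\<And>k. kdot k (vcoef b k) = 0"
  shows "bilin (state_coef u w b) (state_coef u w b) k =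
    (vcoef (convect b b) k - vcoef (convect u u) k, - vcoef (convect u w) k, vcoef (convect b u) k - vcoef (convect u b) k)"
proof -
  have neg: "((\<lambda>j. - f j) has_sum - s) UNIV" if "(f has_sum s) UNIV" for f :: "int^3 \<Rightarrow> cvec" and s
    by (rule has_sum_bounded_linear[OF bounded_linear_minus[OF bounded_linear_ident] that])
  have sub: "\<i> *s (x - y) = \<i> *s x + - (\<i> *s y)" for x y :: cvec by (simp add: vec_eq_iff algebra_simps)
  have "((\<lambda>j. advect k (state_coef u w b j) (state_coef u w b (k - j))) has_sum
    (vcoef (convect b b) k + - vcoef (convect u u) k, - vcoef (convect u w) k, vcoef (convect b u) k + - vcoef (convect u b) k)) UNIV"
    unfolding advect_def state_coef_def fst_conv snd_conv sub
    by (intro has_sum_Pair has_sum_add neg convect_vcoef u w b du db)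
  then show ?thesis unfolding bilin_def by (simp add: infsumI)
qed

section \<open>Time-dependent fields and their modes\<close>

lemma has_vector_derivative_iff_quotient:
  fixes f :: "real \<Rightarrow> 'a::real_normed_vector"
  shows "(f has_vector_derivative D) (at t) \<longleftrightarrow> ((\<lambda>\<tau>. (f \<tau> - f t) /\<^sub>R (\<tau> - t)) \<longlongrightarrow> D) (at t)"
proof -
  have eq: "norm ((f y - f t) - (y - t) *\<^sub>R D) / norm (y - t) = norm ((f y - f t) /\<^sub>R (y - t) - D)" if "y \<noteq> t" for y
  proof -
    have "(f y - f t) /\<^sub>R (y - t) - D = ((f y - f t) - (y - t) *\<^sub>R D) /\<^sub>R (y - t)"
      using that by (simp add: scaleR_diff_right)
    then show ?thesis by (simp add: divide_inverse_commute)
  qed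
  have "(f has_vector_derivative D) (at t) \<longleftrightarrow> ((\<lambda>y. norm ((f y - f t) - (y - t) *\<^sub>R D) / norm (y - t)) \<longlongrightarrow> 0) (at t)"
    unfolding has_vector_derivative_def has_derivative_iff_norm by (simp add: bounded_linear_scaleR_left)
  also have "\<dots> \<longleftrightarrow> ((\<lambda>y. norm ((f y - f t) /\<^sub>R (y - t) - D)) \<longlongrightarrow> 0) (at t)"
    by (rule filterlim_cong[OF refl refl]) (auto simp: eventually_at_filter eq[unfolded real_norm_def])
  also have "\<dots> \<longleftrightarrow> ((\<lambda>\<tau>. (f \<tau> - f t) /\<^sub>R (\<tau> - t)) \<longlongrightarrow> D) (at t)"
    by (simp add: tendsto_norm_zero_iff LIM_zero_iff)
  finally show ?thesis .
qed

lemma eventually_at_nonneg: "0 < t \<Longrightarrow> \<forall>\<^sub>F \<tau> in at (t::real). 0 \<le> \<tau>"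
proof -
  assume "0 < t"
  then have "\<forall>\<^sub>F \<tau> in nhds t. \<tau> \<in> {0<..}" by (intro eventually_nhds_in_open) auto
  then show ?thesis by (auto simp: eventually_at_filter elim: eventually_mono)
qed

lemma vcoef_quotient:
  fixes u v w :: "real^3 \<Rightarrow> real^3"
  assumes "u \<in> L2_torus" "v \<in> L2_torus" "w \<in> L2_torus"
  shows "(\<lambda>x. (u x - v x) /\<^sub>R r - w x) \<in> L2_torus"
    "vcoef (\<lambda>x. (u x - v x) /\<^sub>R r - w x) k = (vcoef u k - vcoef v k) /\<^sub>R r - vcoef w k"
proof -
  show "(\<lambda>x. (u x - v x) /\<^sub>R r - w x) \<in> L2_torus"
    by (intro L2_torus_diff L2_torus_scaleR assms)
  show "vcoef (\<lambda>x. (u x - v x) /\<^sub>R r - w x) k = (vcoef u k - vcoef v k) /\<^sub>R r - vcoef w k"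
    by (simp only: vcoef_ops vcoef_scaleR L1_field_L2 L2_torus_diff L2_torus_scaleR assms)
qed

lemma time_deriv_vcoef:
  assumes "has_time_deriv u v t" "0 < t" "\<And>\<tau>. 0 \<le> \<tau> \<Longrightarrow> u \<tau> \<in> L2_torus"
  shows "((\<lambda>\<tau>. vcoef (u \<tau>) k) has_vector_derivative vcoef v k) (at t)"
  unfolding has_vector_derivative_iff_quotient
proof (rule LIM_zero_cancel, rule Lim_null_comparison)
  have v: "v \<in> L2_torus" and L: "((\<lambda>\<tau>. L2_norm (\<lambda>x. (u \<tau> x - u t x) /\<^sub>R (\<tau> - t) - v x)) \<longlongrightarrow> 0) (at t)"
    using assms(1) by (auto simp: has_time_deriv_def)
  show "((\<lambda>\<tau>. L2_norm (\<lambda>x. (u \<tau> x - u t x) /\<^sub>R (\<tau> - t) - v x)) \<longlongrightarrow> 0) (at t)" by (rule L)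
  show "\<forall>\<^sub>F \<tau> in at t. norm ((vcoef (u \<tau>) k - vcoef (u t) k) /\<^sub>R (\<tau> - t) - vcoef v k) \<le> L2_norm (\<lambda>x. (u \<tau> x - u t x) /\<^sub>R (\<tau> - t) - v x)"
    using eventually_at_nonneg[OF assms(2)]
  proof eventually_elim
    case (elim \<tau>)
    have uL: "u \<tau> \<in> L2_torus" "u t \<in> L2_torus" using assms(2,3) elim by auto
    show ?case
      using norm_vcoef_le_L2_norm[OF vcoef_quotient(1)[OF uL v, of "\<tau> - t"], of k] unfolding vcoef_quotient(2)[OF uL v] .
  qed
qed

lemma sobolev_weight_nonneg: "0 \<le> sobolev_weight s k"
  using sobolev_weight_ge_1[of s k] by linarith

lemma sobolev_diff:
  assumes u: "u \<in> sobolev s" and v: "v \<in> sobolev s"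
  shows "(\<lambda>x. u x - v x :: real^3) \<in> sobolev s" "vcoef (\<lambda>x. u x - v x) k = vcoef u k - vcoef v k"
proof -
  show c: "vcoef (\<lambda>x. u x - v x) k = vcoef u k - vcoef v k" for k
    by (intro vcoef_ops L1_field_L2 sobolev_L2[OF u] sobolev_L2[OF v])
  show "(\<lambda>x. u x - v x) \<in> sobolev s"
  proof (rule sobolev_if_summable)
    show "(\<lambda>x. u x - v x) \<in> L2_torus" by (intro L2_torus_diff sobolev_L2[OF u] sobolev_L2[OF v])
    have s: "(\<lambda>k. 2 * (sobolev_weight s k * (norm (vcoef u k))\<^sup>2) + 2 * (sobolev_weight s k * (norm (vcoef v k))\<^sup>2)) summable_on UNIV"
      using has_sum_sobolev_norm[OF u] has_sum_sobolev_norm[OF v]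
      by (intro summable_on_add summable_on_cmult_right has_sum_imp_summable)
    show "(\<lambda>k. sobolev_weight s k * (norm (vcoef (\<lambda>x. u x - v x) k))\<^sup>2) summable_on UNIV"
    proof (rule summable_on_comparison_test[OF s])
      fix k
      have "(norm (vcoef u k - vcoef v k))\<^sup>2 \<le> 2 * (norm (vcoef u k))\<^sup>2 + 2 * (norm (vcoef v k))\<^sup>2"
        using norm_add_sq_le[of "vcoef u k" "- vcoef v k"] by simp
      from mult_left_mono[OF this sobolev_weight_nonneg[of s k]]
      show "sobolev_weight s k * (norm (vcoef (\<lambda>x. u x - v x) k))\<^sup>2 \<le> 2 * (sobolev_weight s k * (norm (vcoef u k))\<^sup>2) + 2 * (sobolev_weight s k * (norm (vcoef v k))\<^sup>2)"
        unfolding c by (simp add: algebra_simps)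
      show "0 \<le> sobolev_weight s k * (norm (vcoef (\<lambda>x. u x - v x) k))\<^sup>2" by (simp add: sobolev_weight_nonneg)
    qed
  qed
qed

lemma two_pi_cube_ge_1: "1 \<le> (2 * pi) ^ 3"
  using pi_gt3 by (intro one_le_power) linarith

lemma sum_weight_le_sobolev_norm:
  assumes u: "u \<in> sobolev s" and F: "finite F"
  shows "(\<Sum>k\<in>F. sobolev_weight s k * (norm (vcoef u k))\<^sup>2) \<le> (sobolev_norm s u)\<^sup>2"
proof -
  have "(\<Sum>k\<in>F. sobolev_weight s k * (norm (vcoef u k))\<^sup>2) \<le> (sobolev_norm s u)\<^sup>2 / (2 * pi) ^ 3"
    by (rule finite_sum_le_has_sum[OF has_sum_sobolev_norm[OF u]]) (auto simp: F sobolev_weight_nonneg)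
  also have "\<dots> \<le> (sobolev_norm s u)\<^sup>2"
    using two_pi_cube_ge_1 by (simp add: divide_le_eq mult_le_cancel_left1)
  finally show ?thesis .
qed

lemma norm_vcoef_le_sobolev_norm:
  assumes u: "u \<in> sobolev s" shows "norm (vcoef u k) \<le> sobolev_norm s u"
proof -
  have "(norm (vcoef u k))\<^sup>2 \<le> sobolev_weight s k * (norm (vcoef u k))\<^sup>2"
    using mult_right_mono[OF sobolev_weight_ge_1[of s k], of "(norm (vcoef u k))\<^sup>2"] by simp
  also have "\<dots> \<le> (sobolev_norm s u)\<^sup>2" using sum_weight_le_sobolev_norm[OF u, of "{k}"] by simp
  finally show ?thesis by (rule power2_le_imp_le) simp
qed

text \<open>The comparison of weights costs 27, whose square root is rounded up to 6.\<close>

lemma L2_set_le_sobolev_norm: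
  assumes u: "u \<in> sobolev 3" and F: "finite F"
  shows "L2_set (\<lambda>k. wave_norm k ^ 3 * norm (vcoef u k)) F \<le> 6 * sobolev_norm 3 u"
proof -
  have "(\<Sum>k\<in>F. (wave_norm k ^ 3 * norm (vcoef u k))\<^sup>2) \<le> (\<Sum>k\<in>F. 27 * (sobolev_weight 3 k * (norm (vcoef u k))\<^sup>2))"
  proof (rule sum_mono)
    fix k
    show "(wave_norm k ^ 3 * norm (vcoef u k))\<^sup>2 \<le> 27 * (sobolev_weight 3 k * (norm (vcoef u k))\<^sup>2)"
      using mult_right_mono[OF wave_norm_le_sobolev_weight[of k], of "(norm (vcoef u k))\<^sup>2"]
      by (simp add: power_mult_distrib power_mult[symmetric])
  qed
  also have "\<dots> \<le> 27 * (sobolev_norm 3 u)\<^sup>2"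
    unfolding sum_distrib_left[symmetric] by (intro mult_left_mono sum_weight_le_sobolev_norm u F) simp
  also have "\<dots> \<le> (6 * sobolev_norm 3 u)\<^sup>2" by (simp add: power_mult_distrib)
  finally have "L2_set (\<lambda>k. wave_norm k ^ 3 * norm (vcoef u k)) F \<le> sqrt ((6 * sobolev_norm 3 u)\<^sup>2)"
    unfolding L2_set_def by (rule real_sqrt_le_mono)
  then show ?thesis unfolding real_sqrt_abs by (simp add: abs_of_nonneg[OF sobolev_norm_nonneg] abs_mult)
qed

text \<open>The summand 1 pays for the zero mode, since a strong solution is not by definition mean
  free at later times; the rest is the bound for the mean-free part.\<close>

definition l1_const :: real where
  "l1_const = 1 + lattice_const * 6"

lemma sum_norm_vcoef_le:
  assumes u: "u \<in> sobolev 3" and F: "finite F"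
  shows "(\<Sum>k\<in>F. norm (vcoef u k)) \<le> l1_const * sobolev_norm 3 u"
proof -
  define m where "m k = (if k = 0 then 0 else norm (vcoef u k))" for k
  have "L2_set (\<lambda>k. wave_norm k ^ 3 * m k) F' \<le> 6 * sobolev_norm 3 u" if "finite F'" for F'
  proof -
    have "L2_set (\<lambda>k. wave_norm k ^ 3 * m k) F' = L2_set (\<lambda>k. wave_norm k ^ 3 * norm (vcoef u k)) F'"
      by (intro L2_set_cong refl) (simp add: m_def)
    then show ?thesis using L2_set_le_sobolev_norm[OF u that] by simp
  qed
  then have "h3_bounded (6 * sobolev_norm 3 u) m" by (auto simp: h3_bounded_def m_def)
  then have "sum m F \<le> lattice_const * (6 * sobolev_norm 3 u)" using F by (rule h3_bounded_l1)
  moreover have "(\<Sum>k\<in>F. norm (vcoef u k)) \<le> norm (vcoef u 0) + sum m F"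
  proof -
    have "(\<Sum>k\<in>F. norm (vcoef u k)) = (\<Sum>k\<in>F. (if k = 0 then norm (vcoef u 0) else 0) + m k)"
      by (intro sum.cong) (auto simp: m_def)
    also have "\<dots> = (\<Sum>k\<in>F. if k = 0 then norm (vcoef u 0) else 0) + sum m F" by (rule sum.distrib)
    also have "(\<Sum>k\<in>F. if k = 0 then norm (vcoef u 0) else 0) \<le> norm (vcoef u 0)"
      using F by (simp add: sum.delta)
    finally show ?thesis by simp
  qed
  ultimately show ?thesis using norm_vcoef_le_sobolev_norm[OF u, of 0] by (simp add: l1_const_def algebra_simps)
qed

lemma continuous_into_sobolevD:
  assumes "continuous_into_sobolev s u" "0 \<le> t"
  shows "u t \<in> sobolev s" "((\<lambda>\<tau>. sobolev_norm s (\<lambda>x. u \<tau> x - u t x)) \<longlongrightarrow> 0) (at t within {0..})"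
  using assms unfolding continuous_into_sobolev_def by auto

lemma eventually_at_within_mem: "\<forall>\<^sub>F \<tau> in at t within S. \<tau> \<in> S"
  by (simp add: eventually_at_filter)

lemma continuous_on_vcoef:
  assumes u: "continuous_into_sobolev s u"
  shows "continuous_on {0..} (\<lambda>t. vcoef (u t) k)"
  unfolding continuous_on_def
proof
  fix t :: real assume "t \<in> {0..}"
  then have t: "0 \<le> t" by simp
  note D = continuous_into_sobolevD[OF u]
  show "((\<lambda>t. vcoef (u t) k) \<longlongrightarrow> vcoef (u t) k) (at t within {0..})"
  proof (rule LIM_zero_cancel, rule Lim_null_comparison[OF _ D(2)[OF t]])
    show "\<forall>\<^sub>F \<tau> in at t within {0..}. norm (vcoef (u \<tau>) k - vcoef (u t) k) \<le> sobolev_norm s (\<lambda>x. u \<tau> x - u t x)"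
      using eventually_at_within_mem
    proof eventually_elim
      case (elim \<tau>)
      then have m: "u \<tau> \<in> sobolev s" "u t \<in> sobolev s" using D(1) t by auto
      show ?case using norm_vcoef_le_sobolev_norm[OF sobolev_diff(1)[OF m], of k] unfolding sobolev_diff(2)[OF m] .
    qed
  qed
qed

text \<open>The l^1 norm of the coefficients is Lipschitz with respect to the H^3 norm, hence
  continuous in time and bounded on compact intervals.\<close>

lemma l1_bounded_on_Icc:
  assumes u: "continuous_into_sobolev 3 u"
  obtains M where "\<And>t F. t \<in> {0..T} \<Longrightarrow> finite F \<Longrightarrow> (\<Sum>k\<in>F. norm (vcoef (u t) k)) \<le> M"
proof -
  note D = continuous_into_sobolevD[OF u]
  define G where "G t = (\<Sum>\<^sub>\<infinity>k. norm (vcoef (u t) k))" for t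
  have sm: "(\<lambda>k. norm (vcoef v k)) summable_on UNIV" if "v \<in> sobolev 3" for v
    by (rule summable_on_if_sums_le[OF sum_norm_vcoef_le[OF that]]) auto
  have "continuous_on {0..} G" unfolding continuous_on_def
  proof
    fix t :: real assume "t \<in> {0..}"
    then have t: "0 \<le> t" by simp
    show "(G \<longlongrightarrow> G t) (at t within {0..})"
    proof (rule LIM_zero_cancel, rule Lim_null_comparison)
      show "((\<lambda>\<tau>. l1_const * sobolev_norm 3 (\<lambda>x. u \<tau> x - u t x)) \<longlongrightarrow> 0) (at t within {0..})"
        using tendsto_mult_left[OF D(2)[OF t], of l1_const] by simp
      show "\<forall>\<^sub>F \<tau> in at t within {0..}. norm (G \<tau> - G t) \<le> l1_const * sobolev_norm 3 (\<lambda>x. u \<tau> x - u t x)"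
        using eventually_at_within_mem
      proof eventually_elim
        case (elim \<tau>)
        then have m: "u \<tau> \<in> sobolev 3" "u t \<in> sobolev 3" using D(1) t by auto
        have "G \<tau> + - G t = (\<Sum>\<^sub>\<infinity>k. norm (vcoef (u \<tau>) k) + - norm (vcoef (u t) k))"
          unfolding G_def infsum_uminus[symmetric] by (rule infsum_add[symmetric, OF sm[OF m(1)] summable_on_uminus[THEN iffD2, OF sm[OF m(2)]]])
        then have "norm (G \<tau> - G t) = norm (\<Sum>\<^sub>\<infinity>k. norm (vcoef (u \<tau>) k) - norm (vcoef (u t) k))" by simp
        also have "\<dots> \<le> (\<Sum>\<^sub>\<infinity>k. norm (vcoef (\<lambda>x. u \<tau> x - u t x) k))"
        proof (rule norm_infsum_le[OF has_sum_infsum has_sum_infsum[OF sm[OF sobolev_diff(1)[OF m]]]])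
          have "(\<lambda>k. norm (vcoef (u \<tau>) k) + - norm (vcoef (u t) k)) summable_on UNIV"
            by (rule summable_on_add[OF sm[OF m(1)] summable_on_uminus[THEN iffD2, OF sm[OF m(2)]]])
          then show "(\<lambda>k. norm (vcoef (u \<tau>) k) - norm (vcoef (u t) k)) summable_on UNIV" by simp
          show "norm (norm (vcoef (u \<tau>) k) - norm (vcoef (u t) k)) \<le> norm (vcoef (\<lambda>x. u \<tau> x - u t x) k)" for k
            unfolding sobolev_diff(2)[OF m] real_norm_def by (rule norm_triangle_ineq3)
        qed
        also have "\<dots> \<le> l1_const * sobolev_norm 3 (\<lambda>x. u \<tau> x - u t x)"
          by (rule infsum_le_finite_sums[OF sm]) (auto intro: sobolev_diff(1)[OF m] sum_norm_vcoef_le)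
        finally show ?case .
      qed
    qed
  qed
  then have "continuous_on {0..T} G" by (rule continuous_on_subset) auto
  then obtain M where M: "\<And>t. t \<in> {0..T} \<Longrightarrow> norm (G t) \<le> M" using continuous_on_Icc_bounded by blast
  have "(\<Sum>k\<in>F. norm (vcoef (u t) k)) \<le> M" if "t \<in> {0..T}" "finite F" for t F
  proof -
    have "(\<Sum>k\<in>F. norm (vcoef (u t) k)) \<le> G t"
      unfolding G_def by (rule finite_sum_le_infsum) (use that D(1) sm in auto)
    then show ?thesis using M[OF that(1)] by simp
  qed
  then show ?thesis by (rule that)
qed

section \<open>From majorised modes back to fields\<close>

lemma h3_sq_summable:
  assumes m: "h3_bounded A m" and s: "s \<le> 3"
  shows "(\<lambda>k. (wave_norm k ^ s * m k)\<^sup>2) summable_on UNIV" "(\<Sum>\<^sub>\<infinity>k. (wave_norm k ^ s * m k)\<^sup>2) \<le> A\<^sup>2"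
proof -
  have le: "(\<Sum>k\<in>F. (wave_norm k ^ s * m k)\<^sup>2) \<le> A\<^sup>2" if "finite F" for F
  proof -
    have "(L2_set (\<lambda>k. wave_norm k ^ s * m k) F)\<^sup>2 \<le> A\<^sup>2"
      by (intro power_mono h3_bounded_weight[OF m s that]) simp
    then show ?thesis by (simp add: L2_set_def sum_nonneg)
  qed
  show "(\<lambda>k. (wave_norm k ^ s * m k)\<^sup>2) summable_on UNIV" by (rule summable_on_if_sums_le[OF le]) auto
  then show "(\<Sum>\<^sub>\<infinity>k. (wave_norm k ^ s * m k)\<^sup>2) \<le> A\<^sup>2" by (rule infsum_le_finite_sums) (rule le)
qed

definition weight_const :: real where
  "weight_const = real (card {\<alpha>. mi_order \<alpha> \<le> 3})"

lemma weight_const_nonneg: "0 \<le> weight_const"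
  by (simp add: weight_const_def)

lemma weighted_square_le:
  assumes m: "h3_bounded A m" and c: "norm (c :: cvec) \<le> E * m k"
  shows "sobolev_weight 3 k * (norm c)\<^sup>2 \<le> (weight_const * E\<^sup>2) * (wave_norm k ^ 3 * m k)\<^sup>2"
proof (cases "k = 0")
  case True
  then show ?thesis using c h3_boundedD(2)[OF m] by simp
next
  case False
  have "sobolev_weight 3 k * (norm c)\<^sup>2 \<le> (weight_const * wave_norm k ^ (2 * 3)) * (E * m k)\<^sup>2"
    unfolding weight_const_def using c by (intro mult_mono sobolev_weight_le[OF False] power_mono) auto
  then show ?thesis by (simp add: power_mult_distrib power_mult[symmetric] mult_ac)
qed

lemma sobolev_norm_le_modes:
  assumes u: "u \<in> sobolev 3" and m: "h3_bounded A m" and c: "\<And>k. norm (vcoef u k) \<le> E * m k" and E: "0 \<le> E"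
  shows "sobolev_norm 3 u \<le> sqrt ((2 * pi) ^ 3 * weight_const) * E * A"
proof -
  have "(sobolev_norm 3 u)\<^sup>2 / (2 * pi) ^ 3 = (\<Sum>\<^sub>\<infinity>k. sobolev_weight 3 k * (norm (vcoef u k))\<^sup>2)"
    by (rule infsumI[symmetric, OF has_sum_sobolev_norm[OF u]])
  also have "\<dots> \<le> (\<Sum>\<^sub>\<infinity>k. (weight_const * E\<^sup>2) * (wave_norm k ^ 3 * m k)\<^sup>2)"
    by (intro infsum_mono has_sum_imp_summable[OF has_sum_sobolev_norm[OF u]] summable_on_cmult_right h3_sq_summable[OF m]
        weighted_square_le[OF m c]) simp
  also have "\<dots> = (weight_const * E\<^sup>2) * (\<Sum>\<^sub>\<infinity>k. (wave_norm k ^ 3 * m k)\<^sup>2)" by (rule infsum_cmult_right')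
  also have "\<dots> \<le> (weight_const * E\<^sup>2) * A\<^sup>2"
    by (intro mult_left_mono h3_sq_summable[OF m] mult_nonneg_nonneg weight_const_nonneg) auto
  finally have "(sobolev_norm 3 u)\<^sup>2 \<le> (2 * pi) ^ 3 * weight_const * (E * A)\<^sup>2"
    by (simp add: divide_le_eq power_mult_distrib mult_ac)
  also have "\<dots> = (sqrt ((2 * pi) ^ 3 * weight_const) * (E * A))\<^sup>2"
    unfolding power_mult_distrib[of "sqrt _"] using weight_const_nonneg by simp
  finally have "sobolev_norm 3 u \<le> sqrt ((2 * pi) ^ 3 * weight_const) * (E * A)"
    by (rule power2_le_imp_le) (intro mult_nonneg_nonneg real_sqrt_ge_zero weight_const_nonneg E h3_boundedD(4)[OF m], simp)
  then show ?thesis by (simp only: mult.assoc)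
qed

lemma bounded_linear_vcnj: "bounded_linear vcnj"
  unfolding linear_conv_bounded_linear[symmetric] by (rule linearI) (simp_all add: vcnj_simps)

text \<open>The time-independent sequence \<open>m\<close> dominates everything: the modes with
  weight |k|^3, which gives continuity in H^3 by dominated convergence, and their difference
  quotients with weight |k|^2, which gives the time derivative in L^2.\<close>

lemma field_of_modes:
  fixes c d :: "real \<Rightarrow> int^3 \<Rightarrow> cvec"
  assumes m: "h3_bounded A m"
    and c: "\<And>t k. 0 \<le> t \<Longrightarrow> norm (c t k) \<le> 2 * m k"
    and sym: "\<And>t k. 0 \<le> t \<Longrightarrow> c t (- k) = vcnj (c t k)"
    and deriv: "\<And>t k. 0 \<le> t \<Longrightarrow> ((\<lambda>t. c t k) has_vector_derivative d t k) (at t within {0..})"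
    and d: "\<And>t k. 0 \<le> t \<Longrightarrow> norm (d t k) \<le> K * ((wave_norm k)\<^sup>2 * m k)" and K: "0 \<le> K"
  obtains u where "continuous_into_sobolev 3 u" "\<And>t k. 0 \<le> t \<Longrightarrow> vcoef (u t) k = c t k"
    "\<And>t. 0 < t \<Longrightarrow> \<exists>v. has_time_deriv u v t \<and> v \<in> L2_torus \<and> (\<forall>k. vcoef v k = d t k)"
proof -
  note m0 = h3_boundedD(1)[OF m]
  have "\<exists>u\<in>sobolev 3. vcoef u = c t" if t: "0 \<le> t" for t
  proof (rule ex_sobolev_with_vcoef)
    show "(\<lambda>k. sobolev_weight 3 k * (norm (c t k))\<^sup>2) summable_on UNIV"
      by (rule summable_on_comparison_test[OF summable_on_cmult_right[OF h3_sq_summable(1)[OF m, of 3], of "weight_const * 2\<^sup>2"]])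
        (use weighted_square_le[OF m c[OF t]] in \<open>auto simp: sobolev_weight_nonneg\<close>)
  qed (rule sym[OF t])
  then obtain u where u: "\<And>t. 0 \<le> t \<Longrightarrow> u t \<in> sobolev 3" "\<And>t. 0 \<le> t \<Longrightarrow> vcoef (u t) = c t" by metis
  have cont: "continuous_on {0..} (\<lambda>t. c t k)" for k
    by (rule has_vector_derivative_imp_continuous_on) (use deriv in auto)
  have "continuous_into_sobolev 3 u" unfolding continuous_into_sobolev_def
  proof (intro allI impI conjI u)
    fix t :: real assume t: "0 \<le> t"
    have "((\<lambda>\<tau>. (\<Sum>\<^sub>\<infinity>k. sobolev_weight 3 k * (norm (c \<tau> k - c t k))\<^sup>2)) \<longlongrightarrow> (\<Sum>\<^sub>\<infinity>k::int^3. 0)) (at t within {0..})"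
    proof (rule infsum_tendsto_dominated)
      fix k
      have "((\<lambda>\<tau>. c \<tau> k) \<longlongrightarrow> c t k) (at t within {0..})" using cont[of k] t by (auto simp: continuous_on_def)
      then have "((\<lambda>\<tau>. sobolev_weight 3 k * (norm (c \<tau> k - c t k))\<^sup>2) \<longlongrightarrow> sobolev_weight 3 k * (norm (c t k - c t k))\<^sup>2) (at t within {0..})"
        by (intro tendsto_intros)
      then show "((\<lambda>\<tau>. sobolev_weight 3 k * (norm (c \<tau> k - c t k))\<^sup>2) \<longlongrightarrow> 0) (at t within {0..})" by simp
    next
      show "(\<lambda>k. (weight_const * 4\<^sup>2) * (wave_norm k ^ 3 * m k)\<^sup>2) summable_on UNIV"
        by (intro summable_on_cmult_right h3_sq_summable(1)[OF m]) simp
      show "\<forall>\<^sub>F \<tau> in at t within {0..}. \<forall>k. norm (sobolev_weight 3 k * (norm (c \<tau> k - c t k))\<^sup>2) \<le> (weight_const * 4\<^sup>2) * (wave_norm k ^ 3 * m k)\<^sup>2"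
        using eventually_at_within_mem
      proof eventually_elim
        case (elim \<tau>)
        show ?case
        proof
          fix k
          have "norm (c \<tau> k - c t k) \<le> norm (c \<tau> k) + norm (c t k)" by (rule norm_triangle_ineq4)
          also have "\<dots> \<le> 4 * m k" using c[of \<tau> k] c[OF t, of k] elim by simp
          finally show "norm (sobolev_weight 3 k * (norm (c \<tau> k - c t k))\<^sup>2) \<le> (weight_const * 4\<^sup>2) * (wave_norm k ^ 3 * m k)\<^sup>2"
            using weighted_square_le[OF m, of "c \<tau> k - c t k" 4 k] by (simp add: sobolev_weight_nonneg)
        qed
      qed
    qed
    then have "((\<lambda>\<tau>. sqrt ((2 * pi) ^ 3 * (\<Sum>\<^sub>\<infinity>k. sobolev_weight 3 k * (norm (c \<tau> k - c t k))\<^sup>2))) \<longlongrightarrow> sqrt ((2 * pi) ^ 3 * 0)) (at t within {0..})"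
      by (intro tendsto_intros) simp
    then have lim: "((\<lambda>\<tau>. sqrt ((2 * pi) ^ 3 * (\<Sum>\<^sub>\<infinity>k. sobolev_weight 3 k * (norm (c \<tau> k - c t k))\<^sup>2))) \<longlongrightarrow> 0) (at t within {0..})"
      by simp
    show "((\<lambda>\<tau>. sobolev_norm 3 (\<lambda>x. u \<tau> x - u t x)) \<longlongrightarrow> 0) (at t within {0..})"
    proof (rule Lim_transform_eventually[OF lim])
      show "\<forall>\<^sub>F \<tau> in at t within {0..}. sqrt ((2 * pi) ^ 3 * (\<Sum>\<^sub>\<infinity>k. sobolev_weight 3 k * (norm (c \<tau> k - c t k))\<^sup>2)) = sobolev_norm 3 (\<lambda>x. u \<tau> x - u t x)"
        using eventually_at_within_mem
      proof eventually_elim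
        case (elim \<tau>)
        then have \<tau>: "0 \<le> \<tau>" by simp
        note dd = sobolev_diff[OF u(1)[OF \<tau>] u(1)[OF t]]
        have "(\<Sum>\<^sub>\<infinity>k. sobolev_weight 3 k * (norm (c \<tau> k - c t k))\<^sup>2) = (sobolev_norm 3 (\<lambda>x. u \<tau> x - u t x))\<^sup>2 / (2 * pi) ^ 3"
          using infsumI[OF has_sum_sobolev_norm[OF dd(1)]] unfolding dd(2) u(2)[OF \<tau>] u(2)[OF t] .
        then show ?case by simp
      qed
    qed
  qed
  moreover have "\<exists>v. has_time_deriv u v t \<and> v \<in> L2_torus \<and> (\<forall>k. vcoef v k = d t k)" if t: "0 < t" for t
  proof -
    have t0: "0 \<le> t" using t by simp
    have deriv_at: "((\<lambda>t. c t k) has_vector_derivative d t k) (at t)" for k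
      using deriv[OF t0, of k] t at_within_interior[of t "{0..}"] by simp
    \<comment> \<open>The derivative inherits the Hermitian symmetry, so that a real field can
      realise it.\<close>
    have dsym: "d t (- k) = vcnj (d t k)" for k
    proof -
      have "((\<lambda>t. vcnj (c t k)) has_vector_derivative vcnj (d t k)) (at t)"
        by (rule bounded_linear.has_vector_derivative[OF bounded_linear_vcnj deriv_at])
      moreover have "((\<lambda>t. vcnj (c t k)) has_vector_derivative d t (- k)) (at t)"
        by (rule has_vector_derivative_transform_within_open[OF deriv_at[of "- k"], of "{0<..}"]) (use t sym in auto)
      ultimately show ?thesis using vector_derivative_unique_at by blast
    qed
    have sq: "(norm (d t k))\<^sup>2 \<le> K\<^sup>2 * (wave_norm k ^ 2 * m k)\<^sup>2" for k
      using power_mono[OF d[OF t0, of k] norm_ge_zero, of 2] by (simp add: power_mult_distrib)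
    have "(\<lambda>k. (norm (d t k))\<^sup>2) summable_on UNIV"
      by (rule summable_on_comparison_test[OF summable_on_cmult_right[OF h3_sq_summable(1)[OF m, of 2], of "K\<^sup>2"]])
        (use sq in auto)
    then obtain v where v: "v \<in> L2_torus" "vcoef v = d t" using ex_L2_with_vcoef[of "d t"] dsym by blast
    \<comment> \<open>The mean value inequality bounds the difference quotients by the bound on
      \<open>d\<close>, uniformly in \<open>\<tau>\<close>; with the subtracted \<open>d t k\<close>
      this makes the \<open>2 * K\<close> of the summable majorant.\<close>
    have lip: "norm (c \<tau> k - c t k) \<le> (K * ((wave_norm k)\<^sup>2 * m k)) * norm (\<tau> - t)" if \<tau>: "0 \<le> \<tau>" for \<tau> k
    proof (rule differentiable_bound[where S = "{0..}" and f' = "\<lambda>t h. h *\<^sub>R d t k"])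
      show "convex {0::real..}" by (rule convex_real_interval)
      show "((\<lambda>t. c t k) has_derivative (\<lambda>h. h *\<^sub>R d s k)) (at s within {0..})" if "s \<in> {0..}" for s
        using deriv[of s k] that by (simp add: has_vector_derivative_def)
      show "onorm (\<lambda>h. h *\<^sub>R d s k) \<le> K * ((wave_norm k)\<^sup>2 * m k)" if "s \<in> {0..}" for s
      proof (rule onorm_bound)
        show "0 \<le> K * ((wave_norm k)\<^sup>2 * m k)" using K m0 by simp
        show "norm (h *\<^sub>R d s k) \<le> K * ((wave_norm k)\<^sup>2 * m k) * norm h" for h
          using mult_left_mono[OF d[of s k], of "\<bar>h\<bar>"] that by (simp add: mult_ac)
      qed
    qed (use \<tau> t0 in auto)
    let ?q = "\<lambda>\<tau> k. (c \<tau> k - c t k) /\<^sub>R (\<tau> - t) - d t k"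
    have "((\<lambda>\<tau>. (\<Sum>\<^sub>\<infinity>k. (norm (?q \<tau> k))\<^sup>2)) \<longlongrightarrow> (\<Sum>\<^sub>\<infinity>k::int^3. 0)) (at t)"
    proof (rule infsum_tendsto_dominated)
      fix k
      have "((\<lambda>\<tau>. (c \<tau> k - c t k) /\<^sub>R (\<tau> - t)) \<longlongrightarrow> d t k) (at t)"
        using deriv_at[of k] unfolding has_vector_derivative_iff_quotient .
      then have "((\<lambda>\<tau>. (norm (?q \<tau> k))\<^sup>2) \<longlongrightarrow> (norm (d t k - d t k))\<^sup>2) (at t)" by (intro tendsto_intros)
      then show "((\<lambda>\<tau>. (norm (?q \<tau> k))\<^sup>2) \<longlongrightarrow> 0) (at t)" by simp
    next
      show "(\<lambda>k. (2 * K)\<^sup>2 * (wave_norm k ^ 2 * m k)\<^sup>2) summable_on UNIV"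
        by (intro summable_on_cmult_right h3_sq_summable(1)[OF m]) simp
      have "\<forall>\<^sub>F \<tau> in at t. \<tau> \<noteq> t" by (simp add: eventually_at_filter)
      then show "\<forall>\<^sub>F \<tau> in at t. \<forall>k. norm ((norm (?q \<tau> k))\<^sup>2) \<le> (2 * K)\<^sup>2 * (wave_norm k ^ 2 * m k)\<^sup>2"
        using eventually_at_nonneg[OF t]
      proof eventually_elim
        case (elim \<tau>)
        show ?case
        proof
          fix k
          have "norm ((c \<tau> k - c t k) /\<^sub>R (\<tau> - t)) = norm (c \<tau> k - c t k) / norm (\<tau> - t)"
            by (simp add: divide_inverse_commute)
          also have "\<dots> \<le> K * ((wave_norm k)\<^sup>2 * m k)" using lip[of \<tau> k] elim by (simp add: pos_divide_le_eq)
          finally have "norm (?q \<tau> k) \<le> K * ((wave_norm k)\<^sup>2 * m k) + K * ((wave_norm k)\<^sup>2 * m k)"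
            using norm_triangle_ineq4[of "(c \<tau> k - c t k) /\<^sub>R (\<tau> - t)" "d t k"] d[OF t0, of k] by linarith
          then have "norm (?q \<tau> k) \<le> (2 * K) * (wave_norm k ^ 2 * m k)" by (simp add: ac_simps)
          from power_mono[OF this norm_ge_zero, of 2]
          show "norm ((norm (?q \<tau> k))\<^sup>2) \<le> (2 * K)\<^sup>2 * (wave_norm k ^ 2 * m k)\<^sup>2" by (simp add: power_mult_distrib)
        qed
      qed
    qed
    then have "((\<lambda>\<tau>. sqrt ((2 * pi) ^ 3 * (\<Sum>\<^sub>\<infinity>k. (norm (?q \<tau> k))\<^sup>2))) \<longlongrightarrow> sqrt ((2 * pi) ^ 3 * 0)) (at t)"
      by (intro tendsto_intros) simp
    then have lim: "((\<lambda>\<tau>. sqrt ((2 * pi) ^ 3 * (\<Sum>\<^sub>\<infinity>k. (norm (?q \<tau> k))\<^sup>2))) \<longlongrightarrow> 0) (at t)" by simp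
    have "((\<lambda>\<tau>. L2_norm (\<lambda>x. (u \<tau> x - u t x) /\<^sub>R (\<tau> - t) - v x)) \<longlongrightarrow> 0) (at t)"
    proof (rule Lim_transform_eventually[OF lim])
      show "\<forall>\<^sub>F \<tau> in at t. sqrt ((2 * pi) ^ 3 * (\<Sum>\<^sub>\<infinity>k. (norm (?q \<tau> k))\<^sup>2)) = L2_norm (\<lambda>x. (u \<tau> x - u t x) /\<^sub>R (\<tau> - t) - v x)"
        using eventually_at_nonneg[OF t]
      proof eventually_elim
        case (elim \<tau>)
        note q = vcoef_quotient[OF sobolev_L2[OF u(1)[OF elim]] sobolev_L2[OF u(1)[OF t0]] v(1)]
        have "(\<Sum>\<^sub>\<infinity>k. (norm (?q \<tau> k))\<^sup>2) = (L2_norm (\<lambda>x. (u \<tau> x - u t x) /\<^sub>R (\<tau> - t) - v x))\<^sup>2 / (2 * pi) ^ 3"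
          using infsumI[OF has_sum_L2_norm_vcoef[OF q(1)[of "\<tau> - t"]]] unfolding q(2) u(2)[OF elim] u(2)[OF t0] v(2) .
        then show ?case by simp
      qed
    qed
    then have "has_time_deriv u v t" using v(1) by (simp add: has_time_deriv_def)
    then show ?thesis using v by auto
  qed
  ultimately show ?thesis using u(2) by (intro that[of u]) auto
qed

section \<open>Strong solutions\<close>

lemma L1_field_unary: "L1_field u \<Longrightarrow> L1_field (\<lambda>x. r *\<^sub>R u x)" "L1_field u \<Longrightarrow> L1_field (\<lambda>x. - u x)"
  using L1_field_ops[of u u] by auto

lemma AE_divg_eq_0_iff:
  assumes "u \<in> sobolev 3" shows "(AE x in lborel. divg u x = 0) \<longleftrightarrow> (\<forall>k. kdot k (vcoef u k) = 0)"
  using AE_zero_iff_scoef[OF divg_scoef(1)[OF assms]] divg_scoef(2)[OF assms] by simp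

lemma vcoef_0_if_mean_zero:
  assumes u: "u \<in> L2_torus" and mean: "(LINT x:torus_cell|lborel. u x) = 0"
  shows "vcoef u 0 = 0"
proof -
  have "integral\<^sup>L torus u = 0" using mean set_integral_torus[OF L2_torus_borel[OF u]] by simp
  then have "(\<integral>x. u x $ i \<partial>torus) = 0" for i
    using integral_bounded_linear[OF bounded_linear_vec_nth L2_torus_integrable[OF u], of i] by simp
  then show ?thesis by (simp add: vec_eq_iff vcoef_nth fcoef_def echar_def)
qed

lemma norm_components_le:
  "norm (fst z) \<le> norm z" "norm (fst (snd z)) \<le> norm z" "norm (snd (snd z)) \<le> norm (z :: state)"
  by (simp_all add: norm_prod_def real_le_rsqrt)

lemma norm_state_le: "norm ((u, w, b) :: state) \<le> norm u + norm w + norm b"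
  using norm_Pair_le[of u "(w, b)"] norm_Pair_le[of w b] by linarith

lemma has_vector_derivative_state_coef:
  assumes "((\<lambda>\<tau>. vcoef (u \<tau>) k) has_vector_derivative vcoef u' k) (at t)"
    "((\<lambda>\<tau>. vcoef (w \<tau>) k) has_vector_derivative vcoef w' k) (at t)"
    "((\<lambda>\<tau>. vcoef (b \<tau>) k) has_vector_derivative vcoef b' k) (at t)"
  shows "((\<lambda>\<tau>. state_coef (u \<tau>) (w \<tau>) (b \<tau>) k) has_vector_derivative state_coef u' w' b' k) (at t)"
  using has_derivative_Pair[OF assms(1)[unfolded has_vector_derivative_def]
      has_derivative_Pair[OF assms(2)[unfolded has_vector_derivative_def] assms(3)[unfolded has_vector_derivative_def]]]
  by (simp add: has_vector_derivative_def state_coef_def)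

context mhd
begin

text \<open>Both sides of each equation satisfy \<open>L1_field\<close>, so equality almost
  everywhere is equality of all modes. The gradient of \<open>p\<close> has modes parallel to
  \<open>k\<close> and becomes the explicit multiple of \<open>kvec k\<close>.\<close>

lemma equations_iff:
  assumes u: "u \<in> sobolev 3" and w: "w \<in> sobolev 3" and b: "b \<in> sobolev 3"
    and du: "\<And>k. kdot k (vcoef u k) = 0" and db: "\<And>k. kdot k (vcoef b k) = 0"
    and u': "u' \<in> L2_torus" and w': "w' \<in> L2_torus" and b': "b' \<in> L2_torus" and p: "p \<in> sobolev 1"
  shows "(AE x in lborel.
      u' x + convect u u x - chi *\<^sub>R laplacian u x = - grad p x + (2 * chi) *\<^sub>R curl w x + convect b b x \<and>
      w' x + convect u w x + (4 * chi) *\<^sub>R w x - \<kappa> *\<^sub>R grad (divg w) x - \<eta> *\<^sub>R laplacian w x = (2 * chi) *\<^sub>R curl u x \<and>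
      b' x + convect u b x - \<nu> *\<^sub>R laplacian b x = convect b u x) \<longleftrightarrow>
    (\<forall>k. state_coef u' w' b' k = lin k (state_coef u w b k) + bilin (state_coef u w b) (state_coef u w b) k
        + ((- (\<i> * scoef p k)) *s kvec k, 0))"
proof -
  note c = convect_vcoef(1)[OF u u du] convect_vcoef(1)[OF u w du] convect_vcoef(1)[OF u b du]
    convect_vcoef(1)[OF b b db] convect_vcoef(1)[OF b u db]
  note L = L1_field_L2[OF u'] L1_field_L2[OF w'] L1_field_L2[OF b'] c
    L1_field_L2[OF laplacian_vcoef(1)[OF u]] L1_field_L2[OF laplacian_vcoef(1)[OF w]] L1_field_L2[OF laplacian_vcoef(1)[OF b]]
    L1_field_L2[OF curl_vcoef(1)[OF u]] L1_field_L2[OF curl_vcoef(1)[OF w]] L1_field_L2[OF grad_vcoef(1)[OF p]]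
    L1_field_L2[OF grad_vcoef(1)[OF divg_sobolev[OF w]]] L1_field_L2[OF sobolev_L2[OF w]]
  note F = L1_field_ops(1,2) L1_field_unary L
  note V = vcoef_ops vcoef_scaleR F laplacian_vcoef(2)[OF u] laplacian_vcoef(2)[OF w] laplacian_vcoef(2)[OF b]
    curl_vcoef(2)[OF u] curl_vcoef(2)[OF w] grad_vcoef(2)[OF p] grad_vcoef(2)[OF divg_sobolev[OF w]] divg_scoef(2)[OF w]
  have neg: "(- c) *s v = - (c *s v)" for c :: complex and v by (simp add: vec_eq_iff)
  have E1: "(AE x in lborel. u' x + convect u u x - chi *\<^sub>R laplacian u x = - grad p x + (2 * chi) *\<^sub>R curl w x + convect b b x) \<longleftrightarrow>
    (\<forall>k. vcoef u' k = fst (lin k (state_coef u w b k) + bilin (state_coef u w b) (state_coef u w b) k + ((- (\<i> * scoef p k)) *s kvec k, 0)))"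
  proof (subst AE_eq_iff_vcoef)
    show "(\<forall>k. vcoef (\<lambda>x. u' x + convect u u x - chi *\<^sub>R laplacian u x) k = vcoef (\<lambda>x. - grad p x + (2 * chi) *\<^sub>R curl w x + convect b b x) k) \<longleftrightarrow>
    (\<forall>k. vcoef u' k = fst (lin k (state_coef u w b k) + bilin (state_coef u w b) (state_coef u w b) k + ((- (\<i> * scoef p k)) *s kvec k, 0)))"
    \<comment> \<open>The sides of the differential equation and those of the mode equation have the
      same difference, which spares rearranging terms.\<close>
    proof (rule all_cong1, rule diff_eq_diff_eq)
      fix k
      show "vcoef (\<lambda>x. u' x + convect u u x - chi *\<^sub>R laplacian u x) k - vcoef (\<lambda>x. - grad p x + (2 * chi) *\<^sub>R curl w x + convect b b x) k =
        vcoef u' k - fst (lin k (state_coef u w b k) + bilin (state_coef u w b) (state_coef u w b) k + ((- (\<i> * scoef p k)) *s kvec k, 0))"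
        by (simp add: V bilin_state_coef[OF u w b du db] lin_def state_coef_def neg)
    qed
  qed (intro F)+
  have E2: "(AE x in lborel. w' x + convect u w x + (4 * chi) *\<^sub>R w x - \<kappa> *\<^sub>R grad (divg w) x - \<eta> *\<^sub>R laplacian w x = (2 * chi) *\<^sub>R curl u x) \<longleftrightarrow>
    (\<forall>k. vcoef w' k = fst (snd (lin k (state_coef u w b k) + bilin (state_coef u w b) (state_coef u w b) k + ((- (\<i> * scoef p k)) *s kvec k, 0))))"
  proof (subst AE_eq_iff_vcoef)
    show "(\<forall>k. vcoef (\<lambda>x. w' x + convect u w x + (4 * chi) *\<^sub>R w x - \<kappa> *\<^sub>R grad (divg w) x - \<eta> *\<^sub>R laplacian w x) k = vcoef (\<lambda>x. (2 * chi) *\<^sub>R curl u x) k) \<longleftrightarrow>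
    (\<forall>k. vcoef w' k = fst (snd (lin k (state_coef u w b k) + bilin (state_coef u w b) (state_coef u w b) k + ((- (\<i> * scoef p k)) *s kvec k, 0))))"
    proof (rule all_cong1, rule diff_eq_diff_eq)
      fix k
      have ii: "(\<i> * (\<i> * z)) *s v = - (z *s v)" for z v by (simp add: vec_eq_iff mult.assoc[symmetric])
      show "vcoef (\<lambda>x. w' x + convect u w x + (4 * chi) *\<^sub>R w x - \<kappa> *\<^sub>R grad (divg w) x - \<eta> *\<^sub>R laplacian w x) k - vcoef (\<lambda>x. (2 * chi) *\<^sub>R curl u x) k =
        vcoef w' k - fst (snd (lin k (state_coef u w b k) + bilin (state_coef u w b) (state_coef u w b) k + ((- (\<i> * scoef p k)) *s kvec k, 0)))"
        by (simp add: V bilin_state_coef[OF u w b du db] lin_def state_coef_def ii algebra_simps)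
    qed
  qed (intro F)+
  have E3: "(AE x in lborel. b' x + convect u b x - \<nu> *\<^sub>R laplacian b x = convect b u x) \<longleftrightarrow>
    (\<forall>k. vcoef b' k = snd (snd (lin k (state_coef u w b k) + bilin (state_coef u w b) (state_coef u w b) k + ((- (\<i> * scoef p k)) *s kvec k, 0))))"
  proof (subst AE_eq_iff_vcoef)
    show "(\<forall>k. vcoef (\<lambda>x. b' x + convect u b x - \<nu> *\<^sub>R laplacian b x) k = vcoef (convect b u) k) \<longleftrightarrow>
    (\<forall>k. vcoef b' k = snd (snd (lin k (state_coef u w b k) + bilin (state_coef u w b) (state_coef u w b) k + ((- (\<i> * scoef p k)) *s kvec k, 0))))"
    proof (rule all_cong1, rule diff_eq_diff_eq)
      fix k
      show "vcoef (\<lambda>x. b' x + convect u b x - \<nu> *\<^sub>R laplacian b x) k - vcoef (convect b u) k =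
        vcoef b' k - snd (snd (lin k (state_coef u w b k) + bilin (state_coef u w b) (state_coef u w b) k + ((- (\<i> * scoef p k)) *s kvec k, 0)))"
        by (simp add: V bilin_state_coef[OF u w b du db] lin_def state_coef_def)
    qed
  qed (intro F)+
  show ?thesis unfolding AE_conj_iff E1 E2 E3 prod_eq_iff state_coef_def fst_conv snd_conv by blast
qed

text \<open>The pressure of the solution supplies the multiple of \<open>k\<close>. Admitting every
  larger \<open>M'\<close> lets two solutions be compared with a common bound.\<close>

lemma solution_modes:
  assumes sol: "global_strong_solution chi \<kappa> \<eta> \<nu> u0 w0 b0 u w b"
  obtains M where "\<And>M'. M \<le> M' \<Longrightarrow> mode_solution T M' (\<lambda>t. state_coef (u t) (w t) (b t))"
proof -
  have C: "continuous_into_sobolev 3 u" "continuous_into_sobolev 3 w" "continuous_into_sobolev 3 b"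
    and div: "\<And>t. 0 \<le> t \<Longrightarrow> AE x in lborel. divg (u t) x = 0 \<and> divg (b t) x = 0"
    and eq: "\<And>t. 0 < t \<Longrightarrow> \<exists>u' \<omega>' b' p.
        has_time_deriv u u' t \<and> has_time_deriv w \<omega>' t \<and> has_time_deriv b b' t \<and> p \<in> sobolev 1 \<and>
        (AE x in lborel.
           u' x + convect (u t) (u t) x - chi *\<^sub>R laplacian (u t) x
             = - grad p x + (2 * chi) *\<^sub>R curl (w t) x + convect (b t) (b t) x \<and>
           \<omega>' x + convect (u t) (w t) x + (4 * chi) *\<^sub>R w t x
               - \<kappa> *\<^sub>R grad (divg (w t)) x - \<eta> *\<^sub>R laplacian (w t) x
             = (2 * chi) *\<^sub>R curl (u t) x \<and>
           b' x + convect (u t) (b t) x - \<nu> *\<^sub>R laplacian (b t) x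
             = convect (b t) (u t) x)"
    using sol by (auto simp: global_strong_solution_def)
  note S = C[THEN continuous_into_sobolevD(1)]
  have du: "kdot k (vcoef (u t) k) = 0" and db: "kdot k (vcoef (b t) k) = 0" if "0 \<le> t" for t k
    using div[OF that] AE_divg_eq_0_iff[OF S(1)[OF that]] AE_divg_eq_0_iff[OF S(3)[OF that]] by auto
  obtain M1 where M1: "\<And>t F. t \<in> {0..T} \<Longrightarrow> finite F \<Longrightarrow> (\<Sum>k\<in>F. norm (vcoef (u t) k)) \<le> M1" by (rule l1_bounded_on_Icc[OF C(1), of T]) (rule that)
  obtain M2 where M2: "\<And>t F. t \<in> {0..T} \<Longrightarrow> finite F \<Longrightarrow> (\<Sum>k\<in>F. norm (vcoef (w t) k)) \<le> M2" by (rule l1_bounded_on_Icc[OF C(2), of T]) (rule that)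
  obtain M3 where M3: "\<And>t F. t \<in> {0..T} \<Longrightarrow> finite F \<Longrightarrow> (\<Sum>k\<in>F. norm (vcoef (b t) k)) \<le> M3" by (rule l1_bounded_on_Icc[OF C(3), of T]) (rule that)
  have "mode_solution T M' (\<lambda>t. state_coef (u t) (w t) (b t))" if M': "M1 + M2 + M3 \<le> M'" for M'
    unfolding mode_solution_def
  proof (intro conjI allI ballI impI)
    fix k
    have cont: "continuous_on {0..T} (\<lambda>t. vcoef (v t) k)" if "continuous_into_sobolev 3 v" for v
      using continuous_on_vcoef[OF that, of k] by (rule continuous_on_subset) auto
    show "continuous_on {0..T} (\<lambda>t. state_coef (u t) (w t) (b t) k)"
      unfolding state_coef_def by (intro continuous_on_Pair cont C)
  next
    fix t F assume t: "t \<in> {0..T}" and F: "finite (F :: (int^3) set)"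
    have "(\<Sum>k\<in>F. norm (state_coef (u t) (w t) (b t) k)) \<le> (\<Sum>k\<in>F. norm (vcoef (u t) k) + norm (vcoef (w t) k) + norm (vcoef (b t) k))"
      unfolding state_coef_def by (intro sum_mono norm_state_le)
    also have "\<dots> \<le> M1 + M2 + M3" unfolding sum.distrib by (intro add_mono M1 M2 M3 t F)
    finally show "(\<Sum>k\<in>F. norm (state_coef (u t) (w t) (b t) k)) \<le> M'" using M' by linarith
  next
    fix t k assume "t \<in> {0..T}"
    then show "kdot k (fst (state_coef (u t) (w t) (b t) k)) = 0" using du[of t k] by (simp add: state_coef_def)
  next
    fix t k assume t: "0 < t \<and> t < T"
    then have t0: "0 \<le> t" and tp: "0 < t" by auto
    from eq[OF tp] obtain u' w' b' p where d: "has_time_deriv u u' t" "has_time_deriv w w' t" "has_time_deriv b b' t"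
      and p: "p \<in> sobolev 1" and e: "AE x in lborel.
           u' x + convect (u t) (u t) x - chi *\<^sub>R laplacian (u t) x
             = - grad p x + (2 * chi) *\<^sub>R curl (w t) x + convect (b t) (b t) x \<and>
           w' x + convect (u t) (w t) x + (4 * chi) *\<^sub>R w t x
               - \<kappa> *\<^sub>R grad (divg (w t)) x - \<eta> *\<^sub>R laplacian (w t) x
             = (2 * chi) *\<^sub>R curl (u t) x \<and>
           b' x + convect (u t) (b t) x - \<nu> *\<^sub>R laplacian (b t) x
             = convect (b t) (u t) x"
      by (elim exE conjE)
    have d': "u' \<in> L2_torus" "w' \<in> L2_torus" "b' \<in> L2_torus" using d by (auto simp: has_time_deriv_def)
    have "((\<lambda>t. state_coef (u t) (w t) (b t) k) has_vector_derivative state_coef u' w' b' k) (at t)"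
      by (intro has_vector_derivative_state_coef time_deriv_vcoef[OF d(1) tp] time_deriv_vcoef[OF d(2) tp] time_deriv_vcoef[OF d(3) tp]
          sobolev_L2[OF S(1)] sobolev_L2[OF S(2)] sobolev_L2[OF S(3)])
    moreover have "state_coef u' w' b' k = lin k (state_coef (u t) (w t) (b t) k)
        + bilin (state_coef (u t) (w t) (b t)) (state_coef (u t) (w t) (b t)) k + ((- (\<i> * scoef p k)) *s kvec k, 0)"
      using e unfolding equations_iff[OF S(1)[OF t0] S(2)[OF t0] S(3)[OF t0] du[OF t0] db[OF t0] d' p] by (rule spec)
    ultimately show "\<exists>\<pi>. ((\<lambda>t. state_coef (u t) (w t) (b t) k) has_vector_derivative
        lin k (state_coef (u t) (w t) (b t) k) + bilin (state_coef (u t) (w t) (b t)) (state_coef (u t) (w t) (b t)) k + (\<pi> *s kvec k, 0)) (at t)"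
      by (intro exI[of _ "- (\<i> * scoef p k)"]) simp
  qed
  then show ?thesis by (rule that)
qed

lemma solution_unique:
  assumes data: "u0 \<in> L2_torus" "w0 \<in> L2_torus" "b0 \<in> L2_torus"
    and sol: "global_strong_solution chi \<kappa> \<eta> \<nu> u0 w0 b0 u w b"
    and sol': "global_strong_solution chi \<kappa> \<eta> \<nu> u0 w0 b0 u' w' b'" and t: "0 \<le> t"
  shows "AE x in lborel. u' t x = u t x \<and> w' t x = w t x \<and> b' t x = b t x"
proof -
  have init: "state_coef (u 0) (w 0) (b 0) k = state_coef u0 w0 b0 k"
    if "global_strong_solution chi \<kappa> \<eta> \<nu> u0 w0 b0 u w b" for u w b k
  proof -
    have "AE x in lborel. u 0 x = u0 x \<and> w 0 x = w0 x \<and> b 0 x = b0 x"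
      and C: "continuous_into_sobolev 3 u" "continuous_into_sobolev 3 w" "continuous_into_sobolev 3 b"
      using that by (auto simp: global_strong_solution_def)
    then show ?thesis
      using AE_eq_iff_vcoef[OF L1_field_L2[OF sobolev_L2[OF continuous_into_sobolevD(1)[OF C(1)]]] L1_field_L2[OF data(1)]]
        AE_eq_iff_vcoef[OF L1_field_L2[OF sobolev_L2[OF continuous_into_sobolevD(1)[OF C(2)]]] L1_field_L2[OF data(2)]]
        AE_eq_iff_vcoef[OF L1_field_L2[OF sobolev_L2[OF continuous_into_sobolevD(1)[OF C(3)]]] L1_field_L2[OF data(3)]]
      by (simp add: state_coef_def)
  qed
  obtain M where M: "\<And>M'. M \<le> M' \<Longrightarrow> mode_solution t M' (\<lambda>t. state_coef (u t) (w t) (b t))" by (rule solution_modes[OF sol, of t]) (rule that)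
  obtain M1 where M1: "\<And>M'. M1 \<le> M' \<Longrightarrow> mode_solution t M' (\<lambda>t. state_coef (u' t) (w' t) (b' t))" by (rule solution_modes[OF sol', of t]) (rule that)
  have "state_coef (u' t) (w' t) (b' t) k = state_coef (u t) (w t) (b t) k" for k
    by (rule mode_solution_unique[OF M1[of "max M M1"] M[of "max M M1"]]) (use t init[OF sol] init[OF sol'] in \<open>auto simp: fun_eq_iff\<close>)
  then have eq: "\<forall>k. vcoef (u' t) k = vcoef (u t) k" "\<forall>k. vcoef (w' t) k = vcoef (w t) k" "\<forall>k. vcoef (b' t) k = vcoef (b t) k"
    by (auto simp: state_coef_def)
  have C: "continuous_into_sobolev 3 u" "continuous_into_sobolev 3 w" "continuous_into_sobolev 3 b"
    "continuous_into_sobolev 3 u'" "continuous_into_sobolev 3 w'" "continuous_into_sobolev 3 b'"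
    using sol sol' by (auto simp: global_strong_solution_def)
  note L = C[THEN continuous_into_sobolevD(1), OF t, THEN sobolev_L2, THEN L1_field_L2]
  show ?thesis
    using eq unfolding AE_conj_iff AE_eq_iff_vcoef[OF L(4) L(1)] AE_eq_iff_vcoef[OF L(5) L(2)] AE_eq_iff_vcoef[OF L(6) L(3)] by blast
qed

text \<open>The velocity component contributes \<open>3 * chi\<close>, the micro-rotation
  \<open>6 * chi + \<eta> + \<kappa>\<close> and the magnetic field \<open>\<nu>\<close>.\<close>

definition lin_const :: real where
  "lin_const = 9 * chi + \<eta> + \<kappa> + \<nu>"

text \<open>For nonzero \<open>k\<close> the terms of order 0 and 1 in |k| are dominated by
  |k|^2.\<close>

lemma norm_lin_le:
  assumes k: "k \<noteq> 0" shows "norm (lin k z) \<le> lin_const * ((wave_norm k)\<^sup>2 * norm z)"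
proof -
  obtain u w b where z: "z = (u, w, b)" by (metis prod_cases3)
  define n where "n = wave_norm k"
  define N where "N = norm z"
  have n: "1 \<le> n" unfolding n_def by (rule wave_norm_ge_1[OF k])
  then have n2: "n \<le> n\<^sup>2" "1 \<le> n\<^sup>2" by (simp_all add: power2_eq_square mult_le_cancel_left1 order_trans[OF n])
  have N: "norm u \<le> N" "norm w \<le> N" "norm b \<le> N" using norm_components_le[of z] by (simp_all add: N_def z)
  have N0: "0 \<le> N" by (simp add: N_def)
  have nN: "n * N \<le> n\<^sup>2 * N" "N \<le> n\<^sup>2 * N" using mult_right_mono[OF n2(1) N0] mult_right_mono[OF n2(2) N0] by auto
  have curl: "norm (kcurl k v) \<le> n\<^sup>2 * N" if "norm v \<le> N" for v
    using norm_kcurl_le[of k v] mult_left_mono[OF that, of n] n nN(1) unfolding n_def by linarith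
  have gd: "norm (kdot k w *s kvec k) \<le> n\<^sup>2 * N"
  proof -
    have "norm (kdot k w) * n \<le> (n * N) * n"
      using norm_kdot_le[of k w] mult_left_mono[OF N(2), of n] n unfolding n_def by (intro mult_right_mono) auto
    then show ?thesis by (simp add: norm_vector_scalar_mult norm_kvec n_def power2_eq_square mult_ac)
  qed
  have nv: "n\<^sup>2 * norm v \<le> n\<^sup>2 * N" if "norm v \<le> N" for v :: cvec using that by (rule mult_left_mono) simp
  have "norm (- (chi * n\<^sup>2) *\<^sub>R u + (2 * chi) *\<^sub>R kcurl k w) \<le> chi * (n\<^sup>2 * norm u) + 2 * chi * norm (kcurl k w)"
    using norm_triangle_ineq[of "- (chi * n\<^sup>2) *\<^sub>R u" "(2 * chi) *\<^sub>R kcurl k w"] chi by (simp add: abs_mult)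
  also have "\<dots> \<le> chi * (n\<^sup>2 * N) + 2 * chi * (n\<^sup>2 * N)"
    using chi by (intro add_mono mult_left_mono nv curl N) auto
  finally have 1: "norm (- (chi * n\<^sup>2) *\<^sub>R u + (2 * chi) *\<^sub>R kcurl k w) \<le> 3 * chi * (n\<^sup>2 * N)" by linarith
  have "norm (- (4 * chi + \<eta> * n\<^sup>2) *\<^sub>R w - \<kappa> *\<^sub>R (kdot k w *s kvec k) + (2 * chi) *\<^sub>R kcurl k u)
    \<le> norm (- (4 * chi + \<eta> * n\<^sup>2) *\<^sub>R w) + norm (\<kappa> *\<^sub>R (kdot k w *s kvec k)) + norm ((2 * chi) *\<^sub>R kcurl k u)"
    using norm_triangle_ineq[of "- (4 * chi + \<eta> * n\<^sup>2) *\<^sub>R w - \<kappa> *\<^sub>R (kdot k w *s kvec k)" "(2 * chi) *\<^sub>R kcurl k u"]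
      norm_triangle_ineq4[of "- (4 * chi + \<eta> * n\<^sup>2) *\<^sub>R w" "\<kappa> *\<^sub>R (kdot k w *s kvec k)"] by linarith
  also have "norm (- (4 * chi + \<eta> * n\<^sup>2) *\<^sub>R w) = \<bar>4 * chi + \<eta> * n\<^sup>2\<bar> * norm w" unfolding norm_scaleR abs_minus_cancel ..
  also have "\<bar>4 * chi + \<eta> * n\<^sup>2\<bar> * norm w = 4 * chi * norm w + \<eta> * (n\<^sup>2 * norm w)"
    using chi eta by (simp add: algebra_simps abs_of_nonneg)
  also have "norm (\<kappa> *\<^sub>R (kdot k w *s kvec k)) = \<kappa> * norm (kdot k w *s kvec k)" using kappa by simp
  also have "norm ((2 * chi) *\<^sub>R kcurl k u) = 2 * chi * norm (kcurl k u)" using chi by simp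
  also have "4 * chi * norm w + \<eta> * (n\<^sup>2 * norm w) + \<kappa> * norm (kdot k w *s kvec k) + 2 * chi * norm (kcurl k u)
    \<le> 4 * chi * (n\<^sup>2 * N) + \<eta> * (n\<^sup>2 * N) + \<kappa> * (n\<^sup>2 * N) + 2 * chi * (n\<^sup>2 * N)"
    using chi eta kappa nN(2) N(2) by (intro add_mono mult_left_mono nv curl gd N) auto
  finally have 2: "norm (- (4 * chi + \<eta> * n\<^sup>2) *\<^sub>R w - \<kappa> *\<^sub>R (kdot k w *s kvec k) + (2 * chi) *\<^sub>R kcurl k u)
    \<le> 6 * chi * (n\<^sup>2 * N) + \<eta> * (n\<^sup>2 * N) + \<kappa> * (n\<^sup>2 * N)" by linarith
  have "norm (- (\<nu> * n\<^sup>2) *\<^sub>R b) = \<nu> * (n\<^sup>2 * norm b)" using nu by (simp add: abs_mult)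
  also have "\<dots> \<le> \<nu> * (n\<^sup>2 * N)" using nu by (intro mult_left_mono nv N) auto
  finally have 3: "norm (- (\<nu> * n\<^sup>2) *\<^sub>R b) \<le> \<nu> * (n\<^sup>2 * N)" .
  have "norm (lin k z) \<le> 3 * chi * (n\<^sup>2 * N) + (6 * chi * (n\<^sup>2 * N) + \<eta> * (n\<^sup>2 * N) + \<kappa> * (n\<^sup>2 * N)) + \<nu> * (n\<^sup>2 * N)"
    using norm_state_le[of "- (chi * n\<^sup>2) *\<^sub>R u + (2 * chi) *\<^sub>R kcurl k w"
        "- (4 * chi + \<eta> * n\<^sup>2) *\<^sub>R w - \<kappa> *\<^sub>R (kdot k w *s kvec k) + (2 * chi) *\<^sub>R kcurl k u" "- (\<nu> * n\<^sup>2) *\<^sub>R b"] 1 2 3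
    unfolding lin_def z fst_conv snd_conv n_def[symmetric] by linarith
  also have "\<dots> = lin_const * (n\<^sup>2 * N)" by (simp add: lin_const_def algebra_simps)
  finally show ?thesis unfolding n_def N_def .
qed

text \<open>The Leray projection removes a multiple of \<open>k\<close> from the \<open>k\<close>-th mode; this is the gradient of the pressure.\<close>

lemma ex_pressure:
  assumes m: "h3_bounded A m" and B: "\<And>k. norm (B k) \<le> K * (wave_norm k)\<^sup>2 * m k" and K: "0 \<le> K"
    and real: "\<And>k. B (- k) = scnj (B k)"
  shows "\<exists>p\<in>sobolev 1. \<forall>k. leray k (B k) = B k + ((- (\<i> * scoef p k)) *s kvec k, 0)"
proof -
  define W where "W = real (card {\<alpha>. mi_order \<alpha> \<le> 1})"
  \<comment> \<open>The pressure coefficient: \<open>\<i> * c k\<close> is the factor of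
    \<open>kvec k\<close> that the projection subtracts.\<close>
  define c where "c k = - \<i> * (kdot k (fst (B k)) / of_real ((wave_norm k)\<^sup>2))" for k
  have c: "norm (c k) \<le> K * (wave_norm k * m k)" for k
  proof (cases "k = 0")
    case True
    then show ?thesis using h3_boundedD(2)[OF m] by (simp add: c_def)
  next
    case False
    note n = wave_norm_ge_1[OF False]
    have "norm (kdot k (fst (B k))) \<le> wave_norm k * norm (B k)"
      using norm_kdot_le[of k "fst (B k)"] mult_left_mono[OF norm_components_le(1)[of "B k"] norm_ge_zero[of "wave_vec k"]] by linarith
    also have "\<dots> \<le> wave_norm k * (K * (wave_norm k)\<^sup>2 * m k)" by (intro mult_left_mono B) simp
    finally have "norm (kdot k (fst (B k))) / (wave_norm k)\<^sup>2 \<le> K * (wave_norm k * m k)"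
      using n by (simp add: divide_le_eq mult_ac)
    then show ?thesis by (simp add: c_def norm_mult norm_divide norm_power)
  qed
  have c_cnj: "c (- k) = cnj (c k)" for k
  proof -
    have "kdot (- k) (fst (B (- k))) = - cnj (kdot k (fst (B k)))"
      using kdot_vcnj[of "- k" "fst (B k)"] by (simp add: real scnj_def)
    then show ?thesis by (simp add: c_def)
  qed
  have sq: "(norm (c k))\<^sup>2 \<le> K\<^sup>2 * (wave_norm k ^ 1 * m k)\<^sup>2" for k
    using power_mono[OF c[of k] norm_ge_zero, of 2] by (simp add: power_mult_distrib)
  have "(\<lambda>k. (norm (c k))\<^sup>2) summable_on UNIV"
    by (rule summable_on_comparison_test[OF summable_on_cmult_right[OF h3_sq_summable(1)[OF m, of 1], of "K\<^sup>2"]]) (use sq in auto)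
  then obtain p where p: "p \<in> L2_torus" "scoef p = c" using ex_L2_with_scoef[of c] c_cnj by blast
  have "p \<in> sobolev 1"
  proof (rule scalar_sobolev_if_summable[OF p(1)])
    show "(\<lambda>k. sobolev_weight 1 k * (norm (scoef p k))\<^sup>2) summable_on UNIV"
    \<comment> \<open>The H^1 weight raises the bound \<open>|k| * m\<close> to
      \<open>|k|^2 * m\<close>, still within the three powers of |k| that \<open>m\<close>
      allows.\<close>
    proof (rule summable_on_comparison_test[OF summable_on_cmult_right[OF h3_sq_summable(1)[OF m, of 2], of "W * K\<^sup>2"]])
      fix k
      show "sobolev_weight 1 k * (norm (scoef p k))\<^sup>2 \<le> W * K\<^sup>2 * (wave_norm k ^ 2 * m k)\<^sup>2"
      proof (cases "k = 0")
        case True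
        then show ?thesis using h3_boundedD(2)[OF m] by (simp add: p c_def)
      next
        case False
        have "sobolev_weight 1 k * (norm (c k))\<^sup>2 \<le> (W * wave_norm k ^ (2 * 1)) * (K\<^sup>2 * (wave_norm k ^ 1 * m k)\<^sup>2)"
          unfolding W_def by (intro mult_mono sobolev_weight_le[OF False] sq) auto
        then show ?thesis by (simp add: p power_mult_distrib power2_eq_square mult_ac)
      qed
    qed (auto simp: sobolev_weight_nonneg)
  qed
  moreover have "leray k (B k) = B k + ((- (\<i> * scoef p k)) *s kvec k, 0)" for k
    by (simp add: p c_def leray_def project_def prod_eq_iff vec_eq_iff)
  ultimately show ?thesis by blast
qed

text \<open>Three fields, the factor 2 in the bound \<open>2 * m\<close> of the coefficients, and
  the radius \<open>12 * \<epsilon>\<close> of the majorant: \<open>3 * 2 * 12 = 72\<close>.\<close>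

definition sol_const :: real where
  "sol_const = sqrt ((2 * pi) ^ 3 * weight_const) * 72"

text \<open>On the Fourier side the data lie in the ball of radius \<open>6 * \<epsilon>\<close>,
  the 6 coming from the comparison of H^3 weights; this is the radius in the second smallness
  condition. The mean conditions remove the zero mode.\<close>

lemma solution_exists:
  assumes data: "u0 \<in> sobolev 3" "w0 \<in> sobolev 3" "b0 \<in> sobolev 3"
    and div: "AE x in lborel. divg u0 x = 0" "AE x in lborel. divg b0 x = 0"
    and mean: "(LINT x:torus_cell|lborel. u0 x) = 0" "(LINT x:torus_cell|lborel. w0 x) = 0" "(LINT x:torus_cell|lborel. b0 x) = 0"
    and small: "sobolev_norm 3 u0 + sobolev_norm 3 w0 + sobolev_norm 3 b0 \<le> \<epsilon>" "16 * (48 / rate) * lattice_const * (6 * \<epsilon>) \<le> 1"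
  obtains u w b where "global_strong_solution chi \<kappa> \<eta> \<nu> u0 w0 b0 u w b"
    "\<And>t. 0 \<le> t \<Longrightarrow> sobolev_norm 3 (u t) + sobolev_norm 3 (w t) + sobolev_norm 3 (b t) \<le> sol_const * \<epsilon> * exp (- (rate / 2) * t)"
proof -
  define a0 where "a0 = state_coef u0 w0 b0"
  have a0_0: "a0 0 = 0"
    using data mean by (simp add: a0_def state_coef_def vcoef_0_if_mean_zero sobolev_L2 zero_prod_def)
  have "L2_set (\<lambda>k. wave_norm k ^ 3 * norm (a0 k)) F \<le> 6 * \<epsilon>" if F: "finite F" for F
  proof -
    let ?n = "\<lambda>v k. wave_norm k ^ 3 * norm (vcoef v k)"
    have "L2_set (\<lambda>k. wave_norm k ^ 3 * norm (a0 k)) F \<le> L2_set (\<lambda>k. (?n u0 k + ?n w0 k) + ?n b0 k) F"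
    proof (rule L2_set_mono)
      fix k
      show "wave_norm k ^ 3 * norm (a0 k) \<le> (?n u0 k + ?n w0 k) + ?n b0 k"
        unfolding a0_def state_coef_def distrib_left[symmetric] by (intro mult_left_mono norm_state_le) simp
    qed simp
    also have "\<dots> \<le> (L2_set (?n u0) F + L2_set (?n w0) F) + L2_set (?n b0) F"
      using L2_set_triangle_ineq[of "\<lambda>k. ?n u0 k + ?n w0 k" "?n b0" F] L2_set_triangle_ineq[of "?n u0" "?n w0" F] by linarith
    also have "\<dots> \<le> 6 * \<epsilon>"
      using L2_set_le_sobolev_norm[OF data(1) F] L2_set_le_sobolev_norm[OF data(2) F] L2_set_le_sobolev_norm[OF data(3) F] small(1) by linarith
    finally show ?thesis .
  qed
  then have h3: "h3_bounded (6 * \<epsilon>) (\<lambda>k. norm (a0 k))" by (simp add: h3_bounded_def a0_0)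
  have d0: "kdot k (fst (a0 k)) = 0" "kdot k (snd (snd (a0 k))) = 0" for k
    using div AE_divg_eq_0_iff[OF data(1)] AE_divg_eq_0_iff[OF data(3)] by (auto simp: a0_def state_coef_def)
  have real0: "a0 (- k) = scnj (a0 k)" for k by (simp add: a0_def state_coef_def scnj_def vcoef_minus)
  obtain a m where m: "h3_bounded (2 * (6 * \<epsilon>)) m" and init: "a 0 = a0"
    and decay: "\<And>t k. 0 \<le> t \<Longrightarrow> norm (a t k) \<le> 2 * m k * exp (- (rate / 2) * t)"
    and ode: "\<And>t k. 0 \<le> t \<Longrightarrow> ((\<lambda>t. a t k) has_vector_derivative lin k (a t k) + leray k (bilin (a t) (a t) k)) (at t within {0..})"
    and da: "\<And>t k. 0 \<le> t \<Longrightarrow> kdot k (fst (a t k)) = 0" and db: "\<And>t k. 0 \<le> t \<Longrightarrow> kdot k (snd (snd (a t k))) = 0"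
    and real: "\<And>t k. 0 \<le> t \<Longrightarrow> a t (- k) = scnj (a t k)"
    and bil: "\<And>t k. 0 \<le> t \<Longrightarrow> norm (bilin (a t) (a t) k) \<le> (rate / 4) * (wave_norm k)\<^sup>2 * m k"
    by (rule coefficient_solution_exists[OF h3 small(2) d0 real0]) (rule that)
  note m0 = h3_boundedD(1)[OF m]
  have le: "norm (a t k) \<le> 2 * m k" if t: "0 \<le> t" for t k
  proof -
    have "2 * m k * exp (- (rate / 2) * t) \<le> 2 * m k * 1" using t rate(1) m0[of k] by (intro mult_left_mono) auto
    then show ?thesis using decay[OF t, of k] by linarith
  qed
  define d where "d t k = lin k (a t k) + leray k (bilin (a t) (a t) k)" for t k
  define K where "K = lin_const * 2 + rate / 4"
  have lc: "0 \<le> lin_const" using chi kappa eta nu by (simp add: lin_const_def)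
  have K: "0 \<le> K" using lc rate(1) by (simp add: K_def)
  have dle: "norm (d t k) \<le> K * ((wave_norm k)\<^sup>2 * m k)" if t: "0 \<le> t" for t k
  proof -
    have "norm (lin k (a t k)) \<le> lin_const * ((wave_norm k)\<^sup>2 * (2 * m k))"
    proof (cases "k = 0")
      case True
      then have "a t k = 0" using le[OF t, of k] h3_boundedD(2)[OF m] by simp
      then show ?thesis using True by (simp add: linear_0[OF bounded_linear.linear[OF bounded_linear_lin]])
    next
      case False
      have "norm (lin k (a t k)) \<le> lin_const * ((wave_norm k)\<^sup>2 * norm (a t k))" by (rule norm_lin_le[OF False])
      also have "\<dots> \<le> lin_const * ((wave_norm k)\<^sup>2 * (2 * m k))" by (intro mult_left_mono le t lc) auto
      finally show ?thesis .
    qed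
    moreover have "norm (leray k (bilin (a t) (a t) k)) \<le> (rate / 4) * (wave_norm k)\<^sup>2 * m k"
      using norm_leray_le[of k "bilin (a t) (a t) k"] bil[OF t, of k] by linarith
    ultimately show ?thesis
      using norm_triangle_ineq[of "lin k (a t k)" "leray k (bilin (a t) (a t) k)"] by (simp add: d_def K_def algebra_simps)
  qed
  \<comment> \<open>The three fields arise alike from the coordinate projections of the state, which
    do not increase the norm and commute with conjugation.\<close>
  have component: "\<exists>u. continuous_into_sobolev 3 u \<and> (\<forall>t k. 0 \<le> t \<longrightarrow> vcoef (u t) k = f (a t k)) \<and>
      (\<forall>t>0. \<exists>v. has_time_deriv u v t \<and> v \<in> L2_torus \<and> (\<forall>k. vcoef v k = f (d t k)))"
    if f: "bounded_linear f" "\<And>z. norm (f z) \<le> norm z" "\<And>z. f (scnj z) = vcnj (f z)" for f :: "state \<Rightarrow> cvec"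
  proof -
    show ?thesis
    proof (rule field_of_modes[OF m, of "\<lambda>t k. f (a t k)" "\<lambda>t k. f (d t k)" K])
      fix t :: real and k assume t: "0 \<le> t"
      show "norm (f (a t k)) \<le> 2 * m k" by (rule order_trans[OF f(2) le[OF t]])
      show "f (a t (- k)) = vcnj (f (a t k))" unfolding real[OF t] by (rule f(3))
      show "((\<lambda>t. f (a t k)) has_vector_derivative f (d t k)) (at t within {0..})"
        unfolding d_def by (rule bounded_linear.has_vector_derivative[OF f(1) ode[OF t]])
      show "norm (f (d t k)) \<le> K * ((wave_norm k)\<^sup>2 * m k)" by (rule order_trans[OF f(2) dle[OF t]])
    next
      fix u assume "continuous_into_sobolev 3 u" "\<And>t k. 0 \<le> t \<Longrightarrow> vcoef (u t) k = f (a t k)"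
        "\<And>t. 0 < t \<Longrightarrow> \<exists>v. has_time_deriv u v t \<and> v \<in> L2_torus \<and> (\<forall>k. vcoef v k = f (d t k))"
      then show ?thesis by blast
    qed (rule K)
  qed
  obtain u where u: "continuous_into_sobolev 3 u" "\<And>t k. 0 \<le> t \<Longrightarrow> vcoef (u t) k = fst (a t k)"
    "\<And>t. 0 < t \<Longrightarrow> \<exists>v. has_time_deriv u v t \<and> v \<in> L2_torus \<and> (\<forall>k. vcoef v k = fst (d t k))"
    using component[OF bounded_linear_fst norm_components_le(1)] by (auto simp: scnj_def)
  obtain w where w: "continuous_into_sobolev 3 w" "\<And>t k. 0 \<le> t \<Longrightarrow> vcoef (w t) k = fst (snd (a t k))"
    "\<And>t. 0 < t \<Longrightarrow> \<exists>v. has_time_deriv w v t \<and> v \<in> L2_torus \<and> (\<forall>k. vcoef v k = fst (snd (d t k)))"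
    using component[OF bounded_linear_compose[OF bounded_linear_fst bounded_linear_snd] norm_components_le(2)] by (auto simp: scnj_def)
  obtain b where b: "continuous_into_sobolev 3 b" "\<And>t k. 0 \<le> t \<Longrightarrow> vcoef (b t) k = snd (snd (a t k))"
    "\<And>t. 0 < t \<Longrightarrow> \<exists>v. has_time_deriv b v t \<and> v \<in> L2_torus \<and> (\<forall>k. vcoef v k = snd (snd (d t k)))"
    using component[OF bounded_linear_compose[OF bounded_linear_snd bounded_linear_snd] norm_components_le(3)] by (auto simp: scnj_def)
  note S = u(1)[THEN continuous_into_sobolevD(1)] w(1)[THEN continuous_into_sobolevD(1)] b(1)[THEN continuous_into_sobolevD(1)]
  have coef: "state_coef (u t) (w t) (b t) = a t" if "0 \<le> t" for t
    using u(2)[OF that] w(2)[OF that] b(2)[OF that] by (simp add: fun_eq_iff state_coef_def)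
  have "global_strong_solution chi \<kappa> \<eta> \<nu> u0 w0 b0 u w b"
    unfolding global_strong_solution_def
  proof (intro conjI u(1) w(1) b(1) allI impI)
    note L = S[of 0, OF order_refl, THEN sobolev_L2, THEN L1_field_L2]
    note L0 = data[THEN sobolev_L2, THEN L1_field_L2]
    have "state_coef (u 0) (w 0) (b 0) = a0" using coef[of 0] init by simp
    then have "\<forall>k. vcoef (u 0) k = vcoef u0 k" "\<forall>k. vcoef (w 0) k = vcoef w0 k" "\<forall>k. vcoef (b 0) k = vcoef b0 k"
      by (auto simp: a0_def state_coef_def fun_eq_iff)
    then show "AE x in lborel. u 0 x = u0 x \<and> w 0 x = w0 x \<and> b 0 x = b0 x"
      unfolding AE_conj_iff AE_eq_iff_vcoef[OF L(1) L0(1)] AE_eq_iff_vcoef[OF L(2) L0(2)] AE_eq_iff_vcoef[OF L(3) L0(3)] by blast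
  next
    fix t :: real assume t: "0 \<le> t"
    show "AE x in lborel. divg (u t) x = 0 \<and> divg (b t) x = 0"
      unfolding AE_conj_iff AE_divg_eq_0_iff[OF S(1)[OF t]] AE_divg_eq_0_iff[OF S(3)[OF t]] u(2)[OF t] b(2)[OF t]
      using da[OF t] db[OF t] by blast
  next
    fix t :: real assume t: "0 < t"
    then have t0: "0 \<le> t" by simp
    obtain u' where u': "has_time_deriv u u' t" "u' \<in> L2_torus" "\<forall>k. vcoef u' k = fst (d t k)" using u(3)[OF t] by blast
    obtain w' where w': "has_time_deriv w w' t" "w' \<in> L2_torus" "\<forall>k. vcoef w' k = fst (snd (d t k))" using w(3)[OF t] by blast
    obtain b' where b': "has_time_deriv b b' t" "b' \<in> L2_torus" "\<forall>k. vcoef b' k = snd (snd (d t k))" using b(3)[OF t] by blast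
    \<comment> \<open>The Hermitian symmetry of the nonlinearity makes the pressure real.\<close>
    have "bilin (a t) (a t) (- k) = scnj (bilin (a t) (a t) k)" for k
    proof -
      have "(\<lambda>j. (2 * m j) * (2 * m (- k - j))) summable_on UNIV"
        using summable_on_cmult_right[OF h3_conv_summable[OF m m, of "- k"], of 4] by (simp add: mult_ac)
      then have "scnj (bilin (a t) (a t) (- k)) = bilin (\<lambda>j. scnj (a t (- j))) (\<lambda>j. scnj (a t (- j))) k"
        by (rule scnj_bilin[OF le[OF t0]])
      also have "(\<lambda>j. scnj (a t (- j))) = a t" by (simp add: real[OF t0] scnj_scnj)
      finally show ?thesis by (metis scnj_scnj)
    qed
    then obtain p where p: "p \<in> sobolev 1"
      "\<And>k. leray k (bilin (a t) (a t) k) = bilin (a t) (a t) k + ((- (\<i> * scoef p k)) *s kvec k, 0)"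
      using ex_pressure[OF m bil[OF t0]] rate(1) by auto
    have du: "kdot k (vcoef (u t) k) = 0" "kdot k (vcoef (b t) k) = 0" for k using da[OF t0] db[OF t0] u(2)[OF t0] b(2)[OF t0] by auto
    have "state_coef u' w' b' k = lin k (state_coef (u t) (w t) (b t) k)
        + bilin (state_coef (u t) (w t) (b t)) (state_coef (u t) (w t) (b t)) k + ((- (\<i> * scoef p k)) *s kvec k, 0)" for k
    proof -
      have "state_coef u' w' b' k = d t k" using u'(3) w'(3) b'(3) by (simp add: state_coef_def)
      then show ?thesis unfolding coef[OF t0] d_def p(2) by (simp only: add.assoc)
    qed
    then show "\<exists>u' \<omega>' b' p. has_time_deriv u u' t \<and> has_time_deriv w \<omega>' t \<and> has_time_deriv b b' t \<and> p \<in> sobolev 1 \<and>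
        (AE x in lborel.
           u' x + convect (u t) (u t) x - chi *\<^sub>R laplacian (u t) x
             = - grad p x + (2 * chi) *\<^sub>R curl (w t) x + convect (b t) (b t) x \<and>
           \<omega>' x + convect (u t) (w t) x + (4 * chi) *\<^sub>R w t x
               - \<kappa> *\<^sub>R grad (divg (w t)) x - \<eta> *\<^sub>R laplacian (w t) x
             = (2 * chi) *\<^sub>R curl (u t) x \<and>
           b' x + convect (u t) (b t) x - \<nu> *\<^sub>R laplacian (b t) x
             = convect (b t) (u t) x)"
      using u'(1) w'(1) b'(1) p(1)
        equations_iff[OF S(1)[OF t0] S(2)[OF t0] S(3)[OF t0] du u'(2) w'(2) b'(2) p(1), THEN iffD2] by blast
  qed
  moreover have "sobolev_norm 3 (u t) + sobolev_norm 3 (w t) + sobolev_norm 3 (b t) \<le> sol_const * \<epsilon> * exp (- (rate / 2) * t)" if t: "0 \<le> t" for t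
  proof -
    have E: "norm (f (a t k)) \<le> (2 * exp (- (rate / 2) * t)) * m k" if "\<And>z. norm (f z) \<le> norm z" for f :: "state \<Rightarrow> cvec" and k
      using order_trans[OF that decay[OF t]] by (simp add: mult_ac)
    note B = sobolev_norm_le_modes[OF _ m, of _ "2 * exp (- (rate / 2) * t)"]
    have "sobolev_norm 3 (u t) \<le> sqrt ((2 * pi) ^ 3 * weight_const) * (2 * exp (- (rate / 2) * t)) * (2 * (6 * \<epsilon>))"
      by (rule B[OF S(1)[OF t]]) (unfold u(2)[OF t], rule E, rule norm_components_le, simp)
    moreover have "sobolev_norm 3 (w t) \<le> sqrt ((2 * pi) ^ 3 * weight_const) * (2 * exp (- (rate / 2) * t)) * (2 * (6 * \<epsilon>))"
      by (rule B[OF S(2)[OF t]]) (unfold w(2)[OF t], rule E[of "\<lambda>z. fst (snd z)"], rule norm_components_le, simp)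
    moreover have "sobolev_norm 3 (b t) \<le> sqrt ((2 * pi) ^ 3 * weight_const) * (2 * exp (- (rate / 2) * t)) * (2 * (6 * \<epsilon>))"
      by (rule B[OF S(3)[OF t]]) (unfold b(2)[OF t], rule E[of "\<lambda>z. snd (snd z)"], rule norm_components_le, simp)
    moreover have "sol_const * \<epsilon> * exp (- (rate / 2) * t) = 3 * (sqrt ((2 * pi) ^ 3 * weight_const) * (2 * exp (- (rate / 2) * t)) * (2 * (6 * \<epsilon>)))"
      by (simp add: sol_const_def)
    ultimately show ?thesis by linarith
  qed
  ultimately show ?thesis by (rule that)
qed

end

theorem theorem1p1:
  fixes chi \<kappa> \<eta> \<nu> :: real
  assumes "chi > 0" and "\<kappa> \<ge> 0" and "\<eta> > 0" and "\<nu> > 0"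
  shows "\<exists>\<epsilon>>0. \<exists>C>0. \<exists>C0>0.
    \<forall>u0 \<omega>0 b0 :: real^3 \<Rightarrow> real^3.
      u0 \<in> sobolev 3 \<and> \<omega>0 \<in> sobolev 3 \<and> b0 \<in> sobolev 3 \<and>
      (AE x in lborel. divg u0 x = 0) \<and> (AE x in lborel. divg b0 x = 0) \<and>
      (LINT x:torus_cell|lborel. u0 x) = 0 \<and>
      (LINT x:torus_cell|lborel. \<omega>0 x) = 0 \<and>
      (LINT x:torus_cell|lborel. b0 x) = 0 \<and>
      sobolev_norm 3 u0 + sobolev_norm 3 \<omega>0 + sobolev_norm 3 b0 \<le> \<epsilon> \<longrightarrow>
      (\<exists>u \<omega> b.
        global_strong_solution chi \<kappa> \<eta> \<nu> u0 \<omega>0 b0 u \<omega> b \<and>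
        (\<forall>v \<theta> h. global_strong_solution chi \<kappa> \<eta> \<nu> u0 \<omega>0 b0 v \<theta> h \<longrightarrow>
          (\<forall>t\<ge>0. AE x in lborel. v t x = u t x \<and> \<theta> t x = \<omega> t x \<and> h t x = b t x)) \<and>
        (\<forall>t>0. sobolev_norm 3 (u t) + sobolev_norm 3 (\<omega> t) + sobolev_norm 3 (b t) \<le> C * \<epsilon>) \<and>
        (\<forall>t>0. sobolev_norm 3 (u t) + sobolev_norm 3 (\<omega> t) + sobolev_norm 3 (b t)
                 \<le> C * exp (- C0 * t)))"
proof -
  interpret mhd chi \<kappa> \<eta> \<nu> by unfold_locales fact+
  \<comment> \<open>The quotient turns the smallness condition of the existence result into an
    equality; the cap 1 is for the decay estimate, whose right-hand side has no factor
    \<open>\<epsilon>\<close>.\<close>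
  define \<epsilon> where "\<epsilon> = min 1 (rate / (16 * 48 * 6 * lattice_const))"
  \<comment> \<open>The summand 1 secures positivity, as \<open>sol_const\<close> is only shown to
    be nonnegative.\<close>
  define C where "C = sol_const + 1"
  have eps: "0 < \<epsilon>" "\<epsilon> \<le> 1" using rate(1) lattice_const_pos by (auto simp: \<epsilon>_def)
  have "\<epsilon> \<le> rate / (16 * 48 * 6 * lattice_const)" by (simp add: \<epsilon>_def)
  then have small: "16 * (48 / rate) * lattice_const * (6 * \<epsilon>) \<le> 1"
    using rate(1) lattice_const_pos by (simp add: field_simps)
  have sc: "0 \<le> sol_const" using weight_const_nonneg by (simp add: sol_const_def)
  then have C: "0 < C" by (simp add: C_def)
  show ?thesis
  proof (rule exI[of _ \<epsilon>], rule conjI[OF eps(1)], rule exI[of _ C], rule conjI[OF C], rule exI[of _ "rate / 2"], intro conjI allI impI)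
    show "0 < rate / 2" using rate(1) by simp
    fix u0 \<omega>0 b0 :: "real^3 \<Rightarrow> real^3"
    assume A: "u0 \<in> sobolev 3 \<and> \<omega>0 \<in> sobolev 3 \<and> b0 \<in> sobolev 3 \<and>
      (AE x in lborel. divg u0 x = 0) \<and> (AE x in lborel. divg b0 x = 0) \<and>
      (LINT x:torus_cell|lborel. u0 x) = 0 \<and>
      (LINT x:torus_cell|lborel. \<omega>0 x) = 0 \<and>
      (LINT x:torus_cell|lborel. b0 x) = 0 \<and>
      sobolev_norm 3 u0 + sobolev_norm 3 \<omega>0 + sobolev_norm 3 b0 \<le> \<epsilon>"
    then have data: "u0 \<in> L2_torus" "\<omega>0 \<in> L2_torus" "b0 \<in> L2_torus" by (auto intro: sobolev_L2)
    obtain u \<omega> b where sol: "global_strong_solution chi \<kappa> \<eta> \<nu> u0 \<omega>0 b0 u \<omega> b"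
      and bound: "\<And>t. 0 \<le> t \<Longrightarrow> sobolev_norm 3 (u t) + sobolev_norm 3 (\<omega> t) + sobolev_norm 3 (b t) \<le> sol_const * \<epsilon> * exp (- (rate / 2) * t)"
      using solution_exists[of u0 \<omega>0 b0 \<epsilon>] A small by metis
    have 1: "sol_const * \<epsilon> * exp (- (rate / 2) * t) \<le> C * \<epsilon>" if "0 \<le> t" for t
    proof -
      have "sol_const * \<epsilon> * exp (- (rate / 2) * t) \<le> sol_const * \<epsilon> * 1"
        using that rate(1) sc eps by (intro mult_left_mono) auto
      also have "\<dots> \<le> C * \<epsilon>" using eps by (simp add: C_def)
      finally show ?thesis .
    qed
    have 2: "sol_const * \<epsilon> * exp (- (rate / 2) * t) \<le> C * exp (- (rate / 2) * t)" for t
    proof (rule mult_right_mono)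
      show "sol_const * \<epsilon> \<le> C" using mult_left_mono[OF eps(2) sc] by (simp add: C_def)
    qed simp
    show "\<exists>u \<omega> b.
        global_strong_solution chi \<kappa> \<eta> \<nu> u0 \<omega>0 b0 u \<omega> b \<and>
        (\<forall>v \<theta> h. global_strong_solution chi \<kappa> \<eta> \<nu> u0 \<omega>0 b0 v \<theta> h \<longrightarrow>
          (\<forall>t\<ge>0. AE x in lborel. v t x = u t x \<and> \<theta> t x = \<omega> t x \<and> h t x = b t x)) \<and>
        (\<forall>t>0. sobolev_norm 3 (u t) + sobolev_norm 3 (\<omega> t) + sobolev_norm 3 (b t) \<le> C * \<epsilon>) \<and>
        (\<forall>t>0. sobolev_norm 3 (u t) + sobolev_norm 3 (\<omega> t) + sobolev_norm 3 (b t)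
                 \<le> C * exp (- (rate / 2) * t))"
    proof (rule exI[of _ u], rule exI[of _ \<omega>], rule exI[of _ b], intro conjI allI impI sol)
      fix t :: real assume "0 < t"
      then have t: "0 \<le> t" by simp
      show "sobolev_norm 3 (u t) + sobolev_norm 3 (\<omega> t) + sobolev_norm 3 (b t) \<le> C * \<epsilon>"
        by (rule order_trans[OF bound[OF t] 1[OF t]])
      show "sobolev_norm 3 (u t) + sobolev_norm 3 (\<omega> t) + sobolev_norm 3 (b t) \<le> C * exp (- (rate / 2) * t)"
        by (rule order_trans[OF bound[OF t] 2])
    qed (rule solution_unique[OF data sol])
  qed
qed

end
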